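(* Let $T\subset\mathbb{C}$ be a connected compact set that is neither empty nor a single point. Let $r_T$ be the conformal radius of $T$, let $\gamma=0.5772\cdots$ be the Euler–Mascheroni constant, and let $$d=\max\left(\operatorname{diam}(T),\ e^{\gamma}r_T\right),\qquad \tau_0=\tfrac12 e^{2\gamma}r_T^2 .$$ Let $z$ be a point of the exterior of $T$, let $$R_z=\max\left(\sup_{w\in T}|w-z|,\ e^{\gamma}r_T\right),$$ and for $\tau>0$ let $$F_T(z,\tau)=\frac1\tau\int_0^\infty e^{-t/\tau}\,P_T(z,t)\,dt .$$ If $\tau>\frac e2 d^2$, then $$F_T(z,\tau)\ \ge\ 1-\frac{2\pi H_T(z)}{\ln(\tau/\tau_0)}-0.8\,\frac{d^2}{\tau}.$$ If $\tau>\frac e2 R_z^2$, then $$F_T(z,\tau)\ \le\ 1-\frac{2\pi H_T(z)}{\ln(\tau/\tau_0)}+0.8\,\frac{R_z^2}{\tau}.$$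
   Context: The plane is identified with $\mathbb{C}$; the exterior of $T$ is the unbounded component of $\mathbb{C}\setminus T$. $P_T(z,t)$ denotes the probability that a standard planar Brownian motion (transition density $\frac{1}{2\pi t}e^{-|z-w|^2/(2t)}$) started at $z$ hits $T$ by time $t$. Conformal radius: let $\Phi_T$ be the unique conformal map from the exterior of $T$ (with $\infty$ adjoined) onto the complement of the closed unit disk in the Riemann sphere which fixes $\infty$ and has positive derivative at $\infty$ (i.e. $\lim_{z\to\infty}\Phi_T(z)/z>0$). Then $r_T:=\lim_{z\to\infty} z/\Phi_T(z)$. $H_T$ is the Green's function with pole at $\infty$: the unique harmonic function on the exterior of $T$ that tends to $0$ as $z\to T$ and satisfies $H_T(z)\sim\frac1\pi\ln|z|$ as $z\to\infty$; equivalently $H_T(z)=\frac1\pi\ln|\Phi_T(z)|$. *)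

theory Defs
  imports
    "HOL-Complex_Analysis.Complex_Analysis"
    "HOL-Probability.Probability"
    "HOL-Library.Landau_Symbols"
begin

text \<open>The exterior of a compact set \<open>T\<close>, i.e. the unbounded component of its complement,
  is the library's \<^term>\<open>outside T\<close>.\<close>

subsection \<open>Planar Brownian motion and hitting probabilities\<close>

definition heat_kernel :: "real \<Rightarrow> complex \<Rightarrow> complex \<Rightarrow> real" where
  "heat_kernel t z w = 1 / (2 * pi * t) * exp (- (cmod (z - w))\<^sup>2 / (2 * t))"

text \<open>Time is indexed by the reals, and only \<open>t \<ge> 0\<close> matters.  Start point and path continuity are
  required surely rather than almost surely, so that hitting a closed set is an event
  whether or not \<open>M\<close> is complete.  In \<open>indep_increments\<close>, every finite increasing tuple of times
  is an initial segment of some sequence \<open>t\<close>.\<close>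

locale planar_brownian_motion = prob_space M
  for M :: "'w measure" and z :: complex and B :: "real \<Rightarrow> 'w \<Rightarrow> complex" +
  assumes measurable: "\<And>t. 0 \<le> t \<Longrightarrow> B t \<in> borel_measurable M"
    and start: "\<And>\<omega>. \<omega> \<in> space M \<Longrightarrow> B 0 \<omega> = z"
    and continuous_paths: "\<And>\<omega>. \<omega> \<in> space M \<Longrightarrow> continuous_on {0..} (\<lambda>t. B t \<omega>)"
    and gaussian_increments: "\<And>s t. 0 \<le> s \<Longrightarrow> s < t \<Longrightarrow>
          distributed M lborel (\<lambda>\<omega>. B t \<omega> - B s \<omega>) (\<lambda>w. ennreal (heat_kernel (t - s) 0 w))"
    and indep_increments: "\<And>(t :: nat \<Rightarrow> real) n. 0 \<le> t 0 \<Longrightarrow> incseq t \<Longrightarrow>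
          indep_vars (\<lambda>_. borel) (\<lambda>i \<omega>. B (t (Suc i)) \<omega> - B (t i) \<omega>) {..<n}"

text \<open>When \<open>B\<close> is a Brownian motion on \<open>M\<close> started at \<open>z\<close>, this is the probability
  \<open>P\<^sub>T(z,t)\<close>; the start point enters only through \<open>B\<close>.\<close>

definition hit_prob :: "'w measure \<Rightarrow> (real \<Rightarrow> 'w \<Rightarrow> complex) \<Rightarrow> complex set \<Rightarrow> real \<Rightarrow> real" where
  "hit_prob M B T t = measure M {\<omega> \<in> space M. \<exists>s\<in>{0..t}. B s \<omega> \<in> T}"

definition hit_laplace :: "'w measure \<Rightarrow> (real \<Rightarrow> 'w \<Rightarrow> complex) \<Rightarrow> complex set \<Rightarrow> real \<Rightarrow> real" where
  "hit_laplace M B T \<tau> = 1 / \<tau> * (LINT t:{0..}|lborel. exp (- t / \<tau>) * hit_prob M B T t)"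

subsection \<open>Conformal radius\<close>

text \<open>A conformal map of the exterior with \<open>\<infinity>\<close> adjoined fixing \<open>\<infinity>\<close> is described by its restriction
  to finite points, with its behaviour at \<open>\<infinity>\<close> expressed by limits; the singularity there is
  automatically a simple pole.\<close>

definition is_exterior_map :: "complex set \<Rightarrow> (complex \<Rightarrow> complex) \<Rightarrow> bool" where
  "is_exterior_map T \<Phi> \<longleftrightarrow>
     \<Phi> holomorphic_on outside T \<and>
     bij_betw \<Phi> (outside T) {w. 1 < cmod w} \<and>
     filterlim \<Phi> at_infinity at_infinity \<and>
     (\<exists>c::real. 0 < c \<and> ((\<lambda>z. \<Phi> z / z) \<longlongrightarrow> of_real c) at_infinity)"

text \<open>Such a map is unique on the exterior; the choice operator only fills in irrelevant
  values elsewhere.  The same remark applies to \<open>green_function\<close> below.\<close>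

definition exterior_map :: "complex set \<Rightarrow> complex \<Rightarrow> complex" where
  "exterior_map T = (SOME \<Phi>. is_exterior_map T \<Phi>)"

definition conformal_radius :: "complex set \<Rightarrow> real" where
  "conformal_radius T = Re (Lim at_infinity (\<lambda>z. z / exterior_map T z))"

subsection \<open>Green's function with pole at infinity\<close>

definition dir_deriv :: "complex \<Rightarrow> (complex \<Rightarrow> real) \<Rightarrow> complex \<Rightarrow> real" where
  "dir_deriv v u z = deriv (\<lambda>s::real. u (z + of_real s * v)) 0"

definition C1_on :: "(complex \<Rightarrow> real) \<Rightarrow> complex set \<Rightarrow> bool" where
  "C1_on u S \<longleftrightarrow> (\<forall>v\<in>{1, \<i>}.
     (\<forall>z\<in>S. (\<lambda>s::real. u (z + of_real s * v)) differentiable (at 0)) \<and>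
     continuous_on S (dir_deriv v u))"

definition C2_on :: "(complex \<Rightarrow> real) \<Rightarrow> complex set \<Rightarrow> bool" where
  "C2_on u S \<longleftrightarrow> C1_on u S \<and> (\<forall>v\<in>{1, \<i>}. C1_on (dir_deriv v u) S)"

definition harmonic_on :: "(complex \<Rightarrow> real) \<Rightarrow> complex set \<Rightarrow> bool" where
  "harmonic_on u S \<longleftrightarrow> C2_on u S \<and>
     (\<forall>z\<in>S. dir_deriv 1 (dir_deriv 1 u) z + dir_deriv \<i> (dir_deriv \<i> u) z = 0)"

definition is_green_function :: "complex set \<Rightarrow> (complex \<Rightarrow> real) \<Rightarrow> bool" where
  "is_green_function T H \<longleftrightarrow>
     harmonic_on H (outside T) \<and>
     (\<forall>w\<in>T. (H \<longlongrightarrow> 0) (at w within outside T)) \<and>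
     H \<sim>[at_infinity] (\<lambda>z. 1 / pi * ln (cmod z))"

definition green_function :: "complex set \<Rightarrow> complex \<Rightarrow> real" where
  "green_function T = (SOME H. is_green_function T H)"

end

theory Submission
  imports Defs "HOL-Real_Asymp.Real_Asymp"
begin

text \<open>
  Let \<open>u\<close> be the Laplace transform, \<open>h = ln |\<Phi> z|\<close> and \<open>a = ln (\<tau> / \<tau>0) / 2\<close>.  Optional stopping for the resolvent
  kernel \<open>bk (|x - w|\<^sup>2 / (2 \<tau>))\<close>, a discounted martingale away from its pole \<open>w\<close>, relates \<open>u\<close> to the values
  of the kernel at \<open>z\<close> and on \<open>T\<close>.  Write the kernel as \<open>- ln |x - w|\<close> plus a constant plus a small nonnegative
  remainder and average \<open>w\<close> over a level curve of \<open>\<Phi>\<close> close to \<open>T\<close>: the logarithmic potential of that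
  distribution is \<open>ln r\<close> on \<open>T\<close> and \<open>ln r + h\<close> at \<open>z\<close>, by the mean value property of the inverse map.  With
  remainders \<open>\<epsilon>\<close> this gives \<open>a - h \<le> u (a + \<epsilon>)\<close> and \<open>u (a + \<epsilon>') \<le> a - h + \<epsilon>\<close>, and the theorem reduces to bounds on
  the remainders.  For the upper bound \<open>\<epsilon>'\<close> must be bounded below: convexity of the kernel in \<open>ln Y\<close>
  gives this by Jensen's inequality, except in a small corner of the parameter range, where \<open>T\<close> is nearly an
  arc of a circle around \<open>z\<close>; there the first two moments of the level curves provide the missing gain.
\<close>

section \<open>The Bessel kernel\<close>

text \<open>The two estimates place the poles differently. For the upper one the kernel need only be
  a supermartingale, so the poles may lie in the exterior, on level curves that separate
  \<open>T\<close> from \<open>z\<close>. For the lower one they must lie inside the set that is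
  hit, at positive distance from its complement, and \<open>T\<close> may have empty interior. Hence
  \<open>T\<close> is first thickened to the sets where \<open>\<Phi>\<close> is undefined or of
  modulus at most \<open>\<rho>\<close>, and \<rho> tends to 1; a path that starts in the exterior
  and enters the filled \<open>T\<close> must have crossed \<open>T\<close>. The remainder increases
  with distance. The lower estimate measures distances between points of \<open>T\<close>, the upper
  one distances from \<open>z\<close>, whence the radii \<open>d\<close> and \<open>R\<close>. The
  condition on \<tau> says \<open>y < exp (- 1)\<close> for \<open>y = R^2 / (2 * \<tau>)\<close>,
  and the term with Euler's constant makes \<open>ln (R / r) - euler_mascheroni\<close> nonnegative.
  The constant 0.8 is tight for the argument at \<open>y = exp (- 1)\<close>,
  \<open>R = exp euler_mascheroni * r = r * cmod (\<Phi> z)\<close>: the last inequality asks for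
  0.1305 there and Jensen gives about 0.106. This point is the corner.\<close>

lemma exp_neg_div_le:
  fixes x :: real
  assumes "x > 0"
  shows "exp (- x) * x ^ n \<le> fact n"
proof -
  have "x ^ n / fact n \<le> exp x"
  proof -
    have "(\<Sum>k\<in>{n}. x ^ k /\<^sub>R fact k) \<le> (\<Sum>k. x ^ k /\<^sub>R fact k)"
      using assms sum_le_suminf[OF summable_exp_generic[of x], of "{n}"] by simp
    then show ?thesis by (simp add: exp_def divide_inverse mult.commute)
  qed
  then show ?thesis by (simp add: exp_minus divide_simps mult.commute)
qed

text \<open>In terms of the Macdonald functions this is \<open>2 * Y powr ((1 - n) / 2)\<close>
  times the function of order \<open>n - 1\<close> at \<open>2 * sqrt Y\<close>. The integral form
  makes differentiation in \<open>Y\<close> a shift of \<open>n\<close>.\<close>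

definition bessel_moment :: "real \<Rightarrow> nat \<Rightarrow> real" where
  "bessel_moment Y n = (LINT s:{0<..}|lborel. exp (- s - Y / s) / s ^ n)"

lemma set_integrable_exp_neg: "set_integrable lborel {0<..} (\<lambda>s::real. exp (- s))"
proof -
  have "(\<lambda>s::real. exp (- 1 * s)) absolutely_integrable_on {0..}"
    by (intro nonnegative_absolutely_integrable_1 integrable_on_exp_minus_to_infinity) auto
  then have "(\<lambda>s::real. exp (- s)) absolutely_integrable_on {0..}" by simp
  then have "set_integrable lebesgue {0<..} (\<lambda>s::real. exp (- s))"
    by (rule set_integrable_subset) auto
  then show ?thesis
    unfolding set_integrable_def by (subst (asm) integrable_completion) auto
qed

lemma bessel_integrable:
  assumes "Y > 0"
  shows "set_integrable lborel {0<..} (\<lambda>s::real. exp (- s - Y / s) / s ^ n)"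
proof (rule set_integrable_bound)
  show "set_integrable lborel {0<..} (\<lambda>s::real. fact n / Y ^ n * exp (- s))"
    using set_integrable_exp_neg by simp
  show "set_borel_measurable lborel {0<..} (\<lambda>s::real. exp (- s - Y / s) / s ^ n)"
    unfolding set_borel_measurable_def by measurable
  show "AE s in lborel. s \<in> {0<..} \<longrightarrow>
      norm (exp (- s - Y / s) / s ^ n) \<le> norm (fact n / Y ^ n * exp (- s))"
  proof (intro AE_I2 impI)
    fix s :: real assume "s \<in> {0<..}"
    then have s: "s > 0" by simp
    have "exp (- (Y / s)) * (Y / s) ^ n \<le> fact n"
      using assms s by (intro exp_neg_div_le) auto
    then have "exp (- (Y / s)) / s ^ n \<le> fact n / Y ^ n"
      using assms s by (simp add: power_divide pos_le_divide_eq)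
    then have "exp (- s) * (exp (- (Y / s)) / s ^ n) \<le> exp (- s) * (fact n / Y ^ n)"
      by (intro mult_left_mono) auto
    moreover have "exp (- s - Y / s) / s ^ n = exp (- s) * (exp (- (Y / s)) / s ^ n)"
      by (simp add: mult_exp_exp)
    ultimately show "norm (exp (- s - Y / s) / s ^ n) \<le> norm (fact n / Y ^ n * exp (- s))"
      using s assms by (simp add: mult.commute)
  qed
qed

lemma bessel_moment_nonneg: "bessel_moment Y n \<ge> 0"
  unfolding bessel_moment_def set_lebesgue_integral_def
  by (intro integral_nonneg_AE AE_I2) (auto simp: indicator_def)

lemma bessel_moment_antimono:
  assumes "0 < Y1" "Y1 \<le> Y2"
  shows "bessel_moment Y2 n \<le> bessel_moment Y1 n"
  unfolding bessel_moment_def using assms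
  by (intro set_integral_mono bessel_integrable) (auto intro!: divide_right_mono simp: divide_right_mono)

text \<open>Integrate the second-order expansion of \<open>exp (- h / s)\<close>. Since
  \<open>\<bar>h\<bar> \<le> Y / 2\<close>, half of the exponent \<open>Y / s\<close> absorbs the
  Lagrange remainder; this leaves a moment at \<open>Y / 2\<close>, and the two factors
  \<open>1 / s\<close> raise its order by two.\<close>

lemma bessel_moment_Taylor:
  assumes Y: "Y > 0" and h: "\<bar>h\<bar> \<le> Y / 2"
  shows "\<bar>bessel_moment (Y + h) n - bessel_moment Y n + h * bessel_moment Y (Suc n)\<bar>
           \<le> h\<^sup>2 / 2 * bessel_moment (Y / 2) (n + 2)"
proof -
  have Yh: "Y + h > 0" using assms by (auto simp: abs_le_iff)
  let ?f = "\<lambda>Y n (s::real). exp (- s - Y / s) / s ^ n"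
  note i1 = bessel_integrable[OF Yh, of n] note i2 = bessel_integrable[OF Y, of n]
  note i3 = bessel_integrable[OF Y, of "Suc n"]
  have i4: "set_integrable lborel {0<..} (?f (Y/2) (n+2))"
    using Y by (intro bessel_integrable) auto
  have i5: "set_integrable lborel {0<..} (\<lambda>s. (?f (Y+h) n s - ?f Y n s) + h * ?f Y (Suc n) s)"
    using set_integral_add(1)[OF set_integral_diff(1)[OF i1 i2] set_integrable_mult_right[of h, OF i3]] by simp
  have eq: "bessel_moment (Y + h) n - bessel_moment Y n + h * bessel_moment Y (Suc n)
     = (LINT s:{0<..}|lborel. (?f (Y+h) n s - ?f Y n s) + h * ?f Y (Suc n) s)"
    unfolding bessel_moment_def
    using set_integral_add(2)[OF set_integral_diff(1)[OF i1 i2] set_integrable_mult_right[of h, OF i3]]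
      set_integral_diff(2)[OF i1 i2] set_integral_mult_right[of lborel "{0<..}" h "?f Y (Suc n)"]
    by simp
  have "\<bar>LINT s:{0<..}|lborel. (?f (Y+h) n s - ?f Y n s) + h * ?f Y (Suc n) s\<bar>
     \<le> (LINT s:{0<..}|lborel. \<bar>(?f (Y+h) n s - ?f Y n s) + h * ?f Y (Suc n) s\<bar>)"
    using set_integral_norm_bound[OF i5] by simp
  also have "\<dots> \<le> (LINT s:{0<..}|lborel. h\<^sup>2 / 2 * ?f (Y/2) (n+2) s)"
  proof (rule set_integral_mono)
    show "set_integrable lborel {0<..} (\<lambda>s. \<bar>(?f (Y+h) n s - ?f Y n s) + h * ?f Y (Suc n) s\<bar>)"
      using set_integrable_abs[OF i5] .
    show "set_integrable lborel {0<..} (\<lambda>s. h\<^sup>2 / 2 * ?f (Y/2) (n+2) s)"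
      by (rule set_integrable_mult_right) (rule i4)
    fix s :: real assume "s \<in> {0<..}"
    then have s: "s > 0" by simp
    obtain t where t: "\<bar>t\<bar> \<le> \<bar>- h / s\<bar>"
        "exp (- h / s) = (\<Sum>m<2. ((- h / s) ^ m) / fact m) + (exp t / fact 2) * (- h / s) ^ 2"
      using Maclaurin_exp_le[of "- h / s" 2] by blast
    have "(\<Sum>m<2. ((- h / s) ^ m) / fact m) = 1 - h / s"
      by (simp add: lessThan_Suc eval_nat_numeral(3)[of Num.One] numeral_2_eq_2)
    then have e: "exp (- h / s) - 1 + h / s = exp t / 2 * (h\<^sup>2 / s\<^sup>2)"
      using t(2) by (simp add: power_divide)
    have "t \<le> \<bar>h\<bar> / s" using t(1) s by (simp add: abs_divide)
    also have "\<dots> \<le> (Y / 2) / s" using h s by (intro divide_right_mono) auto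
    finally have "- Y / s + t \<le> - (Y / 2) / s" by (simp add: field_simps)
    then have et: "exp (- Y / s) * exp t \<le> exp (- (Y / 2) / s)"
      by (simp only: mult_exp_exp exp_le_cancel_iff)
    have "(?f (Y+h) n s - ?f Y n s) + h * ?f Y (Suc n) s
        = exp (- s) / s ^ n * (exp (- Y / s) * (exp (- h / s) - 1 + h / s))"
    proof -
      have "exp (- s - (Y + h) / s) = exp (- s) * exp (- Y / s) * exp (- h / s)"
        "exp (- s - Y / s) = exp (- s) * exp (- Y / s)"
        by (simp_all add: mult_exp_exp add_divide_distrib)
      then show ?thesis using s by (simp add: field_simps)
    qed
    also have "\<dots> = exp (- s) / s ^ n * (exp (- Y / s) * exp t * (h\<^sup>2 / (2 * s\<^sup>2)))"
      unfolding e by simp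
    finally have eq: "(?f (Y+h) n s - ?f Y n s) + h * ?f Y (Suc n) s
        = exp (- s) / s ^ n * (exp (- Y / s) * exp t * (h\<^sup>2 / (2 * s\<^sup>2)))" .
    have "\<bar>\<dots>\<bar> = exp (- s) / s ^ n * (exp (- Y / s) * exp t * (h\<^sup>2 / (2 * s\<^sup>2)))"
      using s by (intro abs_of_nonneg) auto
    also have "\<dots> \<le> exp (- s) / s ^ n * (exp (- (Y / 2) / s) * (h\<^sup>2 / (2 * s\<^sup>2)))"
      using s et by (intro mult_left_mono mult_right_mono) auto
    also have "\<dots> = h\<^sup>2 / 2 * ?f (Y/2) (n+2) s"
    proof -
      have "exp (- s - Y / 2 / s) = exp (- s) * exp (- (Y / 2) / s)" by (simp add: mult_exp_exp)
      then show ?thesis using s by (simp add: power_add power2_eq_square mult_ac)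
    qed
    finally show "\<bar>(?f (Y+h) n s - ?f Y n s) + h * ?f Y (Suc n) s\<bar> \<le> h\<^sup>2 / 2 * ?f (Y/2) (n+2) s"
      using eq by simp
  qed
  also have "\<dots> = h\<^sup>2 / 2 * bessel_moment (Y / 2) (n + 2)"
    unfolding bessel_moment_def by (rule set_integral_mult_right)
  finally show ?thesis using eq by simp
qed

lemma bessel_moment_has_derivative:
  assumes Y: "Y > 0"
  shows "((\<lambda>Y. bessel_moment Y n) has_real_derivative - bessel_moment Y (Suc n)) (at Y)"
proof -
  define C where "C = bessel_moment (Y / 2) (n + 2)"
  have C: "C \<ge> 0" unfolding C_def by (rule bessel_moment_nonneg)
  have "((\<lambda>h. (bessel_moment (Y + h) n - bessel_moment Y n) / h - (- bessel_moment Y (Suc n))) \<longlongrightarrow> 0) (at 0)"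
  proof (rule Lim_null_comparison)
    show "((\<lambda>h. \<bar>h\<bar> / 2 * C) \<longlongrightarrow> 0) (at (0::real))"
      by (auto intro!: tendsto_eq_intros)
    have "\<forall>\<^sub>F h in at 0. \<bar>h\<bar> < Y / 2"
      using Y by (auto simp: eventually_at dist_norm intro!: exI[of _ "Y/2"])
    moreover have "\<forall>\<^sub>F h in at (0::real). h \<noteq> 0" by (simp add: eventually_at_filter)
    ultimately show "\<forall>\<^sub>F h in at 0. norm ((bessel_moment (Y + h) n - bessel_moment Y n) / h - (- bessel_moment Y (Suc n)))
        \<le> \<bar>h\<bar> / 2 * C"
    proof eventually_elim
      case (elim h)
      have "(bessel_moment (Y + h) n - bessel_moment Y n) / h - (- bessel_moment Y (Suc n))
         = (bessel_moment (Y + h) n - bessel_moment Y n + h * bessel_moment Y (Suc n)) / h"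
        using elim by (simp add: field_simps)
      then have "norm ((bessel_moment (Y + h) n - bessel_moment Y n) / h - (- bessel_moment Y (Suc n)))
        \<le> (h\<^sup>2 / 2 * C) / \<bar>h\<bar>"
        using bessel_moment_Taylor[OF Y, of h n] elim unfolding C_def
        by (simp only: real_norm_def abs_divide, intro divide_right_mono) auto
      also have "\<dots> = \<bar>h\<bar> / 2 * C" using elim by (auto simp: power2_eq_square field_simps abs_if)
      finally show ?case .
    qed
  qed
  from LIM_zero_cancel[OF this] show ?thesis by (simp add: DERIV_def)
qed

text \<open>The substitution \<open>s -> Y / s\<close> is an involution fixing \<open>sqrt Y\<close>
  and exchanging the two terms of the exponent \<open>s + Y / s\<close>. It turns the symmetry of
  the integrand into identities between moments.\<close>

lemma integral_inversion:
  fixes f :: "real \<Rightarrow> real"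
  assumes Y: "Y > 0" and S: "S \<in> sets lborel" "S \<subseteq> {0<..}"
    and f: "set_integrable lborel ((\<lambda>s. Y / s) ` S) f" and m: "(\<lambda>s. Y / s) ` S \<in> sets lborel"
  shows "integral S (\<lambda>s. Y / s\<^sup>2 * f (Y / s)) = integral ((\<lambda>s. Y / s) ` S) f"
proof -
  have f': "f absolutely_integrable_on ((\<lambda>s. Y / s) ` S)"
    using f m unfolding set_integrable_def by (subst integrable_completion) auto
  have "inj_on (\<lambda>s. Y / s) S" using Y S by (auto simp: inj_on_def divide_simps subset_eq)
  moreover have "((\<lambda>s. Y / s) has_field_derivative - (Y / s\<^sup>2)) (at s within S)" if "s \<in> S" for s
    using that S Y by (auto intro!: derivative_eq_intros simp: power2_eq_square subset_eq divide_simps)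
  ultimately have "integral S (\<lambda>s. \<bar>- (Y / s\<^sup>2)\<bar> * f (Y / s)) = integral ((\<lambda>s. Y / s) ` S) f"
    using has_absolute_integral_change_of_variables_1'[of S "\<lambda>s. Y / s" "\<lambda>s. - (Y / s\<^sup>2)" f
       "integral ((\<lambda>s. Y / s) ` S) f"] f' S by auto
  then show ?thesis using Y by simp
qed

lemma image_inversion:
  assumes "(Y::real) > 0"
  shows "(\<lambda>s. Y / s) ` {0<..} = {0<..}" and "c > 0 \<Longrightarrow> (\<lambda>s. Y / s) ` {0<..<c} = {Y / c<..}"
proof -
  show "(\<lambda>s. Y / s) ` {0<..} = {0<..}"
  proof (intro equalityI subsetI)
    fix x :: real assume "x \<in> {0<..}"
    then have "Y / x \<in> {0<..}" "x = Y / (Y / x)" using assms by auto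
    then show "x \<in> (\<lambda>s. Y / s) ` {0<..}" by blast
  qed (use assms in auto)
  show "(\<lambda>s. Y / s) ` {0<..<c} = {Y / c<..}" if "c > 0"
  proof (intro equalityI subsetI)
    fix x assume "x \<in> {Y / c<..}"
    then have x: "x > Y / c" by simp
    moreover have "Y / c > 0" using assms that by simp
    ultimately have "x > 0" by linarith
    then have "Y / x \<in> {0<..<c}" "x = Y / (Y / x)" using x assms that by (auto simp: field_simps)
    then show "x \<in> (\<lambda>s. Y / s) ` {0<..<c}" by blast
  qed (use assms that in \<open>auto simp: field_simps\<close>)
qed

text \<open>The inversion replaces \<open>ds\<close> by \<open>Y / s^2 ds\<close>; for Macdonald
  functions this is the evenness in the order. It closes the system: the derivatives of
  \<open>bk\<close> and \<open>bj\<close> are again expressed by \<open>bk\<close> and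
  \<open>bj\<close>.\<close>

lemma bessel_moment_2:
  assumes Y: "Y > 0"
  shows "Y * bessel_moment Y 2 = bessel_moment Y 0"
proof -
  have "integral {0<..} (\<lambda>s. Y / s\<^sup>2 * exp (- (Y / s) - Y / (Y / s))) = integral {0<..} (\<lambda>s. exp (- s - Y / s))"
    using integral_inversion[OF Y, of "{0<..}" "\<lambda>s. exp (- s - Y / s)"] bessel_integrable[OF Y, of 0]
    by (simp add: image_inversion[OF Y])
  also have "integral {0<..} (\<lambda>s. Y / s\<^sup>2 * exp (- (Y / s) - Y / (Y / s)))
     = integral {0<..} (\<lambda>s. Y * (exp (- s - Y / s) / s\<^sup>2))"
    using Y by (intro integral_cong) (auto simp: algebra_simps)
  also have "\<dots> = Y * integral {0<..} (\<lambda>s. exp (- s - Y / s) / s\<^sup>2)" by (rule integral_mult_right)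
  finally show ?thesis
    unfolding bessel_moment_def
    using set_borel_integral_eq_integral(2)[OF bessel_integrable[OF Y, of 2]]
      set_borel_integral_eq_integral(2)[OF bessel_integrable[OF Y, of 0]]
    by simp
qed

text \<open>The measure \<open>ds / s\<close> is invariant under the inversion, so both sides of the
  fixed point \<open>sqrt Y\<close> contribute equally. On the half that is kept
  \<open>Y / s \<le> sqrt Y\<close>, which allows a comparison with the exponential
  integral.\<close>

lemma bessel_moment_1_half:
  assumes Y: "Y > 0"
  shows "bessel_moment Y 1 = 2 * (LINT s:{sqrt Y<..}|lborel. exp (- s - Y / s) / s)"
proof -
  let ?f = "\<lambda>s::real. exp (- s - Y / s) / s"
  have i: "set_integrable lborel {0<..} ?f" using bessel_integrable[OF Y, of 1] by simp
  have q: "sqrt Y > 0" using Y by simp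
  have i1: "set_integrable lborel {0<..<sqrt Y} ?f" by (rule set_integrable_subset[OF i]) auto
  have i2: "set_integrable lborel {sqrt Y<..} ?f"
    by (rule set_integrable_subset[OF i]) (use Y q in \<open>auto intro: less_trans[OF q]\<close>)
  have e: "Y / sqrt Y = sqrt Y" by (rule real_div_sqrt) (rule less_imp_le[OF Y])
  have "integral {0<..<sqrt Y} (\<lambda>s. Y / s\<^sup>2 * ?f (Y / s)) = integral {sqrt Y<..} ?f"
    using integral_inversion[OF Y, of "{0<..<sqrt Y}" ?f] i2
    by (simp add: image_inversion(2)[OF Y q] e subset_eq)
  also have "integral {0<..<sqrt Y} (\<lambda>s. Y / s\<^sup>2 * ?f (Y / s)) = integral {0<..<sqrt Y} ?f"
    using Y by (intro integral_cong) (auto simp: power2_eq_square field_simps)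
  finally have eq: "(LINT s:{0<..<sqrt Y}|lborel. ?f s) = (LINT s:{sqrt Y<..}|lborel. ?f s)"
    using set_borel_integral_eq_integral(2)[OF i1] set_borel_integral_eq_integral(2)[OF i2] by simp
  have "bessel_moment Y 1 = (LINT s:{0<..<sqrt Y} \<union> {sqrt Y<..}|lborel. ?f s)"
    unfolding bessel_moment_def power_one_right
  proof (rule set_integral_cong_set)
    show "AE s in lborel. (s \<in> {0<..<sqrt Y} \<union> {sqrt Y<..}) = (s \<in> {0<..})"
      using AE_lborel_singleton[of "sqrt Y"] by eventually_elim (auto intro: less_trans[OF q])
  qed (auto simp: set_borel_measurable_def)
  also have "\<dots> = (LINT s:{0<..<sqrt Y}|lborel. ?f s) + (LINT s:{sqrt Y<..}|lborel. ?f s)"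
    by (intro set_integral_Un i1 i2) auto
  finally show ?thesis using eq by simp
qed

section \<open>The exponential integral and Euler's constant\<close>

definition exp_integral :: "real \<Rightarrow> real" where
  "exp_integral x = (LINT s:{x<..}|lborel. exp (- s) / s)"

lemma set_integrable_exp_neg_over:
  assumes "x > 0"
  shows "set_integrable lborel {x<..} (\<lambda>s::real. exp (- s) / s)"
proof (rule set_integrable_bound)
  show "set_integrable lborel {x<..} (\<lambda>s::real. 1 / x * exp (- s))"
    by (intro set_integrable_mult_right set_integrable_subset[OF set_integrable_exp_neg])
       (use assms in auto)
  show "set_borel_measurable lborel {x<..} (\<lambda>s::real. exp (- s) / s)"
    unfolding set_borel_measurable_def by measurable
  show "AE s in lborel. s \<in> {x<..} \<longrightarrow> norm (exp (- s) / s) \<le> norm (1 / x * exp (- s))"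
    using assms by (intro AE_I2) (auto simp: frac_le)
qed

lemma one_minus_exp_bounds:
  fixes s :: real assumes "s > 0"
  shows "0 \<le> (1 - exp (- s)) / s" "(1 - exp (- s)) / s \<le> 1"
  using assms exp_ge_add_one_self[of "- s"] by (auto simp: field_simps)

text \<open>For \<open>p > 0\<close> this is the difference quotient \<open>(Gamma (p + 1) - Gamma 1) / p\<close>; it stays meaningful at
  \<open>p = 0\<close>, where continuity gives \<open>- euler_mascheroni\<close>.\<close>

definition gamma_defect :: "real \<Rightarrow> real" where
  "gamma_defect p = (LINT s:{1<..}|lborel. s powr p * (exp (- s) / s)) -
      (LINT s:{0<..1}|lborel. s powr p * ((1 - exp (- s)) / s))"

lemma gamma_defect_integrable:
  assumes "0 \<le> p" "p \<le> 1"
  shows "set_integrable lborel {1<..} (\<lambda>s::real. s powr p * (exp (- s) / s))"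
    and "set_integrable lborel {0<..1} (\<lambda>s::real. s powr p * ((1 - exp (- s)) / s))"
proof -
  show "set_integrable lborel {1<..} (\<lambda>s::real. s powr p * (exp (- s) / s))"
  proof (rule set_integrable_bound[of _ _ "\<lambda>s. exp (- s)"])
    show "set_integrable lborel {1<..} (\<lambda>s::real. exp (- s))"
      by (rule set_integrable_subset[OF set_integrable_exp_neg]) auto
    show "set_borel_measurable lborel {1<..} (\<lambda>s::real. s powr p * (exp (- s) / s))"
      unfolding set_borel_measurable_def by measurable
    show "AE s in lborel. s \<in> {1<..} \<longrightarrow> norm (s powr p * (exp (- s) / s)) \<le> norm (exp (- s))"
    proof (intro AE_I2 impI)
      fix s :: real assume "s \<in> {1<..}"
      then have s: "s > 1" by simp
      have "s powr p \<le> s powr 1" using s assms by (intro powr_mono) auto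
      then have "s powr p * exp (- s) \<le> s * exp (- s)" using s by (intro mult_right_mono) auto
      then show "norm (s powr p * (exp (- s) / s)) \<le> norm (exp (- s))"
        using s by (simp add: divide_simps mult.commute)
    qed
  qed
  show "set_integrable lborel {0<..1} (\<lambda>s::real. s powr p * ((1 - exp (- s)) / s))"
  proof (rule set_integrable_bound[of _ _ "\<lambda>s. 1"])
    show "set_integrable lborel {0<..1} (\<lambda>s::real. 1::real)"
      by (simp add: set_integrable_def)
    show "set_borel_measurable lborel {0<..1} (\<lambda>s::real. s powr p * ((1 - exp (- s)) / s))"
      unfolding set_borel_measurable_def by measurable
    show "AE s in lborel. s \<in> {0<..1} \<longrightarrow> norm (s powr p * ((1 - exp (- s)) / s)) \<le> norm (1::real)"
    proof (intro AE_I2 impI)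
      fix s :: real assume "s \<in> {0<..1}"
      then have s: "0 < s" "s \<le> 1" by auto
      have "s powr p \<le> 1" using s assms by (intro powr_le1) auto
      then have "s powr p * ((1 - exp (- s)) / s) \<le> 1 * 1"
        using one_minus_exp_bounds[OF s(1)] by (intro mult_mono) auto
      moreover have "s powr p * ((1 - exp (- s)) / s) \<ge> 0"
        using one_minus_exp_bounds[OF s(1)] by (intro mult_nonneg_nonneg) auto
      ultimately show "norm (s powr p * ((1 - exp (- s)) / s)) \<le> norm (1::real)"
        by (simp only: real_norm_def abs_of_nonneg mult_1 abs_one)
    qed
  qed
qed

text \<open>Split the integral for \<open>Gamma p\<close> at 1 and write
  \<open>exp (- t) = 1 - (1 - exp (- t))\<close> on the lower part. The singular piece integrates to
  \<open>1 / p\<close>, and the rest is \<open>gamma_defect p\<close>.\<close>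

lemma gamma_defect_eq:
  assumes p: "0 < p" "p \<le> 1"
  shows "gamma_defect p = (Gamma (p + 1) - 1) / p"
proof -
  have G: "((\<lambda>t. t powr (p - 1) / exp t) has_integral Gamma p) {0..}"
    using p by (intro Gamma_integral_real) auto
  have "(\<lambda>t. t powr (p - 1) / exp t) absolutely_integrable_on {0..}"
    using G by (intro nonnegative_absolutely_integrable_1) auto
  then have i: "set_integrable lborel {0..} (\<lambda>t. t powr (p - 1) / exp t)"
    unfolding set_integrable_def by (subst (asm) integrable_completion) auto
  have "Gamma p = (LINT t:{0..}|lborel. t powr (p - 1) / exp t)"
    using set_borel_integral_eq_integral(2)[OF i] G by (simp add: integral_unique)
  also have "\<dots> = (LINT t:{0<..1} \<union> {1<..}|lborel. t powr (p - 1) / exp t)"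
  proof (rule set_integral_cong_set)
    show "AE s in lborel. (s \<in> {0<..1} \<union> {1<..}) = (s \<in> {0::real..})"
      using AE_lborel_singleton[of "0::real"] by eventually_elim auto
  qed (auto simp: set_borel_measurable_def)
  also have "\<dots> = (LINT t:{0<..1}|lborel. t powr (p - 1) / exp t) + (LINT t:{1<..}|lborel. t powr (p - 1) / exp t)"
    by (intro set_integral_Un set_integrable_subset[OF i]) auto
  also have "(LINT t:{1<..}|lborel. t powr (p - 1) / exp t) = (LINT s:{1<..}|lborel. s powr p * (exp (- s) / s))"
    by (intro set_lebesgue_integral_cong) (auto simp: powr_diff exp_minus inverse_eq_divide)
  also have "(LINT t:{0<..1}|lborel. t powr (p - 1) / exp t)
     = (LINT t:{0<..1}|lborel. t powr (p - 1) - t powr p * ((1 - exp (- t)) / t))"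
    by (intro set_lebesgue_integral_cong)
      (auto simp: powr_diff exp_minus diff_divide_distrib right_diff_distrib inverse_eq_divide)
  also have "\<dots> = (LINT t:{0<..1}|lborel. t powr (p - 1)) - (LINT t:{0<..1}|lborel. t powr p * ((1 - exp (- t)) / t))"
  proof (rule set_integral_diff(2))
    have "(\<lambda>t. t powr (p - 1)) absolutely_integrable_on {0..1}"
      using has_integral_powr_from_0[of "p - 1" 1] p by (intro nonnegative_absolutely_integrable_1) auto
    then have "set_integrable lborel {0..1} (\<lambda>t. t powr (p - 1))"
      unfolding set_integrable_def by (subst (asm) integrable_completion) auto
    then show i1: "set_integrable lborel {0<..1} (\<lambda>t. t powr (p - 1))"
      by (rule set_integrable_subset) auto
    show "set_integrable lborel {0<..1} (\<lambda>t. t powr p * ((1 - exp (- t)) / t))"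
      using gamma_defect_integrable(2)[of p] p by auto
  qed
  also have "(LINT t:{0<..1}|lborel. t powr (p - 1)) = 1 / p"
  proof -
    have h: "((\<lambda>t. t powr (p - 1)) has_integral 1 / p) {0..1}"
      using has_integral_powr_from_0[of "p - 1" 1] p by auto
    then have "(\<lambda>t. t powr (p - 1)) absolutely_integrable_on {0..1}"
      by (intro nonnegative_absolutely_integrable_1) auto
    then have i1: "set_integrable lborel {0..1} (\<lambda>t. t powr (p - 1))"
      unfolding set_integrable_def by (subst (asm) integrable_completion) auto
    have "(LINT t:{0<..1}|lborel. t powr (p - 1)) = (LINT t:{0..1}|lborel. t powr (p - 1))"
    proof (rule set_integral_cong_set)
      show "AE s in lborel. (s \<in> {0..1}) = (s \<in> {0::real<..1})"
        using AE_lborel_singleton[of "0::real"] by eventually_elim auto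
    qed (auto simp: set_borel_measurable_def)
    then show ?thesis using set_borel_integral_eq_integral(2)[OF i1] h by (simp add: integral_unique)
  qed
  finally have "Gamma p = 1 / p + gamma_defect p" unfolding gamma_defect_def by simp
  moreover have "Gamma (p + 1) = p * Gamma p" using p by (intro Gamma_plus1) auto
  ultimately show ?thesis using p by (simp add: field_simps)
qed

text \<open>Let \<open>p = 1 / (n + 1)\<close> tend to 0. The integrals converge by domination,
  while the difference quotients of \<open>Gamma\<close> at 1 converge to \<open>Digamma 1\<close>,
  which is minus Euler's constant.\<close>

lemma gamma_defect_0: "gamma_defect 0 = - euler_mascheroni"
proof -
  let ?p = "\<lambda>n. 1 / real (Suc n)"
  have "(\<lambda>n. gamma_defect (?p n)) \<longlonglongrightarrow> gamma_defect 0"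
    unfolding gamma_defect_def set_lebesgue_integral_def
  proof (rule tendsto_diff)
    have p: "?p \<longlonglongrightarrow> 0" using LIMSEQ_inverse_real_of_nat by (simp add: inverse_eq_divide)
    have P: "(\<lambda>n. s powr ?p n) \<longlonglongrightarrow> s powr 0" if "s > 0" for s :: real
      by (intro tendsto_powr p tendsto_const) (use that in auto)
    show "(\<lambda>n. LINT s|lborel. indicator {1<..} s *\<^sub>R (s powr ?p n * (exp (- s) / s)))
        \<longlonglongrightarrow> (LINT s|lborel. indicator {1<..} s *\<^sub>R (s powr 0 * (exp (- s) / s)))"
    proof (rule integral_dominated_convergence[where w = "\<lambda>s. indicator {1<..} s *\<^sub>R (s powr 1 * (exp (- s) / s))"])
      show "integrable lborel (\<lambda>s::real. indicat_real {1<..} s *\<^sub>R (s powr 1 * (exp (- s) / s)))"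
        by (rule gamma_defect_integrable(1)[OF zero_le_one order_refl, unfolded set_integrable_def])
      show "AE s in lborel. (\<lambda>n. indicat_real {1<..} s *\<^sub>R (s powr ?p n * (exp (- s) / s)))
         \<longlonglongrightarrow> indicat_real {1<..} s *\<^sub>R (s powr 0 * (exp (- s) / s))"
      proof (rule AE_I2)
        fix s :: real
        show "(\<lambda>n. indicat_real {1<..} s *\<^sub>R (s powr ?p n * (exp (- s) / s)))
         \<longlonglongrightarrow> indicat_real {1<..} s *\<^sub>R (s powr 0 * (exp (- s) / s))"
        proof (cases "s > 0")
          case True
          show ?thesis by (intro tendsto_intros P True)
        qed auto
      qed
      show "AE s in lborel. norm (indicat_real {1<..} s *\<^sub>R (s powr ?p n * (exp (- s) / s)))
         \<le> indicat_real {1<..} s *\<^sub>R (s powr 1 * (exp (- s) / s))" for n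
      proof (rule AE_I2)
        fix s :: real
        have "s powr ?p n * (exp (- s) / s) \<le> s powr 1 * (exp (- s) / s)" if "s > 1"
          using that by (intro mult_right_mono powr_mono) auto
        then show "norm (indicat_real {1<..} s *\<^sub>R (s powr ?p n * (exp (- s) / s)))
         \<le> indicat_real {1<..} s *\<^sub>R (s powr 1 * (exp (- s) / s))"
          by (cases "s > 1") (simp_all only: indicator_def, auto)
      qed
    qed measurable
    show "(\<lambda>n. LINT s|lborel. indicator {0<..1} s *\<^sub>R (s powr ?p n * ((1 - exp (- s)) / s)))
        \<longlonglongrightarrow> (LINT s|lborel. indicator {0<..1} s *\<^sub>R (s powr 0 * ((1 - exp (- s)) / s)))"
    proof (rule integral_dominated_convergence[where w = "\<lambda>s. indicator {0<..1} s *\<^sub>R (s powr 0 * ((1 - exp (- s)) / s))"])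
      show "integrable lborel (\<lambda>s::real. indicat_real {0<..1} s *\<^sub>R (s powr 0 * ((1 - exp (- s)) / s)))"
        by (rule gamma_defect_integrable(2)[OF order_refl zero_le_one, unfolded set_integrable_def])
      show "AE s in lborel. (\<lambda>n. indicat_real {0<..1} s *\<^sub>R (s powr ?p n * ((1 - exp (- s)) / s)))
         \<longlonglongrightarrow> indicat_real {0<..1} s *\<^sub>R (s powr 0 * ((1 - exp (- s)) / s))"
      proof (rule AE_I2)
        fix s :: real
        show "(\<lambda>n. indicat_real {0<..1} s *\<^sub>R (s powr ?p n * ((1 - exp (- s)) / s)))
         \<longlonglongrightarrow> indicat_real {0<..1} s *\<^sub>R (s powr 0 * ((1 - exp (- s)) / s))"
        proof (cases "s > 0")
          case True
          show ?thesis by (intro tendsto_intros P True)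
        qed auto
      qed
      show "AE s in lborel. norm (indicat_real {0<..1} s *\<^sub>R (s powr ?p n * ((1 - exp (- s)) / s)))
         \<le> indicat_real {0<..1} s *\<^sub>R (s powr 0 * ((1 - exp (- s)) / s))" for n
      proof (rule AE_I2)
        fix s :: real
        have "s powr ?p n \<le> 1" if "0 < s" "s \<le> 1" using that by (intro powr_le1) auto
        then show "norm (indicat_real {0<..1} s *\<^sub>R (s powr ?p n * ((1 - exp (- s)) / s)))
         \<le> indicat_real {0<..1} s *\<^sub>R (s powr 0 * ((1 - exp (- s)) / s))"
          using one_minus_exp_bounds(1)[of s] by (auto simp: indicator_def abs_mult intro!: divide_right_mono mult_left_le_one_le)
      qed
    qed measurable
  qed
  moreover have "(\<lambda>n. gamma_defect (?p n)) \<longlonglongrightarrow> - euler_mascheroni"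
  proof -
    have "(Gamma has_field_derivative (Gamma 1 * Digamma 1)) (at (1::real))"
      by (intro has_field_derivative_Gamma) auto
    then have "((\<lambda>h. (Gamma (1 + h) - 1) / h) \<longlongrightarrow> - euler_mascheroni) (at (0::real))"
      by (simp add: DERIV_def)
    moreover have "filterlim ?p (at 0) sequentially"
      using LIMSEQ_inverse_real_of_nat by (auto simp: filterlim_at inverse_eq_divide)
    ultimately have "(\<lambda>n. (Gamma (1 + ?p n) - 1) / ?p n) \<longlonglongrightarrow> - euler_mascheroni"
      by (rule filterlim_compose)
    moreover have "gamma_defect (?p n) = (Gamma (1 + ?p n) - 1) / ?p n" for n
      using gamma_defect_eq[of "?p n"] by (simp add: add.commute)
    ultimately show ?thesis by simp
  qed
  ultimately show ?thesis by (rule LIMSEQ_unique)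
qed

text \<open>The excess over \<open>- ln x - euler_mascheroni\<close> is the integral of
  \<open>(1 - exp (- s)) / s\<close> over \<open>(0, x]\<close>, and this integrand lies between 0
  and 1. The logarithm comes from splitting off \<open>1 / s\<close> on \<open>(x, 1]\<close>, the
  constant from \<open>gamma_defect 0\<close>.\<close>

lemma exp_integral_bounds:
  assumes x: "0 < x" "x \<le> 1"
  shows "- ln x - euler_mascheroni \<le> exp_integral x" "exp_integral x \<le> - ln x - euler_mascheroni + x"
proof -
  let ?g = "\<lambda>s::real. (1 - exp (- s)) / s"
  have i: "set_integrable lborel {0<..1} ?g"
    using gamma_defect_integrable(2)[of 0]
    unfolding set_integrable_def by (rule Bochner_Integration.integrable_cong[THEN iffD1, rotated -1]) (auto simp: indicator_def)
  have ix: "set_integrable lborel {0<..x} ?g" "set_integrable lborel {x<..1} ?g"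
    using x by (auto intro!: set_integrable_subset[OF i])
  have ie: "set_integrable lborel {x<..} (\<lambda>s::real. exp (- s) / s)"
    using set_integrable_exp_neg_over[OF x(1)] .
  have "exp_integral x = (LINT s:{x<..1} \<union> {1<..}|lborel. exp (- s) / s)"
  proof -
    have "{x<..} = {x<..1} \<union> {1<..}" using x by auto
    then show ?thesis unfolding exp_integral_def by simp
  qed
  also have "\<dots> = (LINT s:{x<..1}|lborel. exp (- s) / s) + (LINT s:{1<..}|lborel. exp (- s) / s)"
    using x by (intro set_integral_Un set_integrable_subset[OF ie]) auto
  also have "(LINT s:{x<..1}|lborel. exp (- s) / s) = (LINT s:{x<..1}|lborel. 1 / s - ?g s)"
    using x by (intro set_lebesgue_integral_cong) (auto simp: diff_divide_distrib)
  also have "\<dots> = (LINT s:{x<..1}|lborel. 1 / s) - (LINT s:{x<..1}|lborel. ?g s)"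
  proof (rule set_integral_diff(2)[OF _ ix(2)])
    show "set_integrable lborel {x<..1} (\<lambda>s. 1 / s)"
    proof (rule set_integrable_subset)
      show "set_integrable lborel {x..1} (\<lambda>s. 1 / s)"
        using x by (intro borel_integrable_atLeastAtMost') (auto intro!: continuous_intros)
    qed auto
  qed
  also have "(LINT s:{x<..1}|lborel. 1 / s) = - ln x"
  proof -
    have c: "continuous_on {x..1} (\<lambda>s. 1 / s)" using x by (auto intro!: continuous_intros)
    have "(LINT s:{x..1}|lborel. 1 / s) = ln 1 - ln x"
    proof -
      have "((\<lambda>s. 1 / s) has_integral (ln 1 - ln x)) {x..1}"
      proof (rule fundamental_theorem_of_calculus)
        fix s assume "s \<in> {x..1}"
        then have "(ln has_real_derivative 1 / s) (at s within {x..1})"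
          using x by (auto intro!: derivative_eq_intros)
        then show "(ln has_vector_derivative 1 / s) (at s within {x..1})"
          by (simp add: has_real_derivative_iff_has_vector_derivative)
      qed (use x in auto)
      then show ?thesis
        using set_borel_integral_eq_integral(2)[OF borel_integrable_atLeastAtMost'[OF c]] by (simp add: integral_unique)
    qed
    moreover have "(LINT s:{x<..1}|lborel. 1 / s) = (LINT s:{x..1}|lborel. 1 / s)"
    proof (rule set_integral_cong_set)
      show "AE s in lborel. (s \<in> {x..1}) = (s \<in> {x<..1})"
        using AE_lborel_singleton[of x] by eventually_elim auto
    qed (auto simp: set_borel_measurable_def)
    ultimately show ?thesis by simp
  qed
  finally have 1: "exp_integral x = - ln x - (LINT s:{x<..1}|lborel. ?g s) + (LINT s:{1<..}|lborel. exp (- s) / s)" .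
  have "(LINT s:{0<..1}|lborel. ?g s) = (LINT s:{0<..x} \<union> {x<..1}|lborel. ?g s)"
  proof -
    have "{0<..1} = {0<..x} \<union> {x<..1}" using x by auto
    then show ?thesis by simp
  qed
  also have "\<dots> = (LINT s:{0<..x}|lborel. ?g s) + (LINT s:{x<..1}|lborel. ?g s)"
    by (intro set_integral_Un ix) auto
  finally have 2: "(LINT s:{0<..1}|lborel. ?g s) = (LINT s:{0<..x}|lborel. ?g s) + (LINT s:{x<..1}|lborel. ?g s)" .
  have "gamma_defect 0 = (LINT s:{1<..}|lborel. exp (- s) / s) - (LINT s:{0<..1}|lborel. ?g s)"
    unfolding gamma_defect_def
    by (intro arg_cong2[where f = "(-)"] set_lebesgue_integral_cong) auto
  then have 3: "exp_integral x = - ln x - euler_mascheroni + (LINT s:{0<..x}|lborel. ?g s)"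
    using 1 2 gamma_defect_0 by simp
  have "0 \<le> (LINT s:{0<..x}|lborel. ?g s)"
    unfolding set_lebesgue_integral_def
    by (intro integral_nonneg_AE AE_I2) (auto simp: indicator_def one_minus_exp_bounds)
  moreover have "(LINT s:{0<..x}|lborel. ?g s) \<le> (LINT s:{0<..x}|lborel. 1)"
  proof (rule set_integral_mono[OF ix(1)])
    show "set_integrable lborel {0<..x} (\<lambda>s. 1::real)" using x by (auto simp: set_integrable_def)
  qed (use one_minus_exp_bounds in auto)
  moreover have "(LINT s:{0<..x}|lborel. 1) = x"
    using x by (simp add: set_lebesgue_integral_def)
  ultimately show "- ln x - euler_mascheroni \<le> exp_integral x" "exp_integral x \<le> - ln x - euler_mascheroni + x"
    using 3 by auto
qed

lemma nonneg_of_deriv_nonneg: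
  fixes f :: "real \<Rightarrow> real"
  assumes "\<And>t. 0 < t \<Longrightarrow> t \<le> b \<Longrightarrow> (f has_real_derivative f' t) (at t)"
    and "\<And>t. 0 < t \<Longrightarrow> t \<le> b \<Longrightarrow> f' t \<ge> 0"
    and "(f \<longlongrightarrow> 0) (at_right 0)" and x: "0 < x" "x \<le> b"
  shows "f x \<ge> 0"
proof (rule tendsto_upperbound[OF assms(3)])
  have "f t \<le> f x" if "0 < t" "t < x" for t
  proof (rule DERIV_nonneg_imp_nondecreasing[of t x f])
    fix u assume "t \<le> u" "u \<le> x"
    then have "0 < u" "u \<le> b" using that x by auto
    then show "\<exists>y. (f has_real_derivative y) (at u) \<and> 0 \<le> y" using assms(1,2) by blast
  qed (use that in simp)
  then show "\<forall>\<^sub>F t in at_right 0. f t \<le> f x"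
    using x by (intro eventually_at_rightI[of 0 x]) auto
qed simp

text \<open>\<open>bk Y\<close> is \<open>K\<^sub>0 (2 sqrt Y)\<close> and \<open>bj Y\<close> is \<open>sqrt Y K\<^sub>1 (2 sqrt Y)\<close>.  Up to a constant factor,
  \<open>bk (|x - w|\<^sup>2 / (2 \<tau>))\<close> is the resolvent kernel of Brownian motion at rate \<open>1 / \<tau>\<close>.\<close>

definition bk :: "real \<Rightarrow> real" where "bk Y = bessel_moment Y 1 / 2"
definition bj :: "real \<Rightarrow> real" where "bj Y = bessel_moment Y 0 / 2"
definition bk_rem :: "real \<Rightarrow> real" where "bk_rem Y = bk Y + ln Y / 2 + euler_mascheroni"

lemma bk_nonneg: "bk Y \<ge> 0" and bj_nonneg: "bj Y \<ge> 0"
  by (simp_all add: bk_def bj_def bessel_moment_nonneg)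

lemma bk_deriv: "Y > 0 \<Longrightarrow> (bk has_real_derivative - bj Y / Y) (at Y)"
proof -
  assume Y: "Y > 0"
  have "bessel_moment Y 2 / 2 = bj Y / Y" using bessel_moment_2[OF Y] Y by (simp add: bj_def field_simps)
  moreover have "(bk has_real_derivative - bessel_moment Y 2 / 2) (at Y)"
    unfolding bk_def using DERIV_cdivide[OF bessel_moment_has_derivative[OF Y, of 1], of 2]
    by (simp add: numeral_2_eq_2)
  ultimately show ?thesis by simp
qed

lemma bj_deriv: "Y > 0 \<Longrightarrow> (bj has_real_derivative - bk Y) (at Y)"
  unfolding bk_def bj_def using DERIV_cdivide[OF bessel_moment_has_derivative[of Y 0], of 2] by simp

lemma LINT_exp_neg: "(LINT s:{x<..}|lborel. exp (- s)) = exp (- x)" if "x \<ge> 0" for x :: real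
proof -
  have i: "set_integrable lborel {x<..} (\<lambda>s::real. exp (- s))"
    by (rule set_integrable_subset[OF set_integrable_exp_neg]) (use that in auto)
  have "((\<lambda>s::real. exp (- 1 * s)) has_integral exp (- 1 * x) / 1) {x..}"
    by (rule has_integral_exp_minus_to_infinity) simp
  then have "((\<lambda>s::real. exp (- s)) has_integral exp (- x)) {x..}" by simp
  moreover have "negligible ({x..} - {x<..})" "negligible ({x<..} - {x..})"
    by (auto intro: negligible_subset[of "{x}"])
  ultimately have "((\<lambda>s::real. exp (- s)) has_integral exp (- x)) {x<..}"
    using has_integral_spike_set_eq[of "{x..}" "{x<..}" "\<lambda>s. exp (- s)" "exp (- x)"]
    by (metis (no_types, lifting) Diff_iff mem_Collect_eq negligible_subset subsetI)
  then show ?thesis using set_borel_integral_eq_integral(2)[OF i] by (simp add: integral_unique)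
qed

text \<open>For \<open>s > sqrt Y\<close> the exponent \<open>Y / s\<close> is at most
  \<open>sqrt Y\<close>, so this half-line alone contributes \<open>exp (- 2 * sqrt Y)\<close>. The
  two bounds pin the limit at 0 to 1/2.\<close>

lemma bj_bounds:
  assumes Y: "Y > 0" shows "exp (- 2 * sqrt Y) / 2 \<le> bj Y" "bj Y \<le> 1 / 2"
proof -
  have i: "set_integrable lborel {0<..} (\<lambda>s::real. exp (- s - Y / s))"
    using bessel_integrable[OF Y, of 0] by simp
  have "bessel_moment Y 0 \<le> (LINT s:{0<..}|lborel. exp (- s))"
    unfolding bessel_moment_def using i Y by (intro set_integral_mono set_integrable_exp_neg) auto
  then show "bj Y \<le> 1 / 2" using LINT_exp_neg[of 0] by (simp add: bj_def)
  have q: "sqrt Y > 0" using Y by simp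
  have sub: "{sqrt Y<..} \<subseteq> {0<..}" unfolding greaterThan_subset_iff using q by (rule less_imp_le)
  have "exp (- 2 * sqrt Y) = exp (- sqrt Y) * (LINT s:{sqrt Y<..}|lborel. exp (- s))"
    using Y by (simp add: LINT_exp_neg mult_exp_exp)
  also have "\<dots> = (LINT s:{sqrt Y<..}|lborel. exp (- sqrt Y) * exp (- s))" by simp
  also have "\<dots> \<le> (LINT s:{sqrt Y<..}|lborel. exp (- s - Y / s))"
  proof (rule set_integral_mono)
    show "set_integrable lborel {sqrt Y<..} (\<lambda>s. exp (- sqrt Y) * exp (- s))"
      by (intro set_integrable_mult_right set_integrable_subset[OF set_integrable_exp_neg] sub) auto
    show "set_integrable lborel {sqrt Y<..} (\<lambda>s. exp (- s - Y / s))"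
      by (rule set_integrable_subset[OF i]) (use sub in auto)
    fix s assume "s \<in> {sqrt Y<..}"
    then have s: "s > sqrt Y" by simp
    have "Y / s \<le> Y / sqrt Y" using s q Y by (intro frac_le) auto
    also have "\<dots> = sqrt Y" by (rule real_div_sqrt) (rule less_imp_le[OF Y])
    finally show "exp (- sqrt Y) * exp (- s) \<le> exp (- s - Y / s)"
      by (simp add: mult_exp_exp)
  qed
  also have "\<dots> \<le> (LINT s:{0<..}|lborel. exp (- s - Y / s))"
  proof -
    have "set_integrable lborel {sqrt Y<..} (\<lambda>s. exp (- s - Y / s))"
      by (rule set_integrable_subset[OF i]) (use sub in auto)
    then show ?thesis unfolding set_lebesgue_integral_def
      by (intro integral_mono i[unfolded set_integrable_def]) (use sub[THEN subsetD] in \<open>auto simp: set_integrable_def indicator_def\<close>)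
  qed
  finally show "exp (- 2 * sqrt Y) / 2 \<le> bj Y" by (simp add: bj_def bessel_moment_def)
qed

lemma bj_tendsto: "(bj \<longlongrightarrow> 1 / 2) (at_right 0)"
proof (rule tendsto_sandwich)
  show "\<forall>\<^sub>F Y in at_right 0. exp (- 2 * sqrt Y) / 2 \<le> bj Y"
    using bj_bounds(1) by (auto intro!: eventually_at_rightI[of 0 1])
  show "\<forall>\<^sub>F Y in at_right 0. bj Y \<le> 1 / 2"
    using bj_bounds(2) by (auto intro!: eventually_at_rightI[of 0 1])
  show "((\<lambda>Y. exp (- 2 * sqrt Y) / 2) \<longlongrightarrow> 1 / 2) (at_right (0::real))" by real_asymp
qed simp

text \<open>After folding the integral at \<open>sqrt Y\<close> the factor
  \<open>exp (- Y / s)\<close> varies only between \<open>exp (- sqrt Y)\<close> and 1.\<close>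

lemma bk_exp_integral:
  assumes Y: "Y > 0"
  shows "exp (- sqrt Y) * exp_integral (sqrt Y) \<le> bk Y" "bk Y \<le> exp_integral (sqrt Y)"
proof -
  have q: "sqrt Y > 0" using Y by simp
  have sub: "{sqrt Y<..} \<subseteq> {0<..}" unfolding greaterThan_subset_iff using q by (rule less_imp_le)
  have eq: "bk Y = (LINT s:{sqrt Y<..}|lborel. exp (- s - Y / s) / s)"
    using bessel_moment_1_half[OF Y] by (simp add: bk_def)
  have i1: "set_integrable lborel {sqrt Y<..} (\<lambda>s. exp (- s - Y / s) / s)"
    using set_integrable_subset[OF bessel_integrable[OF Y, of 1]] sub by auto
  note i2 = set_integrable_exp_neg_over[OF q]
  show "bk Y \<le> exp_integral (sqrt Y)"
    unfolding eq exp_integral_def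
  proof (rule set_integral_mono[OF i1 i2])
    fix s assume "s \<in> {sqrt Y<..}"
    then have s: "s > 0" using q by (auto dest: order_less_trans[OF q] simp del: real_sqrt_gt_0_iff)
    then show "exp (- s - Y / s) / s \<le> exp (- s) / s" using Y by (intro divide_right_mono) auto
  qed
  have "exp (- sqrt Y) * exp_integral (sqrt Y) = (LINT s:{sqrt Y<..}|lborel. exp (- sqrt Y) * (exp (- s) / s))"
    unfolding exp_integral_def by (rule set_integral_mult_right[symmetric])
  also have "\<dots> \<le> bk Y" unfolding eq
  proof (rule set_integral_mono[OF set_integrable_mult_right[OF i2] i1])
    fix s assume "s \<in> {sqrt Y<..}"
    then have s: "s > sqrt Y" by simp
    with q have s0: "s > 0" by (rule order_less_trans)
    have "Y / s \<le> Y / sqrt Y" using s q Y by (intro frac_le) auto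
    also have "\<dots> = sqrt Y" by (rule real_div_sqrt) (rule less_imp_le[OF Y])
    finally have "exp (- sqrt Y) * exp (- s) \<le> exp (- s - Y / s)" by (simp add: mult_exp_exp)
    then show "exp (- sqrt Y) * (exp (- s) / s) \<le> exp (- s - Y / s) / s"
      using divide_right_mono[of "exp (- sqrt Y) * exp (- s)" _ s] s0 by simp
  qed
  finally show "exp (- sqrt Y) * exp_integral (sqrt Y) \<le> bk Y" .
qed

text \<open>Euler's constant is matched here. The kernel agrees with the exponential integral at
  \<open>sqrt Y\<close> up to a factor between \<open>exp (- sqrt Y)\<close> and 1, and the
  resulting loss, of order \<open>sqrt Y * \<bar>ln Y\<bar>\<close>, tends to 0. This fixes the
  constant of integration in every later bound on \<open>bk_rem\<close>.\<close>

lemma bk_rem_tendsto: "(bk_rem \<longlongrightarrow> 0) (at_right 0)"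
proof (rule tendsto_sandwich)
  define g where "g = (euler_mascheroni :: real)"
  let ?l = "\<lambda>Y. - sqrt Y * (- ln (sqrt Y) - g + sqrt Y)"
  show "(?l \<longlongrightarrow> 0) (at_right 0)" "((\<lambda>Y. sqrt Y) \<longlongrightarrow> 0) (at_right (0::real))" by real_asymp+
  have "?l Y \<le> bk_rem Y \<and> bk_rem Y \<le> sqrt Y" if Y: "0 < Y" "Y < 1" for Y
  proof -
    let ?x = "sqrt Y"
    have x: "0 < ?x" "?x \<le> 1" using Y by auto
    have l: "ln Y / 2 = ln ?x" using Y by (simp add: ln_sqrt)
    note E = exp_integral_bounds[OF x]
    have E0: "exp_integral ?x \<ge> 0" using bk_exp_integral(2)[OF Y(1)] bk_nonneg[of Y] by linarith
    have "(1 - ?x) * exp_integral ?x \<le> exp (- ?x) * exp_integral ?x"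
      using exp_ge_add_one_self[of "- ?x"] E0 by (intro mult_right_mono) auto
    also have "\<dots> \<le> bk Y" using bk_exp_integral(1)[OF Y(1)] .
    finally have "exp_integral ?x - ?x * exp_integral ?x \<le> bk Y" by (simp add: algebra_simps)
    moreover have "?x * exp_integral ?x \<le> ?x * (- ln ?x - g + ?x)"
      using E(2) x by (intro mult_left_mono) (auto simp: g_def)
    ultimately have "?l Y \<le> bk_rem Y" using E(1) l unfolding bk_rem_def g_def by simp
    moreover have "bk_rem Y \<le> ?x" using E(2) bk_exp_integral(2)[OF Y(1)] l unfolding bk_rem_def by linarith
    ultimately show ?thesis by simp
  qed
  then show "\<forall>\<^sub>F Y in at_right 0. ?l Y \<le> bk_rem Y" "\<forall>\<^sub>F Y in at_right 0. bk_rem Y \<le> sqrt Y"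
    by (auto intro!: eventually_at_rightI[of 0 1])
qed

lemma bk_rem_deriv: "Y > 0 \<Longrightarrow> (bk_rem has_real_derivative (1 / 2 - bj Y) / Y) (at Y)"
  unfolding bk_rem_def by (auto intro!: derivative_eq_intros bk_deriv simp: diff_divide_distrib)

lemma bk_rem_nonneg: assumes "Y > 0" shows "bk_rem Y \<ge> 0"
  using nonneg_of_deriv_nonneg[of Y bk_rem "\<lambda>Y. (1 / 2 - bj Y) / Y" Y] assms bk_rem_deriv bj_bounds(2) bk_rem_tendsto
  by auto

lemma bk_rem_mono: assumes "0 < Y1" "Y1 \<le> Y2" shows "bk_rem Y1 \<le> bk_rem Y2"
proof (rule DERIV_nonneg_imp_nondecreasing[OF assms(2)])
  fix x assume "Y1 \<le> x" "x \<le> Y2"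
  then have "x > 0" using assms by simp
  then show "\<exists>y. (bk_rem has_real_derivative y) (at x) \<and> 0 \<le> y"
    using bk_rem_deriv bj_bounds(2) by (intro exI[of _ "(1 / 2 - bj x) / x"]) auto
qed

section \<open>Series bounds for the remainder\<close>

definition logterm :: "real \<Rightarrow> real" where "logterm Y = - ln Y / 2 - euler_mascheroni"

lemma bk_eq: "bk Y = logterm Y + bk_rem Y"
  by (simp add: bk_rem_def logterm_def)

lemma logterm_deriv: "Y > 0 \<Longrightarrow> (logterm has_real_derivative - 1 / (2 * Y)) (at Y)"
  unfolding logterm_def by (auto intro!: derivative_eq_intros)

text \<open>The remainder is a fixed point of twofold integration: if \<open>F' = logterm + f\<close> and
  \<open>G' = F / Y\<close>, a bound \<open>f\<close> on the remainder is improved to \<open>G\<close>.\<close>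

lemma bk_rem_step:
  fixes \<sigma> :: real
  assumes f: "\<And>Y. 0 < Y \<Longrightarrow> Y \<le> b \<Longrightarrow> \<sigma> * bk_rem Y \<le> \<sigma> * f Y"
    and F: "\<And>Y. 0 < Y \<Longrightarrow> Y \<le> b \<Longrightarrow> (F has_real_derivative logterm Y + f Y) (at Y)" "(F \<longlongrightarrow> 0) (at_right 0)"
    and G: "\<And>Y. 0 < Y \<Longrightarrow> Y \<le> b \<Longrightarrow> (G has_real_derivative F Y / Y) (at Y)" "(G \<longlongrightarrow> 0) (at_right 0)"
    and Y: "0 < Y" "Y \<le> b"
  shows "\<sigma> * bk_rem Y \<le> \<sigma> * G Y"
proof -
  \<comment> \<open>The function \<open>1 / 2 - bj\<close> has derivative
    \<open>bk = logterm + bk_rem\<close> and limit 0, so \<open>F\<close> lies on the side of it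
    prescribed by \<open>\<sigma>\<close>. The second integration, after division by
    \<open>Y\<close>, uses that \<open>bk_rem\<close> tends to 0. The value 1 of
    \<open>\<sigma>\<close> yields upper bounds, the value -1 lower ones.\<close>
  have 1: "\<sigma> * (F Y - (1 / 2 - bj Y)) \<ge> 0" if "0 < Y" "Y \<le> b" for Y
  proof (rule nonneg_of_deriv_nonneg[where f' = "\<lambda>Y. \<sigma> * (logterm Y + f Y - bk Y)", OF _ _ _ that])
    fix t assume t: "0 < t" "t \<le> b"
    show "((\<lambda>Y. \<sigma> * (F Y - (1 / 2 - bj Y))) has_real_derivative \<sigma> * (logterm t + f t - bk t)) (at t)"
      by (auto intro!: derivative_eq_intros F bj_deriv t)
    show "\<sigma> * (logterm t + f t - bk t) \<ge> 0"
      using f[OF t] by (simp add: bk_eq algebra_simps)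
  next
    have "((\<lambda>Y. \<sigma> * (F Y - (1 / 2 - bj Y))) \<longlongrightarrow> \<sigma> * (0 - (1/2 - 1/2))) (at_right 0)"
      by (intro tendsto_intros F bj_tendsto)
    then show "((\<lambda>Y. \<sigma> * (F Y - (1 / 2 - bj Y))) \<longlongrightarrow> 0) (at_right 0)" by simp
  qed
  have "\<sigma> * (G Y - bk_rem Y) \<ge> 0"
  proof (rule nonneg_of_deriv_nonneg[where f' = "\<lambda>Y. (\<sigma> * (F Y - (1 / 2 - bj Y))) / Y", OF _ _ _ Y])
    fix t assume t: "0 < t" "t \<le> b"
    show "((\<lambda>Y. \<sigma> * (G Y - bk_rem Y)) has_real_derivative (\<sigma> * (F t - (1 / 2 - bj t))) / t) (at t)"
      by (rule DERIV_cong[OF DERIV_cmult[OF DERIV_diff[OF G(1)[OF t] bk_rem_deriv[OF t(1)]]]])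
        (simp add: diff_divide_distrib right_diff_distrib)
    show "(\<sigma> * (F t - (1 / 2 - bj t))) / t \<ge> 0" using 1[OF t] t by auto
  next
    have "((\<lambda>Y. \<sigma> * (G Y - bk_rem Y)) \<longlongrightarrow> \<sigma> * (0 - 0)) (at_right 0)"
      by (intro tendsto_intros G bk_rem_tendsto)
    then show "((\<lambda>Y. \<sigma> * (G Y - bk_rem Y)) \<longlongrightarrow> 0) (at_right 0)" by simp
  qed
  then show ?thesis by (simp add: algebra_simps)
qed

lemma logterm_limits: "((\<lambda>Y. Y ^ Suc n * (logterm Y + c)) \<longlongrightarrow> 0) (at_right 0)"
proof -
  have "((\<lambda>Y. Y * (logterm Y + c)) \<longlongrightarrow> 0) (at_right 0)"
    unfolding logterm_def by (rule tendsto_eq_rhs) (real_asymp, simp)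
  moreover have "((\<lambda>Y::real. Y ^ n) \<longlongrightarrow> 0 ^ n) (at_right 0)" by (intro tendsto_intros)
  ultimately have "((\<lambda>Y. Y ^ n * (Y * (logterm Y + c))) \<longlongrightarrow> 0 ^ n * 0) (at_right 0)"
    by (intro tendsto_mult)
  then show ?thesis by (simp add: mult_ac)
qed

lemma logterm_pow_deriv:
  assumes "Y > 0"
  shows "((\<lambda>Y. Y ^ Suc n * (logterm Y + c)) has_real_derivative
          Y ^ n * (real (Suc n) * (logterm Y + c) - 1 / 2)) (at Y)"
proof (rule DERIV_cong)
  show "((\<lambda>Y. Y ^ Suc n * (logterm Y + c)) has_real_derivative
      real (Suc n) * Y ^ n * (logterm Y + c) + (- 1 / (2 * Y) + 0) * Y ^ Suc n) (at Y)"
    using DERIV_mult[OF DERIV_pow[of "Suc n" Y UNIV] DERIV_add[OF logterm_deriv[OF assms] DERIV_const[of c]]]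
    by simp
  have "(- 1 / (2 * Y) + 0) * Y ^ Suc n = - (Y ^ n) / 2" using assms by simp
  then show "real (Suc n) * Y ^ n * (logterm Y + c) + (- 1 / (2 * Y) + 0) * Y ^ Suc n
      = Y ^ n * (real (Suc n) * (logterm Y + c) - 1 / 2)"
    by (simp add: algebra_simps)
qed

text \<open>One step from the bound 0. The series of the kernel has the terms
  \<open>Y^k / (fact k)^2 * (logterm Y + H)\<close> with \<open>H\<close> the \<open>k\<close>-th
  harmonic number, and every further step produces one more of them exactly; the constants 1, 3/2,
  11/6, 25/12 below are harmonic numbers.\<close>

lemma bk_rem_lower_1:
  assumes Y: "0 < Y" shows "Y * (logterm Y + 1) \<le> bk_rem Y"
proof -
  have "- 1 * bk_rem Y \<le> - 1 * (Y ^ Suc 0 * (logterm Y + 1))"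
  proof (rule bk_rem_step[of Y "-1" "\<lambda>_. 0" "\<lambda>Y. Y ^ Suc 0 * (logterm Y + 1 / 2)"])
    fix t assume t: "0 < t" "t \<le> Y"
    show "((\<lambda>Y. Y ^ Suc 0 * (logterm Y + 1 / 2)) has_real_derivative logterm t + 0) (at t)"
      by (rule DERIV_cong, rule logterm_pow_deriv, rule t) simp
    show "((\<lambda>Y. Y ^ Suc 0 * (logterm Y + 1)) has_real_derivative (t ^ Suc 0 * (logterm t + 1 / 2)) / t) (at t)"
      by (rule DERIV_cong, rule logterm_pow_deriv, rule t) (use t in simp)
    show "- 1 * bk_rem t \<le> - 1 * 0" using bk_rem_nonneg t by simp
  qed (use Y logterm_limits[of 0] in auto)
  then show ?thesis by simp
qed

lemma bk_rem_lower_2: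
  assumes Y: "0 < Y" shows "Y * (logterm Y + 1) + Y\<^sup>2 / 4 * (logterm Y + 3 / 2) \<le> bk_rem Y"
proof -
  have "- 1 * bk_rem Y \<le> - 1 * (Y ^ Suc 0 * (logterm Y + 1) + 1 / 4 * (Y ^ Suc 1 * (logterm Y + 3 / 2)))"
  proof (rule bk_rem_step[of Y "-1" "\<lambda>Y. Y * (logterm Y + 1)"
       "\<lambda>Y. Y ^ Suc 0 * (logterm Y + 1 / 2) + 1 / 2 * (Y ^ Suc 1 * (logterm Y + 5 / 4))"])
    show "((\<lambda>Y. Y ^ Suc 0 * (logterm Y + 1 / 2) + 1 / 2 * (Y ^ Suc 1 * (logterm Y + 5 / 4))) \<longlongrightarrow> 0) (at_right 0)"
      by (rule tendsto_eq_rhs, (rule logterm_limits tendsto_add tendsto_mult_left)+, simp)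
    show "((\<lambda>Y. Y ^ Suc 0 * (logterm Y + 1) + 1 / 4 * (Y ^ Suc 1 * (logterm Y + 3 / 2))) \<longlongrightarrow> 0) (at_right 0)"
      by (rule tendsto_eq_rhs, (rule logterm_limits tendsto_add tendsto_mult_left)+, simp)
  next
    fix t assume t: "0 < t" "t \<le> Y"
    show "((\<lambda>Y. Y ^ Suc 0 * (logterm Y + 1 / 2) + 1 / 2 * (Y ^ Suc 1 * (logterm Y + 5 / 4))) has_real_derivative
        logterm t + t * (logterm t + 1)) (at t)"
      by (rule DERIV_cong, (rule DERIV_add DERIV_cmult logterm_pow_deriv t)+) (simp add: field_simps)
    show "((\<lambda>Y. Y ^ Suc 0 * (logterm Y + 1) + 1 / 4 * (Y ^ Suc 1 * (logterm Y + 3 / 2))) has_real_derivative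
        (t ^ Suc 0 * (logterm t + 1 / 2) + 1 / 2 * (t ^ Suc 1 * (logterm t + 5 / 4))) / t) (at t)"
      by (rule DERIV_cong, (rule DERIV_add DERIV_cmult logterm_pow_deriv t)+)
        (use t in \<open>simp add: field_simps power2_eq_square\<close>)
    show "- 1 * bk_rem t \<le> - 1 * (t * (logterm t + 1))" using bk_rem_lower_1[of t] t by simp
  qed (use Y in auto)
  then show ?thesis by (simp add: power2_eq_square)
qed

text \<open>By monotonicity \<open>E = bk_rem Y\<close> bounds the remainder on
  \<open>(0, Y]\<close>. Fed into one step, this constant gives
  \<open>E \<le> Y * (logterm Y + 1 + E)\<close>, which is solved for \<open>E\<close>.\<close>

lemma bk_rem_upper_1:
  assumes Y: "0 < Y" "Y < 1" shows "bk_rem Y \<le> Y * (logterm Y + 1) / (1 - Y)"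
proof -
  define E where "E = bk_rem Y"
  have "1 * bk_rem Y \<le> 1 * (Y ^ Suc 0 * (logterm Y + (1 + E)))"
  proof (rule bk_rem_step[of Y 1 "\<lambda>_. E" "\<lambda>Y. Y ^ Suc 0 * (logterm Y + (1 / 2 + E))"])
    show "((\<lambda>Y. Y ^ Suc 0 * (logterm Y + (1 / 2 + E))) \<longlongrightarrow> 0) (at_right 0)"
      "((\<lambda>Y. Y ^ Suc 0 * (logterm Y + (1 + E))) \<longlongrightarrow> 0) (at_right 0)"
      by (rule logterm_limits)+
  next
    fix t assume t: "0 < t" "t \<le> Y"
    show "((\<lambda>Y. Y ^ Suc 0 * (logterm Y + (1 / 2 + E))) has_real_derivative logterm t + E) (at t)"
      by (rule DERIV_cong, rule logterm_pow_deriv, rule t) simp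
    show "((\<lambda>Y. Y ^ Suc 0 * (logterm Y + (1 + E))) has_real_derivative (t ^ Suc 0 * (logterm t + (1 / 2 + E))) / t) (at t)"
      by (rule DERIV_cong, rule logterm_pow_deriv, rule t) (use t in simp)
    show "1 * bk_rem t \<le> 1 * E" using bk_rem_mono t by (simp add: E_def)
  qed (use Y in auto)
  then have "E * (1 - Y) \<le> Y * (logterm Y + 1)" by (simp add: algebra_simps E_def)
  then show ?thesis using Y by (simp add: pos_le_divide_eq E_def)
qed

text \<open>The factor \<open>1 / (1 - b)\<close> of the one-step bound ends up in the last term
  only: each further step turns the preceding terms into exact series terms and pushes the factor to
  the next power of \<open>Y\<close>.\<close>

lemma bk_rem_upper_4:
  assumes b: "0 < b" "b < 1" and pos: "logterm b + 1 \<ge> 0" and Y: "0 < Y" "Y \<le> b"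
  shows "bk_rem Y \<le> Y * (logterm Y + 1) + Y\<^sup>2 / 4 * (logterm Y + 3 / 2)
      + Y ^ 3 / 36 * (logterm Y + 11 / 6) + Y ^ 4 / (576 * (1 - b)) * (logterm Y + 25 / 12)"
proof -
  define c where "c = 1 / (1 - b)"
  have 1: "bk_rem Y \<le> c * (Y ^ Suc 0 * (logterm Y + 1))" if Y: "0 < Y" "Y \<le> b" for Y
  proof -
    have "logterm Y \<ge> logterm b" using Y b by (simp add: logterm_def)
    then have "Y * (logterm Y + 1) \<ge> 0" using pos Y by auto
    \<comment> \<open>Positivity of the bracket on \<open>(0, b]\<close> is what lets the
      denominator \<open>1 - Y\<close> be lowered to \<open>1 - b\<close>.\<close>
    then have "Y * (logterm Y + 1) / (1 - Y) \<le> Y * (logterm Y + 1) / (1 - b)"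
      using Y b by (intro divide_left_mono) auto
    then show ?thesis using bk_rem_upper_1[of Y] Y b by (simp add: c_def)
  qed
  have 2: "1 * bk_rem Y \<le> 1 * (Y ^ Suc 0 * (logterm Y + 1) + c / 4 * (Y ^ Suc 1 * (logterm Y + 3 / 2)))"
    if Y: "0 < Y" "Y \<le> b" for Y
  proof (rule bk_rem_step[of b 1 "\<lambda>Y. c * (Y ^ Suc 0 * (logterm Y + 1))"
       "\<lambda>Y. Y ^ Suc 0 * (logterm Y + 1 / 2) + c / 2 * (Y ^ Suc 1 * (logterm Y + 5 / 4))", OF _ _ _ _ _ Y])
    show "((\<lambda>Y. Y ^ Suc 0 * (logterm Y + 1 / 2) + c / 2 * (Y ^ Suc 1 * (logterm Y + 5 / 4))) \<longlongrightarrow> 0) (at_right 0)"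
      by (rule tendsto_eq_rhs, (rule logterm_limits tendsto_add tendsto_mult_left)+, simp)
    show "((\<lambda>Y. Y ^ Suc 0 * (logterm Y + 1) + c / 4 * (Y ^ Suc 1 * (logterm Y + 3 / 2))) \<longlongrightarrow> 0) (at_right 0)"
      by (rule tendsto_eq_rhs, (rule logterm_limits tendsto_add tendsto_mult_left)+, simp)
  next
    fix t assume t: "0 < t" "t \<le> b"
    show "((\<lambda>Y. Y ^ Suc 0 * (logterm Y + 1 / 2) + c / 2 * (Y ^ Suc 1 * (logterm Y + 5 / 4))) has_real_derivative logterm t + (\<lambda>Y. c * (Y ^ Suc 0 * (logterm Y + 1))) t) (at t)"
      by (rule DERIV_cong, (rule DERIV_add DERIV_cmult logterm_pow_deriv t)+)
        (use t in \<open>simp add: field_simps power2_eq_square\<close>)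
    show "((\<lambda>Y. Y ^ Suc 0 * (logterm Y + 1) + c / 4 * (Y ^ Suc 1 * (logterm Y + 3 / 2))) has_real_derivative (\<lambda>Y. Y ^ Suc 0 * (logterm Y + 1 / 2) + c / 2 * (Y ^ Suc 1 * (logterm Y + 5 / 4))) t / t) (at t)"
      by (rule DERIV_cong, (rule DERIV_add DERIV_cmult logterm_pow_deriv t)+)
        (use t in \<open>simp add: field_simps power2_eq_square power3_eq_cube power4_eq_xxxx\<close>)
    show "1 * bk_rem t \<le> 1 * (\<lambda>Y. c * (Y ^ Suc 0 * (logterm Y + 1))) t" using 1[OF t] by simp
  qed
  have 3: "1 * bk_rem Y \<le> 1 * (Y ^ Suc 0 * (logterm Y + 1) + 1 / 4 * (Y ^ Suc 1 * (logterm Y + 3 / 2))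
       + c / 36 * (Y ^ Suc 2 * (logterm Y + 11 / 6)))"
    if Y: "0 < Y" "Y \<le> b" for Y
  proof (rule bk_rem_step[of b 1 "\<lambda>Y. Y ^ Suc 0 * (logterm Y + 1) + c / 4 * (Y ^ Suc 1 * (logterm Y + 3 / 2))"
       "\<lambda>Y. Y ^ Suc 0 * (logterm Y + 1 / 2) + 1 / 2 * (Y ^ Suc 1 * (logterm Y + 5 / 4))
          + c / 12 * (Y ^ Suc 2 * (logterm Y + 5 / 3))", OF _ _ _ _ _ Y])
    show "((\<lambda>Y. Y ^ Suc 0 * (logterm Y + 1 / 2) + 1 / 2 * (Y ^ Suc 1 * (logterm Y + 5 / 4))
          + c / 12 * (Y ^ Suc 2 * (logterm Y + 5 / 3))) \<longlongrightarrow> 0) (at_right 0)"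
      by (rule tendsto_eq_rhs, (rule logterm_limits tendsto_add tendsto_mult_left)+, simp)
    show "((\<lambda>Y. Y ^ Suc 0 * (logterm Y + 1) + 1 / 4 * (Y ^ Suc 1 * (logterm Y + 3 / 2))
       + c / 36 * (Y ^ Suc 2 * (logterm Y + 11 / 6))) \<longlongrightarrow> 0) (at_right 0)"
      by (rule tendsto_eq_rhs, (rule logterm_limits tendsto_add tendsto_mult_left)+, simp)
  next
    fix t assume t: "0 < t" "t \<le> b"
    show "((\<lambda>Y. Y ^ Suc 0 * (logterm Y + 1 / 2) + 1 / 2 * (Y ^ Suc 1 * (logterm Y + 5 / 4))
          + c / 12 * (Y ^ Suc 2 * (logterm Y + 5 / 3))) has_real_derivative logterm t + (\<lambda>Y. Y ^ Suc 0 * (logterm Y + 1) + c / 4 * (Y ^ Suc 1 * (logterm Y + 3 / 2))) t) (at t)"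
      by (rule DERIV_cong, (rule DERIV_add DERIV_cmult logterm_pow_deriv t)+)
        (use t in \<open>simp add: field_simps power2_eq_square power3_eq_cube power4_eq_xxxx\<close>)
    show "((\<lambda>Y. Y ^ Suc 0 * (logterm Y + 1) + 1 / 4 * (Y ^ Suc 1 * (logterm Y + 3 / 2))
       + c / 36 * (Y ^ Suc 2 * (logterm Y + 11 / 6))) has_real_derivative (\<lambda>Y. Y ^ Suc 0 * (logterm Y + 1 / 2) + 1 / 2 * (Y ^ Suc 1 * (logterm Y + 5 / 4))
          + c / 12 * (Y ^ Suc 2 * (logterm Y + 5 / 3))) t / t) (at t)"
      by (rule DERIV_cong, (rule DERIV_add DERIV_cmult logterm_pow_deriv t)+)
        (use t in \<open>simp add: field_simps power2_eq_square power3_eq_cube power4_eq_xxxx\<close>)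
    show "1 * bk_rem t \<le> 1 * (\<lambda>Y. Y ^ Suc 0 * (logterm Y + 1) + c / 4 * (Y ^ Suc 1 * (logterm Y + 3 / 2))) t" using 2[OF t] by simp
  qed
  have "1 * bk_rem Y \<le> 1 * (Y ^ Suc 0 * (logterm Y + 1) + 1 / 4 * (Y ^ Suc 1 * (logterm Y + 3 / 2))
       + 1 / 36 * (Y ^ Suc 2 * (logterm Y + 11 / 6)) + c / 576 * (Y ^ Suc 3 * (logterm Y + 25 / 12)))"
  proof (rule bk_rem_step[of b 1 "\<lambda>Y. Y ^ Suc 0 * (logterm Y + 1) + 1 / 4 * (Y ^ Suc 1 * (logterm Y + 3 / 2))
       + c / 36 * (Y ^ Suc 2 * (logterm Y + 11 / 6))"
       "\<lambda>Y. Y ^ Suc 0 * (logterm Y + 1 / 2) + 1 / 2 * (Y ^ Suc 1 * (logterm Y + 5 / 4))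
          + 1 / 12 * (Y ^ Suc 2 * (logterm Y + 5 / 3)) + c / 144 * (Y ^ Suc 3 * (logterm Y + 47 / 24))", OF _ _ _ _ _ Y])
    show "((\<lambda>Y. Y ^ Suc 0 * (logterm Y + 1 / 2) + 1 / 2 * (Y ^ Suc 1 * (logterm Y + 5 / 4))
          + 1 / 12 * (Y ^ Suc 2 * (logterm Y + 5 / 3)) + c / 144 * (Y ^ Suc 3 * (logterm Y + 47 / 24))) \<longlongrightarrow> 0) (at_right 0)"
      by (rule tendsto_eq_rhs, (rule logterm_limits tendsto_add tendsto_mult_left)+, simp)
    show "((\<lambda>Y. Y ^ Suc 0 * (logterm Y + 1) + 1 / 4 * (Y ^ Suc 1 * (logterm Y + 3 / 2))
       + 1 / 36 * (Y ^ Suc 2 * (logterm Y + 11 / 6)) + c / 576 * (Y ^ Suc 3 * (logterm Y + 25 / 12))) \<longlongrightarrow> 0) (at_right 0)"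
      by (rule tendsto_eq_rhs, (rule logterm_limits tendsto_add tendsto_mult_left)+, simp)
  next
    fix t assume t: "0 < t" "t \<le> b"
    show "((\<lambda>Y. Y ^ Suc 0 * (logterm Y + 1 / 2) + 1 / 2 * (Y ^ Suc 1 * (logterm Y + 5 / 4))
          + 1 / 12 * (Y ^ Suc 2 * (logterm Y + 5 / 3)) + c / 144 * (Y ^ Suc 3 * (logterm Y + 47 / 24))) has_real_derivative logterm t + (\<lambda>Y. Y ^ Suc 0 * (logterm Y + 1) + 1 / 4 * (Y ^ Suc 1 * (logterm Y + 3 / 2))
       + c / 36 * (Y ^ Suc 2 * (logterm Y + 11 / 6))) t) (at t)"
      by (rule DERIV_cong, (rule DERIV_add DERIV_cmult logterm_pow_deriv t)+)
        (use t in \<open>simp add: field_simps power2_eq_square power3_eq_cube power4_eq_xxxx\<close>)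
    show "((\<lambda>Y. Y ^ Suc 0 * (logterm Y + 1) + 1 / 4 * (Y ^ Suc 1 * (logterm Y + 3 / 2))
       + 1 / 36 * (Y ^ Suc 2 * (logterm Y + 11 / 6)) + c / 576 * (Y ^ Suc 3 * (logterm Y + 25 / 12))) has_real_derivative (\<lambda>Y. Y ^ Suc 0 * (logterm Y + 1 / 2) + 1 / 2 * (Y ^ Suc 1 * (logterm Y + 5 / 4))
          + 1 / 12 * (Y ^ Suc 2 * (logterm Y + 5 / 3)) + c / 144 * (Y ^ Suc 3 * (logterm Y + 47 / 24))) t / t) (at t)"
      by (rule DERIV_cong, (rule DERIV_add DERIV_cmult logterm_pow_deriv t)+)
        (use t in \<open>simp add: field_simps power2_eq_square power3_eq_cube power4_eq_xxxx\<close>)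
    show "1 * bk_rem t \<le> 1 * (\<lambda>Y. Y ^ Suc 0 * (logterm Y + 1) + 1 / 4 * (Y ^ Suc 1 * (logterm Y + 3 / 2))
       + c / 36 * (Y ^ Suc 2 * (logterm Y + 11 / 6))) t" using 3[OF t] by simp
  qed
  then show ?thesis by (simp add: c_def power2_eq_square eval_nat_numeral mult_ac)
qed

text \<open>Convexity in \<open>ln Y\<close>: along \<open>Y = exp v\<close> the second derivative of the left-hand side is
  \<open>Y * (bk Y - k2 + 4 * k3 * Y)\<close>.\<close>

lemma bk_tangent:
  assumes k: "\<And>Y. Y > 0 \<Longrightarrow> bk Y \<ge> k2 - 4 * k3 * Y" and Y: "Y > 0" and Z: "Z > 0"
  shows "bk Z - k2 * Z + k3 * Z\<^sup>2 + (- bj Z - k2 * Z + 2 * k3 * Z\<^sup>2) * (ln Y - ln Z) \<le> bk Y - k2 * Y + k3 * Y\<^sup>2"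
proof -
  let ?F = "\<lambda>v. bk (exp v) - k2 * exp v + k3 * (exp v)\<^sup>2"
  let ?F' = "\<lambda>v. - bj (exp v) - k2 * exp v + 2 * k3 * (exp v)\<^sup>2"
  have dF: "(?F has_real_derivative ?F' v) (at v)" for v
  proof -
    have "((\<lambda>v. bk (exp v)) has_real_derivative - bj (exp v) / exp v * exp v) (at v)"
      by (rule DERIV_chain2[OF bk_deriv]) auto
    then have "((\<lambda>v. bk (exp v)) has_real_derivative - bj (exp v)) (at v)" by simp
    moreover have "((\<lambda>v. (exp v)\<^sup>2) has_real_derivative 2 * (exp v)\<^sup>2) (at v)"
      using DERIV_mult[OF DERIV_exp[of v] DERIV_exp[of v]] by (simp add: power2_eq_square)
    ultimately have "(?F has_real_derivative (- bj (exp v) - k2 * exp v + k3 * (2 * (exp v)\<^sup>2))) (at v)"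
      by (intro DERIV_add DERIV_diff DERIV_cmult DERIV_exp)
    then show ?thesis by (simp only: mult.left_commute mult.assoc)
  qed
  have dF': "(?F' has_real_derivative (exp v * (bk (exp v) - k2 + 4 * k3 * exp v))) (at v)" for v
  proof -
    have "((\<lambda>v. bj (exp v)) has_real_derivative - bk (exp v) * exp v) (at v)"
      by (rule DERIV_chain2[OF bj_deriv]) auto
    moreover have "((\<lambda>v. (exp v)\<^sup>2) has_real_derivative 2 * (exp v)\<^sup>2) (at v)"
      using DERIV_mult[OF DERIV_exp[of v] DERIV_exp[of v]] by (simp add: power2_eq_square)
    ultimately have "(?F' has_real_derivative
        (- (- bk (exp v) * exp v) - k2 * exp v + 2 * k3 * (2 * (exp v)\<^sup>2))) (at v)"
      by (intro DERIV_add DERIV_diff DERIV_minus DERIV_cmult DERIV_exp)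
    moreover have "- (- bk (exp v) * exp v) - k2 * exp v + 2 * k3 * (2 * (exp v)\<^sup>2)
       = exp v * (bk (exp v) - k2 + 4 * k3 * exp v)"
      by (simp add: power2_eq_square ring_distribs)
    ultimately show ?thesis by simp
  qed
  have "mono ?F'"
  proof (rule monoI, rule DERIV_nonneg_imp_nondecreasing[where f = ?F'], assumption)
    fix v
    have "exp v * (bk (exp v) - k2 + 4 * k3 * exp v) \<ge> 0"
      using k[of "exp v"] by (intro mult_nonneg_nonneg) auto
    then show "\<exists>y. (?F' has_real_derivative y) (at v) \<and> 0 \<le> y" by (intro exI conjI) (rule dF')
  qed
  then have "convex_on UNIV ?F"
  proof (intro convex_on_realI)
    show "(?F has_real_derivative ?F' v) (at v)" for v by (rule dF)
    show "?F' x \<le> ?F' y" if "x \<le> y" for x y using \<open>mono ?F'\<close> that by (rule monoD)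
  qed simp
  then have "?F (ln Y) - ?F (ln Z) \<ge> ?F' (ln Z) * (ln Y - ln Z)"
    by (rule convex_on_imp_above_tangent[where A = UNIV]) (use dF in \<open>auto intro: has_field_derivative_at_within\<close>)
  then show ?thesis using Y Z by simp
qed

section \<open>Numerical inequalities\<close>

lemma ln_2_numeric: "(34657 / 50000) \<le> ln (2::real)" "ln (2::real) \<le> (13863 / 20000)"
  using ln_approx_bounds[of 2 5] by (simp_all add: eval_nat_numeral)

lemma ln_numeric:
  "ln (106 / 39 :: real) \<le> 1" "1 \<le> ln (87 / 32 :: real)"
  "ln (317 / 100 :: real) \<le> (5771 / 5000)" "(2887 / 2500) \<le> ln (200 / 63 :: real)"
proof -
  show "ln (106 / 39 :: real) \<le> 1" using ln_approx_bounds[of "106 / 39" 5] by (simp add: eval_nat_numeral)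
  show "1 \<le> ln (87 / 32 :: real)" using ln_approx_bounds[of "87 / 32" 5] by (simp add: eval_nat_numeral)
  show "ln (317 / 100 :: real) \<le> (5771 / 5000)" using ln_approx_bounds[of "317 / 100" 5] by (simp add: eval_nat_numeral)
  show "(2887 / 2500) \<le> ln (200 / 63 :: real)" using ln_approx_bounds[of "200 / 63" 5] by (simp add: eval_nat_numeral)
qed

lemma euler_mascheroni_numeric: "(5771 / 10000) \<le> (euler_mascheroni :: real)" "(euler_mascheroni :: real) \<le> (2887 / 5000)"
proof -
  \<comment> \<open>The bounds at 63 involve the logarithm of 64, a power of 2.\<close>
  have "ln (real (Suc 63)) = 6 * ln 2" using ln_realpow[of 2 6] by simp
  then have "euler_mascheroni \<in> {harm 63 - 6 * ln 2 + 1 / 128 .. harm 63 - 6 * ln (2::real) + 1 / 126}"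
    using euler_mascheroni_bounds[of 63] by (simp add: inverse_eq_divide)
  then show "(5771 / 10000) \<le> (euler_mascheroni :: real)" "(euler_mascheroni :: real) \<le> (2887 / 5000)"
    using ln_2_numeric by (simp_all add: harm_expand)
qed

lemma exp_numeric:
  "(1839 / 5000) \<le> exp (- 1 :: real)" "exp (- 1 :: real) \<le> (46 / 125)"
  "(63 / 200) \<le> exp (- 2 * euler_mascheroni :: real)" "exp (- 2 * euler_mascheroni :: real) \<le> (631 / 2000)"
proof -
  have le: "exp x \<le> 1 / c" if "ln c \<le> - x" "c > 0" for x c :: real
    using iffD2[OF exp_le_cancel_iff, OF that(1)] that(2) by (simp add: exp_minus field_simps)
  have ge: "1 / c \<le> exp x" if "- x \<le> ln c" "c > 0" for x c :: real
    using iffD2[OF exp_le_cancel_iff, OF that(1)] that(2) by (simp add: exp_minus field_simps)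
  have "1 / (87 / 32) \<le> exp (- 1 :: real)" "1 / (200 / 63) \<le> exp (- 2 * euler_mascheroni :: real)"
    by (rule ge; use ln_numeric euler_mascheroni_numeric in simp)+
  moreover have "exp (- 1 :: real) \<le> 1 / (106 / 39)" "exp (- 2 * euler_mascheroni :: real) \<le> 1 / (317 / 100)"
    by (rule le; use ln_numeric euler_mascheroni_numeric in simp)+
  ultimately show "(1839 / 5000) \<le> exp (- 1 :: real)" "exp (- 1 :: real) \<le> (46 / 125)"
    "(63 / 200) \<le> exp (- 2 * euler_mascheroni :: real)" "exp (- 2 * euler_mascheroni :: real) \<le> (631 / 2000)"
    by simp_all
qed

text \<open>The powers \<open>2 ^ 7\<close> and \<open>5 ^ 3\<close> differ only by the factor
  128/125, for which \<open>ln t \<le> t - 1\<close>, applied to it and to its reciprocal, is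
  accurate enough.\<close>

lemma ln_5_bounds: "(16093 / 10000) \<le> ln (5::real)" "ln (5::real) \<le> (1006 / 625)"
proof -
  have "ln (2 ^ 7 :: real) - ln (5 ^ 3) = ln (128 / 125)" by (simp add: ln_div)
  then have e: "7 * ln 2 - 3 * ln 5 = ln ((128 / 125) :: real)" using ln_realpow[of 2 7] ln_realpow[of 5 3] by simp
  have "ln ((128 / 125)::real) \<le> (3 / 125)" using ln_le_minus_one[of "(128 / 125)::real"] by simp
  moreover have "(117 / 5000) \<le> ln ((128 / 125)::real)"
    using ln_le_minus_one[of "1 / (128 / 125)::real"] by (simp add: ln_div)
  ultimately show "(16093 / 10000) \<le> ln (5::real)" "ln (5::real) \<le> (1006 / 625)" using e ln_2_numeric by auto
qed

text \<open>The series of the kernel cut after the terms of second order.\<close>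

definition bk_low :: "real \<Rightarrow> real" where
  "bk_low Y = logterm Y * (1 + Y + Y\<^sup>2 / 4) + Y + 3 / 8 * Y\<^sup>2"

lemma bk_low_le: "Y > 0 \<Longrightarrow> bk_low Y \<le> bk Y"
  using bk_rem_lower_2[of Y] by (simp add: bk_low_def bk_eq algebra_simps add_divide_distrib)

text \<open>The line lies just below the tangent at \<open>1/5\<close> to the convex minorant \<open>bk_low\<close>.\<close>

lemma bk_linear_lower:
  assumes "Y > 0" shows "(81 / 100) - 4 * (81 / 200) * Y \<le> bk Y"
\<comment> \<open>The line vanishes at 1/2, and beyond that point nonnegativity of \<open>bk\<close>
  is enough.\<close>
proof (cases "Y \<le> 1 / 2")
  case False
  then show ?thesis using bk_nonneg[of Y] by simp
next
  case True
  define d where "d = (\<lambda>Y. - 1 / (2 * Y) - 1 / 2 - Y / 8 + logterm Y * (1 + Y / 2) + 1 + 3 / 4 * Y)"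
  have der: "(bk_low has_real_derivative d x) (at x)" if "x > 0" for x
  proof -
    have "((\<lambda>Y. 1 + Y + Y\<^sup>2 / 4) has_real_derivative 1 + x / 2) (at x)" "((\<lambda>Y. 3 / 8 * Y\<^sup>2) has_real_derivative 3 / 4 * x) (at x)"
      by (auto intro!: derivative_eq_intros)
    note DERIV_add[OF DERIV_add[OF DERIV_mult[OF logterm_deriv[OF that] this(1)] DERIV_ident] this(2)]
    moreover have "- 1 / (2 * x) * (1 + x + x\<^sup>2 / 4) = - 1 / (2 * x) - 1 / 2 - x / 8"
      using that by (simp add: power2_eq_square divide_simps)
    ultimately show ?thesis unfolding bk_low_def[abs_def] d_def by (simp add: algebra_simps)
  qed
  have dder: "(d has_real_derivative (1 / (2 * x\<^sup>2) - 1 / 8 - (1 + x / 2) / (2 * x) + logterm x / 2 + 3 / 4)) (at x)" if "x > 0" for x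
  proof -
    have "((\<lambda>Y. - 1 / (2 * Y)) has_real_derivative 1 / (2 * x\<^sup>2)) (at x)"
      using that by (auto intro!: derivative_eq_intros simp: power2_eq_square)
    moreover have "((\<lambda>Y. 1 + Y / 2) has_real_derivative 1 / 2) (at x)" "((\<lambda>Y. Y / 8) has_real_derivative 1 / 8) (at x)"
       "((\<lambda>Y. 3 / 4 * Y) has_real_derivative 3 / 4) (at x)"
      by (auto intro!: derivative_eq_intros)
    ultimately have "(d has_real_derivative 1 / (2 * x\<^sup>2) - 0 - 1 / 8 + (- 1 / (2 * x) * (1 + x / 2) + 1 / 2 * logterm x) + 0 + 3 / 4) (at x)"
      unfolding d_def by (intro DERIV_add DERIV_diff DERIV_mult DERIV_const logterm_deriv that)
    then show ?thesis by (simp add: algebra_simps)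
  qed
  have pos: "1 / (2 * x\<^sup>2) - 1 / 8 - (1 + x / 2) / (2 * x) + logterm x / 2 + 3 / 4 \<ge> 0" if x: "0 < x" "x \<le> 1 / 2" for x
  proof -
    have "ln x \<le> 0" using x by simp
    then have "logterm x \<ge> - (231 / 400)" using euler_mascheroni_numeric by (simp add: logterm_def)
    moreover have "(1 + x / 2) / (2 * x) = 1 / (2 * x) + 1 / 4" using x by (simp add: add_divide_distrib)
    moreover have "1 / (2 * x\<^sup>2) \<ge> 1 / (2 * x)" using x by (simp add: divide_simps power2_eq_square)
    ultimately show ?thesis by simp
  qed
  have L: "logterm (1 / 5) = ln 5 / 2 - euler_mascheroni" by (simp add: logterm_def ln_div)
  have L': "(227 / 1000) \<le> logterm (1 / 5)" "logterm (1 / 5) \<le> (1141 / 5000)" unfolding L using ln_5_bounds euler_mascheroni_numeric by simp_all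
  have c: "convex {0<..1/2::real}" by (rule convex_real_interval)
  have "convex_on {0<..1/2} bk_low" by (rule f''_ge0_imp_convex[OF c der dder pos]; simp)
  moreover have "(bk_low has_real_derivative d (1 / 5)) (at (1 / 5) within {0<..1/2})"
    by (rule has_field_derivative_at_within[OF der]) simp
  ultimately have "bk_low Y - bk_low (1 / 5) \<ge> d (1 / 5) * (Y - 1 / 5)"
    using True assms by (intro convex_on_imp_above_tangent[of "{0<..1/2}"]) auto
  moreover have "bk_low (1 / 5) + d (1 / 5) * (Y - 1 / 5) = (59 / 100) - (15 / 8) * Y + logterm (1 / 5) * ((99 / 100) + (11 / 10) * Y)"
    by (simp add: bk_low_def d_def power2_eq_square field_simps)
  moreover have "(227 / 1000) * ((99 / 100) + (11 / 10) * Y) \<le> logterm (1 / 5) * ((99 / 100) + (11 / 10) * Y)"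
    using L' assms by (intro mult_right_mono) auto
  ultimately show ?thesis using bk_low_le[OF assms] True by simp
qed

text \<open>Throughout, \<open>y = R\<^sup>2 / (2 \<tau>) = exp (- (1 + x))\<close>, \<open>\<Delta> = ln (R / r) - euler_mascheroni\<close> and
  \<open>\<delta> = ln (R / r) - ln |\<Phi> z|\<close>, where \<open>r\<close> is the conformal radius.  Jensen's inequality suffices unless all of
  \<open>x\<close>, \<open>\<Delta>\<close>, \<open>\<delta>\<close> are small; the remaining corner needs the gain computed from the first two moments
  of the level curves.\<close>

lemma bk_rem_final_upper:
  fixes x :: real
  assumes x: "x \<ge> 0" and y: "y = exp (- (1 + x))"
  shows "bk_rem y \<le> y * ((1 + x) / 2 - euler_mascheroni + (569 / 500))"
proof -
  define L where "L = (1 + x) / 2 - euler_mascheroni"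
  have Ly: "logterm y = L" by (simp add: y L_def logterm_def)
  have y0: "0 < y" by (simp add: y)
  have e1: "exp (- 1 :: real) \<le> 46 / 125" using exp_numeric(2) by simp
  have yx: "y * (1 + x) \<le> 46 / 125"
  proof -
    have "y = exp (- 1) * exp (- x)" by (simp add: y exp_add[symmetric])
    then have "y * (1 + x) = exp (- 1) * (exp (- x) * (1 + x))" by simp
    also have "\<dots> \<le> exp (- 1) * (exp (- x) * exp x)"
      using exp_ge_add_one_self[of x] by (intro mult_left_mono) auto
    also have "\<dots> = exp (- 1)" by (simp add: exp_minus)
    finally show ?thesis using e1 by linarith
  qed
  have y1: "y \<le> 46 / 125"
  proof -
    have "y * 1 \<le> y * (1 + x)" using y0 x by (intro mult_left_mono) auto
    then show ?thesis using yx by linarith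
  qed
  \<comment> \<open>The number 771/10000 is a lower bound for
    \<open>euler_mascheroni - 1 / 2\<close>, so that \<open>L + c\<close> is at most
    \<open>c - 771 / 10000\<close> at \<open>x = 0\<close> and then grows more slowly than this
    multiple of \<open>1 + x\<close>; and \<open>y * (1 + x)\<close> never exceeds
    \<open>exp (- 1)\<close>.\<close>
  have t: "y * (L + c) \<le> (46 / 125) * (c - (771 / 10000))" if c: "c \<ge> (5387 / 5000)" for c
  proof -
    have "L + c \<le> (c - (771 / 10000)) * (1 + x)"
    proof -
      have "x * (1 / 2) \<le> x * (c - (771 / 10000))" using x c by (intro mult_left_mono) auto
      moreover have "(c - (771 / 10000)) * (1 + x) = c - (771 / 10000) + x * (c - (771 / 10000))" by (simp add: algebra_simps)
      ultimately show ?thesis using euler_mascheroni_numeric add_divide_distrib[of 1 x 2] unfolding L_def by linarith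
    qed
    then have "y * (L + c) \<le> (c - (771 / 10000)) * (y * (1 + x))" using y0 by (simp add: mult_left_mono mult.left_commute)
    also have "\<dots> \<le> (c - (771 / 10000)) * (46 / 125)" using yx c by (intro mult_left_mono) auto
    finally show ?thesis by (simp add: mult.commute)
  qed
  have L1: "L + 1 \<ge> 0" using x euler_mascheroni_numeric add_divide_distrib[of 1 x 2] unfolding L_def by linarith
  have "bk_rem y \<le> y * (L + 1) + y\<^sup>2 / 4 * (L + 3 / 2) + y ^ 3 / 36 * (L + 11 / 6) + y ^ 4 / (576 * (1 - y)) * (L + 25 / 12)"
    using bk_rem_upper_4[of y y] y0 y1 L1 Ly by simp
  also have "\<dots> = y * (L + 1 + (y * (L + 3 / 2)) / 4 + y * (y * (L + 11 / 6)) / 36 + y\<^sup>2 / (576 * (1 - y)) * (y * (L + 25 / 12)))"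
    by (simp add: algebra_simps power2_eq_square power3_eq_cube power4_eq_xxxx add_divide_distrib)
  \<comment> \<open>Here 569/500 is 1 from the first series term plus 69/500, a bound for the terms
    of orders two to four after division by \<open>y\<close>.\<close>
  also have "\<dots> \<le> y * (L + (569 / 500))"
  proof (intro mult_left_mono)
    have "y * (y * (L + 11 / 6)) \<le> (46 / 125) * ((46 / 125) * (11 / 6 - (771 / 10000)))"
    proof (rule mult_mono[OF y1])
      show "y * (L + 11 / 6) \<le> (46 / 125) * (11 / 6 - (771 / 10000))" by (rule t) simp
    qed (use y0 L1 in auto)
    moreover have "y\<^sup>2 / (576 * (1 - y)) * (y * (L + 25 / 12)) \<le> ((46 / 125)\<^sup>2 / (576 * (1 - (46 / 125)))) * ((46 / 125) * (25 / 12 - (771 / 10000)))"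
    proof (rule mult_mono)
      show "y\<^sup>2 / (576 * (1 - y)) \<le> (46 / 125)\<^sup>2 / (576 * (1 - (46 / 125)))"
        by (intro frac_le power_mono) (use y0 y1 in auto)
      show "y * (L + 25 / 12) \<le> (46 / 125) * (25 / 12 - (771 / 10000))" by (rule t) simp
    qed (use y0 L1 in auto)
    moreover have "y * (L + 3 / 2) \<le> (46 / 125) * (3 / 2 - (771 / 10000))" by (rule t) simp
    ultimately have "(y * (L + 3 / 2)) / 4 + y * (y * (L + 11 / 6)) / 36 + y\<^sup>2 / (576 * (1 - y)) * (y * (L + 25 / 12))
        \<le> (46 / 125) * (3 / 2 - (771 / 10000)) / 4 + (46 / 125) * ((46 / 125) * (11 / 6 - (771 / 10000))) / 36
          + ((46 / 125)\<^sup>2 / (576 * (1 - (46 / 125)))) * ((46 / 125) * (25 / 12 - (771 / 10000)))"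
      by (intro add_mono divide_right_mono) auto
    also have "\<dots> \<le> 69 / 500" by (simp add: power2_eq_square)
    finally show "L + 1 + (y * (L + 3 / 2)) / 4 + y * (y * (L + 11 / 6)) / 36 + y\<^sup>2 / (576 * (1 - y)) * (y * (L + 25 / 12)) \<le> L + (569 / 500)"
      by simp
  qed (use y0 in simp)
  finally show ?thesis by (simp add: L_def algebra_simps)
qed

text \<open>The left side measures by how much the remainder at \<open>y\<close> exceeds the
  allowance \<open>(8 / 5) * y * a\<close> contained in the claimed bound. The second estimate
  multiplies the first by \<open>a\<close>; its quadratic terms in \<open>x\<close> and
  \<open>\<Delta>\<close> are all nonpositive and are dropped.\<close>

lemma bk_rem_defect:
  fixes x \<Delta> :: real
  assumes x: "x \<ge> 0" and \<Delta>: "\<Delta> \<ge> 0" and y: "y = exp (- (1 + x))"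
  defines "a \<equiv> (1 + x) / 2 + \<Delta>"
  shows "bk_rem y - (8 / 5) * y * a \<le> y * ((261 / 1000) - (3 / 10) * x - (8 / 5) * \<Delta>)"
    "a * (bk_rem y - (8 / 5) * y * a) \<le> y * ((261 / 2000) - (39 / 2000) * x - (539 / 1000) * \<Delta>)"
proof -
  have y0: "y > 0" by (simp add: y)
  have "bk_rem y - (8 / 5) * y * a \<le> y * ((1 + x) / 2 - euler_mascheroni + (569 / 500) - (8 / 5) * a)"
    using bk_rem_final_upper[OF x y] by (simp add: algebra_simps)
  also have "\<dots> \<le> y * ((261 / 1000) - (3 / 10) * x - (8 / 5) * \<Delta>)"
    proof (intro mult_left_mono)
    show "(1 + x) / 2 - euler_mascheroni + (569 / 500) - (8 / 5) * a \<le> (261 / 1000) - (3 / 10) * x - (8 / 5) * \<Delta>"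
      proof -
      have "(8 / 5) * a = 4 / 5 + (4 / 5) * x + (8 / 5) * \<Delta>" unfolding a_def by (simp add: field_simps)
      then show ?thesis using euler_mascheroni_numeric(1) add_divide_distrib[of 1 x 2] by linarith
    qed
  qed (use y0 in simp)
  finally show 1: "bk_rem y - (8 / 5) * y * a \<le> y * ((261 / 1000) - (3 / 10) * x - (8 / 5) * \<Delta>)" .
  have a0: "a \<ge> 0" using x \<Delta> by (simp add: a_def)
  have "a * (bk_rem y - (8 / 5) * y * a) \<le> a * (y * ((261 / 1000) - (3 / 10) * x - (8 / 5) * \<Delta>))"
    using 1 a0 by (rule mult_left_mono)
  also have "\<dots> = y * (a * ((261 / 1000) - (3 / 10) * x - (8 / 5) * \<Delta>))" by simp
  also have "\<dots> \<le> y * ((261 / 2000) - (39 / 2000) * x - (539 / 1000) * \<Delta>)"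
  proof (intro mult_left_mono)
    have "a * ((261 / 1000) - (3 / 10) * x - (8 / 5) * \<Delta>) = (261 / 2000) - (39 / 2000) * x - (539 / 1000) * \<Delta> - ((3 / 20) * (x * x) + (11 / 10) * (x * \<Delta>) + (8 / 5) * (\<Delta> * \<Delta>))"
      by (simp add: a_def field_simps)
    moreover have "0 \<le> (3 / 20) * (x * x) + (11 / 10) * (x * \<Delta>) + (8 / 5) * (\<Delta> * \<Delta>)" using x \<Delta> by simp
    ultimately show "a * ((261 / 1000) - (3 / 10) * x - (8 / 5) * \<Delta>) \<le> (261 / 2000) - (39 / 2000) * x - (539 / 1000) * \<Delta>" by linarith
  qed (use y0 in simp)
  finally show "a * (bk_rem y - (8 / 5) * y * a) \<le> y * ((261 / 2000) - (39 / 2000) * x - (539 / 1000) * \<Delta>)" .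
qed

lemma exp_y_lower:
  fixes x :: real assumes "x \<ge> 0" "x \<le> 1" "y = exp (- (1 + x))" shows "y \<ge> (1839 / 5000) * (1 - x)"
proof -
  have "(1839 / 5000) * (1 - x) \<le> exp (- 1) * exp (- x)"
    using exp_numeric(1) exp_ge_add_one_self[of "- x"] assms by (intro mult_mono) auto
  then show ?thesis by (simp add: assms(3) exp_add[symmetric])
qed

text \<open>With \<open>h = euler_mascheroni + \<Delta> - \<delta>\<close>, the quantity
  \<open>K\<close> is \<open>a\<close> times the claimed bound
  \<open>1 - h / a + (8 / 5) * y\<close>. The second form uses \<open>x^2 \<le> x / 5\<close> and
  \<open>y \<ge> 1839 / 6250\<close> to keep a steeper slope in \<open>x\<close> and a term in
  \<open>\<Delta>\<close>.\<close>

lemma factor_lower: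
  fixes x \<Delta> \<delta> :: real
  assumes x: "x \<ge> 0" "x \<le> (22 / 25)" and \<Delta>: "\<Delta> \<ge> 0" and y: "y = exp (- (1 + x))"
  defines "K \<equiv> (1 + x) / 2 - euler_mascheroni + \<delta> + (8 / 5) * y * ((1 + x) / 2 + \<Delta>)"
  shows "(271 / 1250) + (241 / 1000) * x + \<delta> \<le> K" "x \<le> (1 / 5) \<Longrightarrow> (271 / 1250) + (441 / 1000) * x + \<delta> + (47 / 100) * \<Delta> \<le> K"
proof -
  have yl: "y \<ge> (1839 / 5000) * (1 - x)" using exp_y_lower[of x y] x y by simp
  have "(1839 / 5000) * (1 - x) * (1 + x) \<le> y * (1 + x)" using yl x by (intro mult_right_mono) auto
  then have 1: "y * (1 + x) \<ge> (1839 / 5000) - (1839 / 5000) * (x * x)" by (simp add: algebra_simps)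
  have K: "K = (1 + x) / 2 - euler_mascheroni + \<delta> + (4 / 5) * (y * (1 + x)) + (8 / 5) * (y * \<Delta>)"
    by (simp add: K_def algebra_simps)
  have "x * x \<le> (22 / 25) * x" using x by (intro mult_right_mono) auto
  moreover have "y * \<Delta> \<ge> 0" using \<Delta> by (simp add: y)
  ultimately show "(271 / 1250) + (241 / 1000) * x + \<delta> \<le> K" unfolding K using 1 euler_mascheroni_numeric x add_divide_distrib[of 1 x 2] by linarith
  assume x2: "x \<le> (1 / 5)"
  have "x * x \<le> (1 / 5) * x" using x x2 by (intro mult_right_mono) auto
  moreover have "y * \<Delta> \<ge> (1839 / 6250) * \<Delta>"
    using \<Delta> yl x2 by (intro mult_right_mono) auto
  ultimately show "(271 / 1250) + (441 / 1000) * x + \<delta> + (47 / 100) * \<Delta> \<le> K" unfolding K using 1 euler_mascheroni_numeric x \<Delta> add_divide_distrib[of 1 x 2] by linarith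
qed

text \<open>In the application \<open>\<rho>\<close> is the square of \<open>r / R\<close>.\<close>

lemma square_mass_bounds:
  fixes \<Delta> :: real
  assumes "\<Delta> \<ge> 0" defines "\<rho> \<equiv> exp (- 2 * (euler_mascheroni + \<Delta>))"
  shows "\<rho> \<ge> (63 / 200) * (1 - 2 * \<Delta>)" "\<rho> \<le> (631 / 2000)"
proof -
  have e: "\<rho> = exp (- 2 * euler_mascheroni) * exp (- 2 * \<Delta>)" by (simp add: \<rho>_def exp_add[symmetric] algebra_simps)
  show "\<rho> \<le> (631 / 2000)" using mult_mono[OF exp_numeric(4), of "exp (- 2 * \<Delta>)" 1] assms(1) by (simp add: e)
  have "(63 / 200) * (1 - 2 * \<Delta>) \<le> (63 / 200) * exp (- 2 * \<Delta>)" using exp_ge_add_one_self[of "- 2 * \<Delta>"] by simp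
  also have "\<dots> \<le> \<rho>" unfolding e using exp_numeric(3) by (intro mult_right_mono) auto
  finally show "\<rho> \<ge> (63 / 200) * (1 - 2 * \<Delta>)" .
qed

text \<open>The point \<open>y * \<rho>\<close> is \<open>r^2 / (2 * \<tau>)\<close>, the geometric
  mean of the scaled squared distances from a point of \<open>T\<close> to the level curves in the
  limit; Jensen's inequality evaluates the kernel there. Its \<open>logterm\<close> is exactly
  \<open>a\<close>, and two series terms are made nearly linear with
  \<open>y \<ge> (1839 / 5000) * (1 - x)\<close>.\<close>

lemma bk_rem_jensen_lower:
  fixes x \<Delta> :: real
  assumes x: "x \<ge> 0" "x \<le> (22 / 25)" and \<Delta>: "\<Delta> \<ge> 0" "\<Delta> \<le> (17 / 100)" and y: "y = exp (- (1 + x))"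
  defines "\<rho> \<equiv> exp (- 2 * (euler_mascheroni + \<Delta>))"
  shows "y * ((4907 / 10000) + (87 / 625) * x - (703 / 1000) * \<Delta> - (63 / 200) * (x * \<Delta>) - (63 / 100) * (\<Delta> * \<Delta>)) \<le> bk_rem (y * \<rho>)"
proof -
  define a where "a = (1 + x) / 2 + \<Delta>"
  have y0: "y > 0" by (simp add: y)
  have L: "logterm (y * \<rho>) = a" by (simp add: y \<rho>_def a_def logterm_def exp_add[symmetric] algebra_simps add_divide_distrib)
  have \<rho>0: "\<rho> > 0" by (simp add: \<rho>_def)
  have \<rho>: "\<rho> \<ge> (63 / 200) * (1 - 2 * \<Delta>)" using square_mass_bounds[OF \<Delta>(1)] by (simp add: \<rho>_def)
  have p: "0 \<le> 1 - 2 * \<Delta>" using \<Delta> by simp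
  have yl: "y \<ge> (1839 / 5000) * (1 - x)" using exp_y_lower[of x y] x y by simp
  have 1: "(63 / 200) * (1 - 2 * \<Delta>) * (a + 1) \<le> \<rho> * (a + 1)" using \<rho> x \<Delta> by (intro mult_right_mono) (auto simp: a_def)
  have "(57 / 3125) * (1 - 4 * \<Delta> - x) \<le> ((63 / 200) * (1 - 2 * \<Delta>))\<^sup>2 * ((1839 / 5000) * (1 - x)) / 2"
  proof -
    have "1 - 4 * \<Delta> - x \<le> (1 - 2 * \<Delta>)\<^sup>2 * (1 - x)"
    proof -
      have "(1 - 4 * \<Delta>) * (1 - x) \<le> (1 - 2 * \<Delta>)\<^sup>2 * (1 - x)"
        using x by (intro mult_right_mono) (auto simp: power2_eq_square algebra_simps)
      moreover have "(1 - 4 * \<Delta>) * (1 - x) = 1 - 4 * \<Delta> - x + 4 * (\<Delta> * x)" by (simp add: algebra_simps)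
      moreover have "0 \<le> \<Delta> * x" using \<Delta> x by simp
      ultimately show ?thesis by linarith
    qed
    then have "(57 / 3125) * (1 - 4 * \<Delta> - x) \<le> (57 / 3125) * ((1 - 2 * \<Delta>)\<^sup>2 * (1 - x))" by simp
    also have "\<dots> \<le> (7298991 / 400000000) * ((1 - 2 * \<Delta>)\<^sup>2 * (1 - x))" using x by (intro mult_right_mono) auto
    also have "\<dots> = ((63 / 200) * (1 - 2 * \<Delta>))\<^sup>2 * ((1839 / 5000) * (1 - x)) / 2" by (simp add: power2_eq_square field_simps)
    finally show ?thesis .
  qed
  also have "\<dots> \<le> \<rho>\<^sup>2 * y / 2"
    using \<rho> yl p x y0 by (intro divide_right_mono mult_mono power_mono) auto
  also have "\<rho>\<^sup>2 * y / 2 \<le> \<rho>\<^sup>2 * y / 4 * (a + 3 / 2)"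
  proof -
    have "2 \<le> a + 3 / 2" using x \<Delta> by (simp add: a_def field_simps)
    then have "\<rho>\<^sup>2 * y / 4 * 2 \<le> \<rho>\<^sup>2 * y / 4 * (a + 3 / 2)" using y0 by (intro mult_left_mono) auto
    then show ?thesis by simp
  qed
  finally have 2: "(57 / 3125) * (1 - 4 * \<Delta> - x) \<le> \<rho>\<^sup>2 * y / 4 * (a + 3 / 2)" .
  have 3: "(63 / 200) * (1 - 2 * \<Delta>) * (a + 1) = (189 / 400) + (63 / 400) * x - (63 / 100) * \<Delta> - (63 / 200) * (x * \<Delta>) - (63 / 100) * (\<Delta> * \<Delta>)"
    by (simp add: a_def field_simps)
  have lin: "(4907 / 10000) + (87 / 625) * x - (703 / 1000) * \<Delta> - (63 / 200) * (x * \<Delta>) - (63 / 100) * (\<Delta> * \<Delta>) \<le> A + B"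
    if "(189 / 400) + (63 / 400) * x - (63 / 100) * \<Delta> - (63 / 200) * (x * \<Delta>) - (63 / 100) * (\<Delta> * \<Delta>) \<le> A"
      "(57 / 3125) * (1 - 4 * \<Delta> - x) \<le> B" for A B
    using that x \<Delta> by (simp add: right_diff_distrib)
  have "(4907 / 10000) + (87 / 625) * x - (703 / 1000) * \<Delta> - (63 / 200) * (x * \<Delta>) - (63 / 100) * (\<Delta> * \<Delta>)
      \<le> \<rho> * (a + 1) + \<rho>\<^sup>2 * y / 4 * (a + 3 / 2)" using lin[OF 1[unfolded 3] 2] by simp
  then have "y * ((4907 / 10000) + (87 / 625) * x - (703 / 1000) * \<Delta> - (63 / 200) * (x * \<Delta>) - (63 / 100) * (\<Delta> * \<Delta>))
      \<le> y * (\<rho> * (a + 1) + \<rho>\<^sup>2 * y / 4 * (a + 3 / 2))" using y0 by simp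
  also have "\<dots> = y * \<rho> * (logterm (y * \<rho>) + 1) + (y * \<rho>)\<^sup>2 / 4 * (logterm (y * \<rho>) + 3 / 2)"
    unfolding L by (simp add: power2_eq_square algebra_simps)
  also have "\<dots> \<le> bk_rem (y * \<rho>)" by (rule bk_rem_lower_2) (use y0 \<rho>0 in simp)
  finally show ?thesis .
qed

text \<open>Expand about a trial point \<open>m\<close> near the minimum: value \<open>p\<close>,
  slope \<open>k\<close>, and a coefficient of \<open>u^2\<close> that depends on \<open>s\<close>
  but stays above \<open>w\<close> on the unit interval. Completing the square costs at most
  \<open>k^2 / (4 * w)\<close>.\<close>

lemma quartic_lower:
  fixes s :: real
  assumes s: "0 \<le> s" "s \<le> 1" and e: "0 \<le> e" and w: "0 < w" "w \<le> c + 2 * d * m - 3 * e * m\<^sup>2" "e \<le> d - 2 * e * m"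
    and val: "v \<le> a - b * m + c * m\<^sup>2 + d * m ^ 3 - e * m ^ 4 - (- b + 2 * c * m + 3 * d * m\<^sup>2 - 4 * e * m ^ 3)\<^sup>2 / (4 * w)"
  shows "v \<le> a - b * s + c * s\<^sup>2 + d * s ^ 3 - e * s ^ 4"
proof -
  define u where "u = s - m"
  define k where "k = - b + 2 * c * m + 3 * d * m\<^sup>2 - 4 * e * m ^ 3"
  define p where "p = a - b * m + c * m\<^sup>2 + d * m ^ 3 - e * m ^ 4"
  have eq: "a - b * s + c * s\<^sup>2 + d * s ^ 3 - e * s ^ 4
      = p + k * u + u\<^sup>2 * ((c + 2 * d * m - 3 * e * m\<^sup>2) + s * (d - 2 * e * m - e * s))"
    unfolding p_def k_def u_def by (simp add: power2_eq_square power3_eq_cube power4_eq_xxxx algebra_simps)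
  have "e * s \<le> e" using s e by (simp add: mult_left_le)
  then have "0 \<le> s * (d - 2 * e * m - e * s)" using s w(3) by simp
  then have "u\<^sup>2 * w \<le> u\<^sup>2 * ((c + 2 * d * m - 3 * e * m\<^sup>2) + s * (d - 2 * e * m - e * s))"
    using w(2) by (intro mult_left_mono) auto
  moreover have "p - k\<^sup>2 / (4 * w) \<le> p + k * u + u\<^sup>2 * w"
  proof -
    have "0 \<le> (2 * w * u + k)\<^sup>2 / (4 * w)" using w(1) by simp
    also have "\<dots> = u\<^sup>2 * w + k * u + k\<^sup>2 / (4 * w)" using w(1) by (simp add: power2_eq_square field_simps)
    finally show ?thesis by simp
  qed
  ultimately show ?thesis unfolding eq using val unfolding p_def[symmetric] k_def[symmetric] by linarith
qed

text \<open>The right side is affine in \<open>\<delta>\<close>, so the two ends of its range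
  suffice; the left side interpolates the values 33/250 and 51/50000 found there. The right side is
  the gain of \<open>corner_gain\<close> per unit of \<open>y\<close> at \<open>\<Delta> = 0\<close>
  with the extreme numerical data inserted: 1863/12500 is \<open>(81 / 200) * (46 / 125)\<close> and
  1369/2000 is \<open>1 - 631 / 2000\<close>.\<close>

lemma gain_polynomial:
  fixes s \<delta> :: real
  assumes s: "0 \<le> s" "s \<le> 1" and \<delta>: "0 \<le> \<delta>" "\<delta> \<le> (111 / 2000)"
  shows "(33 / 250) - (59 / 25) * \<delta> \<le> (81 / 100) * ((1369 / 2000) - 2 * \<delta> + s\<^sup>2 - 2 * s * ((137 / 200) - (4 / 25) * \<delta>))
      - (1863 / 12500) * ((1 + s\<^sup>2)\<^sup>2 - 4 * (1 + s\<^sup>2) * (s * ((137 / 200) - (4 / 25) * \<delta>)) + 2 * s\<^sup>2 + 2 * s\<^sup>2 * ((19 / 500) + (233 / 50) * \<delta>) - (62 / 625))"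
    (is "_ \<le> ?f \<delta>")
proof -
  define \<theta> where "\<theta> = \<delta> / (111 / 2000)"
  have \<theta>: "0 \<le> \<theta>" "\<theta> \<le> 1" "\<delta> = (111 / 2000) * \<theta>" using \<delta> by (auto simp: \<theta>_def)
  have 0: "(33 / 250) \<le> ?f 0"
  proof -
    have "(33 / 250) \<le> (52523721 / 125000000) - (876663 / 1250000) * s + (632853 / 3125000) * s\<^sup>2 + (255231 / 625000) * s ^ 3 - (1863 / 12500) * s ^ 4"
      by (rule quartic_lower[where m = "(18 / 25)" and w = "(1 / 2)", OF s]) (simp_all add: power2_eq_square power3_eq_cube power4_eq_xxxx)
    also have "\<dots> = ?f 0" by (simp add: power2_eq_square power3_eq_cube power4_eq_xxxx field_simps)
    finally show ?thesis .
  qed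
  have 1: "(51 / 50000) \<le> ?f (111 / 2000)"
  proof -
    have "(51 / 50000) \<le> (41284971 / 125000000) - (108162297 / 156250000) * s + (78387831 / 625000000) * s\<^sup>2 + (31490289 / 78125000) * s ^ 3 - (1863 / 12500) * s ^ 4"
      by (rule quartic_lower[where m = "(41 / 50)" and w = "(2 / 5)", OF s]) (simp_all add: power2_eq_square power3_eq_cube power4_eq_xxxx)
    also have "\<dots> = ?f (111 / 2000)" by (simp add: power2_eq_square power3_eq_cube power4_eq_xxxx field_simps)
    finally show ?thesis .
  qed
  define c where "c = - (81 / 50) + (4 / 25) * s * ((81 / 50) - (1863 / 3125) * (1 + s\<^sup>2)) - (434079 / 312500) * s\<^sup>2"
  have lin: "?f t = ?f 0 + t * c" for t
    by (simp add: c_def power2_eq_square field_simps)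
  have "(1 - \<theta>) * (33 / 250) \<le> (1 - \<theta>) * ?f 0" using 0 \<theta> by (intro mult_left_mono) auto
  moreover have "\<theta> * (51 / 50000) \<le> \<theta> * (?f 0 + (111 / 2000) * c)" using 1 \<theta> unfolding lin[of "(111 / 2000)"] by (intro mult_left_mono) auto
  moreover have "(1 - \<theta>) * g + \<theta> * (g + (111 / 2000) * c) = g + \<delta> * c" for g unfolding \<theta>(3) by (simp add: algebra_simps)
  ultimately have "(1 - \<theta>) * (33 / 250) + \<theta> * (51 / 50000) \<le> ?f 0 + \<delta> * c" by (metis add_mono)
  moreover have "(1 - \<theta>) * (33 / 250) + \<theta> * (51 / 50000) = (33 / 250) - (59 / 25) * \<delta>" unfolding \<theta>(3) by (simp add: field_simps)
  ultimately show ?thesis unfolding lin[of \<delta>] by (simp only:)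
qed

text \<open>If \<open>P\<close> is the claimed bound, it is enough that
  \<open>bk_rem y * P \<le> (8 / 5) * y * a\<close>. Since \<open>P\<close> itself is at most
  \<open>1 - (8 / 5) * y\<close>, it more than compensates the denominator \<open>1 - y\<close> of
  the one-step bound for the remainder.\<close>

lemma laplace_lower_numeric:
  fixes l :: real
  assumes l: "l > 1" and y: "y = exp (- l)" and a: "a \<ge> l / 2" and h: "h \<ge> 0"
    and u: "u \<ge> 0" "a - h \<le> u * (a + bk_rem y)"
  shows "u \<ge> 1 - h / a - (8 / 5) * y"
proof (cases "1 - h / a - (8 / 5) * y \<le> 0")
  case True
  then show ?thesis using u(1) by linarith
next
  case False
  define P where "P = 1 - h / a - (8 / 5) * y"
  have a0: "a > 0" using a l by linarith
  have y0: "y > 0" by (simp add: y)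
  have "y = exp (- 1) * exp (- (l - 1))" by (simp add: y exp_add[symmetric])
  also have "\<dots> \<le> (46 / 125) * 1" using exp_numeric(2) l by (intro mult_mono) auto
  finally have y1: "y \<le> 46 / 125" by simp
  define L where "L = l / 2 - euler_mascheroni"
  have Ly: "logterm y = L" by (simp add: logterm_def y L_def)
  have e: "bk_rem y \<le> y * (L + 1) / (1 - y)" using bk_rem_upper_1[of y] y0 y1 by (simp add: Ly)
  have e0: "bk_rem y \<ge> 0" by (rule bk_rem_nonneg[OF y0])
  have L1: "L + 1 \<le> l / 2 + (4229 / 10000)" "L + 1 \<ge> 0" using euler_mascheroni_numeric l unfolding L_def by linarith+
  have P1: "P \<le> 1 - (8 / 5) * y" using h a0 by (simp add: P_def)
  have "bk_rem y * P \<le> bk_rem y * (1 - (8 / 5) * y)" using P1 e0 by (rule mult_left_mono)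
  also have "\<dots> \<le> (4 / 5) * y * l"
  proof -
    have "bk_rem y * (1 - (8 / 5) * y) \<le> y * (L + 1) / (1 - y) * (1 - (8 / 5) * y)"
      using e y1 by (intro mult_right_mono) auto
    also have "\<dots> = y * ((L + 1) * ((1 - (8 / 5) * y) / (1 - y)))" by simp
    also have "\<dots> \<le> y * ((4 / 5) * l)"
    proof (intro mult_left_mono)
      have q: "(1 - (8 / 5) * y) / (1 - y) = 1 - (3 / 5) * (y / (1 - y))" using y1 by (simp add: field_simps)
      show "(L + 1) * ((1 - (8 / 5) * y) / (1 - y)) \<le> (4 / 5) * l"
      \<comment> \<open>Beyond 71/50 the bound \<open>l / 2 + 4229 / 10000\<close> for
        \<open>L + 1\<close> is below \<open>(4 / 5) * l\<close> unaided. Up to there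
        \<open>y\<close> is at least 23/100 and the quotient supplies the missing factor
        513/625.\<close>
      proof (cases "l \<le> (71 / 50)")
        case True
        have "(43 / 50) \<le> exp (- (7 / 50) :: real)" using exp_ge_add_one_self[of "- (7 / 50)"] by simp
        then have "(43 / 50) ^ 3 \<le> exp (- (7 / 50) :: real) ^ 3" by (intro power_mono) auto
        also have "exp (- (7 / 50) :: real) ^ 3 = exp (- (21 / 50))" by (simp add: exp_of_nat_mult[symmetric])
        finally have "(1839 / 5000) * (43 / 50) ^ 3 \<le> exp (- 1 :: real) * exp (- (21 / 50))" using exp_numeric(1) by (intro mult_mono) auto
        also have "\<dots> = exp (- (71 / 50))" by (simp add: exp_add[symmetric])
        also have "\<dots> \<le> y" using True by (simp add: y)
        finally have y2: "(23 / 100) \<le> y" by (simp add: power3_eq_cube)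
        then have "(23 / 100) / (1 - (23 / 100)) \<le> y / (1 - y)" using y1 by (intro frac_le) auto
        then have "23 / 77 \<le> y / (1 - y)" by simp
        then have "1 - (3 / 5) * (y / (1 - y)) \<le> (513 / 625)" by linarith
        then have "(L + 1) * (1 - (3 / 5) * (y / (1 - y))) \<le> (L + 1) * (513 / 625)" using L1(2) by (rule mult_left_mono)
        then show ?thesis unfolding q using L1(1) l by simp
      next
        case False
        have "1 - (3 / 5) * (y / (1 - y)) \<le> 1" using y0 y1 by simp
        then have "(L + 1) * (1 - (3 / 5) * (y / (1 - y))) \<le> (L + 1) * 1" using L1(2) by (rule mult_left_mono)
        then show ?thesis unfolding q using L1(1) False by simp
      qed
    qed (use y0 in simp)
    finally show ?thesis by simp
  qed
  also have "(4 / 5) * y * l \<le> (8 / 5) * y * a" using a y0 by simp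
  finally have "bk_rem y * P \<le> (8 / 5) * y * a" .
  moreover have "a * P = a - h - (8 / 5) * y * a" using a0 by (simp add: P_def field_simps)
  ultimately have "(a + bk_rem y) * P \<le> a - h" by (simp add: distrib_right)
  also have "\<dots> \<le> (a + bk_rem y) * u" using u(2) by (simp add: mult.commute)
  finally have "P \<le> u" using a0 e0 by (simp add: mult_le_cancel_left_pos add_pos_nonneg)
  then show ?thesis by (simp add: P_def)
qed

text \<open>With \<open>P\<close> the claimed bound, \<open>u \<le> P\<close> follows from
  \<open>\<epsilon> \<le> (8 / 5) * y * a + E * P\<close>, and \<open>star\<close> is this
  inequality multiplied by \<open>a\<close>. It separates the three ingredients: the defect on the
  left, the remainder \<open>E\<close> on \<open>T\<close>, and the factor \<open>K\<close> of
  \<open>factor_lower\<close>.\<close>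

lemma laplace_upper_reduction:
  fixes a :: real
  assumes a: "a > 0" and E: "E \<ge> 0" and u: "u * (a + E) \<le> a - h + \<epsilon>"
    and star: "a * (\<epsilon> - (8 / 5) * y * a) \<le> E * (a - h + (8 / 5) * y * a)"
  shows "u \<le> 1 - h / a + (8 / 5) * y"
proof -
  define P where "P = 1 - h / a + (8 / 5) * y"
  have aP: "a * P = a - h + (8 / 5) * y * a" using a by (simp add: P_def field_simps)
  have "a * (\<epsilon> - (8 / 5) * y * a) \<le> a * (E * P)" using star unfolding aP[symmetric] by (simp add: mult.left_commute)
  then have "\<epsilon> - (8 / 5) * y * a \<le> E * P" using a by simp
  then have "u * (a + E) \<le> P * (a + E)" using u aP by (simp add: algebra_simps)
  then show ?thesis using a E by (simp add: P_def)
qed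

lemma laplace_upper_easy:
  fixes a :: real
  assumes a: "a > 0" and E: "E \<ge> 0" and u: "u \<ge> 0" "u * (a + E) \<le> a - h + \<epsilon>" and e: "\<epsilon> \<le> (8 / 5) * y * a"
  shows "u \<le> 1 - h / a + (8 / 5) * y"
proof -
  have "u * a \<le> u * (a + E)" using u(1) E by (simp add: distrib_left)
  then have "u * a \<le> (1 - h / a + (8 / 5) * y) * a" using u(2) e a by (simp add: algebra_simps)
  then show ?thesis using a by simp
qed

text \<open>At \<open>x = \<Delta> = \<delta> = 0\<close> the bounds for the two factors multiply to
  \<open>(4907 / 10000) * (271 / 1250)\<close>, about 0.106, while 261/2000 is needed. The
  thresholds in \<open>out\<close> are rounded-up values from which growth in one variable alone
  closes this gap.\<close>

lemma laplace_upper_jensen: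
  fixes x \<Delta> \<delta> :: real
  assumes x: "x \<ge> 0" and \<Delta>: "\<Delta> \<ge> 0" and \<delta>: "\<delta> \<ge> 0" and y: "y = exp (- (1 + x))"
    and out: "x \<ge> (51 / 500) \<or> \<Delta> \<ge> (21 / 500) \<or> \<delta> \<ge> (111 / 2000)"
  defines "a \<equiv> (1 + x) / 2 + \<Delta>" and "h \<equiv> euler_mascheroni + \<Delta> - \<delta>"
    and "\<rho> \<equiv> exp (- 2 * (euler_mascheroni + \<Delta>))"
  assumes u: "u \<ge> 0" "u * (a + bk_rem (y * \<rho>)) \<le> a - h + bk_rem y"
  shows "u \<le> 1 - h / a + (8 / 5) * y"
proof -
  have a0: "a > 0" using x \<Delta> by (simp add: a_def add_pos_nonneg)
  have y0: "y > 0" by (simp add: y)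
  have E0: "bk_rem (y * \<rho>) \<ge> 0" by (rule bk_rem_nonneg) (simp add: y \<rho>_def)
  note D = bk_rem_defect[OF x \<Delta> y, folded a_def]
  show ?thesis
  proof (cases "(261 / 1000) - (3 / 10) * x - (8 / 5) * \<Delta> \<le> 0")
    case True
    then have "y * ((261 / 1000) - (3 / 10) * x - (8 / 5) * \<Delta>) \<le> 0" using y0 by (simp add: mult_le_0_iff)
    then show ?thesis using D(1) by (intro laplace_upper_easy[OF a0 E0 u]) linarith
  next
    case False
    then have xb: "x \<le> (87 / 100)" and \<Delta>b: "\<Delta> \<le> (327 / 2000)" using x \<Delta> by auto
    define K where "K = a - h + (8 / 5) * y * a"
    have K: "K = (1 + x) / 2 - euler_mascheroni + \<delta> + (8 / 5) * y * ((1 + x) / 2 + \<Delta>)" by (simp add: K_def a_def h_def)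
    have x': "x \<le> (22 / 25)" using xb by simp
    have k1: "(271 / 1250) + (241 / 1000) * x + \<delta> \<le> K" and k2: "x \<le> (1 / 5) \<Longrightarrow> (271 / 1250) + (441 / 1000) * x + \<delta> + (47 / 100) * \<Delta> \<le> K"
      using factor_lower[OF x x' \<Delta> y, of \<delta>] unfolding K by auto
    define E where "E = (4907 / 10000) + (87 / 625) * x - (703 / 1000) * \<Delta> - (63 / 200) * (x * \<Delta>) - (63 / 100) * (\<Delta> * \<Delta>)"
    have E: "y * E \<le> bk_rem (y * \<rho>)"
      using bk_rem_jensen_lower[OF x x' \<Delta> _ y] \<Delta>b unfolding E_def \<rho>_def by simp
    have "(261 / 2000) - (39 / 2000) * x - (539 / 1000) * \<Delta> \<le> E * K"
    \<comment> \<open>Close to the corner the steep form of \<open>factor_lower\<close> is needed.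
      Farther away the required right side has dropped, or \<open>x\<close> is large, so that the
      rough form suffices.\<close>
    proof (cases "x \<le> (1 / 5) \<and> \<Delta> \<le> (7 / 100)")
      case True
      then have "x * \<Delta> \<le> x * (7 / 100)" "\<Delta> * \<Delta> \<le> (7 / 100) * \<Delta>" using True x \<Delta> mult_left_mono[of \<Delta> "7 / 100" x] mult_right_mono[of \<Delta> "7 / 100" \<Delta>] by simp_all
      then have E1: "(4907 / 10000) + (117 / 1000) * x - (187 / 250) * \<Delta> \<le> E" using x \<Delta> unfolding E_def by simp
      then have E2: "(219 / 500) \<le> E" using x True by simp
      have "(271 / 1250) * ((4907 / 10000) + (117 / 1000) * x - (187 / 250) * \<Delta>) + (219 / 500) * ((441 / 1000) * x + \<delta> + (47 / 100) * \<Delta>)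
          \<le> (271 / 1250) * E + E * ((441 / 1000) * x + \<delta> + (47 / 100) * \<Delta>)"
        using E1 E2 x \<Delta> \<delta> by (intro add_mono mult_left_mono mult_right_mono) auto
      also have "\<dots> = E * ((271 / 1250) + (441 / 1000) * x + \<delta> + (47 / 100) * \<Delta>)" by (simp add: distrib_left mult.commute)
      also have "\<dots> \<le> E * K" using k2 True E2 by (intro mult_left_mono) auto
      also have "(271 / 1250) * ((4907 / 10000) + (117 / 1000) * x - (187 / 250) * \<Delta>) + (219 / 500) * ((441 / 1000) * x + \<delta> + (47 / 100) * \<Delta>)
          = 1329797 / 12500000 + 546309 / 2500000 * x + 54617 / 1250000 * \<Delta> + 219 / 500 * \<delta>" by (simp add: field_simps)
      finally show ?thesis using out x \<Delta> \<delta> by (elim disjE; linarith)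
    next
      case False
      have "x * \<Delta> \<le> x * (327 / 2000)" "\<Delta> * \<Delta> \<le> (327 / 2000) * \<Delta>" using x \<Delta> \<Delta>b mult_left_mono[of \<Delta> "327 / 2000" x] mult_right_mono[of \<Delta> "327 / 2000" \<Delta>] by simp_all
      then have E1: "(4907 / 10000) + (87 / 1000) * x - (807 / 1000) * \<Delta> \<le> E" using x \<Delta> unfolding E_def by simp
      then have E2: "(179 / 500) \<le> E" using x \<Delta>b by simp
      have "(271 / 1250) * ((4907 / 10000) + (87 / 1000) * x - (807 / 1000) * \<Delta>) + (179 / 500) * ((241 / 1000) * x + \<delta>)
          \<le> (271 / 1250) * E + E * ((241 / 1000) * x + \<delta>)"
        using E1 E2 x \<Delta> \<delta> by (intro add_mono mult_left_mono mult_right_mono) auto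
      also have "\<dots> = E * ((271 / 1250) + (241 / 1000) * x + \<delta>)" by (simp add: distrib_left mult.commute)
      also have "\<dots> \<le> E * K" using k1 E2 by (intro mult_left_mono) auto
      also have "(271 / 1250) * ((4907 / 10000) + (87 / 1000) * x - (807 / 1000) * \<Delta>) + (179 / 500) * ((241 / 1000) * x + \<delta>)
          = 1329797 / 12500000 + 262849 / 2500000 * x - 218697 / 1250000 * \<Delta> + 179 / 500 * \<delta>" by (simp add: field_simps)
      finally have "1329797 / 12500000 + 262849 / 2500000 * x - 218697 / 1250000 * \<Delta> + 179 / 500 * \<delta> \<le> E * K" .
      moreover have "1 / 5 < x \<or> 7 / 100 < \<Delta>" using False by auto
      ultimately show ?thesis using x \<Delta> \<delta> by (elim disjE; linarith)
    qed
    then have "y * ((261 / 2000) - (39 / 2000) * x - (539 / 1000) * \<Delta>) \<le> y * (E * K)" using y0 by (intro mult_left_mono) auto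
    also have "\<dots> = (y * E) * K" by simp
    also have "\<dots> \<le> bk_rem (y * \<rho>) * K" using E k1 x \<delta> by (intro mult_right_mono) auto
    finally have "a * (bk_rem y - (8 / 5) * y * a) \<le> bk_rem (y * \<rho>) * (a - h + (8 / 5) * y * a)"
      using D(2) by (simp add: K_def)
    then show ?thesis by (rule laplace_upper_reduction[OF a0 E0 u(2)])
  qed
qed

text \<open>The gain \<open>g\<close> lifts the constant in the bound for the remainder from
  4907/10000 to 6227/10000, and \<open>(6227 / 10000) * (271 / 1250)\<close> exceeds 261/2000. The
  margin also pays for the losses in \<open>\<delta>\<close> and \<open>\<Delta>\<close> inside the
  box.\<close>

lemma laplace_upper_corner:
  fixes x \<Delta> \<delta> :: real
  assumes x: "x \<ge> 0" "x \<le> (51 / 500)" and \<Delta>: "\<Delta> \<ge> 0" "\<Delta> \<le> (21 / 500)" and \<delta>: "\<delta> \<ge> 0" "\<delta> \<le> (111 / 2000)" and y: "y = exp (- (1 + x))"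
  defines "a \<equiv> (1 + x) / 2 + \<Delta>" and "h \<equiv> euler_mascheroni + \<Delta> - \<delta>"
    and "\<rho> \<equiv> exp (- 2 * (euler_mascheroni + \<Delta>))" and "g \<equiv> y * ((33 / 250) - (59 / 25) * \<delta> - (81 / 100) * \<Delta>)"
  assumes u: "u * (a + bk_rem (y * \<rho>) + g) \<le> a - h + bk_rem y"
  shows "u \<le> 1 - h / a + (8 / 5) * y"
proof -
  have a0: "a > 0" using x \<Delta> by (simp add: a_def add_pos_nonneg)
  have y0: "y > 0" by (simp add: y)
  define K where "K = a - h + (8 / 5) * y * a"
  have K: "K = (1 + x) / 2 - euler_mascheroni + \<delta> + (8 / 5) * y * ((1 + x) / 2 + \<Delta>)" by (simp add: K_def a_def h_def)
  have k2: "(271 / 1250) + (441 / 1000) * x + \<delta> + (47 / 100) * \<Delta> \<le> K"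
    using factor_lower(2)[OF x(1) _ \<Delta>(1) y, of \<delta>] x unfolding K by simp
  define E where "E = (4907 / 10000) + (87 / 625) * x - (703 / 1000) * \<Delta> - (63 / 200) * (x * \<Delta>) - (63 / 100) * (\<Delta> * \<Delta>)"
  define E' where "E' = (6227 / 10000) - (59 / 25) * \<delta> - (779 / 500) * \<Delta>"
  have "y * E \<le> bk_rem (y * \<rho>)"
    using bk_rem_jensen_lower[OF x(1) _ \<Delta>(1) _ y] x \<Delta> unfolding E_def \<rho>_def by simp
  moreover have "x * \<Delta> \<le> x * (21 / 500)" "\<Delta> * \<Delta> \<le> (21 / 500) * \<Delta>" using x \<Delta> mult_left_mono[of \<Delta> "21 / 500" x] mult_right_mono[of \<Delta> "21 / 500" \<Delta>] by simp_all
  then have "(4907 / 10000) - (187 / 250) * \<Delta> \<le> E" using x \<Delta> unfolding E_def by simp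
  then have "y * ((4907 / 10000) - (187 / 250) * \<Delta>) \<le> y * E" using y0 by simp
  ultimately have E: "y * E' \<le> bk_rem (y * \<rho>) + g"
    unfolding E'_def g_def by (simp add: algebra_simps)
  have E2: "(213 / 500) \<le> E'" using \<delta> \<Delta> by (simp add: E'_def)
  have "(261 / 2000) - (539 / 1000) * \<Delta> \<le> E' * ((271 / 1250) + \<delta>)"
  proof -
    have "\<delta> * \<delta> \<le> (111 / 2000) * \<delta>" "\<Delta> * \<delta> \<le> \<Delta> * (111 / 2000)" using \<delta> \<Delta> mult_left_mono[of \<delta> "111 / 2000" \<Delta>] mult_right_mono[of \<delta> "111 / 2000" \<delta>] by simp_all
    then show ?thesis using \<delta> \<Delta> unfolding E'_def by (simp add: algebra_simps)
  qed
  also have "\<dots> \<le> E' * ((271 / 1250) + (441 / 1000) * x + \<delta> + (47 / 100) * \<Delta>)" using E2 x \<Delta> by (intro mult_left_mono) auto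
  also have "\<dots> \<le> E' * K" using k2 E2 by (intro mult_left_mono) auto
  finally have "y * ((261 / 2000) - (539 / 1000) * \<Delta>) \<le> y * (E' * K)" using y0 by (intro mult_left_mono) auto
  also have "\<dots> = (y * E') * K" by simp
  also have "\<dots> \<le> (bk_rem (y * \<rho>) + g) * K" using E k2 x \<delta> \<Delta> by (intro mult_right_mono) auto
  finally have "y * ((261 / 2000) - (539 / 1000) * \<Delta>) \<le> (bk_rem (y * \<rho>) + g) * K" .
  moreover have "y * ((261 / 2000) - (39 / 2000) * x - (539 / 1000) * \<Delta>) \<le> y * ((261 / 2000) - (539 / 1000) * \<Delta>)" using y0 x by (intro mult_left_mono) auto
  ultimately have "a * (bk_rem y - (8 / 5) * y * a) \<le> (bk_rem (y * \<rho>) + g) * (a - h + (8 / 5) * y * a)"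
    using bk_rem_defect(2)[OF x(1) \<Delta>(1) y] unfolding K_def a_def[symmetric] by linarith
  moreover have "bk_rem (y * \<rho>) + g \<ge> 0" using E E2 mult_nonneg_nonneg[of y E'] y0 by linarith
  ultimately show ?thesis by (intro laplace_upper_reduction[OF a0, where E = "bk_rem (y * \<rho>) + g" and \<epsilon> = "bk_rem y"]) (use u in \<open>simp_all add: add.assoc\<close>)
qed

text \<open>\<open>e\<close> and \<open>q\<close> stand for \<open>1 / |\<Phi> z|\<close> and \<open>r |\<Phi> z| / R\<close>.\<close>

lemma corner_moment_bounds:
  fixes \<Delta> \<delta> :: real
  assumes \<Delta>: "\<Delta> \<ge> 0" "\<Delta> \<le> (21 / 500)" and \<delta>: "\<delta> \<ge> 0" "\<delta> \<le> (111 / 2000)"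
  defines "q \<equiv> exp (- \<delta>)" and "e \<equiv> exp (- (euler_mascheroni + \<Delta> - \<delta>))"
  shows "q * ((1 - e\<^sup>2) + 2 * \<delta> * e) \<le> (137 / 200) - (4 / 25) * \<delta> + (67 / 100) * \<Delta>"
    "q\<^sup>2 * (\<bar>(1 - e\<^sup>2) * (1 - 3 * e\<^sup>2)\<bar> + 8 * \<delta> * e * (1 - e\<^sup>2) + e\<^sup>2 * (4 * \<delta> + 8 * \<delta>\<^sup>2)) \<le> (19 / 500) + (233 / 50) * \<delta> + (31 / 20) * \<Delta>"
    "q\<^sup>2 \<ge> 1 - 2 * \<delta>"
proof -
  define p where "p = exp (- (euler_mascheroni + \<Delta>))"
  \<comment> \<open>In the application \<open>p\<close> and \<open>\<rho>\<close> are
    \<open>r / R\<close> and its square; they do not involve \<open>\<delta>\<close>, and so the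
    products \<open>q * e\<close> and \<open>q^2 * e^2\<close> are estimated rather than the
    factors.\<close>
  define \<rho> where "\<rho> = exp (- 2 * (euler_mascheroni + \<Delta>))"
  have pq: "q * e = p" by (simp add: q_def e_def p_def exp_add[symmetric])
  have p\<rho>: "p\<^sup>2 = \<rho>" by (simp add: p_def \<rho>_def power2_eq_square exp_add[symmetric])
  have \<rho>: "(63 / 200) * (1 - 2 * \<Delta>) \<le> \<rho>" "\<rho> \<le> (631 / 2000)" using square_mass_bounds[OF \<Delta>(1)] by (simp_all add: \<rho>_def)
  have p0: "p > 0" "q > 0" "e > 0" by (simp_all add: p_def q_def e_def)
  have p: "p \<le> (2809 / 5000)"
  proof (rule power2_le_imp_le)
    show "p\<^sup>2 \<le> (2809 / 5000)\<^sup>2" unfolding p\<rho> using \<rho>(2) by (simp add: power2_eq_square)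
  qed simp
  have q1: "q \<le> 1" using \<delta> by (simp add: q_def)
  have iq: "1 / q \<ge> 1 + \<delta>" using exp_ge_add_one_self[of \<delta>] by (simp add: q_def exp_minus inverse_eq_divide)
  have qu: "q \<le> 1 - \<delta> + \<delta>\<^sup>2 / 2"
  proof -
    have "1 + \<delta> + \<delta>\<^sup>2 / 2 \<le> exp \<delta>" using exp_lower_Taylor_quadratic[OF \<delta>(1)] .
    moreover have "1 \<le> (1 - \<delta> + \<delta>\<^sup>2 / 2) * (1 + \<delta> + \<delta>\<^sup>2 / 2)"
    proof -
      have "(1 - \<delta> + \<delta>\<^sup>2 / 2) * (1 + \<delta> + \<delta>\<^sup>2 / 2) = 1 + (\<delta>\<^sup>2)\<^sup>2 / 4" by (simp add: power2_eq_square field_simps)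
      then show ?thesis by simp
    qed
    moreover have "0 \<le> 1 - \<delta> + \<delta>\<^sup>2 / 2" using \<delta> by simp
    ultimately have "1 \<le> (1 - \<delta> + \<delta>\<^sup>2 / 2) * exp \<delta>" by (meson mult_left_mono order_trans)
    then have "exp (- \<delta>) * 1 \<le> exp (- \<delta>) * ((1 - \<delta> + \<delta>\<^sup>2 / 2) * exp \<delta>)" by (intro mult_left_mono) auto
    then show ?thesis by (simp add: q_def exp_minus field_simps)
  qed
  have qq: "q\<^sup>2 = exp (- 2 * \<delta>)" by (simp add: q_def power2_eq_square exp_add[symmetric])
  show q2: "q\<^sup>2 \<ge> 1 - 2 * \<delta>" unfolding qq using exp_ge_add_one_self[of "- 2 * \<delta>"] by simp
  have \<rho>0: "\<rho> > 0" by (simp add: \<rho>_def)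
  have qe2: "q * e\<^sup>2 = \<rho> / q" using p0 unfolding p\<rho>[symmetric] pq[symmetric] by (simp add: power2_eq_square)
  have q2e2: "q\<^sup>2 * e\<^sup>2 = \<rho>" unfolding p\<rho>[symmetric] pq[symmetric] by (simp add: power_mult_distrib)
  have e2: "e\<^sup>2 = \<rho> / q\<^sup>2" using q2e2 p0 by (simp add: field_simps)
  have \<delta>\<delta>: "\<delta>\<^sup>2 \<le> (111 / 2000) * \<delta>" using \<delta> mult_right_mono[of \<delta> "111 / 2000" \<delta>] by (simp add: power2_eq_square)
  have \<Delta>\<delta>: "\<Delta> * \<delta> \<le> (111 / 2000) * \<Delta>" using \<delta> \<Delta> mult_left_mono[of \<delta> "(111 / 2000)" \<Delta>] by simp
  have "\<rho> / q \<ge> (63 / 200) * (1 - 2 * \<Delta>) * (1 + \<delta>)"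
  proof -
    have "(63 / 200) * (1 - 2 * \<Delta>) * (1 + \<delta>) \<le> \<rho> * (1 / q)" using \<rho>(1) iq \<Delta> \<delta> \<rho>0 by (intro mult_mono) auto
    then show ?thesis by simp
  qed
  moreover have "(63 / 200) * (1 - 2 * \<Delta>) * (1 + \<delta>) = (63 / 200) + (63 / 200) * \<delta> - (63 / 100) * \<Delta> - (63 / 100) * (\<Delta> * \<delta>)" by (simp add: field_simps)
  moreover have "\<delta> * p \<le> \<delta> * (2809 / 5000)" using p \<delta> by (intro mult_left_mono) auto
  moreover have "q * ((1 - e\<^sup>2) + 2 * \<delta> * e) = q - \<rho> / q + 2 * (\<delta> * p)" unfolding qe2[symmetric] pq[symmetric] by (simp add: algebra_simps)
  ultimately show "q * ((1 - e\<^sup>2) + 2 * \<delta> * e) \<le> (137 / 200) - (4 / 25) * \<delta> + (67 / 100) * \<Delta>"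
    using qu \<delta>\<delta> \<Delta>\<delta> \<delta> \<Delta> by simp
  have q21: "q\<^sup>2 \<le> 1" using q1 p0 by (simp add: power_le_one)
  have A: "q\<^sup>2 - \<rho> \<le> (137 / 200) + (63 / 100) * \<Delta>" "0 \<le> q\<^sup>2 - \<rho>" using q21 \<rho> q2 \<delta> by (simp_all add: right_diff_distrib)
  \<comment> \<open>In the corner \<open>e^2\<close> is close to
    \<open>exp (- 2 * euler_mascheroni)\<close>, about 0.315, hence to 1/3. The leading part of the
    second moment therefore almost cancels.\<close>
  have B: "\<bar>1 - 3 * e\<^sup>2\<bar> \<le> (11 / 200) + (189 / 100) * \<Delta> + (1 / 4) * \<delta>"
  proof (rule abs_leI)
    have "\<rho> \<le> e\<^sup>2" unfolding e2 using q21 p0 \<rho>0 by (simp add: pos_le_divide_eq)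
    then show "1 - 3 * e\<^sup>2 \<le> (11 / 200) + (189 / 100) * \<Delta> + (1 / 4) * \<delta>" using \<rho>(1) \<delta> by (simp add: right_diff_distrib)
    have "e\<^sup>2 \<le> (631 / 2000) / (1 - 2 * \<delta>)" unfolding e2 using \<rho> \<rho>0 q2 \<delta> by (intro frac_le) auto
    also have "\<dots> \<le> (631 / 2000) * (1 + (9 / 4) * \<delta>)"
    proof -
      have "1 \<le> (1 + (9 / 4) * \<delta>) * (1 - 2 * \<delta>)"
        using \<delta>\<delta> \<delta> by (simp add: algebra_simps power2_eq_square)
      then have "(631 / 2000) * 1 \<le> (631 / 2000) * ((1 + (9 / 4) * \<delta>) * (1 - 2 * \<delta>))" by (intro mult_left_mono) auto
      moreover have "1 - 2 * \<delta> > 0" using \<delta> by simp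
      ultimately show ?thesis by (subst pos_divide_le_eq) (simp_all only: mult.assoc mult_1_right)
    qed
    finally show "- (1 - 3 * e\<^sup>2) \<le> (11 / 200) + (189 / 100) * \<Delta> + (1 / 4) * \<delta>" using \<delta> \<Delta> by simp
  qed
  have "q\<^sup>2 * \<bar>(1 - e\<^sup>2) * (1 - 3 * e\<^sup>2)\<bar> = (q\<^sup>2 - \<rho>) * \<bar>1 - 3 * e\<^sup>2\<bar>"
  proof -
    have "q\<^sup>2 * \<bar>(1 - e\<^sup>2) * (1 - 3 * e\<^sup>2)\<bar> = \<bar>q\<^sup>2 * ((1 - e\<^sup>2) * (1 - 3 * e\<^sup>2))\<bar>" by (simp add: abs_mult)
    also have "q\<^sup>2 * ((1 - e\<^sup>2) * (1 - 3 * e\<^sup>2)) = (q\<^sup>2 - \<rho>) * (1 - 3 * e\<^sup>2)" unfolding q2e2[symmetric] by (simp add: algebra_simps)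
    finally show ?thesis using A(2) by (simp add: abs_mult)
  qed
  also have "\<dots> \<le> ((137 / 200) + (63 / 100) * \<Delta>) * ((11 / 200) + (189 / 100) * \<Delta> + (1 / 4) * \<delta>)"
    using A B \<Delta> by (intro mult_mono) auto
  finally have 1: "q\<^sup>2 * \<bar>(1 - e\<^sup>2) * (1 - 3 * e\<^sup>2)\<bar> \<le> ((137 / 200) + (63 / 100) * \<Delta>) * ((11 / 200) + (189 / 100) * \<Delta> + (1 / 4) * \<delta>)" .
  have 2: "q\<^sup>2 * (8 * \<delta> * e * (1 - e\<^sup>2)) \<le> 8 * \<delta> * ((2809 / 5000) * ((137 / 200) + (63 / 100) * \<Delta>))"
  proof -
    have "q - p * e \<le> (137 / 200) + (63 / 100) * \<Delta>"
    proof -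
      have "p \<le> e" using pq q1 p0 by (metis mult_left_le_one_le less_imp_le)
      then have "\<rho> \<le> p * e" unfolding p\<rho>[symmetric] using p0 by (simp add: power2_eq_square)
      then show ?thesis using q1 \<rho>(1) by (simp add: right_diff_distrib)
    qed
    then have "p * (q - p * e) \<le> p * ((137 / 200) + (63 / 100) * \<Delta>)" using p0 by (intro mult_left_mono) auto
    also have "\<dots> \<le> (2809 / 5000) * ((137 / 200) + (63 / 100) * \<Delta>)" using p \<Delta> by (intro mult_right_mono) auto
    finally have "p * (q - p * e) \<le> (2809 / 5000) * ((137 / 200) + (63 / 100) * \<Delta>)" .
    then have "8 * \<delta> * (p * (q - p * e)) \<le> 8 * \<delta> * ((2809 / 5000) * ((137 / 200) + (63 / 100) * \<Delta>))" using \<delta> by (intro mult_left_mono) auto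
    moreover have "q\<^sup>2 * (8 * \<delta> * e * (1 - e\<^sup>2)) = 8 * \<delta> * (p * (q - p * e))" unfolding pq[symmetric] by (simp add: power2_eq_square algebra_simps)
    ultimately show ?thesis by (simp only:)
  qed
  have 3: "q\<^sup>2 * (e\<^sup>2 * (4 * \<delta> + 8 * \<delta>\<^sup>2)) \<le> (631 / 2000) * (4 * \<delta> + 8 * \<delta>\<^sup>2)"
    unfolding mult.assoc[symmetric] q2e2 using \<rho>(2) \<delta> by (intro mult_right_mono) auto
  have \<Delta>\<Delta>: "\<Delta> * \<Delta> \<le> (21 / 500) * \<Delta>" using \<Delta> by (intro mult_right_mono) auto
  have "q\<^sup>2 * (\<bar>(1 - e\<^sup>2) * (1 - 3 * e\<^sup>2)\<bar> + 8 * \<delta> * e * (1 - e\<^sup>2) + e\<^sup>2 * (4 * \<delta> + 8 * \<delta>\<^sup>2))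
      \<le> ((137 / 200) + (63 / 100) * \<Delta>) * ((11 / 200) + (189 / 100) * \<Delta> + (1 / 4) * \<delta>) + 8 * \<delta> * ((2809 / 5000) * ((137 / 200) + (63 / 100) * \<Delta>)) + (631 / 2000) * (4 * \<delta> + 8 * \<delta>\<^sup>2)"
  proof -
    have d: "q\<^sup>2 * (A + B + C) = q\<^sup>2 * A + q\<^sup>2 * B + q\<^sup>2 * C" for A B C by (simp add: distrib_left)
    show ?thesis unfolding d by (intro add_mono 1 2 3)
  qed
  also have "\<dots> = (1507 / 40000) + (13293 / 10000) * \<Delta> + (11907 / 10000) * (\<Delta> * \<Delta>) + (2255957 / 500000) * \<delta> + (747243 / 250000) * (\<Delta> * \<delta>) + (631 / 250) * \<delta>\<^sup>2"
    by (simp add: power2_eq_square field_simps)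
  also have "\<dots> \<le> (19 / 500) + (233 / 50) * \<delta> + (31 / 20) * \<Delta>" using \<delta>\<delta> \<Delta>\<delta> \<Delta>\<Delta> \<delta> \<Delta> by simp
  finally show "q\<^sup>2 * (\<bar>(1 - e\<^sup>2) * (1 - 3 * e\<^sup>2)\<bar> + 8 * \<delta> * e * (1 - e\<^sup>2) + e\<^sup>2 * (4 * \<delta> + 8 * \<delta>\<^sup>2)) \<le> (19 / 500) + (233 / 50) * \<delta> + (31 / 20) * \<Delta>" .
qed

text \<open>The expression is affine in \<open>t\<close> and in \<open>M2\<close>, and decreases in
  both because \<open>4 * k * (1 + s^2)\<close> stays below 81/50; so the upper bounds
  \<open>s * M\<close> and \<open>N\<close> may be inserted. What remains is
  \<open>A - k * C\<close>, where \<open>k\<close> is replaced by its largest value if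
  \<open>C \<ge> 0\<close> and \<open>k * C\<close> is discarded otherwise.\<close>

lemma corner_gain:
  fixes \<Delta> \<delta> :: real
  assumes \<Delta>: "\<Delta> \<ge> 0" "\<Delta> \<le> (21 / 500)" and \<delta>: "\<delta> \<ge> 0" "\<delta> \<le> (111 / 2000)" and y: "0 < y" "y \<le> (46 / 125)"
  defines "q \<equiv> exp (- \<delta>)" and "e \<equiv> exp (- (euler_mascheroni + \<Delta> - \<delta>))"
    and "\<rho> \<equiv> exp (- 2 * (euler_mascheroni + \<Delta>))"
  defines "M1 \<equiv> q * ((1 - e\<^sup>2) + 2 * \<delta> * e)"
    and "M2 \<equiv> q\<^sup>2 * (\<bar>(1 - e\<^sup>2) * (1 - 3 * e\<^sup>2)\<bar> + 8 * \<delta> * e * (1 - e\<^sup>2) + e\<^sup>2 * (4 * \<delta> + 8 * \<delta>\<^sup>2))"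
  assumes s: "0 \<le> s" "s \<le> 1" and t: "t \<le> s * M1"
  shows "y * ((33 / 250) - (59 / 25) * \<delta> - (81 / 100) * \<Delta>) \<le> (81 / 100) * (y * (q\<^sup>2 + s\<^sup>2 - 2 * t) - y * \<rho>)
      - (81 / 200) * (y\<^sup>2 * ((1 + s\<^sup>2)\<^sup>2 - 4 * (1 + s\<^sup>2) * t + 2 * s\<^sup>2 + 2 * s\<^sup>2 * M2) - (y * \<rho>)\<^sup>2)"
proof -
  define k where "k = (81 / 200) * y"
  have k: "0 \<le> k" "k \<le> (1863 / 12500)" using y by (auto simp: k_def)
  define M where "M = (137 / 200) - (4 / 25) * \<delta> + (67 / 100) * \<Delta>"
  define N where "N = (19 / 500) + (233 / 50) * \<delta> + (31 / 20) * \<Delta>"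
  have M: "M1 \<le> M" and N: "M2 \<le> N" and q: "1 - 2 * \<delta> \<le> q\<^sup>2"
    using corner_moment_bounds[OF \<Delta> \<delta>] by (simp_all add: M1_def M2_def M_def N_def q_def e_def)
  have \<rho>: "(63 / 200) * (1 - 2 * \<Delta>) \<le> \<rho>" "\<rho> \<le> (631 / 2000)" using square_mass_bounds[OF \<Delta>(1)] by (simp_all add: \<rho>_def)
  have \<rho>2: "(62 / 625) * (1 - 4 * \<Delta>) \<le> \<rho>\<^sup>2"
  proof -
    have "(62 / 625) * (1 - 4 * \<Delta>) \<le> (3969 / 40000) * (1 - 4 * \<Delta>)" using \<Delta> by (intro mult_right_mono) auto
    also have "\<dots> \<le> (3969 / 40000) * (1 - 2 * \<Delta>)\<^sup>2" by (intro mult_left_mono) (auto simp: power2_eq_square algebra_simps)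
    also have "\<dots> = ((63 / 200) * (1 - 2 * \<Delta>))\<^sup>2" by (simp add: power2_eq_square field_simps)
    also have "\<dots> \<le> \<rho>\<^sup>2" using \<rho> \<Delta> by (intro power_mono) auto
    finally show ?thesis .
  qed
  have s2: "s\<^sup>2 \<le> 1" "0 \<le> s\<^sup>2" using s by (auto simp: power_le_one)
  have t': "t \<le> s * M" using t mult_left_mono[OF M s(1)] by linarith
  define C where "C = (1 + s\<^sup>2)\<^sup>2 - 4 * (1 + s\<^sup>2) * (s * M) + 2 * s\<^sup>2 + 2 * s\<^sup>2 * N - \<rho>\<^sup>2"
  define A where "A = (81 / 100) * ((1369 / 2000) - 2 * \<delta> + s\<^sup>2 - 2 * (s * M))"
  have "(81 / 100) * (q\<^sup>2 + s\<^sup>2 - 2 * t - \<rho>) - k * ((1 + s\<^sup>2)\<^sup>2 - 4 * (1 + s\<^sup>2) * t + 2 * s\<^sup>2 + 2 * s\<^sup>2 * M2 - \<rho>\<^sup>2) \<ge> A - k * C"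
  proof -
    have "4 * k * (1 + s\<^sup>2) \<le> 4 * (1863 / 12500) * 2" using k s2 by (intro mult_mono) auto
    then have "0 \<le> (s * M - t) * ((81 / 50) - 4 * k * (1 + s\<^sup>2))" using t' by (intro mult_nonneg_nonneg) auto
    moreover have "0 \<le> k * (2 * s\<^sup>2 * (N - M2))" using k N s2 by (intro mult_nonneg_nonneg) auto
    moreover have "(81 / 100) * (q\<^sup>2 + s\<^sup>2 - 2 * t - \<rho>) - k * ((1 + s\<^sup>2)\<^sup>2 - 4 * (1 + s\<^sup>2) * t + 2 * s\<^sup>2 + 2 * s\<^sup>2 * M2 - \<rho>\<^sup>2)
        = A - k * C + (81 / 100) * (q\<^sup>2 - (1 - 2 * \<delta>)) + (81 / 100) * ((631 / 2000) - \<rho>) + (s * M - t) * ((81 / 50) - 4 * k * (1 + s\<^sup>2)) + k * (2 * s\<^sup>2 * (N - M2))"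
      unfolding A_def C_def by (simp add: field_simps)
    moreover have "0 \<le> (81 / 100) * (q\<^sup>2 - (1 - 2 * \<delta>))" "0 \<le> (81 / 100) * ((631 / 2000) - \<rho>)" using q \<rho>(2) by simp_all
    moreover have "X = Y + v1 + v2 + v3 + v4 \<Longrightarrow> 0 \<le> v1 \<Longrightarrow> 0 \<le> v2 \<Longrightarrow> 0 \<le> v3 \<Longrightarrow> 0 \<le> v4 \<Longrightarrow> Y \<le> X" for X Y v1 v2 v3 v4 :: real
      by simp
    ultimately show ?thesis by blast
  qed
  moreover have "(33 / 250) - (59 / 25) * \<delta> - (81 / 100) * \<Delta> \<le> A - k * C"
  proof (cases "C \<ge> 0")
    case True
    then have "k * C \<le> (1863 / 12500) * C" using k by (intro mult_right_mono) auto
    moreover have "(33 / 250) - (59 / 25) * \<delta> - (81 / 100) * \<Delta> \<le> A - (1863 / 12500) * C"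
    proof -
      \<comment> \<open>\<open>J\<close> collects the coefficient of \<open>- \<Delta>\<close>, so
        that the remaining polynomial is the one of \<open>gain_polynomial\<close>.\<close>
      define J where "J = (5427 / 5000) * s - (124821 / 312500) * s * (1 + s\<^sup>2) + (57753 / 125000) * s\<^sup>2 + (115506 / 1953125)"
      have "J \<le> (81 / 100)"
      proof -
        have "s * s\<^sup>2 \<le> 1" using s s2 by (simp add: mult_le_one)
        have "0 \<le> 747 / 1000 + 31 / 500 * s - 2 / 5 * s\<^sup>2" using s s2 by simp
        then have "0 \<le> (1 - s) * (747 / 1000 + 31 / 500 * s - 2 / 5 * s\<^sup>2)" using s by (intro mult_nonneg_nonneg) auto
        also have "\<dots> = (747 / 1000) - (137 / 200) * s - (231 / 500) * s\<^sup>2 + (2 / 5) * (s * s\<^sup>2)" by (simp add: power2_eq_square field_simps)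
        finally show ?thesis unfolding J_def using s s2 \<open>s * s\<^sup>2 \<le> 1\<close> by (simp add: field_simps)
      qed
      then have "\<Delta> * J \<le> \<Delta> * (81 / 100)" using \<Delta> by (intro mult_left_mono) auto
      moreover have "A - (1863 / 12500) * C = (81 / 100) * ((1369 / 2000) - 2 * \<delta> + s\<^sup>2 - 2 * s * ((137 / 200) - (4 / 25) * \<delta>))
          - (1863 / 12500) * ((1 + s\<^sup>2)\<^sup>2 - 4 * (1 + s\<^sup>2) * (s * ((137 / 200) - (4 / 25) * \<delta>)) + 2 * s\<^sup>2 + 2 * s\<^sup>2 * ((19 / 500) + (233 / 50) * \<delta>) - (62 / 625))
          - \<Delta> * J + (1863 / 12500) * (\<rho>\<^sup>2 - (62 / 625) * (1 - 4 * \<Delta>))"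
        unfolding A_def C_def M_def N_def J_def by (simp add: field_simps)
      moreover have "0 \<le> (1863 / 12500) * (\<rho>\<^sup>2 - (62 / 625) * (1 - 4 * \<Delta>))" using \<rho>2 by simp
      moreover have "D \<le> \<Delta> * (81 / 100) \<Longrightarrow> X = Y - V - D + W \<Longrightarrow> 0 \<le> W \<Longrightarrow> (33 / 250) - (59 / 25) * \<delta> \<le> Y - V
          \<Longrightarrow> (33 / 250) - (59 / 25) * \<delta> - (81 / 100) * \<Delta> \<le> X" for X Y V W D
        by linarith
      ultimately show ?thesis using gain_polynomial[OF s \<delta>] by blast
    qed
    ultimately show ?thesis by linarith
  next
    case False
    then have "k * C \<le> 0" using k by (simp add: mult_nonneg_nonpos)
    moreover have "(33 / 250) - (59 / 25) * \<delta> - (81 / 100) * \<Delta> \<le> A"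
    proof -
      have "M\<^sup>2 \<le> ((137 / 200) + (67 / 100) * \<Delta>)\<^sup>2" using \<delta> \<Delta> by (intro power_mono) (auto simp: M_def)
      moreover have "\<Delta> * \<Delta> \<le> (21 / 500) * \<Delta>" using \<Delta> by (intro mult_right_mono) auto
      then have "((137 / 200) + (67 / 100) * \<Delta>)\<^sup>2 \<le> (4693 / 10000) + (937 / 1000) * \<Delta>" using \<Delta> by (simp add: power2_eq_square field_simps)
      moreover have "0 \<le> (s - M)\<^sup>2" by simp
      then have "- M\<^sup>2 \<le> s\<^sup>2 - 2 * (s * M)" by (simp add: power2_eq_square algebra_simps)
      ultimately show ?thesis unfolding A_def using \<delta> \<Delta> by (simp add: field_simps)
    qed
    ultimately show ?thesis by linarith
  qed
  ultimately have "y * ((33 / 250) - (59 / 25) * \<delta> - (81 / 100) * \<Delta>) \<le> y * ((81 / 100) * (q\<^sup>2 + s\<^sup>2 - 2 * t - \<rho>)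
      - k * ((1 + s\<^sup>2)\<^sup>2 - 4 * (1 + s\<^sup>2) * t + 2 * s\<^sup>2 + 2 * s\<^sup>2 * M2 - \<rho>\<^sup>2))"
    using y by (intro mult_left_mono) auto
  also have "\<dots> = (81 / 100) * (y * (q\<^sup>2 + s\<^sup>2 - 2 * t) - y * \<rho>)
      - (81 / 200) * (y\<^sup>2 * ((1 + s\<^sup>2)\<^sup>2 - 4 * (1 + s\<^sup>2) * t + 2 * s\<^sup>2 + 2 * s\<^sup>2 * M2) - (y * \<rho>)\<^sup>2)"
    unfolding k_def by (simp add: power2_eq_square field_simps)
  finally show ?thesis .
qed

section \<open>The Markov property up to a hitting time\<close>

text \<open>Conditioning on \<open>W\<close>, written as Fubini's theorem for the product of the two
  laws. The predicate \<open>indep_var\<close> wants both variables in one type, hence the pair with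
  first entry 0; and \<open>G\<close> clips the weight so as to be bounded on the whole product
  space.\<close>

lemma (in prob_space) expectation_indep_shift:
  fixes W :: "'a \<Rightarrow> real \<times> complex" and V :: "'a \<Rightarrow> complex" and \<phi> :: "complex \<Rightarrow> real"
  assumes ind: "indep_var borel W borel (\<lambda>\<omega>. (0::real, V \<omega>))"
    and V: "distributed M lborel V (\<lambda>v. ennreal (p v))" and p: "\<And>v. p v \<ge> 0" "p \<in> borel_measurable borel"
    and \<phi>: "\<phi> \<in> borel_measurable borel" "\<And>x. \<bar>\<phi> x\<bar> \<le> C"
    and W: "\<And>\<omega>. \<omega> \<in> space M \<Longrightarrow> \<bar>fst (W \<omega>)\<bar> \<le> 1"
  shows "expectation (\<lambda>\<omega>. fst (W \<omega>) * \<phi> (snd (W \<omega>) + V \<omega>))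
       = expectation (\<lambda>\<omega>. fst (W \<omega>) * (LINT v|lborel. p v * \<phi> (snd (W \<omega>) + v)))"
proof -
  note [measurable] = \<phi>(1) p(2)
  let ?V = "\<lambda>\<omega>. (0::real, V \<omega>)"
  have Wm[measurable]: "W \<in> borel_measurable M" and V'm: "?V \<in> borel_measurable M"
    using ind by (auto dest: indep_var_rv1 indep_var_rv2)
  have Vm[measurable]: "V \<in> borel_measurable M"
    using distributed_measurable[OF V] by simp
  define G where "G = (\<lambda>(w :: real \<times> complex, v :: real \<times> complex). max (-1) (min 1 (fst w)) * \<phi> (snd w + snd v))"
  have [measurable]: "(fst :: real \<times> complex \<Rightarrow> real) \<in> borel_measurable borel"
    "(snd :: real \<times> complex \<Rightarrow> complex) \<in> borel_measurable borel"
    by (intro borel_measurable_continuous_onI continuous_intros)+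
  have [measurable]: "G \<in> borel_measurable (borel \<Otimes>\<^sub>M borel)" unfolding G_def by measurable
  have Gb: "\<bar>G x\<bar> \<le> C" for x
  proof -
    obtain w v where x: "x = (w, v)" by (cases x)
    have "\<bar>max (-1) (min 1 (fst w))\<bar> * \<bar>\<phi> (snd w + snd v)\<bar> \<le> 1 * C"
      using \<phi>(2) by (intro mult_mono) auto
    then show ?thesis by (simp add: G_def x abs_mult)
  qed
  have GW: "G (W \<omega>, v) = fst (W \<omega>) * \<phi> (snd (W \<omega>) + snd v)" if "\<omega> \<in> space M" for \<omega> v
    using W[OF that] unfolding G_def by (auto simp: max_def min_def abs_le_iff)
  let ?DW = "distr M borel W" and ?DV = "distr M borel ?V"
  interpret DW: prob_space ?DW by (rule prob_space_distr) measurable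
  interpret DV: prob_space ?DV by (rule prob_space_distr) (rule V'm)
  interpret P: pair_prob_space ?DW ?DV ..
  have prod: "?DW \<Otimes>\<^sub>M ?DV = distr M (borel \<Otimes>\<^sub>M borel) (\<lambda>\<omega>. (W \<omega>, ?V \<omega>))"
    using ind indep_var_distribution_eq by blast
  have int: "integrable (?DW \<Otimes>\<^sub>M ?DV) G"
    by (rule P.integrable_const_bound[where B = C]) (auto simp: Gb)
  have inner: "(LINT v|?DV. G (w, v)) = (LINT v|lborel. p v * G (w, (0, v)))" for w
  proof -
    have "(LINT v|?DV. G (w, v)) = (LINT \<omega>|M. G (w, ?V \<omega>))" by (rule integral_distr) measurable
    also have "\<dots> = (LINT v|lborel. p v * G (w, (0, v)))"
      by (rule distributed_integral[OF V, symmetric]) (auto simp: p)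
    finally show ?thesis .
  qed
  have "expectation (\<lambda>\<omega>. fst (W \<omega>) * \<phi> (snd (W \<omega>) + V \<omega>)) = expectation (\<lambda>\<omega>. G (W \<omega>, ?V \<omega>))"
    by (intro Bochner_Integration.integral_cong) (simp_all add: GW)
  also have "\<dots> = (LINT x|(?DW \<Otimes>\<^sub>M ?DV). G x)"
    unfolding prod by (subst integral_distr) auto
  also have "\<dots> = (LINT w|?DW. LINT v|?DV. G (w, v))"
    by (rule P.integral_fst'[OF int, symmetric])
  also have "\<dots> = (LINT w|?DW. LINT v|lborel. p v * G (w, (0, v)))" by (simp only: inner)
  also have "\<dots> = expectation (\<lambda>\<omega>. LINT v|lborel. p v * G (W \<omega>, (0, v)))"
    by (rule integral_distr) (measurable)
  also have "\<dots> = expectation (\<lambda>\<omega>. fst (W \<omega>) * (LINT v|lborel. p v * \<phi> (snd (W \<omega>) + v)))"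
  proof (intro Bochner_Integration.integral_cong refl)
    fix \<omega> assume "\<omega> \<in> space M"
    then have "(LINT v|lborel. p v * G (W \<omega>, (0, v))) = (LINT v|lborel. fst (W \<omega>) * (p v * \<phi> (snd (W \<omega>) + v)))"
      by (intro Bochner_Integration.integral_cong) (simp_all add: GW mult_ac)
    then show "(LINT v|lborel. p v * G (W \<omega>, (0, v))) = fst (W \<omega>) * (LINT v|lborel. p v * \<phi> (snd (W \<omega>) + v))"
      by simp
  qed
  finally show ?thesis .
qed

definition heat_op :: "real \<Rightarrow> (complex \<Rightarrow> real) \<Rightarrow> complex \<Rightarrow> real" where
  "heat_op s \<phi> x = (LINT v|lborel. heat_kernel s 0 v * \<phi> (x + v))"

lemma heat_kernel_nonneg: "s \<ge> 0 \<Longrightarrow> heat_kernel s x y \<ge> 0"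
  by (simp add: heat_kernel_def)

lemma heat_kernel_measurable [measurable]: "heat_kernel s x \<in> borel_measurable borel"
  unfolding heat_kernel_def[abs_def] by measurable

lemma heat_op_measurable [measurable]:
  assumes [measurable]: "\<phi> \<in> borel_measurable borel"
  shows "heat_op s \<phi> \<in> borel_measurable borel"
  unfolding heat_op_def[abs_def] by measurable

context planar_brownian_motion begin

text \<open>The total mass is read off from the law of an increment of the given process, which
  avoids computing a Gaussian integral.\<close>

lemma heat_kernel_integral: "t > 0 \<Longrightarrow> (\<integral>\<^sup>+ v. ennreal (heat_kernel t 0 v) \<partial>lborel) = 1"
proof -
  assume t: "t > 0"
  have "distributed M lborel (\<lambda>\<omega>. B t \<omega> - B 0 \<omega>) (\<lambda>w. ennreal (heat_kernel t 0 w))"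
    using gaussian_increments[of 0 t] t by simp
  from distributed_emeasure[OF this, of UNIV] show ?thesis
    by (simp add: emeasure_space_1)
qed

definition avoid :: "complex set \<Rightarrow> real \<Rightarrow> 'w set" where
  "avoid S t = {\<omega> \<in> space M. \<forall>s\<in>{0..t}. B s \<omega> \<notin> S}"

definition grid_event :: "complex set \<Rightarrow> real \<Rightarrow> nat \<Rightarrow> 'w set" where
  "grid_event C h N = {\<omega> \<in> space M. \<forall>j\<le>N. B (real j * h) \<omega> \<in> C}"

lemma grid_event_sets: "closed C \<Longrightarrow> 0 \<le> h \<Longrightarrow> grid_event C h N \<in> sets M"
  unfolding grid_event_def
proof -
  assume C: "closed C" and h: "0 \<le> h"
  have "{\<omega> \<in> space M. \<forall>j\<le>N. B (real j * h) \<omega> \<in> C} = (\<Inter>j\<in>{..N}. B (real j * h) -` C \<inter> space M)" by auto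
  moreover have "B (real j * h) -` C \<inter> space M \<in> sets M" for j
    using h C by (intro measurable_sets[OF measurable[of "real j * h"]] borel_closed) auto
  ultimately show "{\<omega> \<in> space M. \<forall>j\<le>N. B (real j * h) \<omega> \<in> C} \<in> sets M"
    by (metis (no_types, lifting) finite_atMost sets.finite_INT atMost_iff empty_iff le0)
qed

text \<open>The Markov property at time \<open>t\<close> restricted to a single event. No filtration
  is set up, since only the events that a closed set has been avoided so far will be used.\<close>

definition markov_event :: "'w set \<Rightarrow> real \<Rightarrow> bool" where
  "markov_event A t \<longleftrightarrow> A \<in> sets M \<and> (\<forall>s>0. \<forall>\<phi> C. \<phi> \<in> borel_measurable borel \<longrightarrow> (\<forall>x. \<bar>\<phi> x\<bar> \<le> C) \<longrightarrow>
     expectation (\<lambda>\<omega>. indicator A \<omega> * \<phi> (B (t + s) \<omega>)) = expectation (\<lambda>\<omega>. indicator A \<omega> * heat_op s \<phi> (B t \<omega>)))"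

text \<open>The path on the grid is a function of the first \<open>N\<close> increments, and these
  are independent of the increment over the following time \<open>s\<close>.\<close>

lemma markov_grid_event:
  assumes C: "closed C" and h: "0 \<le> h"
  shows "markov_event (grid_event C h N) (real N * h)"
  unfolding markov_event_def
proof (intro conjI allI impI)
  show "grid_event C h N \<in> sets M" using C h by (rule grid_event_sets)
next
  fix s :: real and \<phi> :: "complex \<Rightarrow> real" and D :: real
  assume s: "s > 0" and \<phi>: "\<phi> \<in> borel_measurable borel" "\<forall>x. \<bar>\<phi> x\<bar> \<le> D"
  \<comment> \<open>Beyond index \<open>N\<close> the sequence stays at \<open>N * h + s\<close>; so
    increment number \<open>N\<close> is the one over the extra time \<open>s\<close>, although
    \<open>s\<close> is unrelated to the mesh.\<close>
  define t where "t i = (if i \<le> N then real i * h else real N * h + s)" for i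
  define X where "X i \<omega> = B (t (Suc i)) \<omega> - B (t i) \<omega>" for i \<omega>
  have inc: "incseq t"
  proof (rule incseq_SucI)
    fix i show "t i \<le> t (Suc i)"
      using s h by (cases "i \<le> N"; cases "Suc i \<le> N") (auto simp: t_def algebra_simps le_Suc_eq not_less_eq_eq)
  qed
  have ind: "indep_vars (\<lambda>_. borel) X {..<Suc N}"
    unfolding X_def[abs_def] using indep_increments[OF _ inc, of "Suc N"] by (simp add: t_def)
  have ind2: "indep_var (PiM {..<N} (\<lambda>_. borel)) (\<lambda>\<omega>. restrict (\<lambda>i. X i \<omega>) {..<N})
                (PiM {N} (\<lambda>_. borel)) (\<lambda>\<omega>. restrict (\<lambda>i. X i \<omega>) {N})"
    by (rule indep_var_restrict[OF ind]) auto
  define f where "f = (\<lambda>u :: nat \<Rightarrow> complex.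
     (if \<forall>j\<le>N. z + (\<Sum>i<j. u i) \<in> C then 1 else 0 :: real, z + (\<Sum>i<N. u i)))"
  have [measurable]: "C \<in> sets borel" using C by simp
  have sm: "(\<lambda>u. z + (\<Sum>i<j. u i)) \<in> borel_measurable (PiM {..<N} (\<lambda>_. borel))" if "j \<le> N" for j
    using that by (intro borel_measurable_add borel_measurable_sum measurable_component_singleton) auto
  have fm: "f \<in> measurable (PiM {..<N} (\<lambda>_. borel)) borel"
  proof -
    have "{u \<in> space (PiM {..<N} (\<lambda>_. borel :: complex measure)). \<forall>j\<le>N. z + (\<Sum>i<j. u i) \<in> C}
        \<in> sets (PiM {..<N} (\<lambda>_. borel))"
    proof -
      have "{u \<in> space (PiM {..<N} (\<lambda>_. borel :: complex measure)). \<forall>j\<in>{..N}. z + (\<Sum>i<j. u i) \<in> C}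
        \<in> sets (PiM {..<N} (\<lambda>_. borel))"
        by (intro sets.sets_Collect_finite_All') (use sm C in \<open>auto intro!: measurable_sets_borel simp: \<close>)
      then show ?thesis by simp
    qed
    then have "(\<lambda>u. if \<forall>j\<le>N. z + (\<Sum>i<j. u i) \<in> C then 1 else 0 :: real) \<in> borel_measurable (PiM {..<N} (\<lambda>_. borel))"
      by (intro measurable_If) auto
    then show ?thesis unfolding f_def using sm[of N] by (intro borel_measurable_Pair) auto
  qed
  have ind3: "indep_var borel (f \<circ> (\<lambda>\<omega>. restrict (\<lambda>i. X i \<omega>) {..<N})) borel ((\<lambda>u. (0, u N)) \<circ> (\<lambda>\<omega>. restrict (\<lambda>i. X i \<omega>) {N}))"
    by (rule indep_var_compose[OF ind2 fm]) (intro borel_measurable_Pair measurable_component_singleton, auto)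
  have sumX: "z + (\<Sum>i<j. X i \<omega>) = B (real j * h) \<omega>" if "j \<le> N" "\<omega> \<in> space M" for j \<omega>
    using that
  proof (induction j)
    case 0
    then show ?case using start by simp
  next
    case (Suc j)
    then have "z + (\<Sum>i<j. X i \<omega>) = B (real j * h) \<omega>" by simp
    then have "z + (\<Sum>i<Suc j. X i \<omega>) = B (real j * h) \<omega> + X j \<omega>" by (simp add: add.assoc[symmetric])
    also have "\<dots> = B (t (Suc j)) \<omega>" using Suc.prems by (simp add: X_def t_def)
    finally show ?case using Suc.prems by (simp add: t_def)
  qed
  let ?W = "f \<circ> (\<lambda>\<omega>. restrict (\<lambda>i. X i \<omega>) {..<N})"
  have fW: "?W \<omega> = (indicator (grid_event C h N) \<omega>, B (real N * h) \<omega>)" if \<omega>: "\<omega> \<in> space M" for \<omega>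
  proof -
    have 1: "(\<Sum>i<j. restrict (\<lambda>i. X i \<omega>) {..<N} i) = (\<Sum>i<j. X i \<omega>)" if "j \<le> N" for j
      using that by (intro sum.cong) auto
    have "(\<forall>j\<le>N. z + (\<Sum>i<j. restrict (\<lambda>i. X i \<omega>) {..<N} i) \<in> C) \<longleftrightarrow> \<omega> \<in> grid_event C h N"
      using sumX[OF _ \<omega>] \<omega> by (auto simp: grid_event_def 1)
    then show ?thesis using sumX[OF order_refl \<omega>] by (simp add: f_def 1 indicator_def)
  qed
  have VX: "((\<lambda>u. (0, u N)) \<circ> (\<lambda>\<omega>. restrict (\<lambda>i. X i \<omega>) {N})) = (\<lambda>\<omega>. (0::real, X N \<omega>))" by (auto simp: fun_eq_iff)
  have tN: "X N = (\<lambda>\<omega>. B (real N * h + s) \<omega> - B (real N * h) \<omega>)" by (auto simp: X_def t_def fun_eq_iff)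
  have dX: "distributed M lborel (X N) (\<lambda>w. ennreal (heat_kernel s 0 w))"
    using gaussian_increments[of "real N * h" "real N * h + s"] s h unfolding tN by simp
  have "expectation (\<lambda>\<omega>. fst (?W \<omega>) * \<phi> (snd (?W \<omega>) + X N \<omega>)) =
        expectation (\<lambda>\<omega>. fst (?W \<omega>) * (LINT v|lborel. heat_kernel s 0 v * \<phi> (snd (?W \<omega>) + v)))"
  proof (rule expectation_indep_shift)
    show "indep_var borel ?W borel (\<lambda>\<omega>. (0::real, X N \<omega>))" using ind3 unfolding VX .
    show "\<bar>fst (?W \<omega>)\<bar> \<le> 1" if "\<omega> \<in> space M" for \<omega> unfolding fW[OF that] by (simp add: indicator_def)
  qed (use dX \<phi> s heat_kernel_nonneg in auto)
  moreover have "expectation (\<lambda>\<omega>. fst (?W \<omega>) * \<phi> (snd (?W \<omega>) + X N \<omega>))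
      = expectation (\<lambda>\<omega>. indicator (grid_event C h N) \<omega> * \<phi> (B (real N * h + s) \<omega>))"
    by (intro Bochner_Integration.integral_cong refl) (simp add: fW[unfolded o_def] tN)
  moreover have "expectation (\<lambda>\<omega>. fst (?W \<omega>) * (LINT v|lborel. heat_kernel s 0 v * \<phi> (snd (?W \<omega>) + v)))
      = expectation (\<lambda>\<omega>. indicator (grid_event C h N) \<omega> * heat_op s \<phi> (B (real N * h) \<omega>))"
    by (intro Bochner_Integration.integral_cong refl) (simp add: fW[unfolded o_def] heat_op_def)
  ultimately show "expectation (\<lambda>\<omega>. indicator (grid_event C h N) \<omega> * \<phi> (B (real N * h + s) \<omega>))
      = expectation (\<lambda>\<omega>. indicator (grid_event C h N) \<omega> * heat_op s \<phi> (B (real N * h) \<omega>))"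
    by simp
qed

lemma heat_op_bounded:
  assumes "s > 0" "\<phi> \<in> borel_measurable borel" "\<And>x. \<bar>\<phi> x\<bar> \<le> C"
  shows "\<bar>heat_op s \<phi> x\<bar> \<le> C"
proof -
  have p: "integrable lborel (heat_kernel s 0)" "(LINT v|lborel. heat_kernel s 0 v) = 1"
    using heat_kernel_integral[OF assms(1)] heat_kernel_nonneg[of s] assms(1)
    by (auto intro!: integrableI_nonneg integral_eq_nn_integral[THEN trans])
  note [measurable] = assms(2)
  have bd: "\<bar>heat_kernel s 0 v * \<phi> (x + v)\<bar> \<le> C * heat_kernel s 0 v" for v
    using mult_right_mono[OF assms(3)[of "x + v"], of "heat_kernel s 0 v"] assms(1) heat_kernel_nonneg[of s 0 v]
    by (simp add: abs_mult mult.commute)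
  have i: "integrable lborel (\<lambda>v. heat_kernel s 0 v * \<phi> (x + v))"
  proof (rule Bochner_Integration.integrable_bound[of _ "\<lambda>v. C * heat_kernel s 0 v"])
    show "integrable lborel (\<lambda>v. C * heat_kernel s 0 v)" using p by simp
    show "AE v in lborel. norm (heat_kernel s 0 v * \<phi> (x + v)) \<le> norm (C * heat_kernel s 0 v)"
      using order_trans[OF bd abs_ge_self] by (intro AE_I2) (simp only: real_norm_def)
  qed measurable
  have "\<bar>heat_op s \<phi> x\<bar> \<le> (LINT v|lborel. \<bar>heat_kernel s 0 v * \<phi> (x + v)\<bar>)"
    unfolding heat_op_def by (rule integral_abs_bound)
  also have "\<dots> \<le> (LINT v|lborel. C * heat_kernel s 0 v)"
    using i p(1) by (intro integral_mono bd integrable_abs integrable_mult_right)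
  also have "\<dots> = C" using p by simp
  finally show ?thesis .
qed

lemma markov_event_limit:
  assumes ev: "\<And>n. markov_event (A n) t" and t: "0 \<le> t" and A: "A' \<in> sets M"
    and lim: "\<And>\<omega>. \<omega> \<in> space M \<Longrightarrow> (\<lambda>n. indicator (A n) \<omega> :: real) \<longlonglongrightarrow> indicator A' \<omega>"
  shows "markov_event A' t"
  unfolding markov_event_def
proof (intro conjI allI impI)
  show "A' \<in> sets M" by (rule A)
  fix s :: real and \<phi> :: "complex \<Rightarrow> real" and D :: real
  assume s: "s > 0" and \<phi>: "\<phi> \<in> borel_measurable borel" "\<forall>x. \<bar>\<phi> x\<bar> \<le> D"
  have [measurable]: "A n \<in> sets M" for n using ev by (auto simp: markov_event_def)
  note [measurable] = A \<phi>(1) measurable[OF t]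
  have Bts[measurable]: "B (t + s) \<in> borel_measurable M" using measurable t s by simp
  have conv: "(\<lambda>n. expectation (\<lambda>\<omega>. indicator (A n) \<omega> * \<psi> (B u \<omega>))) \<longlonglongrightarrow> expectation (\<lambda>\<omega>. indicator A' \<omega> * \<psi> (B u \<omega>))"
    if \<psi>[measurable]: "\<psi> \<in> borel_measurable borel" and b: "\<And>x. \<bar>\<psi> x\<bar> \<le> D" and u[measurable]: "B u \<in> borel_measurable M" for \<psi> :: "complex \<Rightarrow> real" and u
  proof (rule integral_dominated_convergence[where w = "\<lambda>_. D"])
    show "AE \<omega> in M. (\<lambda>n. indicator (A n) \<omega> * \<psi> (B u \<omega>)) \<longlonglongrightarrow> indicator A' \<omega> * \<psi> (B u \<omega>)"
      by (intro AE_I2 tendsto_intros lim)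
    show "AE \<omega> in M. norm (indicator (A n) \<omega> * \<psi> (B u \<omega>)) \<le> D" for n
      using b order_trans[OF abs_ge_zero b] by (intro AE_I2) (auto simp: indicator_def)
  qed auto
  have "(\<lambda>n. expectation (\<lambda>\<omega>. indicator (A n) \<omega> * \<phi> (B (t + s) \<omega>))) \<longlonglongrightarrow> expectation (\<lambda>\<omega>. indicator A' \<omega> * \<phi> (B (t + s) \<omega>))"
    by (rule conv) (use \<phi> Bts in blast)+
  moreover have "expectation (\<lambda>\<omega>. indicator (A n) \<omega> * \<phi> (B (t + s) \<omega>))
     = expectation (\<lambda>\<omega>. indicator (A n) \<omega> * heat_op s \<phi> (B t \<omega>))" for n
    using ev[of n] s \<phi> unfolding markov_event_def by blast
  ultimately have 1: "(\<lambda>n. expectation (\<lambda>\<omega>. indicator (A n) \<omega> * heat_op s \<phi> (B t \<omega>)))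
     \<longlonglongrightarrow> expectation (\<lambda>\<omega>. indicator A' \<omega> * \<phi> (B (t + s) \<omega>))" by simp
  have "(\<lambda>n. expectation (\<lambda>\<omega>. indicator (A n) \<omega> * heat_op s \<phi> (B t \<omega>))) \<longlonglongrightarrow> expectation (\<lambda>\<omega>. indicator A' \<omega> * heat_op s \<phi> (B t \<omega>))"
    by (rule conv) (use \<phi> in \<open>auto intro: heat_op_bounded[OF s]\<close>)
  from LIMSEQ_unique[OF 1 this]
  show "expectation (\<lambda>\<omega>. indicator A' \<omega> * \<phi> (B (t + s) \<omega>)) = expectation (\<lambda>\<omega>. indicator A' \<omega> * heat_op s \<phi> (B t \<omega>))" .
qed

text \<open>Membership passes from a dense set of times to the whole path only for closed sets. The
  complement of a closed \<open>S\<close> is not closed, and these closed sets exhaust it.\<close>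

definition far :: "complex set \<Rightarrow> nat \<Rightarrow> complex set" where
  "far S m = {x. \<forall>y\<in>S. 1 / real (Suc m) \<le> dist x y}"

lemma closed_far: "closed (far S m)"
proof -
  have "far S m = (\<Inter>y\<in>S. {x. 1 / real (Suc m) \<le> dist x y})" by (auto simp: far_def)
  then show ?thesis by (auto intro!: closed_INT closed_Collect_le continuous_intros)
qed

lemma path_far_iff:
  assumes \<omega>: "\<omega> \<in> space M" and t: "0 \<le> t" and C: "closed C"
  shows "(\<forall>n. \<forall>j\<le>2 ^ n. B (real j * (t / 2 ^ n)) \<omega> \<in> C) \<longleftrightarrow> (\<forall>s\<in>{0..t}. B s \<omega> \<in> C)"
proof (intro iffI ballI allI impI)
  fix n j assume a: "\<forall>s\<in>{0..t}. B s \<omega> \<in> C" and j: "j \<le> (2::nat) ^ n"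
  have "real j \<le> 2 ^ n" using j by simp
  then have "real j * t \<le> 2 ^ n * t" using t by (intro mult_right_mono) auto
  then have "real j * (t / 2 ^ n) \<in> {0..t}" using t by (simp add: pos_divide_le_eq mult.commute)
  then show "B (real j * (t / 2 ^ n)) \<omega> \<in> C" using a by blast
next
  fix s assume a: "\<forall>n. \<forall>j\<le>2 ^ n. B (real j * (t / 2 ^ n)) \<omega> \<in> C" and s: "s \<in> {0..t}"
  show "B s \<omega> \<in> C"
  proof (cases "t = 0")
    case True
    then show ?thesis using s a[rule_format, of 0 0] by simp
  next
    case False
    then have t0: "t > 0" using t by simp
    \<comment> \<open>The dyadic times just below \<open>s\<close>, obtained by rounding down,
      converge to \<open>s\<close>; closedness of \<open>C\<close> carries membership over.\<close>
    have fl: "y - 1 \<le> real (nat \<lfloor>y\<rfloor>)" "real (nat \<lfloor>y\<rfloor>) \<le> y" if "y \<ge> 0" for y :: real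
      using that by linarith+
    define x where "x n = s / t * 2 ^ n" for n
    define j where "j n = nat \<lfloor>x n\<rfloor>" for n
    have x0: "x n \<ge> 0" for n using s t0 by (simp add: x_def)
    have l: "x n - 1 \<le> real (j n)" "real (j n) \<le> x n" for n
      unfolding j_def using fl[OF x0] by auto
    have xt: "x n * (t / 2 ^ n) = s" for n using t0 by (simp add: x_def)
    have jle: "j n \<le> 2 ^ n" for n
    proof -
      have "s / t \<le> 1" using s t0 by simp
      then have "x n \<le> 1 * 2 ^ n" unfolding x_def by (intro mult_right_mono) auto
      then have "real (j n) \<le> 2 ^ n" using l(2)[of n] by linarith
      then show ?thesis by simp
    qed
    have conv: "(\<lambda>n. real (j n) * (t / 2 ^ n)) \<longlonglongrightarrow> s"
    proof (rule tendsto_sandwich[of "\<lambda>n. s - t / 2 ^ n" _ _ "\<lambda>n. s"])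
      have "(x n - 1) * (t / 2 ^ n) \<le> real (j n) * (t / 2 ^ n)" for n
        using l t0 by (intro mult_right_mono) auto
      then show "\<forall>\<^sub>F n in sequentially. s - t / 2 ^ n \<le> real (j n) * (t / 2 ^ n)"
        by (intro always_eventually allI) (simp only: left_diff_distrib xt mult_1)
      have "real (j n) * (t / 2 ^ n) \<le> x n * (t / 2 ^ n)" for n
        using l t0 by (intro mult_right_mono) auto
      then show "\<forall>\<^sub>F n in sequentially. real (j n) * (t / 2 ^ n) \<le> s"
        by (intro always_eventually allI) (simp only: xt)
      have "(\<lambda>n. s - t * (1 / 2) ^ n) \<longlonglongrightarrow> s - t * 0"
        by (intro tendsto_diff tendsto_mult tendsto_const LIMSEQ_power_zero) auto
      moreover have "t * (1 / 2) ^ n = t / 2 ^ n" for n by (simp add: power_one_over)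
      ultimately show "(\<lambda>n. s - t / 2 ^ n) \<longlonglongrightarrow> s" by simp
    qed simp
    have lim: "(\<lambda>n. B (real (j n) * (t / 2 ^ n)) \<omega>) \<longlonglongrightarrow> B s \<omega>"
    proof (rule continuous_on_tendsto_compose[OF continuous_paths[OF \<omega>] conv])
      show "s \<in> {0..}" using s by simp
      show "\<forall>\<^sub>F n in sequentially. real (j n) * (t / 2 ^ n) \<in> {0..}"
        by (intro always_eventually allI) (use t0 in simp)
    qed
    have mem: "B (real (j n) * (t / 2 ^ n)) \<omega> \<in> C" for n using a jle by blast
    show ?thesis by (rule closed_sequentially[OF C mem lim])
  qed
qed

text \<open>By compactness of the path over \<open>[0, t]\<close>, avoiding a closed set means
  keeping some distance \<open>1 / (m + 1)\<close> from it, and keeping that distance is a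
  decreasing limit of dyadic grid events. The Markov property survives both monotone limits.\<close>

lemma markov_avoid:
  assumes S: "closed S" and t: "0 \<le> t"
  shows "markov_event (avoid S t) t"
proof -
  define E where "E m n = grid_event (far S m) (t / 2 ^ n) (2 ^ n)" for m n
  define F where "F m = {\<omega> \<in> space M. \<forall>s\<in>{0..t}. B s \<omega> \<in> far S m}" for m
  have mE: "markov_event (E m n) t" for m n
    using markov_grid_event[OF closed_far, of "t / 2 ^ n" S m "2 ^ n"] t by (simp add: E_def)
  have FE: "F m = (\<Inter>n. E m n)" for m
    using path_far_iff[OF _ t closed_far[of S m]] unfolding F_def E_def grid_event_def by blast
  have dec: "decseq (E m)" for m
  proof (rule decseq_SucI, rule subsetI)
    fix n \<omega> assume \<omega>: "\<omega> \<in> E m (Suc n)"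
    have "B (real j * (t / 2 ^ n)) \<omega> \<in> far S m" if "j \<le> 2 ^ n" for j
    proof -
      have "B (real (2 * j) * (t / 2 ^ Suc n)) \<omega> \<in> far S m" using \<omega> that unfolding E_def grid_event_def
        by (auto simp del: of_nat_mult)
      then show ?thesis by simp
    qed
    then show "\<omega> \<in> E m n" using \<omega> by (auto simp: E_def grid_event_def)
  qed
  have sE: "E m n \<in> sets M" for m n using mE by (auto simp: markov_event_def)
  have mF: "markov_event (F m) t" for m
  proof (rule markov_event_limit[of "E m"])
    show "F m \<in> sets M" unfolding FE using sE by blast
    show "(\<lambda>n. indicator (E m n) \<omega> :: real) \<longlonglongrightarrow> indicator (F m) \<omega>" for \<omega>
      unfolding FE by (rule LIMSEQ_indicator_decseq[OF dec])
  qed (use mE t in auto)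
  have AF: "avoid S t = (\<Union>m. F m)"
  proof (intro equalityI subsetI)
    fix \<omega> assume "\<omega> \<in> avoid S t"
    then have \<omega>: "\<omega> \<in> space M" "\<And>s. s \<in> {0..t} \<Longrightarrow> B s \<omega> \<notin> S" by (auto simp: avoid_def)
    have "compact ((\<lambda>s. B s \<omega>) ` {0..t})"
      by (intro compact_continuous_image continuous_on_subset[OF continuous_paths[OF \<omega>(1)]]) auto
    moreover have "((\<lambda>s. B s \<omega>) ` {0..t}) \<inter> S = {}" using \<omega>(2) by auto
    ultimately obtain d where d: "d > 0" "\<And>x y. x \<in> (\<lambda>s. B s \<omega>) ` {0..t} \<Longrightarrow> y \<in> S \<Longrightarrow> d \<le> dist x y"
      using separate_compact_closed[OF _ S] by metis
    obtain m where "inverse (real (Suc m)) < d" using reals_Archimedean[OF d(1)] by blast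
    then have "\<omega> \<in> F m" using d(2) \<omega>(1) by (fastforce simp: F_def far_def inverse_eq_divide)
    then show "\<omega> \<in> (\<Union>m. F m)" by blast
  next
    fix \<omega> assume "\<omega> \<in> (\<Union>m. F m)"
    then obtain m where m: "\<omega> \<in> F m" by blast
    have "B s \<omega> \<notin> S" if "s \<in> {0..t}" for s
    proof
      assume "B s \<omega> \<in> S"
      then have "1 / real (Suc m) \<le> dist (B s \<omega>) (B s \<omega>)" using m that unfolding F_def far_def by blast
      then show False by simp
    qed
    then show "\<omega> \<in> avoid S t" using m by (auto simp: avoid_def F_def)
  qed
  have inc: "incseq F"
  proof (rule incseq_SucI, rule subsetI)
    fix m \<omega> assume "\<omega> \<in> F m"
    moreover have "1 / real (Suc (Suc m)) \<le> 1 / real (Suc m)" by (intro divide_left_mono) auto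
    ultimately show "\<omega> \<in> F (Suc m)" unfolding F_def far_def by (fastforce intro: order_trans)
  qed
  show ?thesis
  proof (rule markov_event_limit[of F])
    show "avoid S t \<in> sets M" unfolding AF using mF by (auto simp: markov_event_def)
    show "(\<lambda>n. indicator (F n) \<omega> :: real) \<longlonglongrightarrow> indicator (avoid S t) \<omega>" for \<omega>
      unfolding AF by (rule LIMSEQ_indicator_incseq[OF inc])
  qed (use mF t in auto)
qed

end

section \<open>Optional stopping\<close>

context planar_brownian_motion begin

definition hits :: "complex set \<Rightarrow> 'w \<Rightarrow> bool" where
  "hits S \<omega> \<longleftrightarrow> (\<exists>s\<ge>0. B s \<omega> \<in> S)"

definition hit_time :: "complex set \<Rightarrow> 'w \<Rightarrow> real" where
  "hit_time S \<omega> = Inf {s. 0 \<le> s \<and> B s \<omega> \<in> S}"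

text \<open>The default 0 for paths that never hit is the limit of a discounted bounded value at
  time infinity. For \<open>place\<close> the default is arbitrary, but it only occurs multiplied by
  a zero discount.\<close>

definition stopped :: "complex set \<Rightarrow> (real \<Rightarrow> complex \<Rightarrow> 'b::real_normed_vector) \<Rightarrow> 'w \<Rightarrow> 'b" where
  "stopped S F \<omega> = (if hits S \<omega> then F (hit_time S \<omega>) (B (hit_time S \<omega>) \<omega>) else 0)"

lemma hit_time_props:
  assumes S: "closed S" and \<omega>: "\<omega> \<in> space M" and h: "hits S \<omega>"
  shows "0 \<le> hit_time S \<omega>" "B (hit_time S \<omega>) \<omega> \<in> S"
    "\<And>s. 0 \<le> s \<Longrightarrow> B s \<omega> \<in> S \<Longrightarrow> hit_time S \<omega> \<le> s"
proof -
  let ?H = "{s. 0 \<le> s \<and> B s \<omega> \<in> S}"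
  have eq: "?H = {0..} \<inter> (\<lambda>s. B s \<omega>) -` S" by auto
  have cl: "closed ?H"
    unfolding eq by (rule continuous_closed_preimage[OF continuous_paths[OF \<omega>] _ S]) simp
  have ne: "?H \<noteq> {}" using h by (auto simp: hits_def)
  have bd: "bdd_below ?H" by (rule bdd_belowI[of _ 0]) auto
  have "Inf ?H \<in> ?H" using closed_contains_Inf[OF ne bd cl] .
  then show "0 \<le> hit_time S \<omega>" "B (hit_time S \<omega>) \<omega> \<in> S" by (auto simp: hit_time_def)
  show "hit_time S \<omega> \<le> s" if "0 \<le> s" "B s \<omega> \<in> S" for s
    unfolding hit_time_def using that bd by (intro cInf_lower) auto
qed

lemma avoid_iff:
  assumes S: "closed S" and \<omega>: "\<omega> \<in> space M" and t: "0 \<le> t"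
  shows "\<omega> \<in> avoid S t \<longleftrightarrow> \<not> (hits S \<omega> \<and> hit_time S \<omega> \<le> t)"
proof (cases "hits S \<omega>")
  case True
  note p = hit_time_props[OF S \<omega> True]
  show ?thesis
  proof
    assume a: "\<omega> \<in> avoid S t"
    then have "\<not> hit_time S \<omega> \<le> t" using p(1,2) by (auto simp: avoid_def)
    then show "\<not> (hits S \<omega> \<and> hit_time S \<omega> \<le> t)" by blast
  next
    assume a: "\<not> (hits S \<omega> \<and> hit_time S \<omega> \<le> t)"
    have "B s \<omega> \<notin> S" if "s \<in> {0..t}" for s
      using p(3)[of s] that a True by auto
    then show "\<omega> \<in> avoid S t" using \<omega> by (auto simp: avoid_def)
  qed
next
  case False
  then show ?thesis using \<omega> by (auto simp: avoid_def hits_def)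
qed

text \<open>The stopped value with the hitting time rounded up to the grid of mesh \<open>h\<close>.\<close>

definition stopped_sum :: "complex set \<Rightarrow> (real \<Rightarrow> complex \<Rightarrow> 'b::real_normed_vector) \<Rightarrow> real \<Rightarrow> nat \<Rightarrow> 'w \<Rightarrow> 'b" where
  "stopped_sum S F h K \<omega> = (\<Sum>k<K. (indicator (avoid S (real k * h)) \<omega> - indicator (avoid S (real (Suc k) * h)) \<omega>) *\<^sub>R
       F (real (Suc k) * h) (B (real (Suc k) * h) \<omega>))"

text \<open>The difference of indicators is 1 exactly for the cell
  \<open>(k * h, (k + 1) * h]\<close> containing the hitting time. As \<open>z\<close> is not in
  \<open>S\<close>, the hitting time is positive and the rounded index is at least 1, so that index
  minus one is a legitimate summand.\<close>

lemma stopped_sum_eq: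
  assumes S: "closed S" and zS: "z \<notin> S" and \<omega>: "\<omega> \<in> space M" and h: "h > 0"
  shows "\<not> hits S \<omega> \<Longrightarrow> stopped_sum S F h K \<omega> = 0"
    and "hits S \<omega> \<Longrightarrow> stopped_sum S F h K \<omega> =
      (if nat \<lceil>hit_time S \<omega> / h\<rceil> \<le> K then
        F (real (nat \<lceil>hit_time S \<omega> / h\<rceil>) * h) (B (real (nat \<lceil>hit_time S \<omega> / h\<rceil>) * h) \<omega>) else 0)"
proof -
  have av: "\<omega> \<in> avoid S (real k * h) \<longleftrightarrow> \<not> (hits S \<omega> \<and> hit_time S \<omega> \<le> real k * h)" for k
    by (rule avoid_iff[OF S \<omega>]) (use h in auto)
  show "stopped_sum S F h K \<omega> = 0" if "\<not> hits S \<omega>"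
    unfolding stopped_sum_def using av that by (simp add: indicator_def del: of_nat_Suc)
  assume hit: "hits S \<omega>"
  let ?s = "hit_time S \<omega>"
  define m where "m = nat \<lceil>?s / h\<rceil>"
  have s0: "?s > 0"
  proof -
    have "?s \<noteq> 0" using hit_time_props(2)[OF S \<omega> hit] start[OF \<omega>] zS by metis
    then show ?thesis using hit_time_props(1)[OF S \<omega> hit] by simp
  qed
  have m: "m \<ge> 1" using s0 h by (simp add: m_def Suc_le_eq)
  have mle: "?s \<le> real k * h \<longleftrightarrow> m \<le> k" for k
  proof -
    have "?s \<le> real k * h \<longleftrightarrow> ?s / h \<le> real k" using h by (simp add: pos_divide_le_eq)
    also have "\<dots> \<longleftrightarrow> m \<le> k" unfolding m_def by linarith
    finally show ?thesis .
  qed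
  have d: "(indicator (avoid S (real k * h)) \<omega> - indicator (avoid S (real (Suc k) * h)) \<omega> :: real) = (if k = m - 1 then 1 else 0)" for k
    using av[of k] av[of "Suc k"] hit mle[of k] mle[of "Suc k"] m by (auto simp: indicator_def simp del: of_nat_Suc)
  have "stopped_sum S F h K \<omega> = (\<Sum>k<K. if k = m - 1 then F (real m * h) (B (real m * h) \<omega>) else 0)"
    unfolding stopped_sum_def d using m by (intro sum.cong) (auto simp del: of_nat_Suc)
  also have "\<dots> = (if m \<le> K then F (real m * h) (B (real m * h) \<omega>) else 0)"
    using m by (auto simp: sum.delta)
  finally show "stopped_sum S F h K \<omega> = (if m \<le> K then F (real m * h) (B (real m * h) \<omega>) else 0)" .
qed

text \<open>With mesh \<open>1 / (n + 1)\<close> and \<open>(n + 1)^2\<close> cells the horizon is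
  \<open>n + 1\<close>: the mesh shrinks while every finite hitting time is eventually covered.
  Rounding up converges to the hitting time from above, and the path is continuous.\<close>

lemma stopped_sum_tendsto:
  fixes F :: "real \<Rightarrow> complex \<Rightarrow> 'b::real_normed_vector"
  assumes S: "closed S" and zS: "z \<notin> S" and \<omega>: "\<omega> \<in> space M"
    and F: "continuous_on ({0..} \<times> UNIV) (\<lambda>(t, x). F t x)"
  shows "(\<lambda>n. stopped_sum S F (1 / real (Suc n)) (Suc n * Suc n) \<omega>) \<longlonglongrightarrow> stopped S F \<omega>"
proof (cases "hits S \<omega>")
  case False
  have "stopped_sum S F (1 / real (Suc n)) (Suc n * Suc n) \<omega> = 0" for n
    by (rule stopped_sum_eq(1)[OF S zS \<omega> _ False]) simp
  then show ?thesis using False by (simp add: stopped_def del: of_nat_Suc mult_Suc mult_Suc_right)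
next
  case True
  let ?s = "hit_time S \<omega>"
  note p = hit_time_props[OF S \<omega> True]
  define u where "u n = real (nat \<lceil>?s / (1 / real (Suc n))\<rceil>) * (1 / real (Suc n))" for n
  have c: "y \<le> real (nat \<lceil>y\<rceil>)" "real (nat \<lceil>y\<rceil>) \<le> y + 1" if "y \<ge> 0" for y :: real using that by linarith+
  have u1: "?s \<le> u n" "u n \<le> ?s + 1 / real (Suc n)" for n
  proof -
    let ?y = "?s / (1 / real (Suc n))"
    have y: "?y \<ge> 0" using p(1) by simp
    have e: "?y * (1 / real (Suc n)) = ?s" by simp
    have "?y * (1 / real (Suc n)) \<le> u n" unfolding u_def by (intro mult_right_mono c y) auto
    then show "?s \<le> u n" unfolding e .
    have "u n \<le> (?y + 1) * (1 / real (Suc n))" unfolding u_def by (intro mult_right_mono c y) auto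
    then show "u n \<le> ?s + 1 / real (Suc n)" by (simp only: distrib_right e mult_1)
  qed
  have ut: "u \<longlonglongrightarrow> ?s"
  proof (rule tendsto_sandwich[of "\<lambda>_. ?s" _ _ "\<lambda>n. ?s + 1 / real (Suc n)"])
    show "(\<lambda>n. ?s + 1 / real (Suc n)) \<longlonglongrightarrow> ?s"
      using LIMSEQ_inverse_real_of_nat_add[of ?s] by (simp add: inverse_eq_divide)
  qed (use u1 in auto)
  have Bt: "(\<lambda>n. B (u n) \<omega>) \<longlonglongrightarrow> B ?s \<omega>"
    by (rule continuous_on_tendsto_compose[OF continuous_paths[OF \<omega>] ut])
       (use p(1) order_trans[OF p(1) u1(1)] in auto)
  have "(\<lambda>n. (u n, B (u n) \<omega>)) \<longlonglongrightarrow> (?s, B ?s \<omega>)" by (intro tendsto_Pair ut Bt)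
  then have "(\<lambda>n. (\<lambda>(t, x). F t x) (u n, B (u n) \<omega>)) \<longlonglongrightarrow> (\<lambda>(t, x). F t x) (?s, B ?s \<omega>)"
    by (rule continuous_on_tendsto_compose[OF F])
       (use p(1) order_trans[OF p(1) u1(1)] in auto)
  then have lim: "(\<lambda>n. F (u n) (B (u n) \<omega>)) \<longlonglongrightarrow> F ?s (B ?s \<omega>)" by simp
  obtain N where N: "?s \<le> real N" using real_arch_simple by blast
  have ev: "\<forall>\<^sub>F n in sequentially. F (u n) (B (u n) \<omega>) = stopped_sum S F (1 / real (Suc n)) (Suc n * Suc n) \<omega>"
  proof (rule eventually_sequentiallyI[of N])
    fix n assume n: "N \<le> n"
    have "?s / (1 / real (Suc n)) \<le> real (Suc n) * real (Suc n)"
    proof -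
      have "?s \<le> real (Suc n)" using N n by linarith
      then have "?s * real (Suc n) \<le> real (Suc n) * real (Suc n)" by (intro mult_right_mono) auto
      then show ?thesis by simp
    qed
    then have "nat \<lceil>?s / (1 / real (Suc n))\<rceil> \<le> Suc n * Suc n"
      by (simp only: nat_le_iff ceiling_le_iff of_int_of_nat_eq of_nat_mult of_int_mult)
    then show "F (u n) (B (u n) \<omega>) = stopped_sum S F (1 / real (Suc n)) (Suc n * Suc n) \<omega>"
      using stopped_sum_eq(2)[OF S zS \<omega> _ True, of "1 / real (Suc n)" F "Suc n * Suc n"]
      by (simp add: u_def del: of_nat_Suc)
  qed
  have "(\<lambda>n. stopped_sum S F (1 / real (Suc n)) (Suc n * Suc n) \<omega>) \<longlonglongrightarrow> F ?s (B ?s \<omega>)"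
    using Lim_transform_eventually[OF lim ev] .
  then show ?thesis using True by (simp add: stopped_def)
qed

lemma avoid_sets [measurable]: "closed S \<Longrightarrow> 0 \<le> t \<Longrightarrow> avoid S t \<in> sets M"
  using markov_avoid[of S t] by (simp add: markov_event_def)

lemma stopped_sum_measurable:
  fixes F :: "real \<Rightarrow> complex \<Rightarrow> 'b::{real_normed_vector, second_countable_topology}"
  assumes S: "closed S" and h: "h \<ge> 0" and F: "\<And>t. t \<ge> 0 \<Longrightarrow> F t \<in> borel_measurable borel"
  shows "stopped_sum S F h K \<in> borel_measurable M"
proof -
  have [measurable]: "avoid S (real k * h) \<in> sets M" for k
    using S h by (intro avoid_sets) auto
  have [measurable]: "avoid S (real (Suc k) * h) \<in> sets M" for k
    using S h by (intro avoid_sets) auto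
  have [measurable]: "(\<lambda>\<omega>. F (real (Suc k) * h) (B (real (Suc k) * h) \<omega>)) \<in> borel_measurable M" for k
    using h by (intro measurable_compose[OF measurable F]) auto
  show ?thesis unfolding stopped_sum_def[abs_def] by measurable
qed

lemma stopped_measurable:
  fixes F :: "real \<Rightarrow> complex \<Rightarrow> 'b::{real_normed_vector, second_countable_topology}"
  assumes S: "closed S" and zS: "z \<notin> S" and F: "continuous_on ({0..} \<times> UNIV) (\<lambda>(t, x). F t x)"
  shows "stopped S F \<in> borel_measurable M"
proof (rule borel_measurable_LIMSEQ_metric)
  show "stopped_sum S F (1 / real (Suc n)) (Suc n * Suc n) \<in> borel_measurable M" for n
  proof (rule stopped_sum_measurable[OF S])
    fix t :: real assume t: "t \<ge> 0"
    have "continuous_on UNIV (\<lambda>x. (\<lambda>(t, x). F t x) (t, x))"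
      by (rule continuous_on_compose2[OF F]) (use t in \<open>auto intro!: continuous_intros\<close>)
    then show "F t \<in> borel_measurable borel" by (simp add: borel_measurable_continuous_onI)
  qed auto
  show "(\<lambda>n. stopped_sum S F (1 / real (Suc n)) (Suc n * Suc n) \<omega>) \<longlonglongrightarrow> stopped S F \<omega>" if "\<omega> \<in> space M" for \<omega>
    by (rule stopped_sum_tendsto[OF S zS that F])
qed

text \<open>A discrete Dynkin formula, telescoping in \<open>K\<close>. On the event that
  \<open>S\<close> has been avoided up to the current time the Markov property replaces the next
  value of \<open>\<phi>\<close> by \<open>heat_op\<close>, so \<open>E k\<close> is the expected
  one-step loss of the discounted process.\<close>

lemma stopping_identity:
  fixes \<phi> :: "complex \<Rightarrow> real"
  assumes S: "closed S" and zS: "z \<notin> S" and h: "h > 0" and \<tau>: "\<tau> > 0"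
    and \<phi>: "\<phi> \<in> borel_measurable borel" "\<And>x. \<bar>\<phi> x\<bar> \<le> C"
  defines "E k \<equiv> expectation (\<lambda>\<omega>. indicator (avoid S (real k * h)) \<omega> *
       (\<phi> (B (real k * h) \<omega>) - exp (- h / \<tau>) * heat_op h \<phi> (B (real k * h) \<omega>)))"
  shows "\<phi> z = expectation (stopped_sum S (\<lambda>t x. exp (- t / \<tau>) * \<phi> x) h K)
     + (\<Sum>k<K. exp (- (real k * h) / \<tau>) * E k)
     + exp (- (real K * h) / \<tau>) * expectation (\<lambda>\<omega>. indicator (avoid S (real K * h)) \<omega> * \<phi> (B (real K * h) \<omega>))"
proof (induction K)
  case 0
  have "avoid S 0 = space M" using zS start by (auto simp: avoid_def)
  moreover have "expectation (\<lambda>\<omega>. indicator (space M) \<omega> * \<phi> (B 0 \<omega>)) = expectation (\<lambda>\<omega>. \<phi> z)"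
    by (intro Bochner_Integration.integral_cong refl) (simp add: start)
  ultimately show ?case by (simp add: stopped_sum_def prob_space)
next
  case (Suc K)
  let ?t = "real K * h" and ?t' = "real (Suc K) * h"
  have t: "0 \<le> ?t" "0 \<le> ?t'" using h by auto
  have t': "?t' = ?t + h" by (simp add: algebra_simps)
  note tt = avoid_sets[OF S t(1)] avoid_sets[OF S t(2)] measurable[OF t(1)] measurable[OF t(2)]
  note [measurable] = \<phi>(1) tt
  have i: "integrable M (\<lambda>\<omega>. indicator A \<omega> * \<psi> (B u \<omega>))"
    if [measurable]: "A \<in> sets M" "\<psi> \<in> borel_measurable borel" "B u \<in> borel_measurable M" and "\<And>x. \<bar>\<psi> x\<bar> \<le> D"
    for A and \<psi> :: "complex \<Rightarrow> real" and u D
    by (rule integrable_const_bound[where B = D])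
       (use that(4) order_trans[OF abs_ge_zero that(4)] in \<open>auto simp: indicator_def\<close>)
  have mk: "expectation (\<lambda>\<omega>. indicator (avoid S ?t) \<omega> * \<phi> (B ?t' \<omega>))
      = expectation (\<lambda>\<omega>. indicator (avoid S ?t) \<omega> * heat_op h \<phi> (B ?t \<omega>))"
    unfolding t' using markov_avoid[OF S t(1)] h \<phi> unfolding markov_event_def by blast
  have i1: "integrable M (\<lambda>\<omega>. indicator (avoid S ?t) \<omega> * \<phi> (B ?t \<omega>))"
    by (rule i) (use \<phi> tt in \<open>auto simp del: of_nat_Suc\<close>)
  have i2: "integrable M (\<lambda>\<omega>. indicator (avoid S ?t) \<omega> * heat_op h \<phi> (B ?t \<omega>))"
    by (rule i) (use heat_op_bounded[OF h \<phi>] tt in \<open>auto simp del: of_nat_Suc\<close>)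
  have i3: "integrable M (\<lambda>\<omega>. indicator (avoid S ?t) \<omega> * \<phi> (B ?t' \<omega>))"
    by (rule i) (use \<phi> tt in \<open>auto simp del: of_nat_Suc\<close>)
  have i4: "integrable M (\<lambda>\<omega>. indicator (avoid S ?t') \<omega> * \<phi> (B ?t' \<omega>))"
    by (rule i) (use \<phi> tt in \<open>auto simp del: of_nat_Suc\<close>)
  have EK: "E K = expectation (\<lambda>\<omega>. indicator (avoid S ?t) \<omega> * \<phi> (B ?t \<omega>))
      - exp (- h / \<tau>) * expectation (\<lambda>\<omega>. indicator (avoid S ?t) \<omega> * \<phi> (B ?t' \<omega>))"
  proof -
    have "E K = expectation (\<lambda>\<omega>. indicator (avoid S ?t) \<omega> * \<phi> (B ?t \<omega>)
       - exp (- h / \<tau>) * (indicator (avoid S ?t) \<omega> * heat_op h \<phi> (B ?t \<omega>)))"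
      unfolding E_def by (intro Bochner_Integration.integral_cong refl) (simp add: algebra_simps)
    also have "\<dots> = expectation (\<lambda>\<omega>. indicator (avoid S ?t) \<omega> * \<phi> (B ?t \<omega>))
       - exp (- h / \<tau>) * expectation (\<lambda>\<omega>. indicator (avoid S ?t) \<omega> * heat_op h \<phi> (B ?t \<omega>))"
      using i1 i2 by (subst Bochner_Integration.integral_diff) auto
    finally show ?thesis unfolding mk .
  qed
  let ?D = "\<lambda>\<omega>. (indicator (avoid S ?t) \<omega> - indicator (avoid S ?t') \<omega>) * (exp (- ?t' / \<tau>) * \<phi> (B ?t' \<omega>))"
  have eD: "?D = (\<lambda>\<omega>. exp (- ?t' / \<tau>) * (indicator (avoid S ?t) \<omega> * \<phi> (B ?t' \<omega>) - indicator (avoid S ?t') \<omega> * \<phi> (B ?t' \<omega>)))"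
    by (auto simp: algebra_simps)
  have iD: "integrable M ?D" unfolding eD using i3 i4 by (intro integrable_mult_right Bochner_Integration.integrable_diff)
  have ED: "expectation ?D = exp (- ?t' / \<tau>) * (expectation (\<lambda>\<omega>. indicator (avoid S ?t) \<omega> * \<phi> (B ?t' \<omega>))
      - expectation (\<lambda>\<omega>. indicator (avoid S ?t') \<omega> * \<phi> (B ?t' \<omega>)))"
    unfolding eD using i3 i4 by (simp add: Bochner_Integration.integral_diff)
  have iS: "integrable M (stopped_sum S (\<lambda>t x. exp (- t / \<tau>) * \<phi> x) h K)"
  proof -
    have "integrable M (\<lambda>\<omega>. (indicator (avoid S (real k * h)) \<omega> - indicator (avoid S (real (Suc k) * h)) \<omega>) *\<^sub>R
       (exp (- (real (Suc k) * h) / \<tau>) * \<phi> (B (real (Suc k) * h) \<omega>)))" for k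
    proof -
      have tk: "0 \<le> real k * h" "0 \<le> real (Suc k) * h" using h by auto
      note ttk = avoid_sets[OF S tk(1)] avoid_sets[OF S tk(2)] measurable[OF tk(2)]
      have "integrable M (\<lambda>\<omega>. exp (- (real (Suc k) * h) / \<tau>) * (indicator (avoid S (real k * h)) \<omega> * \<phi> (B (real (Suc k) * h) \<omega>)
         - indicator (avoid S (real (Suc k) * h)) \<omega> * \<phi> (B (real (Suc k) * h) \<omega>)))"
        by (intro integrable_mult_right Bochner_Integration.integrable_diff i[of _ _ _ C])
          (use \<phi> ttk in \<open>auto simp del: of_nat_Suc\<close>)
      then show ?thesis by (rule Bochner_Integration.integrable_cong[THEN iffD1, rotated 2]) (auto simp: algebra_simps)
    qed
    then show ?thesis unfolding stopped_sum_def[abs_def] by (intro Bochner_Integration.integrable_sum)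
  qed
  have "stopped_sum S (\<lambda>t x. exp (- t / \<tau>) * \<phi> x) h (Suc K) = (\<lambda>\<omega>. stopped_sum S (\<lambda>t x. exp (- t / \<tau>) * \<phi> x) h K \<omega> + ?D \<omega>)"
    by (rule ext) (simp add: stopped_sum_def)
  then have "expectation (stopped_sum S (\<lambda>t x. exp (- t / \<tau>) * \<phi> x) h (Suc K))
     = expectation (stopped_sum S (\<lambda>t x. exp (- t / \<tau>) * \<phi> x) h K) + expectation ?D"
    using iS iD by (simp add: Bochner_Integration.integral_add)
  moreover have "exp (- ?t' / \<tau>) = exp (- ?t / \<tau>) * exp (- h / \<tau>)"
    unfolding t' by (simp add: mult_exp_exp diff_divide_distrib)
  ultimately show ?case using Suc.IH EK ED by (simp only: sum.lessThan_Suc) (simp add: algebra_simps)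
qed

lemma stopped_sum_bounded:
  assumes S: "closed S" and zS: "z \<notin> S" and \<omega>: "\<omega> \<in> space M" and h: "h > 0" and \<tau>: "\<tau> > 0" and \<phi>: "\<And>x. \<bar>\<phi> x\<bar> \<le> C"
  shows "\<bar>stopped_sum S (\<lambda>t x. exp (- t / \<tau>) * \<phi> x) h K \<omega>\<bar> \<le> C"
proof -
  have C: "C \<ge> 0" using order_trans[OF abs_ge_zero \<phi>] .
  have b: "\<bar>exp (- t / \<tau>) * \<phi> x\<bar> \<le> C" if "t \<ge> 0" for t x
  proof -
    have "exp (- t / \<tau>) * \<bar>\<phi> x\<bar> \<le> 1 * C" using that \<tau> \<phi> by (intro mult_mono) auto
    then show ?thesis by (simp add: abs_mult)
  qed
  show ?thesis
  proof (cases "hits S \<omega>")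
    case True
    show ?thesis unfolding stopped_sum_eq(2)[OF S zS \<omega> h True] using b h C by auto
  next
    case False
    show ?thesis unfolding stopped_sum_eq(1)[OF S zS \<omega> h False] using C by simp
  qed
qed

lemma stopped_sum_expectation_tendsto:
  assumes S: "closed S" and zS: "z \<notin> S" and \<tau>: "\<tau> > 0"
    and \<phi>: "continuous_on UNIV \<phi>" "\<And>x. \<bar>\<phi> x\<bar> \<le> C"
  shows "(\<lambda>n. expectation (stopped_sum S (\<lambda>t x. exp (- t / \<tau>) * \<phi> x) (1 / real (Suc n)) (Suc n * Suc n)))
     \<longlonglongrightarrow> expectation (stopped S (\<lambda>t x. exp (- t / \<tau>) * \<phi> x))"
proof (rule integral_dominated_convergence[where w = "\<lambda>_. C"])
  let ?F = "\<lambda>t x. exp (- t / \<tau>) * \<phi> x"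
  have F: "continuous_on ({0..} \<times> UNIV) (\<lambda>(t, x). ?F t x)"
    unfolding case_prod_beta using \<tau>
    by (auto intro!: continuous_intros continuous_on_compose2[OF \<phi>(1)])
  have \<phi>m: "\<phi> \<in> borel_measurable borel" using \<phi>(1) by (rule borel_measurable_continuous_onI)
  show "stopped S ?F \<in> borel_measurable M" by (rule stopped_measurable[OF S zS F])
  show "stopped_sum S ?F (1 / real (Suc n)) (Suc n * Suc n) \<in> borel_measurable M" for n
    by (rule stopped_sum_measurable[OF S]) (use \<phi>m in auto)
  show "AE \<omega> in M. (\<lambda>n. stopped_sum S ?F (1 / real (Suc n)) (Suc n * Suc n) \<omega>) \<longlonglongrightarrow> stopped S ?F \<omega>"
    by (intro AE_I2 stopped_sum_tendsto[OF S zS _ F])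
  show "AE \<omega> in M. norm (stopped_sum S ?F (1 / real (Suc n)) (Suc n * Suc n) \<omega>) \<le> C" for n
    using stopped_sum_bounded[OF S zS _ _ \<tau> \<phi>(2), of _ "1 / real (Suc n)"] by (intro AE_I2) simp
qed simp

text \<open>For a nonnegative discounted supersolution both other terms of
  \<open>stopping_identity\<close> are nonnegative.\<close>

lemma stopped_upper:
  assumes S: "closed S" and zS: "z \<notin> S" and \<tau>: "\<tau> > 0"
    and \<phi>: "continuous_on UNIV \<phi>" "\<And>x. \<bar>\<phi> x\<bar> \<le> C" "\<And>x. \<phi> x \<ge> 0"
    and super: "\<And>h x. h > 0 \<Longrightarrow> exp (- h / \<tau>) * heat_op h \<phi> x \<le> \<phi> x"
  shows "expectation (stopped S (\<lambda>t x. exp (- t / \<tau>) * \<phi> x)) \<le> \<phi> z"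
proof (rule LIMSEQ_le_const2[OF stopped_sum_expectation_tendsto[OF S zS \<tau> \<phi>(1,2)]], intro exI allI impI)
  fix n
  let ?h = "1 / real (Suc n)" and ?K = "Suc n * Suc n"
  have h: "?h > 0" by simp
  have \<phi>m: "\<phi> \<in> borel_measurable borel" using \<phi>(1) by (rule borel_measurable_continuous_onI)
  have "0 \<le> (\<Sum>k<?K. exp (- (real k * ?h) / \<tau>) * expectation (\<lambda>\<omega>. indicator (avoid S (real k * ?h)) \<omega> *
       (\<phi> (B (real k * ?h) \<omega>) - exp (- ?h / \<tau>) * heat_op ?h \<phi> (B (real k * ?h) \<omega>))))"
    using super[OF h] by (intro sum_nonneg mult_nonneg_nonneg integral_nonneg_AE AE_I2) auto
  moreover have "0 \<le> exp (- (real ?K * ?h) / \<tau>) * expectation (\<lambda>\<omega>. indicator (avoid S (real ?K * ?h)) \<omega> * \<phi> (B (real ?K * ?h) \<omega>))"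
    using \<phi>(3) by (intro mult_nonneg_nonneg integral_nonneg_AE AE_I2) auto
  ultimately show "expectation (stopped_sum S (\<lambda>t x. exp (- t / \<tau>) * \<phi> x) ?h ?K) \<le> \<phi> z"
    using stopping_identity[OF S zS h \<tau> \<phi>m \<phi>(2), of ?K] by linarith
qed

lemma geometric_sum_bound:
  fixes q :: real assumes "0 \<le> q" "q < 1"
  shows "(\<Sum>k<K. q ^ k) \<le> 1 / (1 - q)"
proof -
  have "(\<Sum>k<K. q ^ k) = (1 - q ^ K) / (1 - q)" using assms by (intro sum_gp_strict[THEN trans]) auto
  also have "\<dots> \<le> 1 / (1 - q)" using assms by (intro divide_right_mono) auto
  finally show ?thesis .
qed

text \<open>A loss of \<open>c * h * (h + \<epsilon>)\<close> per step, summed with the discount,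
  amounts to at most \<open>c * (h + \<epsilon>) * (\<tau> + h)\<close>; as the mesh tends to 0 only
  \<open>c * \<tau> * \<epsilon>\<close> survives. The loss has to be controlled off
  \<open>S\<close> only, because the sum runs over times before the hit.\<close>

lemma stopped_lower:
  assumes S: "closed S" and zS: "z \<notin> S" and \<tau>: "\<tau> > 0" and c: "c \<ge> 0" "\<epsilon> \<ge> 0"
    and \<phi>: "continuous_on UNIV \<phi>" "\<And>x. \<bar>\<phi> x\<bar> \<le> C"
    and sub: "\<And>h x. h > 0 \<Longrightarrow> x \<notin> S \<Longrightarrow> \<phi> x - exp (- h / \<tau>) * heat_op h \<phi> x \<le> c * h * (h + \<epsilon>)"
  shows "\<phi> z \<le> expectation (stopped S (\<lambda>t x. exp (- t / \<tau>) * \<phi> x)) + c * \<tau> * \<epsilon>"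
proof -
  have \<phi>m[measurable]: "\<phi> \<in> borel_measurable borel" using \<phi>(1) by (rule borel_measurable_continuous_onI)
  let ?X = "\<lambda>n. expectation (stopped_sum S (\<lambda>t x. exp (- t / \<tau>) * \<phi> x) (1 / real (Suc n)) (Suc n * Suc n))"
  have C: "C \<ge> 0" using order_trans[OF abs_ge_zero \<phi>(2)] .
  have ind: "\<bar>expectation f\<bar> \<le> D" if "\<And>\<omega>. \<omega> \<in> space M \<Longrightarrow> \<bar>f \<omega>\<bar> \<le> D" "f \<in> borel_measurable M" for f and D :: real
  proof -
    have i: "integrable M f" by (rule integrable_const_bound[where B = D]) (use that in auto)
    have "\<bar>expectation f\<bar> \<le> expectation (\<lambda>\<omega>. \<bar>f \<omega>\<bar>)" by (rule integral_abs_bound)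
    also have "\<dots> \<le> expectation (\<lambda>_. D)" using i that by (intro integral_mono) auto
    finally show ?thesis by (simp add: prob_space)
  qed
  have main: "\<phi> z \<le> ?X n + c * (1 / real (Suc n) + \<epsilon>) * (\<tau> + 1 / real (Suc n)) + exp (- real (Suc n) / \<tau>) * C" for n
  proof -
    let ?h = "1 / real (Suc n)" and ?K = "Suc n * Suc n"
    define h where "h = ?h"
    have h: "h > 0" by (simp add: h_def)
    define E where "E k = expectation (\<lambda>\<omega>. indicator (avoid S (real k * h)) \<omega> *
       (\<phi> (B (real k * h) \<omega>) - exp (- h / \<tau>) * heat_op h \<phi> (B (real k * h) \<omega>)))" for k
    have t: "0 \<le> real k * h" for k using h by simp
    have Ek: "E k \<le> c * h * (h + \<epsilon>)" for k
    proof -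
      have [measurable]: "avoid S (real k * h) \<in> sets M" "B (real k * h) \<in> borel_measurable M"
        using avoid_sets[OF S t] measurable[OF t] by auto
      have p: "0 \<le> c * h * (h + \<epsilon>)" using c h by auto
      let ?f = "\<lambda>\<omega>. indicator (avoid S (real k * h)) \<omega> *
       (\<phi> (B (real k * h) \<omega>) - exp (- h / \<tau>) * heat_op h \<phi> (B (real k * h) \<omega>))"
      have bb: "\<bar>?f \<omega>\<bar> \<le> C + C" for \<omega>
      proof -
        have "\<bar>exp (- h / \<tau>) * heat_op h \<phi> (B (real k * h) \<omega>)\<bar> \<le> 1 * C"
          unfolding abs_mult using h \<tau> heat_op_bounded[OF h \<phi>m \<phi>(2)] by (intro mult_mono) auto
        then have "\<bar>\<phi> (B (real k * h) \<omega>) - exp (- h / \<tau>) * heat_op h \<phi> (B (real k * h) \<omega>)\<bar> \<le> C + C"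
          using \<phi>(2)[of "B (real k * h) \<omega>"] by linarith
        then show ?thesis using C by (simp add: indicator_def)
      qed
      have i: "integrable M ?f" by (rule integrable_const_bound[where B = "C + C"]) (use bb in auto)
      have "E k \<le> expectation (\<lambda>_. c * h * (h + \<epsilon>))" unfolding E_def
      proof (rule integral_mono[OF i])
        fix \<omega> assume \<omega>: "\<omega> \<in> space M"
        show "?f \<omega> \<le> c * h * (h + \<epsilon>)"
        proof (cases "\<omega> \<in> avoid S (real k * h)")
          case True
          then have "B (real k * h) \<omega> \<notin> S" using t[of k] by (auto simp: avoid_def)
          from sub[OF h this] show ?thesis using True by simp
        qed (use p in simp)
      qed simp
      then show ?thesis by (simp add: prob_space)
    qed
    define q where "q = exp (- h / \<tau>)"
    have q: "0 \<le> q" "q < 1" using h \<tau> by (auto simp: q_def)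
    have qk: "exp (- (real k * h) / \<tau>) = q ^ k" for k by (simp add: q_def exp_of_nat_mult[symmetric])
    \<comment> \<open>This bounds the geometric series: \<open>h / (1 - q)\<close> is at most
      \<open>\<tau> + h\<close>.\<close>
    have "h / \<tau> * q \<le> 1 - q"
    proof -
      have "1 + h / \<tau> \<le> exp (h / \<tau>)" by (rule exp_ge_add_one_self)
      then have "(1 + h / \<tau>) * q \<le> exp (h / \<tau>) * q" using q by (intro mult_right_mono) auto
      then show ?thesis by (simp add: q_def mult_exp_exp algebra_simps)
    qed
    then have "h \<le> (1 - q) * (\<tau> + h)" using \<tau> by (simp add: field_simps)
    then have hq: "h * (1 / (1 - q)) \<le> \<tau> + h" using q by (simp add: pos_divide_le_eq mult.commute)
    have p: "0 \<le> c * (h + \<epsilon>)" using c h by auto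
    have "(\<Sum>k<?K. exp (- (real k * h) / \<tau>) * E k) \<le> (\<Sum>k<?K. q ^ k * (c * h * (h + \<epsilon>)))"
      unfolding qk using q Ek by (intro sum_mono mult_left_mono) auto
    also have "\<dots> = (c * (h + \<epsilon>)) * (h * (\<Sum>k<?K. q ^ k))"
      unfolding sum_distrib_right[symmetric] by (simp only: mult_ac)
    also have "\<dots> \<le> (c * (h + \<epsilon>)) * (\<tau> + h)"
    proof (intro mult_left_mono p)
      have "h * (\<Sum>k<?K. q ^ k) \<le> h * (1 / (1 - q))" using h q by (intro mult_left_mono geometric_sum_bound) auto
      then show "h * (\<Sum>k<?K. q ^ k) \<le> \<tau> + h" using hq by linarith
    qed
    finally have 1: "(\<Sum>k<?K. exp (- (real k * h) / \<tau>) * E k) \<le> c * (h + \<epsilon>) * (\<tau> + h)" .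
    have [measurable]: "avoid S (real ?K * h) \<in> sets M" "B (real ?K * h) \<in> borel_measurable M"
      using avoid_sets[OF S t] measurable[OF t] by blast+
    have "\<bar>expectation (\<lambda>\<omega>. indicator (avoid S (real ?K * h)) \<omega> * \<phi> (B (real ?K * h) \<omega>))\<bar> \<le> C"
    proof (rule ind)
      show "(\<lambda>\<omega>. indicator (avoid S (real ?K * h)) \<omega> * \<phi> (B (real ?K * h) \<omega>)) \<in> borel_measurable M" by measurable
    qed (use \<phi>(2) C in \<open>auto simp: indicator_def\<close>)
    then have "exp (- (real ?K * h) / \<tau>) * expectation (\<lambda>\<omega>. indicator (avoid S (real ?K * h)) \<omega> * \<phi> (B (real ?K * h) \<omega>)) \<le> exp (- (real ?K * h) / \<tau>) * C"
      by (intro mult_left_mono) auto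
    moreover have "real ?K * h = real (Suc n)" unfolding h_def of_nat_mult by (simp del: of_nat_Suc)
    ultimately have 2: "exp (- (real ?K * h) / \<tau>) * expectation (\<lambda>\<omega>. indicator (avoid S (real ?K * h)) \<omega> * \<phi> (B (real ?K * h) \<omega>))
      \<le> exp (- real (Suc n) / \<tau>) * C" by simp
    show ?thesis
      using stopping_identity[OF S zS h \<tau> \<phi>m \<phi>(2), of ?K] 1 2 unfolding E_def h_def by linarith
  qed
  have hn: "(\<lambda>n. 1 / real (Suc n)) \<longlonglongrightarrow> 0" using LIMSEQ_inverse_real_of_nat by (simp add: inverse_eq_divide)
  have "(\<lambda>n. exp (- real (Suc n) / \<tau>)) \<longlonglongrightarrow> 0"
  proof -
    have "(\<lambda>n. exp (- 1 / \<tau>) ^ Suc n) \<longlonglongrightarrow> 0"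
      using \<tau> by (intro LIMSEQ_Suc LIMSEQ_power_zero) auto
    moreover have "exp (- 1 / \<tau>) ^ Suc n = exp (- real (Suc n) / \<tau>)" for n
      by (simp only: exp_of_nat_mult[symmetric]) (simp del: of_nat_Suc)
    ultimately show ?thesis by (simp only:)
  qed
  then have "(\<lambda>n. ?X n + c * (1 / real (Suc n) + \<epsilon>) * (\<tau> + 1 / real (Suc n)) + exp (- real (Suc n) / \<tau>) * C)
     \<longlonglongrightarrow> expectation (stopped S (\<lambda>t x. exp (- t / \<tau>) * \<phi> x)) + c * (0 + \<epsilon>) * (\<tau> + 0) + 0 * C"
    by (intro tendsto_intros hn stopped_sum_expectation_tendsto[OF S zS \<tau> \<phi>])
  then have "\<phi> z \<le> expectation (stopped S (\<lambda>t x. exp (- t / \<tau>) * \<phi> x)) + c * (0 + \<epsilon>) * (\<tau> + 0) + 0 * C"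
    by (rule LIMSEQ_le_const) (use main in blast)
  then show ?thesis by (simp add: mult_ac)
qed

end

section \<open>The stopped resolvent kernel\<close>

text \<open>Removing the small times makes the kernel bounded and continuous at its pole.\<close>

definition bk_tail :: "real \<Rightarrow> real \<Rightarrow> real" where
  "bk_tail e Y = (LINT s:{e<..}|lborel. exp (- s - Y / s) / s) / 2"

lemma bk_tail_0: "bk_tail 0 = bk"
  by (auto simp: bk_tail_def bk_def bessel_moment_def)

lemma bk_tail_measurable [measurable]: "bk_tail e \<in> borel_measurable borel"
  unfolding bk_tail_def[abs_def] set_lebesgue_integral_def by measurable

lemma bk_measurable [measurable]: "bk \<in> borel_measurable borel"
  using bk_tail_measurable[of 0] by (simp add: bk_tail_0)

lemma bk_tail_integrand_le:
  fixes s :: real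
  assumes "e > 0" "Y \<ge> 0" "s > e"
  shows "exp (- s - Y / s) / s \<le> exp (- s) / e"
  using assms by (intro frac_le) auto

lemma bk_tail_integrable:
  assumes "e > 0" "Y \<ge> 0"
  shows "set_integrable lborel {e<..} (\<lambda>s::real. exp (- s - Y / s) / s)"
proof (rule set_integrable_bound[of _ _ "\<lambda>s::real. 1 / e * exp (- s)"])
  show "set_integrable lborel {e<..} (\<lambda>s::real. 1 / e * exp (- s))"
    by (intro set_integrable_mult_right set_integrable_subset[OF set_integrable_exp_neg]) (use assms in auto)
  show "set_borel_measurable lborel {e<..} (\<lambda>s::real. exp (- s - Y / s) / s)"
    unfolding set_borel_measurable_def by measurable
  show "AE s::real in lborel. s \<in> {e<..} \<longrightarrow> norm (exp (- s - Y / s) / s) \<le> norm (1 / e * exp (- s))"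
    using bk_tail_integrand_le[OF assms] assms by (intro AE_I2) auto
qed

lemma bk_tail_nonneg: "e \<ge> 0 \<Longrightarrow> bk_tail e Y \<ge> 0"
  unfolding bk_tail_def set_lebesgue_integral_def
  by (intro divide_nonneg_pos integral_nonneg_AE AE_I2) (auto simp: indicator_def)

lemma bk_tail_le:
  assumes "e > 0" "Y \<ge> 0" shows "bk_tail e Y \<le> 1 / (2 * e)"
proof -
  have "(LINT s:{e<..}|lborel. exp (- s - Y / s) / s) \<le> (LINT s:{e<..}|lborel. 1 / e * exp (- s))"
  proof (rule set_integral_mono[OF bk_tail_integrable[OF assms]])
    show "set_integrable lborel {e<..} (\<lambda>s. 1 / e * exp (- s))"
      by (intro set_integrable_mult_right set_integrable_subset[OF set_integrable_exp_neg]) (use assms in auto)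
  qed (use bk_tail_integrand_le[OF assms] in auto)
  also have "\<dots> = exp (- e) / e" using assms by (simp add: LINT_exp_neg)
  also have "\<dots> \<le> 1 / e" using assms by (intro divide_right_mono) auto
  finally show ?thesis by (simp add: bk_tail_def)
qed

lemma bk_tail_continuous:
  assumes e: "e > 0" shows "continuous_on {0..} (bk_tail e)"
  unfolding continuous_on_sequentially
proof (intro ballI allI impI)
  fix Y and y :: "nat \<Rightarrow> real" assume Y: "Y \<in> {0..}" and y: "(\<forall>n. y n \<in> {0..}) \<and> y \<longlonglongrightarrow> Y"
  have "(\<lambda>n. LINT s|lborel. indicator {e<..} s *\<^sub>R (exp (- s - y n / s) / s)) \<longlonglongrightarrow>
     (LINT s|lborel. indicator {e<..} s *\<^sub>R (exp (- s - Y / s) / s))"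
  proof (rule integral_dominated_convergence[where w = "\<lambda>s. indicator {e<..} s *\<^sub>R (1 / e * exp (- s))"])
    have "set_integrable lborel {e<..} (\<lambda>s. 1 / e * exp (- s))"
      by (intro set_integrable_mult_right set_integrable_subset[OF set_integrable_exp_neg]) (use e in auto)
    then show "integrable lborel (\<lambda>s. indicator {e<..} s *\<^sub>R (1 / e * exp (- s)))" by (simp only: set_integrable_def)
    show "AE s in lborel. (\<lambda>n. indicat_real {e<..} s *\<^sub>R (exp (- s - y n / s) / s)) \<longlonglongrightarrow> indicat_real {e<..} s *\<^sub>R (exp (- s - Y / s) / s)"
    proof (rule AE_I2)
      fix s :: real
      show "(\<lambda>n. indicat_real {e<..} s *\<^sub>R (exp (- s - y n / s) / s)) \<longlonglongrightarrow> indicat_real {e<..} s *\<^sub>R (exp (- s - Y / s) / s)"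
      proof (cases "s > e")
        case True
        then have "s \<noteq> 0" using e by simp
        then show ?thesis using y by (intro tendsto_intros) auto
      qed simp
    qed
    show "AE s in lborel. norm (indicat_real {e<..} s *\<^sub>R (exp (- s - y n / s) / s)) \<le> indicat_real {e<..} s *\<^sub>R (1 / e * exp (- s))" for n
      using bk_tail_integrand_le[OF e, of "y n"] y e by (intro AE_I2) (auto simp: indicator_def)
  qed measurable
  then show "(bk_tail e \<circ> y) \<longlonglongrightarrow> bk_tail e Y"
    unfolding bk_tail_def set_lebesgue_integral_def o_def by (intro tendsto_intros) auto
qed

text \<open>On the removed interval \<open>exp (- v) * v^2 \<le> 2\<close> with
  \<open>v = Y / s\<close> bounds the integrand by \<open>2 * (e + h) / Y^2\<close>. Away from the
  pole the loss is thus of the order \<open>h * (e + h)\<close> that \<open>stopped_lower\<close>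
  can absorb.\<close>

lemma bk_tail_diff:
  assumes e: "0 \<le> e" and h: "h \<ge> 0" and Y: "Y > 0"
  shows "bk_tail (e + h) Y \<le> bk_tail e Y" "bk_tail e Y \<le> bk_tail (e + h) Y + h * (e + h) / Y\<^sup>2"
proof -
  let ?f = "\<lambda>s. exp (- s - Y / s) / s"
  have i: "set_integrable lborel {0<..} ?f" using bessel_integrable[OF Y, of 1] by simp
  have i1: "set_integrable lborel {e<..e+h} ?f" and i2: "set_integrable lborel {e+h<..} ?f"
    using e h by (auto intro!: set_integrable_subset[OF i])
  have "{e<..} = {e<..e+h} \<union> {e+h<..}" using h by auto
  then have "(LINT s:{e<..}|lborel. ?f s) = (LINT s:{e<..e+h} \<union> {e+h<..}|lborel. ?f s)" by simp
  also have "\<dots> = (LINT s:{e<..e+h}|lborel. ?f s) + (LINT s:{e+h<..}|lborel. ?f s)"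
    by (rule set_integral_Un[OF _ i1 i2]) auto
  finally have eq: "bk_tail e Y = bk_tail (e + h) Y + (LINT s:{e<..e+h}|lborel. ?f s) / 2"
    by (simp add: bk_tail_def)
  have "0 \<le> (LINT s:{e<..e+h}|lborel. ?f s)"
    unfolding set_lebesgue_integral_def using e
    by (intro integral_nonneg_AE AE_I2) (auto simp: indicator_def)
  then show "bk_tail (e + h) Y \<le> bk_tail e Y" using eq by simp
  have "(LINT s:{e<..e+h}|lborel. ?f s) \<le> (LINT s:{e<..e+h}|lborel. 2 * (e + h) / Y\<^sup>2)"
  proof (rule set_integral_mono[OF i1])
    show "set_integrable lborel {e<..e+h} (\<lambda>s. 2 * (e + h) / Y\<^sup>2)"
      unfolding set_integrable_def using h by (intro integrable_scaleR_left integrable_real_indicator) auto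
    fix s assume "s \<in> {e<..e+h}"
    then have s: "0 < s" "s \<le> e + h" using e by auto
    have "exp (- (Y / s)) * (Y / s) ^ 2 \<le> fact 2" using s Y by (intro exp_neg_div_le) auto
    then have "exp (- (Y / s)) / s \<le> 2 * s / Y\<^sup>2"
      using s Y by (simp add: power_divide pos_divide_le_eq pos_le_divide_eq power2_eq_square fact_2 mult_ac)
    also have "\<dots> \<le> 2 * (e + h) / Y\<^sup>2" using s by (intro divide_right_mono) auto
    finally have "exp (- (Y / s)) / s \<le> 2 * (e + h) / Y\<^sup>2" .
    moreover have "?f s \<le> exp (- (Y / s)) / s" using s by (intro divide_right_mono) auto
    ultimately show "?f s \<le> 2 * (e + h) / Y\<^sup>2" by linarith
  qed
  also have "\<dots> = 2 * (h * (e + h) / Y\<^sup>2)" using h by (simp add: set_lebesgue_integral_def)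
  finally have "(LINT s:{e<..e+h}|lborel. ?f s) / 2 \<le> h * (e + h) / Y\<^sup>2" by linarith
  then show "bk_tail e Y \<le> bk_tail (e + h) Y + h * (e + h) / Y\<^sup>2" using eq by simp
qed

lemma bk_antimono: "0 < Y1 \<Longrightarrow> Y1 \<le> Y2 \<Longrightarrow> bk Y2 \<le> bk Y1"
  unfolding bk_def using bessel_moment_antimono[of Y1 Y2 1] by simp

lemma nn_integral_translate:
  fixes f :: "complex \<Rightarrow> ennreal"
  assumes [measurable]: "f \<in> borel_measurable borel"
  shows "(\<integral>\<^sup>+ v. f (c + v) \<partial>lborel) = (\<integral>\<^sup>+ v. f v \<partial>lborel)"
proof -
  have "(\<integral>\<^sup>+ v. f v \<partial>lborel) = (\<integral>\<^sup>+ v. f v \<partial>distr lborel borel ((+) c))"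
    by (simp add: lborel_distr_plus)
  also have "\<dots> = (\<integral>\<^sup>+ v. f (c + v) \<partial>lborel)" by (rule nn_integral_distr) measurable
  finally show ?thesis by simp
qed

lemma heat_kernel_0: "heat_kernel t 0 v = 1 / (2 * pi * t) * exp (- (cmod v)\<^sup>2 / (2 * t))"
  by (simp add: heat_kernel_def)

context planar_brownian_motion begin

text \<open>Completing the square makes the product in \<open>v\<close> a constant times a heat
  kernel at time \<open>h * c / (c + h)\<close>, centred at \<open>- \<mu>\<close>, whose total mass
  is known.\<close>

lemma gaussian_convolution:
  assumes c: "c > 0" and h: "h > 0"
  shows "(\<integral>\<^sup>+ v. ennreal (heat_kernel h 0 v * exp (- (cmod (y + v))\<^sup>2 / (2 * c))) \<partial>lborel)
     = ennreal (c / (c + h) * exp (- (cmod y)\<^sup>2 / (2 * (c + h))))"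
proof -
  define k where "k = h * c / (c + h)"
  have k: "k > 0" using c h by (simp add: k_def)
  define \<mu> where "\<mu> = complex_of_real (h / (c + h)) * y"
  define E where "E = c / (c + h) * exp (- (cmod y)\<^sup>2 / (2 * (c + h)))"
  have pt: "heat_kernel h 0 v * exp (- (cmod (y + v))\<^sup>2 / (2 * c)) = E * heat_kernel k 0 (\<mu> + v)" for v
  proof -
    have "(cmod v)\<^sup>2 / (2 * h) + (cmod (y + v))\<^sup>2 / (2 * c) = (cmod y)\<^sup>2 / (2 * (c + h)) + (cmod (\<mu> + v))\<^sup>2 / (2 * k)"
    proof -
      have ch: "c + h \<noteq> 0" "c \<noteq> 0" "h \<noteq> 0" using c h by auto
      have re: "a\<^sup>2 / (2 * h) + (b + a)\<^sup>2 / (2 * c) = b\<^sup>2 / (2 * (c + h)) + (h / (c + h) * b + a)\<^sup>2 / (2 * k)" for a b :: real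
        unfolding k_def using ch by (simp add: divide_simps) algebra
      show ?thesis
        using re[of "Re v" "Re y"] re[of "Im v" "Im y"]
        by (simp add: cmod_power2 \<mu>_def add_divide_distrib)
    qed
    then have "exp (- (cmod v)\<^sup>2 / (2 * h)) * exp (- (cmod (y + v))\<^sup>2 / (2 * c)) =
        exp (- (cmod y)\<^sup>2 / (2 * (c + h))) * exp (- (cmod (\<mu> + v))\<^sup>2 / (2 * k))"
      by (simp add: mult_exp_exp)
    moreover have "1 / (2 * pi * h) = c / (c + h) * (1 / (2 * pi * k))"
      using c h by (simp add: k_def add_pos_pos[THEN less_imp_neq, THEN not_sym])
    ultimately show ?thesis
      unfolding heat_kernel_0 E_def by (simp only: mult_ac)
  qed
  have E: "E \<ge> 0" using c h by (simp add: E_def)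
  have "(\<integral>\<^sup>+ v. ennreal (heat_kernel h 0 v * exp (- (cmod (y + v))\<^sup>2 / (2 * c))) \<partial>lborel)
    = (\<integral>\<^sup>+ v. ennreal E * ennreal (heat_kernel k 0 (\<mu> + v)) \<partial>lborel)"
    unfolding pt using E by (simp add: ennreal_mult' heat_kernel_nonneg k less_imp_le)
  also have "\<dots> = ennreal E * (\<integral>\<^sup>+ v. ennreal (heat_kernel k 0 (\<mu> + v)) \<partial>lborel)"
    by (rule nn_integral_cmult) measurable
  also have "(\<integral>\<^sup>+ v. ennreal (heat_kernel k 0 (\<mu> + v)) \<partial>lborel) = 1"
    using nn_integral_translate[of "\<lambda>v. ennreal (heat_kernel k 0 v)" \<mu>] heat_kernel_integral[OF k] by simp
  finally show ?thesis by (simp add: E_def)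
qed

definition pot :: "real \<Rightarrow> real \<Rightarrow> complex \<Rightarrow> complex \<Rightarrow> real" where
  "pot \<tau> e w x = bk_tail e ((cmod (x - w))\<^sup>2 / (2 * \<tau>))"

lemma bk_tail_nn:
  assumes "e > 0" "Y \<ge> 0"
  shows "ennreal (bk_tail e Y) = (\<integral>\<^sup>+ s. ennreal (indicator {e<..} s * (exp (- s) / (2 * s)) * exp (- Y / s)) \<partial>lborel)"
proof -
  have i: "integrable lborel (\<lambda>s. indicator {e<..} s *\<^sub>R (exp (- s - Y / s) / s))"
    using bk_tail_integrable[OF assms] by (simp only: set_integrable_def)
  have eq: "indicator {e<..} s * (exp (- s) / (2 * s)) * exp (- Y / s) = indicator {e<..} s *\<^sub>R (exp (- s - Y / s) / s) / 2" for s :: real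
  proof -
    have "exp (- s - Y / s) = exp (- s) * exp (- Y / s)" by (simp add: mult_exp_exp)
    then show ?thesis by simp
  qed
  have "(\<integral>\<^sup>+ s. ennreal (indicator {e<..} s *\<^sub>R (exp (- s - Y / s) / s) / 2) \<partial>lborel)
      = ennreal (LINT s|lborel. indicator {e<..} s *\<^sub>R (exp (- s - Y / s) / s) / 2)"
    using i assms by (intro nn_integral_eq_integral integrable_divide AE_I2) (auto simp: indicator_def)
  then show ?thesis by (simp only: eq bk_tail_def set_lebesgue_integral_def integral_divide_zero)
qed

lemma pot_bounded: "e > 0 \<Longrightarrow> \<tau> > 0 \<Longrightarrow> \<bar>pot \<tau> e w x\<bar> \<le> 1 / (2 * e)"
  using bk_tail_le[of e "(cmod (x - w))\<^sup>2 / (2 * \<tau>)"] bk_tail_nonneg[of e] by (simp add: pot_def)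

lemma pot_nonneg: "e \<ge> 0 \<Longrightarrow> 0 \<le> pot \<tau> e w x"
  by (simp add: pot_def bk_tail_nonneg)

lemma pot_continuous: "e > 0 \<Longrightarrow> \<tau> > 0 \<Longrightarrow> continuous_on UNIV (pot \<tau> e w)"
  unfolding pot_def[abs_def]
  by (rule continuous_on_compose2[OF bk_tail_continuous]) (auto intro!: continuous_intros)

text \<open>The kernel is a discounted integral of Gaussians of variance \<open>\<tau> * s\<close>
  over \<open>s > e\<close>. Running the heat flow for time \<open>h\<close> adds \<open>h\<close>
  to each variance, so flow and discount together only move the cut from \<open>e\<close> to
  \<open>e + h / \<tau>\<close>; Tonelli's theorem justifies the exchange.\<close>

lemma heat_op_pot:
  assumes e: "e > 0" and \<tau>: "\<tau> > 0" and h: "h > 0"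
  shows "exp (- h / \<tau>) * heat_op h (pot \<tau> e w) x = pot \<tau> (e + h / \<tau>) w x"
proof -
  define y where "y = x - w"
  have [measurable]: "pot \<tau> e w \<in> borel_measurable borel"
    using pot_continuous[OF e \<tau>] by (rule borel_measurable_continuous_onI)
  let ?g = "\<lambda>v s. heat_kernel h 0 v * (indicator {e<..} s * (exp (- s) / (2 * s)) * exp (- ((cmod (y + v))\<^sup>2 / (2 * \<tau>)) / s))"
  have g0: "?g v s \<ge> 0" for v s using h e heat_kernel_nonneg[of h 0 v] by (auto simp: indicator_def)
  have "ennreal (heat_op h (pot \<tau> e w) x) = (\<integral>\<^sup>+ v. ennreal (heat_kernel h 0 v * pot \<tau> e w (x + v)) \<partial>lborel)"
    unfolding heat_op_def
  proof (rule nn_integral_eq_integral[symmetric])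
    have p: "integrable lborel (heat_kernel h 0)"
      using heat_kernel_integral[OF h] heat_kernel_nonneg[of h] h by (auto intro!: integrableI_nonneg)
    have bd: "\<bar>heat_kernel h 0 v * pot \<tau> e w (x + v)\<bar> \<le> 1 / (2 * e) * heat_kernel h 0 v" for v
      using mult_right_mono[OF pot_bounded[OF e \<tau>, of w "x + v"], of "heat_kernel h 0 v"] h heat_kernel_nonneg[of h 0 v]
      by (simp add: abs_mult mult.commute)
    show "integrable lborel (\<lambda>v. heat_kernel h 0 v * pot \<tau> e w (x + v))"
    proof (rule Bochner_Integration.integrable_bound[of _ "\<lambda>v. 1 / (2 * e) * heat_kernel h 0 v"])
      show "integrable lborel (\<lambda>v. 1 / (2 * e) * heat_kernel h 0 v)" using p by simp
      show "(\<lambda>v. heat_kernel h 0 v * pot \<tau> e w (x + v)) \<in> borel_measurable lborel" by measurable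
      show "AE v in lborel. norm (heat_kernel h 0 v * pot \<tau> e w (x + v)) \<le> norm (1 / (2 * e) * heat_kernel h 0 v)"
        using order_trans[OF bd abs_ge_self] by (intro AE_I2) (simp only: real_norm_def)
    qed
    show "AE v in lborel. 0 \<le> heat_kernel h 0 v * pot \<tau> e w (x + v)"
      using heat_kernel_nonneg[of h] pot_nonneg[of e] h e by (intro AE_I2 mult_nonneg_nonneg) auto
  qed
  also have "\<dots> = (\<integral>\<^sup>+ v. \<integral>\<^sup>+ s. ennreal (?g v s) \<partial>lborel \<partial>lborel)"
  proof (rule nn_integral_cong)
    fix v :: complex
    have xv: "x + v - w = y + v" by (simp add: y_def)
    have "ennreal (heat_kernel h 0 v * pot \<tau> e w (x + v)) = ennreal (heat_kernel h 0 v) * ennreal (pot \<tau> e w (x + v))"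
      using heat_kernel_nonneg[of h 0 v] h by (simp add: ennreal_mult')
    also have "\<dots> = ennreal (heat_kernel h 0 v) * (\<integral>\<^sup>+ s. ennreal (indicator {e<..} s * (exp (- s) / (2 * s)) * exp (- ((cmod (y + v))\<^sup>2 / (2 * \<tau>)) / s)) \<partial>lborel)"
      unfolding pot_def xv using e \<tau> by (subst bk_tail_nn) auto
    also have "\<dots> = (\<integral>\<^sup>+ s. ennreal (heat_kernel h 0 v) * ennreal (indicator {e<..} s * (exp (- s) / (2 * s)) * exp (- ((cmod (y + v))\<^sup>2 / (2 * \<tau>)) / s)) \<partial>lborel)"
      by (rule nn_integral_cmult[symmetric]) measurable
    also have "\<dots> = (\<integral>\<^sup>+ s. ennreal (?g v s) \<partial>lborel)"
      using heat_kernel_nonneg[of h 0 v] h by (intro nn_integral_cong ennreal_mult'[symmetric]) auto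
    finally show "ennreal (heat_kernel h 0 v * pot \<tau> e w (x + v)) = (\<integral>\<^sup>+ s. ennreal (?g v s) \<partial>lborel)" .
  qed
  also have "\<dots> = (\<integral>\<^sup>+ s. \<integral>\<^sup>+ v. ennreal (?g v s) \<partial>lborel \<partial>lborel)"
    by (rule lborel_pair.Fubini'[symmetric]) measurable
  also have "\<dots> = (\<integral>\<^sup>+ s. ennreal (indicator {e<..} s * (exp (- s) / 2 * (\<tau> / (\<tau> * s + h)) * exp (- (cmod y)\<^sup>2 / (2 * (\<tau> * s + h))))) \<partial>lborel)"
  proof (rule nn_integral_cong)
    fix s :: real
    show "(\<integral>\<^sup>+ v. ennreal (?g v s) \<partial>lborel) = ennreal (indicator {e<..} s * (exp (- s) / 2 * (\<tau> / (\<tau> * s + h)) * exp (- (cmod y)\<^sup>2 / (2 * (\<tau> * s + h)))))"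
    proof (cases "s > e")
      case True
      then have s: "s > 0" using e by simp
      then have c: "\<tau> * s > 0" using \<tau> by simp
      have "(\<integral>\<^sup>+ v. ennreal (?g v s) \<partial>lborel) = (\<integral>\<^sup>+ v. ennreal (exp (- s) / (2 * s)) * ennreal (heat_kernel h 0 v * exp (- (cmod (y + v))\<^sup>2 / (2 * (\<tau> * s)))) \<partial>lborel)"
        using True s h heat_kernel_nonneg[of h 0]
        by (intro nn_integral_cong) (simp add: ennreal_mult'[symmetric] mult_ac)
      also have "\<dots> = ennreal (exp (- s) / (2 * s)) * (\<integral>\<^sup>+ v. ennreal (heat_kernel h 0 v * exp (- (cmod (y + v))\<^sup>2 / (2 * (\<tau> * s)))) \<partial>lborel)"
        by (rule nn_integral_cmult) measurable
      also have "\<dots> = ennreal (exp (- s) / (2 * s) * (\<tau> * s / (\<tau> * s + h) * exp (- (cmod y)\<^sup>2 / (2 * (\<tau> * s + h)))))"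
        unfolding gaussian_convolution[OF c h] by (rule ennreal_mult'[symmetric]) (use s in simp)
      also have "exp (- s) / (2 * s) * (\<tau> * s / (\<tau> * s + h) * exp (- (cmod y)\<^sup>2 / (2 * (\<tau> * s + h))))
          = exp (- s) / 2 * (\<tau> / (\<tau> * s + h)) * exp (- (cmod y)\<^sup>2 / (2 * (\<tau> * s + h)))"
        using s by simp
      finally show ?thesis using True by simp
    qed simp
  qed
  finally have 1: "ennreal (heat_op h (pot \<tau> e w) x) = \<dots>" .
  define q where "q = h / \<tau>"
  have q: "q > 0" using h \<tau> by (simp add: q_def)
  define Y where "Y = (cmod y)\<^sup>2 / (2 * \<tau>)"
  have Y: "Y \<ge> 0" using \<tau> by (simp add: Y_def)
  have "ennreal (exp (- q)) * ennreal (heat_op h (pot \<tau> e w) x)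
     = (\<integral>\<^sup>+ s. ennreal (exp (- q)) * ennreal (indicator {e<..} s * (exp (- s) / 2 * (\<tau> / (\<tau> * s + h)) * exp (- (cmod y)\<^sup>2 / (2 * (\<tau> * s + h))))) \<partial>lborel)"
    unfolding 1 by (rule nn_integral_cmult[symmetric]) measurable
  also have "\<dots> = (\<integral>\<^sup>+ s. ennreal (indicator {e + q<..} (q + 1 * s) * (exp (- (q + 1 * s)) / (2 * (q + 1 * s))) * exp (- Y / (q + 1 * s))) \<partial>lborel)"
  proof (rule nn_integral_cong)
    fix s :: real
    show "ennreal (exp (- q)) * ennreal (indicator {e<..} s * (exp (- s) / 2 * (\<tau> / (\<tau> * s + h)) * exp (- (cmod y)\<^sup>2 / (2 * (\<tau> * s + h)))))
      = ennreal (indicator {e + q<..} (q + 1 * s) * (exp (- (q + 1 * s)) / (2 * (q + 1 * s))) * exp (- Y / (q + 1 * s)))"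
    proof (cases "s > e")
      case True
      then have s: "s > 0" using e by simp
      have ts: "\<tau> * s + h = \<tau> * (q + s)" using \<tau> by (simp add: q_def distrib_left)
      have qs: "q + s > 0" using q s by simp
      have "exp (- q) * (exp (- s) / 2 * (\<tau> / (\<tau> * s + h)) * exp (- (cmod y)\<^sup>2 / (2 * (\<tau> * s + h))))
         = exp (- (q + s)) / (2 * (q + s)) * exp (- Y / (q + s))"
        unfolding ts Y_def using \<tau> by (simp add: mult_exp_exp[symmetric] exp_add[symmetric] mult_ac)
      then show ?thesis using True by (simp add: ennreal_mult'[symmetric])
    qed simp
  qed
  also have "\<dots> = (\<integral>\<^sup>+ s. ennreal (indicator {e + q<..} s * (exp (- s) / (2 * s)) * exp (- Y / s)) \<partial>lborel)"
    using nn_integral_real_affine[of "\<lambda>s. ennreal (indicator {e + q<..} s * (exp (- s) / (2 * s)) * exp (- Y / s))" 1 q] by simp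
  also have "\<dots> = ennreal (bk_tail (e + q) Y)" using e q Y by (subst bk_tail_nn) auto
  finally have "ennreal (exp (- q) * heat_op h (pot \<tau> e w) x) = ennreal (pot \<tau> (e + q) w x)"
    by (simp add: ennreal_mult' pot_def Y_def y_def)
  moreover have "0 \<le> heat_op h (pot \<tau> e w) x"
    unfolding heat_op_def using heat_kernel_nonneg[of h] pot_nonneg[of e] h e by (intro integral_nonneg_AE AE_I2 mult_nonneg_nonneg) auto
  ultimately show ?thesis
    using pot_nonneg[of "e + q"] e q by (simp add: q_def)
qed

definition discount :: "complex set \<Rightarrow> real \<Rightarrow> 'w \<Rightarrow> real" where
  "discount S \<tau> = stopped S (\<lambda>t x. exp (- t / \<tau>))"

definition place :: "complex set \<Rightarrow> 'w \<Rightarrow> complex" where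
  "place S = stopped S (\<lambda>t x. x)"

lemma stopped_discount: "stopped S (\<lambda>t x. exp (- t / \<tau>) * \<phi> x) \<omega> = discount S \<tau> \<omega> * \<phi> (place S \<omega>)"
  by (simp add: stopped_def discount_def place_def)

lemma discount_measurable: "closed S \<Longrightarrow> z \<notin> S \<Longrightarrow> \<tau> > 0 \<Longrightarrow> discount S \<tau> \<in> borel_measurable M"
  unfolding discount_def by (intro stopped_measurable) (auto simp: case_prod_beta intro!: continuous_intros)

lemma place_measurable: "closed S \<Longrightarrow> z \<notin> S \<Longrightarrow> place S \<in> borel_measurable M"
  unfolding place_def by (intro stopped_measurable) (auto simp: case_prod_beta intro!: continuous_intros)

lemma discount_bounds:
  assumes "closed S" "\<omega> \<in> space M" "\<tau> > 0" shows "0 \<le> discount S \<tau> \<omega>" "discount S \<tau> \<omega> \<le> 1"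
  using hit_time_props(1)[OF assms(1,2)] assms(3) by (auto simp: discount_def stopped_def)

text \<open>The weight \<open>exp (- t / \<tau>) / \<tau>\<close> integrated from the hitting time
  onwards equals the discount at that time. The event of a hit by time \<open>t\<close> is
  \<open>exp (- t / \<tau>) \<le> discount\<close>, also for paths that never hit, whose discount is
  0.\<close>

lemma hit_laplace_eq:
  assumes S: "closed S" and zS: "z \<notin> S" and \<tau>: "\<tau> > 0"
  shows "hit_laplace M B S \<tau> = expectation (discount S \<tau>)"
proof -
  note [measurable] = discount_measurable[OF assms]
  let ?D = "discount S \<tau>"
  have hp: "hit_prob M B S t = expectation (\<lambda>\<omega>. indicator {x. exp (- t / \<tau>) \<le> x} (?D \<omega>))" if t: "t \<ge> 0" for t
  proof -
    have "{\<omega> \<in> space M. \<exists>s\<in>{0..t}. B s \<omega> \<in> S} = {\<omega> \<in> space M. exp (- t / \<tau>) \<le> ?D \<omega>}"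
    proof (intro Collect_cong conj_cong refl)
      fix \<omega> assume \<omega>: "\<omega> \<in> space M"
      have "(\<exists>s\<in>{0..t}. B s \<omega> \<in> S) \<longleftrightarrow> \<omega> \<notin> avoid S t" using \<omega> by (auto simp: avoid_def)
      also have "\<dots> \<longleftrightarrow> hits S \<omega> \<and> hit_time S \<omega> \<le> t" using avoid_iff[OF S \<omega> t] by blast
      also have "\<dots> \<longleftrightarrow> exp (- t / \<tau>) \<le> ?D \<omega>"
        using \<tau> by (simp add: discount_def stopped_def not_le divide_le_cancel)
      finally show "(\<exists>s\<in>{0..t}. B s \<omega> \<in> S) \<longleftrightarrow> exp (- t / \<tau>) \<le> ?D \<omega>" .
    qed
    then have "hit_prob M B S t = expectation (indicator {\<omega> \<in> space M. exp (- t / \<tau>) \<le> ?D \<omega>})"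
      unfolding hit_prob_def by simp
    also have "\<dots> = expectation (\<lambda>\<omega>. indicator {x. exp (- t / \<tau>) \<le> x} (?D \<omega>))"
      by (intro Bochner_Integration.integral_cong refl) (simp add: indicator_def)
    finally show ?thesis .
  qed
  interpret P: pair_sigma_finite "lborel :: real measure" M
    by (intro pair_sigma_finite.intro lborel.sigma_finite_measure_axioms sigma_finite_measure_axioms)
  let ?f = "\<lambda>t \<omega>. indicator {0..} t * (exp (- t / \<tau>) / \<tau>) * indicator {x. exp (- t / \<tau>) \<le> x} (?D \<omega>) :: real"
  have fm: "case_prod ?f \<in> borel_measurable (lborel \<Otimes>\<^sub>M M)"
    unfolding indicator_def by measurable
  have f0: "?f t \<omega> \<ge> 0" for t \<omega> using \<tau> by simp
  have inner: "(LINT \<omega>|M. ?f t \<omega>) = indicator {0..} t * (exp (- t / \<tau>) * hit_prob M B S t) / \<tau>" for t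
    by (cases "t \<ge> 0") (simp_all add: hp)
  have inner2: "((\<lambda>t. ?f t \<omega>) has_integral ?D \<omega>) UNIV" if \<omega>: "\<omega> \<in> space M" for \<omega>
  proof (cases "hits S \<omega>")
    case False
    then show ?thesis by (simp add: discount_def stopped_def not_le)
  next
    case True
    let ?s = "hit_time S \<omega>"
    have s0: "?s \<ge> 0" using hit_time_props(1)[OF S \<omega> True] .
    have "((\<lambda>t. exp (- (1 / \<tau>) * t)) has_integral exp (- (1 / \<tau>) * ?s) / (1 / \<tau>)) {?s..}"
      by (rule has_integral_exp_minus_to_infinity) (use \<tau> in simp)
    from has_integral_mult_right[OF this, of "1 / \<tau>"]
    have "((\<lambda>t. exp (- t / \<tau>) / \<tau>) has_integral exp (- ?s / \<tau>)) {?s..}"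
      using \<tau> by (simp add: field_simps)
    then have "((\<lambda>t. if t \<in> {?s..} then exp (- t / \<tau>) / \<tau> else 0) has_integral exp (- ?s / \<tau>)) UNIV"
      by (simp only: has_integral_restrict_UNIV)
    moreover have "(if t \<in> {?s..} then exp (- t / \<tau>) / \<tau> else 0) = ?f t \<omega>" for t
      using True s0 \<tau> by (auto simp: discount_def stopped_def divide_le_cancel indicator_def)
    ultimately show ?thesis using True by (simp add: discount_def stopped_def)
  qed
  have nn: "(\<integral>\<^sup>+ t. ennreal (?f t \<omega>) \<partial>lborel) = ennreal (?D \<omega>)" if \<omega>: "\<omega> \<in> space M" for \<omega>
    by (rule nn_integral_has_integral_lborel[OF _ f0 inner2[OF \<omega>]]) measurable
  have "(\<integral>\<^sup>+ t. ennreal (indicator {0..} t * (exp (- t / \<tau>) * hit_prob M B S t) / \<tau>) \<partial>lborel) = (\<integral>\<^sup>+ t. \<integral>\<^sup>+ \<omega>. ennreal (?f t \<omega>) \<partial>M \<partial>lborel)"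
  proof (rule nn_integral_cong)
    fix t :: real
    have "integrable M (?f t)"
      by (rule integrable_const_bound[where B = "\<bar>exp (- t / \<tau>) / \<tau>\<bar>"]) (auto simp: indicator_def)
    then show "ennreal (indicator {0..} t * (exp (- t / \<tau>) * hit_prob M B S t) / \<tau>) = (\<integral>\<^sup>+ \<omega>. ennreal (?f t \<omega>) \<partial>M)"
      unfolding inner[symmetric] using f0 by (intro nn_integral_eq_integral[symmetric]) auto
  qed
  also have "\<dots> = (\<integral>\<^sup>+ \<omega>. \<integral>\<^sup>+ t. ennreal (?f t \<omega>) \<partial>lborel \<partial>M)"
    using fm by (intro P.Fubini'[symmetric]) (simp add: case_prod_beta')
  also have "\<dots> = (\<integral>\<^sup>+ \<omega>. ennreal (?D \<omega>) \<partial>M)" using nn by (intro nn_integral_cong) simp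
  finally have eq: "(\<integral>\<^sup>+ t. ennreal (indicator {0..} t * (exp (- t / \<tau>) * hit_prob M B S t) / \<tau>) \<partial>lborel) = (\<integral>\<^sup>+ \<omega>. ennreal (?D \<omega>) \<partial>M)" .
  have hm: "(\<lambda>t. indicator {0..} t * (exp (- t / \<tau>) * hit_prob M B S t) / \<tau>) \<in> borel_measurable lborel"
    unfolding inner[symmetric] using fm by (intro borel_measurable_lebesgue_integral)
  have "hit_laplace M B S \<tau> = (LINT t|lborel. indicator {0..} t * (exp (- t / \<tau>) * hit_prob M B S t) / \<tau>)"
    unfolding hit_laplace_def set_lebesgue_integral_def by simp
  also have "\<dots> = enn2real (\<integral>\<^sup>+ t. ennreal (indicator {0..} t * (exp (- t / \<tau>) * hit_prob M B S t) / \<tau>) \<partial>lborel)"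
    using \<tau> hm by (intro integral_eq_nn_integral AE_I2) (auto simp: hit_prob_def indicator_def)
  also have "\<dots> = enn2real (\<integral>\<^sup>+ \<omega>. ennreal (?D \<omega>) \<partial>M)" unfolding eq ..
  also have "\<dots> = expectation ?D"
    using discount_bounds(1)[OF S _ \<tau>] by (intro integral_eq_nn_integral[symmetric] AE_I2) auto
  finally show ?thesis .
qed

end

lemma bk_continuous_on: "continuous_on {0<..} bk"
  by (intro continuous_at_imp_continuous_on ballI DERIV_isCont[OF bk_deriv]) auto

lemma nn_integral_unit_interval:
  fixes g :: "real \<Rightarrow> real"
  assumes g: "continuous_on {0..1} g" "\<And>\<theta>. \<theta> \<in> {0..1} \<Longrightarrow> g \<theta> \<ge> 0"
  shows "(\<integral>\<^sup>+ \<theta>. ennreal (indicator {0..1} \<theta> * g \<theta>) \<partial>lborel) = ennreal (integral {0..1} g)"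
proof (rule nn_integral_has_integral_lborel)
  have "(\<lambda>\<theta>. indicator {0..1} \<theta> *\<^sub>R g \<theta>) \<in> borel_measurable borel"
    by (rule borel_measurable_continuous_on_indicator[OF _ g(1)]) simp
  then show "(\<lambda>\<theta>. indicator {0..1} \<theta> * g \<theta>) \<in> borel_measurable borel" by simp
  show "0 \<le> indicator {0..1} \<theta> * g \<theta>" for \<theta> using g(2) by (simp add: indicator_def)
  have "(g has_integral integral {0..1} g) {0..1}"
    by (intro integrable_integral integrable_continuous_interval g)
  then have "((\<lambda>\<theta>. if \<theta> \<in> {0..1} then g \<theta> else 0) has_integral integral {0..1} g) UNIV"
    by (simp only: has_integral_restrict_UNIV)
  then show "((\<lambda>\<theta>. indicator {0..1} \<theta> * g \<theta>) has_integral integral {0..1} g) UNIV"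
    by (rule has_integral_eq[rotated]) (simp add: indicator_def)
qed

context planar_brownian_motion begin

text \<open>Just before the hitting time the path is off \<open>S\<close>, hence the stopping place
  is a limit of points of the complement.\<close>

lemma place_frontier:
  assumes S: "closed S" and zS: "z \<notin> S" and \<omega>: "\<omega> \<in> space M" and h: "hits S \<omega>"
  shows "place S \<omega> \<in> S" "place S \<omega> \<in> closure (- S)"
proof -
  let ?s = "hit_time S \<omega>"
  note p = hit_time_props[OF S \<omega> h]
  have pl: "place S \<omega> = B ?s \<omega>" using h by (simp add: place_def stopped_def)
  show "place S \<omega> \<in> S" using p(2) pl by simp
  have s0: "?s > 0"
  proof -
    have "?s \<noteq> 0" using p(2) start[OF \<omega>] zS by metis
    then show ?thesis using p(1) by simp
  qed
  define u where "u n = ?s * (1 - 1 / real (Suc n))" for n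
  have un: "0 \<le> u n" "u n < ?s" for n
  proof -
    have "0 \<le> 1 - 1 / real (Suc n)" "1 - 1 / real (Suc n) < 1" by simp_all
    then show "0 \<le> u n" "u n < ?s" using s0 by (simp_all only: u_def mult_nonneg_nonneg less_imp_le) (simp add: mult_less_cancel_left2)
  qed
  have "(\<lambda>n. ?s * (1 - 1 / real (Suc n))) \<longlonglongrightarrow> ?s * (1 - 0)"
    using LIMSEQ_inverse_real_of_nat by (intro tendsto_intros) (simp add: inverse_eq_divide)
  then have "u \<longlonglongrightarrow> ?s" by (simp add: u_def[abs_def])
  then have "(\<lambda>n. B (u n) \<omega>) \<longlonglongrightarrow> B ?s \<omega>"
    by (rule continuous_on_tendsto_compose[OF continuous_paths[OF \<omega>]]) (use p(1) un in auto)
  moreover have "B (u n) \<omega> \<in> - S" for n using p(3)[of "u n"] un[of n] by auto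
  ultimately show "place S \<omega> \<in> closure (- S)"
    unfolding pl closure_sequential by (intro exI[of _ "\<lambda>n. B (u n) \<omega>"]) simp
qed

lemma discount_eq_0: "\<not> hits S \<omega> \<Longrightarrow> discount S \<tau> \<omega> = 0"
  by (simp add: discount_def stopped_def)

lemma bk_le_bk_tail:
  assumes "e \<ge> 0" "0 < Y0" "Y0 \<le> Y"
  shows "bk Y \<le> bk_tail e Y + e\<^sup>2 / Y0\<^sup>2"
proof -
  have "bk_tail 0 Y \<le> bk_tail (0 + e) Y + e * (0 + e) / Y\<^sup>2"
    by (rule bk_tail_diff(2)) (use assms in auto)
  also have "e * (0 + e) / Y\<^sup>2 \<le> e\<^sup>2 / Y0\<^sup>2"
    using assms by (auto simp: power2_eq_square intro!: divide_left_mono mult_mono mult_pos_pos)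
  finally show ?thesis by (simp add: bk_tail_0)
qed

lemma scaled_sq_bound:
  assumes "0 < \<eta>" "\<eta> \<le> cmod y" "\<tau> > 0"
  shows "0 < \<eta>\<^sup>2 / (2 * \<tau>)" "\<eta>\<^sup>2 / (2 * \<tau>) \<le> (cmod y)\<^sup>2 / (2 * \<tau>)"
  using assms by (auto intro!: divide_right_mono power_mono)

lemma discount_bk_integrable:
  assumes S: "closed S" and zS: "z \<notin> S" and \<tau>: "\<tau> > 0" and \<eta>: "\<eta> > 0"
    and far: "\<And>\<omega>. \<omega> \<in> space M \<Longrightarrow> hits S \<omega> \<Longrightarrow> \<eta> \<le> cmod (place S \<omega> - w)"
  shows "integrable M (\<lambda>\<omega>. discount S \<tau> \<omega> * bk ((cmod (place S \<omega> - w))\<^sup>2 / (2 * \<tau>)))"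
proof -
  note [measurable] = discount_measurable[OF S zS \<tau>] place_measurable[OF S zS]
  show ?thesis
  proof (rule integrable_const_bound[where B = "bk (\<eta>\<^sup>2 / (2 * \<tau>))"])
    show "AE \<omega> in M. norm (discount S \<tau> \<omega> * bk ((cmod (place S \<omega> - w))\<^sup>2 / (2 * \<tau>))) \<le> bk (\<eta>\<^sup>2 / (2 * \<tau>))"
    proof (rule AE_I2)
      fix \<omega> assume \<omega>: "\<omega> \<in> space M"
      show "norm (discount S \<tau> \<omega> * bk ((cmod (place S \<omega> - w))\<^sup>2 / (2 * \<tau>))) \<le> bk (\<eta>\<^sup>2 / (2 * \<tau>))"
      proof (cases "hits S \<omega>")
        case True
        have "bk ((cmod (place S \<omega> - w))\<^sup>2 / (2 * \<tau>)) \<le> bk (\<eta>\<^sup>2 / (2 * \<tau>))"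
          by (rule bk_antimono) (use scaled_sq_bound[OF \<eta> far[OF \<omega> True] \<tau>] in auto)
        then have "discount S \<tau> \<omega> * bk ((cmod (place S \<omega> - w))\<^sup>2 / (2 * \<tau>)) \<le> 1 * bk (\<eta>\<^sup>2 / (2 * \<tau>))"
          using discount_bounds[OF S \<omega> \<tau>] by (intro mult_mono bk_nonneg) auto
        then show ?thesis using discount_bounds[OF S \<omega> \<tau>] bk_nonneg by (simp add: abs_mult)
      qed (simp add: discount_eq_0 bk_nonneg)
    qed
  qed measurable
qed

lemma discount_pot_integrable:
  assumes S: "closed S" and zS: "z \<notin> S" and \<tau>: "\<tau> > 0" and e: "e > 0"
  shows "integrable M (\<lambda>\<omega>. discount S \<tau> \<omega> * pot \<tau> e w (place S \<omega>))"
proof -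
  note [measurable] = discount_measurable[OF S zS \<tau>] place_measurable[OF S zS]
  have [measurable]: "pot \<tau> e w \<in> borel_measurable borel"
    using pot_continuous[OF e \<tau>] by (rule borel_measurable_continuous_onI)
  show ?thesis
  proof (rule integrable_const_bound[where B = "1 / (2 * e)"])
    show "AE \<omega> in M. norm (discount S \<tau> \<omega> * pot \<tau> e w (place S \<omega>)) \<le> 1 / (2 * e)"
    proof (rule AE_I2)
      fix \<omega> assume \<omega>: "\<omega> \<in> space M"
      have "\<bar>discount S \<tau> \<omega>\<bar> * \<bar>pot \<tau> e w (place S \<omega>)\<bar> \<le> 1 * (1 / (2 * e))"
        using discount_bounds[OF S \<omega> \<tau>] pot_bounded[OF e \<tau>] by (intro mult_mono) auto
      then show "norm (discount S \<tau> \<omega> * pot \<tau> e w (place S \<omega>)) \<le> 1 / (2 * e)" by (simp add: abs_mult)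
    qed
  qed measurable
qed

lemma le_of_le_add_square:
  fixes x y :: real
  assumes "\<And>e. 0 < e \<Longrightarrow> x \<le> y + c * e"
  shows "x \<le> y"
proof (rule tendsto_lowerbound)
  show "((\<lambda>e. y + c * e) \<longlongrightarrow> y) (at_right 0)" by (auto intro!: tendsto_eq_intros)
  show "\<forall>\<^sub>F e in at_right 0. x \<le> y + c * e"
    by (rule eventually_at_rightI[of 0 1]) (use assms in auto)
qed simp

text \<open>For a pole off \<open>S\<close> the truncated kernels are bounded continuous
  supersolutions, because the flow only raises the truncation. On \<open>S\<close>, at distance
  \<open>\<eta>\<close> from the pole, the truncation costs at most a multiple of
  \<open>e^2\<close>, which vanishes.\<close>

lemma hit_kernel_upper:
  assumes S: "closed S" and zS: "z \<notin> S" and \<tau>: "\<tau> > 0" and \<eta>: "\<eta> > 0"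
    and far: "\<And>x. x \<in> S \<Longrightarrow> \<eta> \<le> cmod (x - w)" and zw: "z \<noteq> w"
  shows "expectation (\<lambda>\<omega>. discount S \<tau> \<omega> * bk ((cmod (place S \<omega> - w))\<^sup>2 / (2 * \<tau>))) \<le> bk ((cmod (z - w))\<^sup>2 / (2 * \<tau>))"
proof -
  let ?Y0 = "\<eta>\<^sup>2 / (2 * \<tau>)"
  have farp: "\<eta> \<le> cmod (place S \<omega> - w)" if "\<omega> \<in> space M" "hits S \<omega>" for \<omega>
    using far place_frontier(1)[OF S zS that] by blast
  note i1 = discount_bk_integrable[OF S zS \<tau> \<eta> farp]
  have step: "expectation (\<lambda>\<omega>. discount S \<tau> \<omega> * bk ((cmod (place S \<omega> - w))\<^sup>2 / (2 * \<tau>)))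
      \<le> bk ((cmod (z - w))\<^sup>2 / (2 * \<tau>)) + e\<^sup>2 / ?Y0\<^sup>2" if e: "e > 0" for e
  proof -
    note i2 = discount_pot_integrable[OF S zS \<tau> e, of w]
    have "expectation (\<lambda>\<omega>. discount S \<tau> \<omega> * bk ((cmod (place S \<omega> - w))\<^sup>2 / (2 * \<tau>)))
      \<le> expectation (\<lambda>\<omega>. discount S \<tau> \<omega> * pot \<tau> e w (place S \<omega>) + e\<^sup>2 / ?Y0\<^sup>2)"
    proof (rule integral_mono[OF i1])
      show "integrable M (\<lambda>\<omega>. discount S \<tau> \<omega> * pot \<tau> e w (place S \<omega>) + e\<^sup>2 / ?Y0\<^sup>2)" using i2 by simp
      fix \<omega> assume \<omega>: "\<omega> \<in> space M"
      show "discount S \<tau> \<omega> * bk ((cmod (place S \<omega> - w))\<^sup>2 / (2 * \<tau>)) \<le> discount S \<tau> \<omega> * pot \<tau> e w (place S \<omega>) + e\<^sup>2 / ?Y0\<^sup>2"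
      proof (cases "hits S \<omega>")
        case True
        have "bk ((cmod (place S \<omega> - w))\<^sup>2 / (2 * \<tau>)) \<le> pot \<tau> e w (place S \<omega>) + e\<^sup>2 / ?Y0\<^sup>2"
          unfolding pot_def by (rule bk_le_bk_tail) (use e scaled_sq_bound[OF \<eta> farp[OF \<omega> True] \<tau>] in auto)
        then have "discount S \<tau> \<omega> * bk ((cmod (place S \<omega> - w))\<^sup>2 / (2 * \<tau>)) \<le> discount S \<tau> \<omega> * (pot \<tau> e w (place S \<omega>) + e\<^sup>2 / ?Y0\<^sup>2)"
          using discount_bounds[OF S \<omega> \<tau>] by (intro mult_left_mono) auto
        also have "\<dots> \<le> discount S \<tau> \<omega> * pot \<tau> e w (place S \<omega>) + 1 * (e\<^sup>2 / ?Y0\<^sup>2)"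
          unfolding distrib_left using discount_bounds[OF S \<omega> \<tau>] by (intro add_left_mono mult_right_mono) auto
        finally show ?thesis by simp
      qed (simp add: discount_eq_0)
    qed
    also have "\<dots> = expectation (\<lambda>\<omega>. discount S \<tau> \<omega> * pot \<tau> e w (place S \<omega>)) + e\<^sup>2 / ?Y0\<^sup>2"
      using i2 by (simp add: prob_space)
    also have "expectation (\<lambda>\<omega>. discount S \<tau> \<omega> * pot \<tau> e w (place S \<omega>)) \<le> pot \<tau> e w z"
    proof -
      have "expectation (stopped S (\<lambda>t x. exp (- t / \<tau>) * pot \<tau> e w x)) \<le> pot \<tau> e w z"
      proof (rule stopped_upper[OF S zS \<tau> pot_continuous[OF e \<tau>] pot_bounded[OF e \<tau>]])
        show "0 \<le> pot \<tau> e w x" for x using pot_nonneg e by simp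
        fix h :: real and x assume h: "h > 0"
        show "exp (- h / \<tau>) * heat_op h (pot \<tau> e w) x \<le> pot \<tau> e w x"
        proof (cases "x = w")
          case False
          then show ?thesis unfolding heat_op_pot[OF e \<tau> h] unfolding pot_def
            by (intro bk_tail_diff) (use e h \<tau> in auto)
        next
          case True
          \<comment> \<open>\<open>bk_tail_diff\<close> excludes the pole itself; there the
            inequality follows by continuity from the punctured plane.\<close>
          have c: "continuous_on UNIV (\<lambda>y. pot \<tau> e w y - pot \<tau> (e + h / \<tau>) w y)"
            using e h \<tau> by (intro continuous_intros pot_continuous add_pos_pos) auto
          have "0 \<le> pot \<tau> e w y - pot \<tau> (e + h / \<tau>) w y" if "y \<in> - {w}" for y
            unfolding pot_def using bk_tail_diff(1)[of e "h / \<tau>" "(cmod (y - w))\<^sup>2 / (2 * \<tau>)"] that e h \<tau> by auto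
          then have "0 \<le> pot \<tau> e w w - pot \<tau> (e + h / \<tau>) w w"
            by (intro continuous_ge_on_closure[of "- {w}" "\<lambda>y. pot \<tau> e w y - pot \<tau> (e + h / \<tau>) w y" w 0] continuous_on_subset[OF c])
               (auto simp: closure_complement)
          then show ?thesis using True unfolding heat_op_pot[OF e \<tau> h] by simp
        qed
      qed
      then show ?thesis by (simp only: stopped_discount[abs_def])
    qed
    also have "pot \<tau> e w z \<le> bk ((cmod (z - w))\<^sup>2 / (2 * \<tau>))"
      using bk_tail_diff(1)[of 0 e "(cmod (z - w))\<^sup>2 / (2 * \<tau>)"] e zw \<tau> by (simp add: pot_def bk_tail_0)
    finally show ?thesis by simp
  qed
  show ?thesis
  proof (rule le_of_le_add_square[where c = "1 / ?Y0\<^sup>2"])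
    fix e :: real assume e: "e > 0"
    show "expectation (\<lambda>\<omega>. discount S \<tau> \<omega> * bk ((cmod (place S \<omega> - w))\<^sup>2 / (2 * \<tau>)))
      \<le> bk ((cmod (z - w))\<^sup>2 / (2 * \<tau>)) + 1 / ?Y0\<^sup>2 * e"
      using step[of "sqrt e"] e by simp
  qed
qed

text \<open>With the pole inside \<open>S\<close>, all points off \<open>S\<close> keep the distance
  \<open>\<eta>\<close> from it, so the loss per step of the truncated kernel is uniformly of order
  \<open>h * (h + \<tau> * e)\<close> and \<open>stopped_lower\<close> applies. The mesh tends to 0
  first, the truncation \<open>e\<close> afterwards.\<close>

lemma hit_kernel_lower:
  assumes S: "closed S" and zS: "z \<notin> S" and \<tau>: "\<tau> > 0" and \<eta>: "\<eta> > 0"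
    and far: "\<And>x. x \<notin> S \<Longrightarrow> \<eta> \<le> cmod (x - w)"
  shows "bk ((cmod (z - w))\<^sup>2 / (2 * \<tau>)) \<le> expectation (\<lambda>\<omega>. discount S \<tau> \<omega> * bk ((cmod (place S \<omega> - w))\<^sup>2 / (2 * \<tau>)))"
proof -
  let ?Y0 = "\<eta>\<^sup>2 / (2 * \<tau>)"
  have farp: "\<eta> \<le> cmod (place S \<omega> - w)" if "\<omega> \<in> space M" "hits S \<omega>" for \<omega>
  proof -
    have "closed {x. \<eta> \<le> cmod (x - w)}" by (intro closed_Collect_le continuous_intros)
    moreover have "- S \<subseteq> {x. \<eta> \<le> cmod (x - w)}" using far by auto
    ultimately have "closure (- S) \<subseteq> {x. \<eta> \<le> cmod (x - w)}" by (rule closure_minimal[rotated])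
    then show ?thesis using place_frontier(2)[OF S zS that] by blast
  qed
  note i1 = discount_bk_integrable[OF S zS \<tau> \<eta> farp]
  have Y0: "?Y0 > 0" using \<eta> \<tau> by simp
  let ?c = "1 / (\<tau> * ?Y0)\<^sup>2"
  have step: "bk ((cmod (z - w))\<^sup>2 / (2 * \<tau>)) \<le> expectation (\<lambda>\<omega>. discount S \<tau> \<omega> * bk ((cmod (place S \<omega> - w))\<^sup>2 / (2 * \<tau>)))
      + (?c * \<tau> * (\<tau> * e) + e\<^sup>2 / ?Y0\<^sup>2)" if e: "e > 0" for e
  proof -
    have "bk ((cmod (z - w))\<^sup>2 / (2 * \<tau>)) \<le> pot \<tau> e w z + e\<^sup>2 / ?Y0\<^sup>2"
      unfolding pot_def by (rule bk_le_bk_tail) (use e scaled_sq_bound[OF \<eta> far[OF zS] \<tau>] in auto)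
    moreover have "pot \<tau> e w z \<le> expectation (\<lambda>\<omega>. discount S \<tau> \<omega> * pot \<tau> e w (place S \<omega>)) + ?c * \<tau> * (\<tau> * e)"
    proof -
      have "pot \<tau> e w z \<le> expectation (stopped S (\<lambda>t x. exp (- t / \<tau>) * pot \<tau> e w x)) + ?c * \<tau> * (\<tau> * e)"
      proof (rule stopped_lower[OF S zS \<tau> _ _ pot_continuous[OF e \<tau>] pot_bounded[OF e \<tau>]])
        fix h :: real and x assume h: "h > 0" and x: "x \<notin> S"
        define Y where "Y = (cmod (x - w))\<^sup>2 / (2 * \<tau>)"
        define Yz where "Yz = ?Y0"
        have Yb: "0 < Yz" "Yz \<le> Y"
          using scaled_sq_bound[OF \<eta> far[OF x] \<tau>] unfolding Y_def Yz_def by auto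
        have "pot \<tau> e w x - exp (- h / \<tau>) * heat_op h (pot \<tau> e w) x \<le> h / \<tau> * (e + h / \<tau>) / Y\<^sup>2"
          unfolding heat_op_pot[OF e \<tau> h] unfolding pot_def Y_def[symmetric]
          using bk_tail_diff(2)[of e "h / \<tau>" Y] e h \<tau> Yb by simp
        moreover have "h / \<tau> * (e + h / \<tau>) / Y\<^sup>2 \<le> h / \<tau> * (e + h / \<tau>) / Yz\<^sup>2"
          using Yb e h \<tau> by (intro divide_left_mono power_mono mult_pos_pos zero_less_power) auto
        moreover have "h / \<tau> * (e + h / \<tau>) / Yz\<^sup>2 = 1 / (\<tau> * Yz)\<^sup>2 * h * (h + \<tau> * e)"
          using \<tau> Yb(1) by (simp add: field_simps power2_eq_square)
        ultimately show "pot \<tau> e w x - exp (- h / \<tau>) * heat_op h (pot \<tau> e w) x \<le> ?c * h * (h + \<tau> * e)"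
          unfolding Yz_def by linarith
      qed (use \<tau> e in auto)
      then show ?thesis by (simp only: stopped_discount[abs_def])
    qed
    moreover have "expectation (\<lambda>\<omega>. discount S \<tau> \<omega> * pot \<tau> e w (place S \<omega>))
       \<le> expectation (\<lambda>\<omega>. discount S \<tau> \<omega> * bk ((cmod (place S \<omega> - w))\<^sup>2 / (2 * \<tau>)))"
    proof (rule integral_mono[OF discount_pot_integrable[OF S zS \<tau> e] i1])
      fix \<omega> assume \<omega>: "\<omega> \<in> space M"
      show "discount S \<tau> \<omega> * pot \<tau> e w (place S \<omega>) \<le> discount S \<tau> \<omega> * bk ((cmod (place S \<omega> - w))\<^sup>2 / (2 * \<tau>))"
      proof (cases "hits S \<omega>")
        case True
        have "pot \<tau> e w (place S \<omega>) \<le> bk ((cmod (place S \<omega> - w))\<^sup>2 / (2 * \<tau>))"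
          using bk_tail_diff(1)[of 0 e "(cmod (place S \<omega> - w))\<^sup>2 / (2 * \<tau>)"] e scaled_sq_bound[OF \<eta> farp[OF \<omega> True] \<tau>]
          by (simp add: pot_def bk_tail_0)
        then show ?thesis using discount_bounds[OF S \<omega> \<tau>] by (intro mult_left_mono) auto
      qed (simp add: discount_eq_0)
    qed
    ultimately show ?thesis by linarith
  qed
  show ?thesis
  proof (rule tendsto_lowerbound)
    let ?E = "expectation (\<lambda>\<omega>. discount S \<tau> \<omega> * bk ((cmod (place S \<omega> - w))\<^sup>2 / (2 * \<tau>)))"
    have "((\<lambda>e. ?E + (?c * \<tau> * (\<tau> * e) + e\<^sup>2 / ?Y0\<^sup>2)) \<longlongrightarrow> ?E + (?c * \<tau> * (\<tau> * 0) + 0\<^sup>2 / ?Y0\<^sup>2)) (at_right 0)"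
      using Y0 by (intro tendsto_intros) auto
    then show "((\<lambda>e. ?E + (?c * \<tau> * (\<tau> * e) + e\<^sup>2 / ?Y0\<^sup>2)) \<longlongrightarrow> ?E) (at_right 0)" by simp
    show "\<forall>\<^sub>F e in at_right 0. bk ((cmod (z - w))\<^sup>2 / (2 * \<tau>)) \<le> ?E + (?c * \<tau> * (\<tau> * e) + e\<^sup>2 / ?Y0\<^sup>2)"
      by (rule eventually_at_rightI[of 0 1]) (use step in auto)
  qed simp
qed

section \<open>Averaging the pole over a curve\<close>

lemma hit_average:
  fixes W :: "real \<Rightarrow> complex"
  assumes S: "closed S" and zS: "z \<notin> S" and \<tau>: "\<tau> > 0" and \<eta>: "\<eta> > 0"
    and W: "continuous_on {0..1} W"
    and farp: "\<And>\<omega> \<theta>. \<omega> \<in> space M \<Longrightarrow> hits S \<omega> \<Longrightarrow> \<theta> \<in> {0..1} \<Longrightarrow> \<eta> \<le> cmod (place S \<omega> - W \<theta>)"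
  defines "k x \<theta> \<equiv> bk ((cmod (x - W \<theta>))\<^sup>2 / (2 * \<tau>))"
  shows "(\<integral>\<^sup>+ \<theta>. ennreal (indicator {0..1} \<theta> * expectation (\<lambda>\<omega>. discount S \<tau> \<omega> * k (place S \<omega>) \<theta>)) \<partial>lborel)
     = (\<integral>\<^sup>+ \<omega>. ennreal (discount S \<tau> \<omega> * integral {0..1} (k (place S \<omega>))) \<partial>M)"
proof -
  note [measurable] = discount_measurable[OF S zS \<tau>] place_measurable[OF S zS]
  interpret P: pair_sigma_finite "lborel :: real measure" M
    by (intro pair_sigma_finite.intro lborel.sigma_finite_measure_axioms sigma_finite_measure_axioms)
  define W' where "W' = (\<lambda>\<theta>. indicator {0..1} \<theta> *\<^sub>R W \<theta>)"
  have [measurable]: "W' \<in> borel_measurable borel"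
    unfolding W'_def by (rule borel_measurable_continuous_on_indicator[OF _ W]) simp
  let ?f = "\<lambda>\<theta> \<omega>. indicator {0..1} \<theta> * (discount S \<tau> \<omega> * bk ((cmod (place S \<omega> - W' \<theta>))\<^sup>2 / (2 * \<tau>)))"
  have fk: "?f \<theta> \<omega> = indicator {0..1} \<theta> * (discount S \<tau> \<omega> * k (place S \<omega>) \<theta>)" for \<theta> \<omega>
    by (simp add: k_def W'_def indicator_def)
  have fm: "(\<lambda>(\<theta>, \<omega>). ennreal (?f \<theta> \<omega>)) \<in> borel_measurable (lborel \<Otimes>\<^sub>M M)" by measurable
  have "(\<integral>\<^sup>+ \<theta>. ennreal (indicator {0..1} \<theta> * expectation (\<lambda>\<omega>. discount S \<tau> \<omega> * k (place S \<omega>) \<theta>)) \<partial>lborel)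
     = (\<integral>\<^sup>+ \<theta>. \<integral>\<^sup>+ \<omega>. ennreal (?f \<theta> \<omega>) \<partial>M \<partial>lborel)"
  proof (rule nn_integral_cong)
    fix \<theta> :: real
    show "ennreal (indicator {0..1} \<theta> * expectation (\<lambda>\<omega>. discount S \<tau> \<omega> * k (place S \<omega>) \<theta>)) = (\<integral>\<^sup>+ \<omega>. ennreal (?f \<theta> \<omega>) \<partial>M)"
    proof (cases "\<theta> \<in> {0..1}")
      case True
      have "integrable M (\<lambda>\<omega>. discount S \<tau> \<omega> * k (place S \<omega>) \<theta>)"
        unfolding k_def by (rule discount_bk_integrable[OF S zS \<tau> \<eta>]) (use farp True in auto)
      then show ?thesis unfolding fk using True discount_bounds(1)[OF S _ \<tau>] bk_nonneg
        by (simp add: nn_integral_eq_integral k_def)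
    qed simp
  qed
  also have "\<dots> = (\<integral>\<^sup>+ \<omega>. \<integral>\<^sup>+ \<theta>. ennreal (?f \<theta> \<omega>) \<partial>lborel \<partial>M)"
    using fm by (intro P.Fubini'[symmetric]) (simp add: case_prod_beta')
  also have "\<dots> = (\<integral>\<^sup>+ \<omega>. ennreal (discount S \<tau> \<omega> * integral {0..1} (k (place S \<omega>))) \<partial>M)"
  proof (rule nn_integral_cong)
    fix \<omega> assume \<omega>: "\<omega> \<in> space M"
    show "(\<integral>\<^sup>+ \<theta>. ennreal (?f \<theta> \<omega>) \<partial>lborel) = ennreal (discount S \<tau> \<omega> * integral {0..1} (k (place S \<omega>)))"
    proof (cases "hits S \<omega>")
      case True
      have c: "continuous_on {0..1} (k (place S \<omega>))"
        unfolding k_def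
      proof (rule continuous_on_compose2[OF bk_continuous_on])
        show "continuous_on {0..1} (\<lambda>\<theta>. (cmod (place S \<omega> - W \<theta>))\<^sup>2 / (2 * \<tau>))"
          using \<tau> by (intro continuous_intros W) auto
        show "(\<lambda>\<theta>. (cmod (place S \<omega> - W \<theta>))\<^sup>2 / (2 * \<tau>)) ` {0..1} \<subseteq> {0<..}"
          using less_le_trans[OF scaled_sq_bound(1)[OF \<eta> farp[OF \<omega> True] \<tau>] scaled_sq_bound(2)[OF \<eta> farp[OF \<omega> True] \<tau>]]
          unfolding image_subset_iff greaterThan_iff by blast
      qed
      have "(\<integral>\<^sup>+ \<theta>. ennreal (indicator {0..1} \<theta> * (discount S \<tau> \<omega> * k (place S \<omega>) \<theta>)) \<partial>lborel)
         = ennreal (integral {0..1} (\<lambda>\<theta>. discount S \<tau> \<omega> * k (place S \<omega>) \<theta>))"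
        by (rule nn_integral_unit_interval) (use c discount_bounds(1)[OF S \<omega> \<tau>] bk_nonneg in \<open>auto simp: k_def intro!: continuous_intros\<close>)
      then show ?thesis unfolding fk by simp
    qed (simp add: discount_eq_0)
  qed
  finally show ?thesis .
qed

lemma curve_continuous:
  assumes \<tau>: "\<tau> > 0" and \<eta>: "\<eta> > 0" and W: "continuous_on {0..1} W"
    and far: "\<And>\<theta>. \<theta> \<in> {0..1} \<Longrightarrow> \<eta> \<le> cmod (x - W \<theta>)"
  shows "continuous_on {0..1} (\<lambda>\<theta>. bk ((cmod (x - W \<theta>))\<^sup>2 / (2 * \<tau>)))"
proof (rule continuous_on_compose2[OF bk_continuous_on])
  show "continuous_on {0..1} (\<lambda>\<theta>. (cmod (x - W \<theta>))\<^sup>2 / (2 * \<tau>))"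
    using \<tau> by (intro continuous_intros W) auto
  show "(\<lambda>\<theta>. (cmod (x - W \<theta>))\<^sup>2 / (2 * \<tau>)) ` {0..1} \<subseteq> {0<..}"
    using less_le_trans[OF scaled_sq_bound(1)[OF \<eta> far \<tau>] scaled_sq_bound(2)[OF \<eta> far \<tau>]]
    unfolding image_subset_iff greaterThan_iff by blast
qed

theorem hit_upper:
  fixes W :: "real \<Rightarrow> complex"
  assumes S: "closed S" and zS: "z \<notin> S" and \<tau>: "\<tau> > 0" and \<eta>: "\<eta> > 0"
    and W: "continuous_on {0..1} W"
    and far: "\<And>x \<theta>. x \<in> S \<Longrightarrow> \<theta> \<in> {0..1} \<Longrightarrow> \<eta> \<le> cmod (x - W \<theta>)"
    and farz: "\<And>\<theta>. \<theta> \<in> {0..1} \<Longrightarrow> \<eta> \<le> cmod (z - W \<theta>)"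
    and m: "m \<ge> 0" "\<And>b. b \<in> S \<Longrightarrow> m \<le> integral {0..1} (\<lambda>\<theta>. bk ((cmod (b - W \<theta>))\<^sup>2 / (2 * \<tau>)))"
  shows "hit_laplace M B S \<tau> * m \<le> integral {0..1} (\<lambda>\<theta>. bk ((cmod (z - W \<theta>))\<^sup>2 / (2 * \<tau>)))"
proof -
  let ?k = "\<lambda>x \<theta>. bk ((cmod (x - W \<theta>))\<^sup>2 / (2 * \<tau>))"
  note [measurable] = discount_measurable[OF S zS \<tau>]
  have i: "integrable M (discount S \<tau>)"
    by (rule integrable_const_bound[where B = 1]) (use discount_bounds[OF S _ \<tau>] in auto)
  have kz: "continuous_on {0..1} (?k z)" by (rule curve_continuous[OF \<tau> \<eta> W farz])
  have farp: "\<eta> \<le> cmod (place S \<omega> - W \<theta>)" if "\<omega> \<in> space M" "hits S \<omega>" "\<theta> \<in> {0..1}" for \<omega> \<theta>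
    using far place_frontier(1)[OF S zS that(1,2)] that(3) by blast
  have "ennreal (expectation (discount S \<tau>) * m) = (\<integral>\<^sup>+ \<omega>. ennreal (discount S \<tau> \<omega> * m) \<partial>M)"
    using i m(1) discount_bounds(1)[OF S _ \<tau>] by (subst nn_integral_eq_integral) auto
  also have "\<dots> \<le> (\<integral>\<^sup>+ \<omega>. ennreal (discount S \<tau> \<omega> * integral {0..1} (?k (place S \<omega>))) \<partial>M)"
  proof (rule nn_integral_mono)
    fix \<omega> assume \<omega>: "\<omega> \<in> space M"
    show "ennreal (discount S \<tau> \<omega> * m) \<le> ennreal (discount S \<tau> \<omega> * integral {0..1} (?k (place S \<omega>)))"
    proof (cases "hits S \<omega>")
      case True
      show ?thesis using m(2)[OF place_frontier(1)[OF S zS \<omega> True]] discount_bounds(1)[OF S \<omega> \<tau>]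
        by (intro ennreal_leI mult_left_mono) auto
    qed (simp add: discount_eq_0)
  qed
  also have "\<dots> = (\<integral>\<^sup>+ \<theta>. ennreal (indicator {0..1} \<theta> * expectation (\<lambda>\<omega>. discount S \<tau> \<omega> * ?k (place S \<omega>) \<theta>)) \<partial>lborel)"
    using hit_average[OF S zS \<tau> \<eta> W farp] by simp
  also have "\<dots> \<le> (\<integral>\<^sup>+ \<theta>. ennreal (indicator {0..1} \<theta> * ?k z \<theta>) \<partial>lborel)"
  proof (rule nn_integral_mono)
    fix \<theta> :: real
    show "ennreal (indicator {0..1} \<theta> * expectation (\<lambda>\<omega>. discount S \<tau> \<omega> * ?k (place S \<omega>) \<theta>)) \<le> ennreal (indicator {0..1} \<theta> * ?k z \<theta>)"
    proof (cases "\<theta> \<in> {0..1}")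
      case True
      have "z \<noteq> W \<theta>" using farz[OF True] \<eta> by auto
      then show ?thesis using True hit_kernel_upper[OF S zS \<tau> \<eta> far[OF _ True]] by (auto intro!: ennreal_leI)
    qed simp
  qed
  also have "\<dots> = ennreal (integral {0..1} (?k z))"
    by (rule nn_integral_unit_interval[OF kz]) (simp add: bk_nonneg)
  finally have "expectation (discount S \<tau>) * m \<le> integral {0..1} (?k z)"
    using integral_nonneg[OF integrable_continuous_interval[OF kz]] bk_nonneg by (subst (asm) ennreal_le_iff) auto
  then show ?thesis by (simp add: hit_laplace_eq[OF S zS \<tau>])
qed

text \<open>Since the path comes from outside, the averaged kernel has to be bounded only at points
  of \<open>S\<close> that are limits of its complement, not throughout \<open>S\<close>, where the
  curve itself lies.\<close>

theorem hit_lower: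
  fixes W :: "real \<Rightarrow> complex"
  assumes S: "closed S" and zS: "z \<notin> S" and \<tau>: "\<tau> > 0" and \<eta>: "\<eta> > 0"
    and W: "continuous_on {0..1} W"
    and far: "\<And>x \<theta>. x \<notin> S \<Longrightarrow> \<theta> \<in> {0..1} \<Longrightarrow> \<eta> \<le> cmod (x - W \<theta>)"
    and m: "m \<ge> 0" "\<And>b. b \<in> S \<Longrightarrow> b \<in> closure (- S) \<Longrightarrow> integral {0..1} (\<lambda>\<theta>. bk ((cmod (b - W \<theta>))\<^sup>2 / (2 * \<tau>))) \<le> m"
  shows "integral {0..1} (\<lambda>\<theta>. bk ((cmod (z - W \<theta>))\<^sup>2 / (2 * \<tau>))) \<le> hit_laplace M B S \<tau> * m"
proof -
  let ?k = "\<lambda>x \<theta>. bk ((cmod (x - W \<theta>))\<^sup>2 / (2 * \<tau>))"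
  note [measurable] = discount_measurable[OF S zS \<tau>]
  have i: "integrable M (discount S \<tau>)"
    by (rule integrable_const_bound[where B = 1]) (use discount_bounds[OF S _ \<tau>] in auto)
  have kz: "continuous_on {0..1} (?k z)" by (rule curve_continuous[OF \<tau> \<eta> W far[OF zS]])
  have farp: "\<eta> \<le> cmod (place S \<omega> - W \<theta>)" if "\<omega> \<in> space M" "hits S \<omega>" "\<theta> \<in> {0..1}" for \<omega> \<theta>
  proof -
    have "closed {x. \<eta> \<le> cmod (x - W \<theta>)}" by (intro closed_Collect_le continuous_intros)
    moreover have "- S \<subseteq> {x. \<eta> \<le> cmod (x - W \<theta>)}" using far that(3) by auto
    ultimately have "closure (- S) \<subseteq> {x. \<eta> \<le> cmod (x - W \<theta>)}" by (rule closure_minimal[rotated])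
    then show ?thesis using place_frontier(2)[OF S zS that(1,2)] by blast
  qed
  have "ennreal (integral {0..1} (?k z)) = (\<integral>\<^sup>+ \<theta>. ennreal (indicator {0..1} \<theta> * ?k z \<theta>) \<partial>lborel)"
    by (rule nn_integral_unit_interval[OF kz, symmetric]) (simp add: bk_nonneg)
  also have "\<dots> \<le> (\<integral>\<^sup>+ \<theta>. ennreal (indicator {0..1} \<theta> * expectation (\<lambda>\<omega>. discount S \<tau> \<omega> * ?k (place S \<omega>) \<theta>)) \<partial>lborel)"
  proof (rule nn_integral_mono)
    fix \<theta> :: real
    show "ennreal (indicator {0..1} \<theta> * ?k z \<theta>) \<le> ennreal (indicator {0..1} \<theta> * expectation (\<lambda>\<omega>. discount S \<tau> \<omega> * ?k (place S \<omega>) \<theta>))"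
    proof (cases "\<theta> \<in> {0..1}")
      case True
      then show ?thesis using hit_kernel_lower[OF S zS \<tau> \<eta> far[OF _ True]] by (auto intro!: ennreal_leI)
    qed simp
  qed
  also have "\<dots> = (\<integral>\<^sup>+ \<omega>. ennreal (discount S \<tau> \<omega> * integral {0..1} (?k (place S \<omega>))) \<partial>M)"
    using hit_average[OF S zS \<tau> \<eta> W farp] by simp
  also have "\<dots> \<le> (\<integral>\<^sup>+ \<omega>. ennreal (discount S \<tau> \<omega> * m) \<partial>M)"
  proof (rule nn_integral_mono)
    fix \<omega> assume \<omega>: "\<omega> \<in> space M"
    show "ennreal (discount S \<tau> \<omega> * integral {0..1} (?k (place S \<omega>))) \<le> ennreal (discount S \<tau> \<omega> * m)"
    proof (cases "hits S \<omega>")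
      case True
      show ?thesis using m(2)[OF place_frontier[OF S zS \<omega> True]] discount_bounds(1)[OF S \<omega> \<tau>]
        by (intro ennreal_leI mult_left_mono) auto
    qed (simp add: discount_eq_0)
  qed
  also have "\<dots> = ennreal (expectation (discount S \<tau>) * m)"
    using i m(1) discount_bounds(1)[OF S _ \<tau>] by (subst nn_integral_eq_integral) auto
  finally have "integral {0..1} (?k z) \<le> expectation (discount S \<tau>) * m"
    using m(1) discount_bounds(1)[OF S _ \<tau>] by (subst (asm) ennreal_le_iff) (auto intro!: mult_nonneg_nonneg integral_nonneg_AE AE_I2)
  then show ?thesis by (simp add: hit_laplace_eq[OF S zS \<tau>])
qed

lemma hit_laplace_bounds:
  assumes "closed S" "z \<notin> S" "\<tau> > 0"
  shows "0 \<le> hit_laplace M B S \<tau>" "hit_laplace M B S \<tau> \<le> 1"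
proof -
  have i: "integrable M (discount S \<tau>)"
    by (rule integrable_const_bound[where B = 1]) (use discount_bounds[OF assms(1) _ assms(3)] discount_measurable[OF assms] in auto)
  show "0 \<le> hit_laplace M B S \<tau>"
    unfolding hit_laplace_eq[OF assms] using discount_bounds[OF assms(1) _ assms(3)] by (intro integral_nonneg_AE AE_I2) auto
  have "expectation (discount S \<tau>) \<le> expectation (\<lambda>_. 1)"
    using i discount_bounds[OF assms(1) _ assms(3)] by (intro integral_mono) auto
  then show "hit_laplace M B S \<tau> \<le> 1" unfolding hit_laplace_eq[OF assms] by (simp add: prob_space)
qed

end

section \<open>The exterior map\<close>

text \<open>The exterior with infinity adjoined, in the coordinate \<open>1 / (z - a)\<close> that
  sends infinity to 0. This makes it a plane domain to which the Riemann mapping theorem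
  applies.\<close>

definition recip_domain :: "complex set \<Rightarrow> complex \<Rightarrow> complex set" where
  "recip_domain T a = insert 0 {\<omega>. a + 1 / \<omega> \<in> outside T}"

lemma outside_contains_exterior_ball:
  assumes "bounded T" obtains R where "R > 0" "\<And>z. R < cmod z \<Longrightarrow> z \<in> outside T"
proof -
  obtain B where "B > 0" "\<And>x. x \<in> - outside T \<Longrightarrow> norm x \<le> B"
    using cobounded_outside[OF assms] bounded_pos by metis
  then show ?thesis by (intro that[of B]) force+
qed

lemma recip_domain_ball:
  assumes "bounded T" obtains e where "e > 0" "ball 0 e \<subseteq> recip_domain T a"
proof -
  obtain R where R: "R > 0" "\<And>z. R < cmod z \<Longrightarrow> z \<in> outside T"
    using outside_contains_exterior_ball[OF assms] by blast
  define e where "e = 1 / (R + cmod a)"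
  have e: "e > 0" using R(1) by (auto simp: e_def intro!: add_pos_nonneg)
  have "\<omega> \<in> recip_domain T a" if "\<omega> \<in> ball 0 e" for \<omega>
  proof (cases "\<omega> = 0")
    case False
    have "cmod \<omega> < 1 / (R + cmod a)" using that by (simp add: e_def)
    then have "R + cmod a < 1 / cmod \<omega>" using False R(1)
      by (simp add: pos_less_divide_eq add_pos_nonneg mult.commute)
    also have "1 / cmod \<omega> \<le> cmod (a + 1 / \<omega>) + cmod a"
      using norm_triangle_ineq4[of "a + 1 / \<omega>" a] by (simp add: norm_divide)
    finally have "R < cmod (a + 1 / \<omega>)" by simp
    then show ?thesis using R(2) by (simp add: recip_domain_def)
  qed (simp add: recip_domain_def)
  then show ?thesis using e that by blast
qed

lemma open_recip_domain:
  assumes T: "compact T"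
  shows "open (recip_domain T a)"
proof -
  obtain e where e: "e > 0" "ball 0 e \<subseteq> recip_domain T a"
    using recip_domain_ball compact_imp_bounded[OF T] by blast
  have "open (- {0} \<inter> (\<lambda>\<omega>. a + 1 / \<omega>) -` outside T)"
    by (intro continuous_open_preimage) (auto intro!: continuous_intros open_outside compact_imp_closed T)
  moreover have "recip_domain T a = ball 0 e \<union> (- {0} \<inter> (\<lambda>\<omega>. a + 1 / \<omega>) -` outside T)"
    using e by (auto simp: recip_domain_def)
  ultimately show ?thesis using open_Un[OF open_ball] by metis
qed

lemma recip_domain_image:
  assumes a: "a \<in> T" shows "recip_domain T a = insert 0 ((\<lambda>z. 1 / (z - a)) ` outside T)"
proof -
  have na: "a \<notin> outside T" using a outside_no_overlap[of T] by blast
  have "{\<omega>. a + 1 / \<omega> \<in> outside T} = (\<lambda>z. 1 / (z - a)) ` outside T"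
  proof (intro equalityI subsetI)
    fix \<omega> assume \<omega>: "\<omega> \<in> {\<omega>. a + 1 / \<omega> \<in> outside T}"
    then have "\<omega> = (\<lambda>z. 1 / (z - a)) (a + 1 / \<omega>)" by simp
    then show "\<omega> \<in> (\<lambda>z. 1 / (z - a)) ` outside T" using \<omega> by blast
  qed (use na in auto)
  then show ?thesis by (simp add: recip_domain_def)
qed

lemma connected_recip_domain:
  assumes T: "compact T" and a: "a \<in> T"
  shows "connected (recip_domain T a)"
proof -
  let ?I = "(\<lambda>z. 1 / (z - a)) ` outside T"
  have na: "a \<notin> outside T" using a outside_no_overlap[of T] by blast
  have c: "connected ?I"
    by (intro connected_continuous_image connected_outside)
       (use T na in \<open>auto intro!: continuous_intros compact_imp_bounded\<close>)
  have "0 \<in> closure ?I"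
  proof -
    obtain e where e: "e > 0" "ball 0 e \<subseteq> recip_domain T a"
      using recip_domain_ball compact_imp_bounded[OF T] by blast
    have "0 \<in> closure (ball 0 e - {0::complex})"
      using islimpt_ball[of 0 0 e] e(1) unfolding closure_def islimpt_def by auto
    moreover have "ball 0 e - {0} \<subseteq> ?I" using e recip_domain_image[OF a] by auto
    ultimately show ?thesis using closure_mono by blast
  qed
  then have "insert 0 ?I \<subseteq> closure ?I" using closure_subset[of ?I] by (rule insert_subsetI)
  then show ?thesis unfolding recip_domain_image[OF a]
    by (intro connected_intermediate_closure[OF c]) auto
qed

text \<open>A bounded component of the complement would pull back to a proper clopen piece of the
  filled set, by the Sura--Bura theorem.\<close>

lemma simply_connected_recip_domain:
  assumes T: "compact T" "connected T" and a: "a \<in> T"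
  shows "simply_connected (recip_domain T a)"
proof -
  let ?U = "recip_domain T a"
  have opU: "open ?U" by (rule open_recip_domain[OF T(1)])
  have unb: "\<not> bounded C" if C: "C \<in> components (- ?U)" for C
  proof
    assume bC: "bounded C"
    have clU: "closed (- ?U)" using opU by auto
    have "closed C" using closed_components[OF clU C] .
    then have cC: "compact C" using bC by (simp add: compact_eq_bounded_closed)
    obtain K where K: "openin (top_of_set (- ?U)) K" "compact K" "C \<subseteq> K" "K \<subseteq> UNIV"
      using Sura_Bura_clopen_subset[of "- ?U" C UNIV] C cC clU closed_imp_locally_compact by blast
    obtain V where V: "open V" "K = - ?U \<inter> V" using K(1) by (auto simp: openin_open)
    have K0: "0 \<notin> K" using V(2) by (auto simp: recip_domain_def)
    let ?f = "\<lambda>\<omega>. a + 1 / \<omega>"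
    define L where "L = ?f ` K"
    let ?T = "- outside T"
    have conT: "connected ?T"
      using connected_with_inside[OF compact_imp_closed[OF T(1)] T(2)] by (simp add: union_with_inside)
    have LT: "L \<subseteq> ?T" using V(2) by (auto simp: L_def recip_domain_def)
    have "compact L" unfolding L_def
      by (intro compact_continuous_image K(2)) (use K0 in \<open>auto intro!: continuous_intros\<close>)
    then have clL: "closedin (top_of_set ?T) L" using LT by (simp add: closed_subset compact_imp_closed)
    have aL: "a \<notin> L" using K0 by (auto simp: L_def)
    have Leq: "L = ?T \<inter> (- {a} \<inter> (\<lambda>z. 1 / (z - a)) -` V)"
    proof (intro equalityI subsetI)
      fix x assume "x \<in> L"
      then obtain \<omega> where "\<omega> \<in> K" "x = a + 1 / \<omega>" by (auto simp: L_def)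
      then show "x \<in> ?T \<inter> (- {a} \<inter> (\<lambda>z. 1 / (z - a)) -` V)" using LT V(2) K0 \<open>x \<in> L\<close> by auto
    next
      fix x assume x: "x \<in> ?T \<inter> (- {a} \<inter> (\<lambda>z. 1 / (z - a)) -` V)"
      then have "1 / (x - a) \<notin> ?U" by (auto simp: recip_domain_def)
      then have "1 / (x - a) \<in> K" using x V(2) by auto
      moreover have "x = ?f (1 / (x - a))" by simp
      ultimately show "x \<in> L" unfolding L_def by blast
    qed
    have "open (- {a} \<inter> (\<lambda>z. 1 / (z - a)) -` V)"
      by (intro continuous_open_preimage) (auto intro!: continuous_intros V)
    then have opL: "openin (top_of_set ?T) L" unfolding Leq by (auto simp: openin_open)
    have "L = {} \<or> L = ?T" using conT clL opL by (auto simp: connected_clopen)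
    moreover have "C \<noteq> {}" using C in_components_nonempty by blast
    then have "L \<noteq> {}" using K(3) by (auto simp: L_def)
    moreover have "a \<in> ?T" using a outside_no_overlap[of T] by blast
    ultimately show False using aL by blast
  qed
  show ?thesis
    unfolding simply_connected_eq_unbounded_complement_components[OF opU]
    using connected_recip_domain[OF T(1) a] unb by blast
qed

text \<open>A Riemann map of \<open>recip_domain T a\<close> is moved by a disc automorphism so as
  to fix 0, then rotated to have positive derivative there, and transported back by reciprocals. The
  second point \<open>b\<close> of \<open>T\<close> ensures that the domain is not the whole
  plane.\<close>

theorem exterior_map_exists:
  assumes T: "compact T" "connected T" "T \<noteq> {}" "\<forall>a. T \<noteq> {a}"
  shows "is_exterior_map T (exterior_map T)"
proof -
  obtain a where a: "a \<in> T" using T(3) by blast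
  obtain b where b: "b \<in> T" "b \<noteq> a" using T(4) a by blast
  let ?U = "recip_domain T a"
  have na: "a \<notin> outside T" using a outside_no_overlap[of T] by blast
  have opU: "open ?U" by (rule open_recip_domain[OF T(1)])
  have "b \<notin> outside T" using b(1) outside_no_overlap[of T] by blast
  then have "1 / (b - a) \<notin> ?U" using b(2) by (auto simp: recip_domain_def)
  then have "?U \<noteq> UNIV" by blast
  moreover have "?U \<noteq> {}" by (auto simp: recip_domain_def)
  ultimately obtain f g where fg: "f holomorphic_on ?U" "g holomorphic_on ball 0 1"
      "\<And>z. z \<in> ?U \<Longrightarrow> f z \<in> ball 0 1 \<and> g (f z) = z" "\<And>z. z \<in> ball 0 1 \<Longrightarrow> g z \<in> ?U \<and> f (g z) = z"
    using Riemann_mapping_theorem[of ?U] opU simply_connected_recip_domain[OF T(1,2) a] by blast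
  have U0: "0 \<in> ?U" by (simp add: recip_domain_def)
  obtain m m' where m: "m (f 0) = 0" "m holomorphic_on ball 0 1" "m ` ball 0 1 \<subseteq> ball 0 1"
      "m' holomorphic_on ball 0 1" "m' ` ball 0 1 \<subseteq> ball 0 1"
      "\<And>z. z \<in> ball 0 1 \<Longrightarrow> m (m' z) = z" "\<And>z. z \<in> ball 0 1 \<Longrightarrow> m' (m z) = z"
    using ball_biholomorphism_exists[of "f 0"] fg(3)[OF U0] by blast
  define F where "F = m \<circ> f"
  have F0: "F 0 = 0" by (simp add: F_def m(1))
  have holF: "F holomorphic_on ?U"
    unfolding F_def by (rule holomorphic_on_compose_gen[OF fg(1) m(2)]) (use fg(3) in auto)
  have bijF: "bij_betw F ?U (ball 0 1)"
  proof (rule bij_betw_byWitness[where f' = "g \<circ> m'"])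
    show "\<forall>z\<in>?U. (g \<circ> m') (F z) = z" using fg(3) m(7) by (simp add: F_def)
    show "\<forall>z\<in>ball 0 1. F ((g \<circ> m') z) = z" using fg(4) m(5,6) by (simp add: F_def image_subset_iff)
    show "F ` ?U \<subseteq> ball 0 1" using fg(3) m(3) by (auto simp: F_def image_subset_iff)
    show "(g \<circ> m') ` ball 0 1 \<subseteq> ?U" using fg(4) m(5) by (auto simp: image_subset_iff)
  qed
  have injF: "inj_on F ?U" using bijF by (simp add: bij_betw_def)
  define d where "d = deriv F 0"
  have d: "d \<noteq> 0" unfolding d_def by (rule holomorphic_injective_imp_regular[OF holF opU injF U0])
  define u where "u = cnj d / cmod d"
  have u: "cmod u = 1" using d by (simp add: u_def norm_divide)
  have ud: "u * d = cmod d" using d by (simp add: u_def complex_norm_square[symmetric] power2_eq_square mult.commute[of "cnj d"])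
  define G where "G = (\<lambda>\<omega>. u * F \<omega>)"
  have Gnz: "G \<omega> \<noteq> 0" if "\<omega> \<in> ?U" "\<omega> \<noteq> 0" for \<omega>
    using inj_onD[OF injF _ that(1) U0] that F0 u by (auto simp: G_def)
  have bijG: "bij_betw G ?U (ball 0 1)"
  proof -
    have "bij_betw (\<lambda>w. u * w) (ball 0 1) (ball 0 1)"
      by (rule bij_betw_byWitness[where f' = "\<lambda>w. w / u"]) (use u in \<open>auto simp: norm_mult norm_divide\<close>)
    from bij_betw_trans[OF bijF this] show ?thesis by (simp add: G_def o_def)
  qed
  have derG: "(G has_field_derivative complex_of_real (cmod d)) (at 0)"
  proof -
    have "(F has_field_derivative d) (at 0)" unfolding d_def by (rule holomorphic_derivI[OF holF opU U0])
    from DERIV_cmult[OF this, of u] show ?thesis by (simp add: G_def ud)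
  qed
  define \<Phi> where "\<Phi> = (\<lambda>z. 1 / G (1 / (z - a)))"
  have inU: "1 / (z - a) \<in> ?U" if "z \<in> outside T" for z
    using that na by (auto simp: recip_domain_def)
  have za: "z - a \<noteq> 0" if "z \<in> outside T" for z using that na by auto
  have "is_exterior_map T \<Phi>"
    unfolding is_exterior_map_def
  proof (intro conjI)
    have hG: "G holomorphic_on ?U" unfolding G_def by (intro holomorphic_intros holF)
    have "(\<lambda>z. 1 / (z - a)) ` outside T \<subseteq> ?U" using inU by blast
    then have "(\<lambda>z. G (1 / (z - a))) holomorphic_on outside T"
      using holomorphic_on_compose_gen[of "\<lambda>z. 1 / (z - a)" "outside T" G ?U, OF _ hG] za
      unfolding o_def by (force intro!: holomorphic_intros)
    then show "\<Phi> holomorphic_on outside T"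
      unfolding \<Phi>_def using Gnz inU za by (intro holomorphic_intros) auto
    show "bij_betw \<Phi> (outside T) {w. 1 < cmod w}"
    proof -
      have b1: "bij_betw (\<lambda>z. 1 / (z - a)) (outside T) (?U - {0})"
      proof (rule bij_betw_byWitness[where f' = "\<lambda>\<omega>. a + 1 / \<omega>"])
        show "(\<lambda>\<omega>. a + 1 / \<omega>) ` (?U - {0}) \<subseteq> outside T" by (auto simp: recip_domain_def)
        show "(\<lambda>z. 1 / (z - a)) ` outside T \<subseteq> ?U - {0}" using inU za by auto
      qed auto
      have G0: "G 0 = 0" by (simp add: G_def F0)
      have b2: "bij_betw G (?U - {0}) (ball 0 1 - {0})"
        using bij_betw_DiffI[OF bijG, of "{0}" "{0}"] U0 G0 by (auto simp: bij_betw_def)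
      have b3: "bij_betw (\<lambda>w. 1 / w) (ball 0 1 - {0}) {w :: complex. 1 < cmod w}"
        by (rule bij_betw_byWitness[where f' = "\<lambda>w. 1 / w"]) (auto simp: norm_divide pos_less_divide_eq dest: less_trans[OF zero_less_one] simp flip: zero_less_norm_iff)
      show ?thesis using bij_betw_trans[OF bij_betw_trans[OF b1 b2] b3] by (simp add: \<Phi>_def o_def)
    qed
    have lim0: "((\<lambda>z. \<Phi> z / z) \<longlongrightarrow> of_real (1 / cmod d)) at_infinity"
    proof -
      have G': "((\<lambda>\<omega>. G \<omega> / \<omega>) \<longlongrightarrow> complex_of_real (cmod d)) (at 0)"
        using derG by (simp add: DERIV_def G_def F0)
      have i: "filterlim (\<lambda>z. 1 / (z - a)) (at 0) at_infinity"
      proof -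
        have "filterlim (\<lambda>z. - a + z) at_infinity at_infinity"
          by (rule tendsto_add_filterlim_at_infinity[OF tendsto_const filterlim_ident])
        then have "filterlim (\<lambda>z. z - a) at_infinity at_infinity" by (simp add: add.commute)
        then show ?thesis using filterlim_inverse_at_iff[of "\<lambda>z. z - a" at_infinity] by (simp add: inverse_eq_divide)
      qed
      have 1: "((\<lambda>z. G (1 / (z - a)) / (1 / (z - a))) \<longlongrightarrow> complex_of_real (cmod d)) at_infinity"
        by (rule filterlim_compose[OF G' i])
      have 2: "((\<lambda>z. (z - a) / z) \<longlongrightarrow> 1) at_infinity"
      proof -
        have "((\<lambda>z. 1 - a * inverse z) \<longlongrightarrow> 1 - a * 0) at_infinity"
          by (intro tendsto_intros tendsto_inverse_0)
        moreover have "\<forall>\<^sub>F z in at_infinity. 1 - a * inverse z = (z - a) / z"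
          using eventually_not_equal_at_infinity[of 0] by eventually_elim (simp add: field_simps)
        ultimately show ?thesis by (auto elim: Lim_transform_eventually)
      qed
      have "((\<lambda>z. (z - a) / z / (G (1 / (z - a)) / (1 / (z - a)))) \<longlongrightarrow> 1 / complex_of_real (cmod d)) at_infinity"
        by (intro tendsto_divide 1 2) (use d in simp)
      moreover have "\<forall>\<^sub>F z in at_infinity. (z - a) / z / (G (1 / (z - a)) / (1 / (z - a))) = \<Phi> z / z"
        using eventually_not_equal_at_infinity[of a] by eventually_elim (simp add: \<Phi>_def)
      ultimately show ?thesis by (auto elim: Lim_transform_eventually)
    qed
    then show "\<exists>c>0. ((\<lambda>z. \<Phi> z / z) \<longlongrightarrow> of_real c) at_infinity"
      using d by (intro exI[of _ "1 / cmod d"]) simp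
    have "filterlim (\<lambda>z. \<Phi> z / z * z) at_infinity at_infinity"
      by (rule tendsto_mult_filterlim_at_infinity[OF lim0 _ filterlim_ident]) (use d in simp)
    then show "filterlim \<Phi> at_infinity at_infinity"
    proof (rule filterlim_cong[THEN iffD1, OF refl refl, rotated])
      show "\<forall>\<^sub>F z in at_infinity. \<Phi> z / z * z = \<Phi> z"
        using eventually_not_equal_at_infinity[of 0] by eventually_elim simp
    qed
  qed
  then show ?thesis unfolding exterior_map_def by (rule someI[of "is_exterior_map T"])
qed

section \<open>The inverse map, at infinity and at the boundary\<close>

locale exterior_uniformization =
  fixes T :: "complex set" and \<Phi> :: "complex \<Rightarrow> complex" and c :: real
  assumes compactT: "compact T" and connectedT: "connected T" and nonempty: "T \<noteq> {}"
    and holo: "\<Phi> holomorphic_on outside T"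
    and bij: "bij_betw \<Phi> (outside T) {w. 1 < cmod w}"
    and infinity: "filterlim \<Phi> at_infinity at_infinity"
    and c_pos: "0 < c"
    and leading: "((\<lambda>z. \<Phi> z / z) \<longlongrightarrow> of_real c) at_infinity"
begin

definition \<Psi> :: "complex \<Rightarrow> complex" where "\<Psi> = inv_into (outside T) \<Phi>"

lemma open_ext: "open (outside T)"
  using compactT by (simp add: compact_imp_closed open_outside)

lemma ext_notin: "v \<in> outside T \<Longrightarrow> v \<notin> T"
  using outside_no_overlap[of T] by blast

lemma \<Phi>_gt1: "v \<in> outside T \<Longrightarrow> 1 < cmod (\<Phi> v)"
  using bij_betwE[OF bij] by blast

lemma \<Phi>_nz: "v \<in> outside T \<Longrightarrow> \<Phi> v \<noteq> 0"
  using \<Phi>_gt1[of v] by auto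

lemma \<Psi>_\<Phi>: "v \<in> outside T \<Longrightarrow> \<Psi> (\<Phi> v) = v"
  unfolding \<Psi>_def using bij by (intro inv_into_f_f) (auto simp: bij_betw_def)

lemma \<Psi>_ext: "1 < cmod \<zeta> \<Longrightarrow> \<Psi> \<zeta> \<in> outside T"
  unfolding \<Psi>_def using bij by (intro inv_into_into) (auto simp: bij_betw_def)

lemma \<Phi>_\<Psi>: "1 < cmod \<zeta> \<Longrightarrow> \<Phi> (\<Psi> \<zeta>) = \<zeta>"
  unfolding \<Psi>_def using bij by (intro f_inv_into_f) (auto simp: bij_betw_def)

lemma continuous_\<Phi>: "continuous_on (outside T) \<Phi>"
  using holo by (rule holomorphic_on_imp_continuous_on)

lemma holo_\<Psi>: "\<Psi> holomorphic_on {w. 1 < cmod w}"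
proof -
  have im: "\<Phi> ` outside T = {w. 1 < cmod w}" and inj: "inj_on \<Phi> (outside T)"
    using bij by (auto simp: bij_betw_def)
  obtain g where g: "g holomorphic_on (\<Phi> ` outside T)" "\<And>z. z \<in> outside T \<Longrightarrow> g (\<Phi> z) = z"
    using holomorphic_has_inverse[OF holo open_ext inj] by metis
  have "g w = \<Psi> w" if "1 < cmod w" for w
    using g(2)[OF \<Psi>_ext[OF that]] \<Phi>_\<Psi>[OF that] by simp
  then show ?thesis
    using g(1) unfolding im by (rule_tac holomorphic_transform[of g]) auto
qed

lemma continuous_\<Psi>: "continuous_on {w. 1 < cmod w} \<Psi>"
  using holo_\<Psi> by (rule holomorphic_on_imp_continuous_on)

text \<open>In reciprocal coordinates \<open>\<Phi>\<close> becomes \<open>F\<close>, which extends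
  holomorphically by \<open>F 0 = 0\<close> and is open. So every point of large modulus is the
  image of a point of large modulus, and by injectivity that point is its
  \<open>\<Psi>\<close>.\<close>

lemma \<Psi>_infinity: "filterlim \<Psi> at_infinity at_infinity"
  unfolding filterlim_at_infinity[OF order_refl]
proof (intro allI impI)
  fix K :: real assume K: "K > 0"
  obtain R0 where R0: "R0 > 0" "\<And>z. R0 < cmod z \<Longrightarrow> z \<in> outside T"
    using outside_contains_exterior_ball[OF compact_imp_bounded[OF compactT]] by blast
  define \<delta> where "\<delta> = 1 / (max R0 K)"
  have \<delta>: "\<delta> > 0" using R0(1) by (simp add: \<delta>_def)
  have big: "max R0 K < cmod (inverse \<omega>)" if "\<omega> \<in> ball 0 \<delta>" "\<omega> \<noteq> 0" for \<omega>
  proof -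
    have "cmod \<omega> < 1 / max R0 K" using that by (simp add: \<delta>_def)
    then have "cmod \<omega> * max R0 K < 1" using R0(1) by (simp add: pos_less_divide_eq)
    then have "max R0 K < 1 / cmod \<omega>" using that(2) by (subst pos_less_divide_eq) (simp_all add: mult.commute)
    then show ?thesis by (simp only: norm_inverse inverse_eq_divide norm_divide norm_one)
  qed
  have out: "inverse \<omega> \<in> outside T" if "\<omega> \<in> ball 0 \<delta>" "\<omega> \<noteq> 0" for \<omega>
    using big[OF that] R0(2) by simp
  define F where "F = (\<lambda>\<omega>. if \<omega> = 0 then 0 else inverse (\<Phi> (inverse \<omega>)))"
  have hol: "F holomorphic_on ball 0 \<delta>"
  proof (rule no_isolated_singularity'[where K = "{0}"])
    have "(inverse \<longlongrightarrow> (0::complex)) at_infinity" by (rule tendsto_inverse_0)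
    then have "((\<lambda>\<omega>. inverse (\<Phi> (inverse \<omega>))) \<longlongrightarrow> 0) (at 0)"
      using filterlim_compose[OF filterlim_compose[OF _ infinity] filterlim_inverse_at_infinity] by blast
    then have "(F \<longlongrightarrow> 0) (at 0)"
      by (rule Lim_transform_eventually) (auto simp: F_def eventually_at_filter)
    then have "(F \<longlongrightarrow> 0) (at 0 within ball 0 \<delta>)" by (rule tendsto_within_subset) simp
    then show "(F \<longlongrightarrow> F z) (at z within ball 0 \<delta>)" if "z \<in> {0}" for z
      using that by (simp add: F_def)
    have sub: "inverse ` (ball 0 \<delta> - {0}) \<subseteq> outside T" using out by blast
    have "(\<Phi> \<circ> inverse) holomorphic_on (ball 0 \<delta> - {0})"
      by (rule holomorphic_on_compose_gen[OF _ holo sub]) (auto intro!: holomorphic_intros)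
    then have "(\<lambda>\<omega>. inverse (\<Phi> (inverse \<omega>))) holomorphic_on (ball 0 \<delta> - {0})"
      unfolding o_def using out \<Phi>_nz by (intro holomorphic_intros) auto
    then show "F holomorphic_on (ball 0 \<delta> - {0})"
      by (rule holomorphic_transform) (auto simp: F_def)
  qed auto
  have nc: "\<not> F constant_on ball 0 \<delta>"
  proof
    assume "F constant_on ball 0 \<delta>"
    then obtain k where k: "\<And>x. x \<in> ball 0 \<delta> \<Longrightarrow> F x = k" by (auto simp: constant_on_def)
    have "k = 0" using k[of 0] \<delta> by (simp add: F_def)
    moreover have "F (of_real (\<delta> / 2)) \<noteq> 0"
      using out[of "of_real (\<delta> / 2)"] \<delta> \<Phi>_nz by (auto simp: F_def)
    moreover have "F (of_real (\<delta> / 2)) = k" using \<delta> by (intro k) auto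
    ultimately show False by simp
  qed
  have "open (F ` ball 0 \<delta>)" by (rule open_mapping_thm[OF hol _ _ _ _ nc]) auto
  moreover have "0 \<in> F ` ball 0 \<delta>" using \<delta> by (auto simp: F_def image_iff)
  ultimately obtain e where e: "e > 0" "ball 0 e \<subseteq> F ` ball 0 \<delta>" by (auto simp: open_contains_ball)
  have "K \<le> cmod (\<Psi> \<zeta>)" if "cmod \<zeta> \<ge> max 2 (2 / e)" for \<zeta>
  proof -
    have "2 / e \<le> cmod \<zeta>" using that by simp
    then have "1 / cmod \<zeta> \<le> e / 2" using e(1) that by (simp add: divide_simps mult.commute)
    then have "inverse \<zeta> \<in> ball 0 e" using e(1) by (simp add: norm_divide inverse_eq_divide)
    then obtain \<omega> where \<omega>: "\<omega> \<in> ball 0 \<delta>" "inverse \<zeta> = F \<omega>" using e(2) by blast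
    have "\<zeta> \<noteq> 0" using that by auto
    then have "\<omega> \<noteq> 0" using \<omega>(2) by (auto simp: F_def)
    then have "\<zeta> = \<Phi> (inverse \<omega>)" using \<omega>(2) by (simp add: F_def)
    then show ?thesis using \<Psi>_\<Phi>[OF out[OF \<omega>(1) \<open>\<omega> \<noteq> 0\<close>]] big[OF \<omega>(1) \<open>\<omega> \<noteq> 0\<close>] by simp
  qed
  then show "\<forall>\<^sub>F \<zeta> in at_infinity. K \<le> cmod (\<Psi> \<zeta>)" unfolding eventually_at_infinity by blast
qed

definition r :: real where "r = 1 / c"

lemma r_pos: "r > 0" using c_pos by (simp add: r_def)

lemma \<Psi>_leading: "((\<lambda>\<zeta>. \<Psi> \<zeta> / \<zeta>) \<longlongrightarrow> of_real r) at_infinity"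
proof -
  have "((\<lambda>\<zeta>. \<Phi> (\<Psi> \<zeta>) / \<Psi> \<zeta>) \<longlongrightarrow> of_real c) at_infinity"
    by (rule filterlim_compose[OF leading \<Psi>_infinity])
  then have "((\<lambda>\<zeta>. inverse (\<Phi> (\<Psi> \<zeta>) / \<Psi> \<zeta>)) \<longlongrightarrow> inverse (of_real c)) at_infinity"
    by (rule tendsto_inverse) (use c_pos in simp)
  moreover have "\<forall>\<^sub>F \<zeta> in at_infinity. inverse (\<Phi> (\<Psi> \<zeta>) / \<Psi> \<zeta>) = \<Psi> \<zeta> / \<zeta>"
    unfolding eventually_at_infinity by (intro exI[of _ 2]) (simp add: \<Phi>_\<Psi>)
  ultimately show ?thesis
    by (auto elim: Lim_transform_eventually simp: r_def inverse_eq_divide)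
qed

lemma conformal_radius_limit: "Re (Lim at_infinity (\<lambda>z. z / \<Phi> z)) = r"
proof -
  have "((\<lambda>z. inverse (\<Phi> z / z)) \<longlongrightarrow> inverse (of_real c)) at_infinity"
    using leading by (rule tendsto_inverse) (use c_pos in simp)
  then have "((\<lambda>z. z / \<Phi> z) \<longlongrightarrow> of_real r) at_infinity" by (simp add: r_def inverse_eq_divide)
  then have "Lim at_infinity (\<lambda>z. z / \<Phi> z) = of_real r" by (intro tendsto_Lim) (simp_all add: trivial_limit_at_infinity)
  then show ?thesis by simp
qed

text \<open>Exterior points at distance at least \<open>\<kappa>\<close> from \<open>T\<close>
  inside a large disc form a compact set, as the closure of the exterior adds only points of
  \<open>T\<close>. On it \<open>cmod \<circ> \<Phi>\<close> has a minimum above 1, and outside the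
  disc \<open>\<Phi>\<close> is large anyway.\<close>

lemma shell_close:
  assumes "\<kappa> > 0"
  obtains \<rho> where "\<rho> > 1" "\<And>v. v \<in> outside T \<Longrightarrow> cmod (\<Phi> v) < \<rho> \<Longrightarrow> infdist v T < \<kappa>"
proof -
  obtain R where R: "\<And>v. R \<le> cmod v \<Longrightarrow> 2 \<le> cmod (\<Phi> v)"
    using infinity unfolding filterlim_at_infinity[OF order_refl] eventually_at_infinity by (metis zero_less_numeral)
  define K where "K = outside T \<inter> {v. \<kappa> \<le> infdist v T} \<inter> cball 0 R"
  have "closure (outside T) \<subseteq> outside T \<union> T"
    using frontier_outside_subset[OF compact_imp_closed[OF compactT]] closure_Un_frontier[of "outside T"] by blast
  then have "K = closure (outside T) \<inter> {v. \<kappa> \<le> infdist v T} \<inter> cball 0 R"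
    using closure_subset[of "outside T"] assms unfolding K_def by (auto simp: in_closure_iff_infdist_zero)
  then have "compact K" by (simp, intro compact_Int_closed closed_Int_compact closed_Int) (auto intro!: closed_Collect_le continuous_intros)
  have cK: "continuous_on K (\<lambda>v. cmod (\<Phi> v))"
    by (intro continuous_intros continuous_on_subset[OF continuous_\<Phi>]) (auto simp: K_def)
  have far: "2 \<le> cmod (\<Phi> v)" if "v \<in> outside T" "\<kappa> \<le> infdist v T" "v \<notin> K" for v
    using R[of v] that by (auto simp: K_def)
  show thesis
  proof (cases "K = {}")
    case True
    then show ?thesis using far by (intro that[of 2]) (auto simp: not_le[symmetric])
  next
    case False
    then obtain k where k: "k \<in> K" "\<And>v. v \<in> K \<Longrightarrow> cmod (\<Phi> k) \<le> cmod (\<Phi> v)"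
      using continuous_attains_inf[OF \<open>compact K\<close> False cK] by blast
    have "1 < cmod (\<Phi> k)" using k(1) \<Phi>_gt1 by (simp add: K_def)
    show ?thesis
    proof (rule that[of "min 2 (cmod (\<Phi> k))"])
      fix v assume "v \<in> outside T" "cmod (\<Phi> v) < min 2 (cmod (\<Phi> k))"
      then show "infdist v T < \<kappa>" using k(2)[of v] far[of v] by (cases "v \<in> K"; cases "\<kappa> \<le> infdist v T") auto
    qed (use \<open>1 < cmod (\<Phi> k)\<close> in auto)
  qed
qed

text \<open>The image under \<open>\<Psi>\<close> of the closed annulus from \<open>1 + e\<close> to
  \<open>\<rho>\<close> is compact in the exterior and so misses a neighbourhood of
  \<open>w\<close>; moduli beyond \<open>\<rho>\<close> are excluded because \<open>\<Psi>\<close>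
  is large there.\<close>

lemma \<Phi>_boundary:
  assumes w: "w \<in> T" shows "((\<lambda>v. cmod (\<Phi> v)) \<longlongrightarrow> 1) (at w within outside T)"
proof (rule tendstoI)
  fix e :: real assume e: "e > 0"
  obtain \<rho> where \<rho>: "\<And>\<zeta>. \<rho> \<le> cmod \<zeta> \<Longrightarrow> cmod w + 1 \<le> cmod (\<Psi> \<zeta>)"
    using \<Psi>_infinity unfolding filterlim_at_infinity[OF order_refl] eventually_at_infinity
    by (metis add.commute add_pos_nonneg norm_ge_zero zero_less_one)
  define A where "A = \<Psi> ` (cball 0 \<rho> - ball 0 (1 + e))"
  have "compact A" unfolding A_def
    by (intro compact_continuous_image continuous_on_subset[OF continuous_\<Psi>] compact_diff) (use e in auto)
  moreover have "w \<notin> A" using \<Psi>_ext ext_notin w e unfolding A_def by fastforce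
  ultimately have "open (- A \<inter> ball w 1)" "w \<in> - A \<inter> ball w 1"
    by (auto simp: open_Compl compact_imp_closed intro!: open_Int)
  then have "\<forall>\<^sub>F v in at w within outside T. v \<in> - A \<inter> ball w 1"
    by (meson eventually_at_topological)
  moreover have "\<forall>\<^sub>F v in at w within outside T. v \<in> outside T" by (simp add: eventually_at_filter)
  ultimately show "\<forall>\<^sub>F v in at w within outside T. dist (cmod (\<Phi> v)) 1 < e"
  proof eventually_elim
    case (elim v)
    have "cmod v < cmod w + 1" using elim(1) norm_triangle_ineq2[of v w] by (auto simp: dist_norm norm_minus_commute)
    then have "cmod (\<Phi> v) < \<rho>" using \<rho>[of "\<Phi> v"] \<Psi>_\<Phi>[OF elim(2)] by force
    then have "cmod (\<Phi> v) < 1 + e"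
      using elim \<Psi>_\<Phi>[OF elim(2)] unfolding A_def by (force simp: image_iff)
    then show ?case using \<Phi>_gt1[OF elim(2)] by (simp add: dist_real_def)
  qed
qed

end

section \<open>Green's function\<close>

lemma line_derivative:
  assumes "(\<lambda>s::real. u (z + of_real s * v)) differentiable (at 0)"
  shows "((\<lambda>s::real. u (z + of_real s * v)) has_real_derivative dir_deriv v u z) (at 0)"
  unfolding dir_deriv_def using assms by (simp add: DERIV_deriv_iff_real_differentiable)

lemma line_derivative_shift:
  assumes "C1_on u S" "v \<in> {1, \<i>}" "x + of_real s * v \<in> S"
  shows "((\<lambda>s::real. u (x + of_real s * v)) has_real_derivative dir_deriv v u (x + of_real s * v)) (at s)"
proof -
  have "((\<lambda>t::real. u (x + of_real s * v + of_real t * v)) has_real_derivative dir_deriv v u (x + of_real s * v)) (at 0)"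
    by (rule line_derivative) (use assms in \<open>auto simp: C1_on_def\<close>)
  then have "((\<lambda>t::real. u (x + of_real (t + s) * v)) has_real_derivative dir_deriv v u (x + of_real s * v)) (at 0)"
    by (simp add: algebra_simps)
  then show ?thesis using DERIV_shift[of "\<lambda>s. u (x + of_real s * v)" _ 0 s] by simp
qed

lemma line_bound:
  assumes u: "C1_on u S" "v \<in> {1, \<i>}" and seg: "\<And>t. \<bar>t\<bar> \<le> \<bar>h\<bar> \<Longrightarrow> x + of_real t * v \<in> S"
    and K: "\<And>t. \<bar>t\<bar> \<le> \<bar>h\<bar> \<Longrightarrow> \<bar>dir_deriv v u (x + of_real t * v)\<bar> \<le> K"
  shows "\<bar>u (x + of_real h * v) - u x\<bar> \<le> K * \<bar>h\<bar>"
proof -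
  let ?f = "\<lambda>s::real. u (x + of_real s * v)"
  have "norm (?f h - ?f 0) \<le> K * norm (h - 0)"
  proof (rule field_differentiable_bound[where S = "{t. \<bar>t\<bar> \<le> \<bar>h\<bar>}" and f' = "\<lambda>t. dir_deriv v u (x + of_real t * v)"])
    show "convex {t. \<bar>t\<bar> \<le> \<bar>h\<bar>}"
      using convex_real_interval(5)[of "- \<bar>h\<bar>" "\<bar>h\<bar>"] by (simp add: abs_le_iff atLeastAtMost_def atLeast_def atMost_def Int_def conj_commute minus_le_iff)
    show "(?f has_field_derivative dir_deriv v u (x + of_real t * v)) (at t within {t. \<bar>t\<bar> \<le> \<bar>h\<bar>})"
      if "t \<in> {t. \<bar>t\<bar> \<le> \<bar>h\<bar>}" for t
      using line_derivative_shift[OF u seg] that by (auto intro: has_field_derivative_at_within)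
  qed (use K in auto)
  then show ?thesis by simp
qed

text \<open>Go from \<open>z\<close> to \<open>y\<close> along a horizontal and then a vertical
  segment. The partial derivatives are continuous, hence locally bounded, and \<open>u\<close> is
  locally Lipschitz.\<close>

lemma C1_on_continuous:
  assumes u: "C1_on u S" and S: "open S"
  shows "continuous_on S u"
proof -
  have "isCont u z" if z: "z \<in> S" for z
  proof -
    define K where "K = max \<bar>dir_deriv 1 u z\<bar> \<bar>dir_deriv \<i> u z\<bar> + 1"
    have "isCont (dir_deriv 1 u) z" "isCont (dir_deriv \<i> u) z"
      using u z S by (auto simp: C1_on_def continuous_on_eq_continuous_at)
    then have "\<forall>\<^sub>F x in nhds z. \<bar>dir_deriv 1 u x\<bar> < K" "\<forall>\<^sub>F x in nhds z. \<bar>dir_deriv \<i> u x\<bar> < K"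
      using order_tendstoD(2)[OF tendsto_rabs] unfolding K_def continuous_at tendsto_at_iff_tendsto_nhds
      by (metis add_strict_increasing2 max.cobounded1 max.cobounded2 abs_ge_zero zero_less_one less_add_one order_le_less_trans)+
    moreover have "\<forall>\<^sub>F x in nhds z. x \<in> S" using S z by (rule eventually_nhds_in_open)
    ultimately have "\<forall>\<^sub>F x in nhds z. x \<in> S \<and> \<bar>dir_deriv 1 u x\<bar> < K \<and> \<bar>dir_deriv \<i> u x\<bar> < K"
      by eventually_elim auto
    then obtain \<delta> where \<delta>: "\<delta> > 0" "\<And>x. dist x z < \<delta> \<Longrightarrow> x \<in> S \<and> \<bar>dir_deriv 1 u x\<bar> < K \<and> \<bar>dir_deriv \<i> u x\<bar> < K"
      unfolding eventually_nhds_metric by blast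
    have bound: "\<bar>u y - u z\<bar> \<le> 2 * K * cmod (y - z)" if y: "dist y z < \<delta> / 2" for y
    proof -
      let ?a = "Re (y - z)" and ?b = "Im (y - z)"
      have c: "\<bar>?a\<bar> \<le> cmod (y - z)" "\<bar>?b\<bar> \<le> cmod (y - z)" by (rule abs_Re_le_cmod abs_Im_le_cmod)+
      have 1: "\<bar>u (z + of_real ?a * 1) - u z\<bar> \<le> K * \<bar>?a\<bar>"
        by (rule line_bound[OF u]) (use \<delta>(2) c y in \<open>force simp: dist_norm less_imp_le\<close>)+
      let ?x = "z + of_real ?a"
      have near: "dist (?x + of_real t * \<i>) z < \<delta>" if "\<bar>t\<bar> \<le> \<bar>?b\<bar>" for t
      proof -
        have e: "?x + of_real t * \<i> - z = of_real ?a + of_real t * \<i>" by simp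
        have "dist (?x + of_real t * \<i>) z \<le> \<bar>?a\<bar> + \<bar>t\<bar>"
          using norm_triangle_ineq[of "of_real ?a" "of_real t * \<i>"] unfolding dist_norm e by (simp add: norm_mult del: of_real_diff minus_complex.sel)
        also have "\<dots> < \<delta>" using that c y by (simp add: dist_norm)
        finally show ?thesis .
      qed
      have 2: "\<bar>u (?x + of_real ?b * \<i>) - u ?x\<bar> \<le> K * \<bar>?b\<bar>"
        by (rule line_bound[OF u]) (use \<delta>(2)[OF near] in \<open>auto simp: less_imp_le\<close>)
      have "?x + of_real ?b * \<i> = y" by (simp add: complex_eq_iff)
      moreover have "K \<ge> 0" by (simp add: K_def)
      then have "K * \<bar>?a\<bar> \<le> K * cmod (y - z)" "K * \<bar>?b\<bar> \<le> K * cmod (y - z)" using c by (auto intro: mult_left_mono)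
      ultimately show ?thesis using 1 2 by simp
    qed
    have lim: "((\<lambda>y. 2 * K * cmod (y - z)) \<longlongrightarrow> 0) (at z)" by (auto intro!: tendsto_eq_intros)
    have "\<forall>\<^sub>F y in at z. norm (u y - u z) \<le> 2 * K * cmod (y - z)"
      unfolding eventually_at using bound \<delta>(1) by (intro exI[of _ "\<delta> / 2"]) auto
    from Lim_null_comparison[OF this lim] have "((\<lambda>y. u y - u z) \<longlongrightarrow> 0) (at z)" .
    then show ?thesis by (simp add: isCont_def LIM_zero_iff)
  qed
  then show ?thesis using S by (simp add: continuous_on_eq_continuous_at)
qed

lemma second_derivative_test:
  fixes f :: "real \<Rightarrow> real"
  assumes \<delta>: "\<delta> > 0" and f: "\<And>s. \<bar>s\<bar> < \<delta> \<Longrightarrow> (f has_real_derivative f' s) (at s)"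
    and f': "(f' has_real_derivative l) (at 0)"
    and max: "\<And>s. \<bar>s\<bar> < \<delta> \<Longrightarrow> f s \<le> f 0"
  shows "l \<le> 0"
proof (rule ccontr)
  assume "\<not> l \<le> 0"
  then have l: "l > 0" by simp
  have "f' 0 = 0" by (rule DERIV_local_max[OF f \<delta>]) (use \<delta> max in auto)
  with DERIV_pos_inc_right[OF f' l] obtain e where e: "e > 0" "\<And>h. h > 0 \<Longrightarrow> h < e \<Longrightarrow> 0 < f' h" by auto
  define h where "h = min e \<delta> / 2"
  have h: "0 < h" "h < e" "h < \<delta>" using e \<delta> by (auto simp: h_def)
  have "f 0 < f h"
    by (rule DERIV_pos_imp_increasing_open[OF h(1)])
       (use f e h in \<open>force intro!: DERIV_continuous_on DERIV_subset[OF f]\<close>)+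
  then show False using max[of h] h by simp
qed

text \<open>Maximum principle for \<open>G - (1 + \<epsilon>) H\<close>, made strict by adding a small multiple of \<open>|x - z|\<^sup>2\<close>.\<close>

lemma green_function_le:
  assumes T: "compact T" and G: "is_green_function T G" and H: "is_green_function T H" and z: "z \<in> outside T"
  shows "G z \<le> H z"
proof -
  let ?S = "outside T"
  have S: "open ?S" using T by (simp add: compact_imp_closed open_outside)
  have c1: "C1_on G ?S" "C1_on H ?S" and c2: "\<And>v. v \<in> {1, \<i>} \<Longrightarrow> C1_on (dir_deriv v G) ?S" "\<And>v. v \<in> {1, \<i>} \<Longrightarrow> C1_on (dir_deriv v H) ?S"
    using G H by (auto simp: is_green_function_def harmonic_on_def C2_on_def)
  have lap: "dir_deriv 1 (dir_deriv 1 G) x + dir_deriv \<i> (dir_deriv \<i> G) x = 0"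
     "dir_deriv 1 (dir_deriv 1 H) x + dir_deriv \<i> (dir_deriv \<i> H) x = 0" if "x \<in> ?S" for x
    using G H that by (auto simp: is_green_function_def harmonic_on_def)
  have main: "G z \<le> (1 + \<epsilon>) * H z" if \<epsilon>: "\<epsilon> > 0" for \<epsilon>
  proof (rule ccontr)
    define U where "U = (\<lambda>x. G x - (1 + \<epsilon>) * H x)"
    assume "\<not> G z \<le> (1 + \<epsilon>) * H z"
    then have p: "U z > 0" by (simp add: U_def)
    define K where "K = {x \<in> ?S. U z / 2 \<le> U x}"
    have contU: "continuous_on ?S U"
      unfolding U_def by (intro continuous_intros C1_on_continuous c1 S)
    have "open (- K)"
    proof (subst open_subopen, intro ballI)
      fix x assume x: "x \<in> - K"
      consider "x \<in> ?S" | "x \<in> T" | "x \<in> inside T" using inside_Un_outside[of T] by blast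
      then show "\<exists>N. open N \<and> x \<in> N \<and> N \<subseteq> - K"
      proof cases
        case 1
        have "open (?S \<inter> U -` {..<U z / 2})" by (rule continuous_open_preimage[OF contU S]) auto
        then show ?thesis using 1 x by (intro exI[of _ "?S \<inter> U -` {..<U z / 2}"]) (auto simp: K_def)
      next
        case 2
        have "(U \<longlongrightarrow> 0 - (1 + \<epsilon>) * 0) (at x within ?S)" unfolding U_def
          by (intro tendsto_intros) (use G H 2 in \<open>auto simp: is_green_function_def\<close>)
        then have "\<forall>\<^sub>F v in at x within ?S. U v < U z / 2" using p by (intro order_tendstoD) auto
        then obtain N where "open N" "x \<in> N" "\<forall>v\<in>N. v \<noteq> x \<longrightarrow> v \<in> ?S \<longrightarrow> U v < U z / 2"
          unfolding eventually_at_topological by blast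
        then show ?thesis using x by (intro exI[of _ N]) (fastforce simp: K_def)
      next
        case 3
        then show ?thesis using open_inside[OF compact_imp_closed[OF T]] inside_Int_outside[of T]
          by (intro exI[of _ "inside T"]) (auto simp: K_def disjoint_iff simp del: inside_Int_outside)
      qed
    qed
    then have clK: "closed K" by (simp add: closed_def)
    \<comment> \<open>The factor \<open>1 + \<epsilon>\<close> is needed at infinity: relative to
      the logarithm, \<open>U\<close> tends to \<open>- \<epsilon>\<close>.\<close>
    have "\<exists>R. \<forall>x. R \<le> cmod x \<longrightarrow> U x \<le> 0"
    proof -
      let ?l = "\<lambda>z::complex. 1 / pi * ln (cmod z)"
      have lpos: "\<forall>\<^sub>F x in at_infinity. ?l x > 0"
        unfolding eventually_at_infinity by (intro exI[of _ 2]) (auto intro!: divide_pos_pos ln_gt_zero)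
      then have nz: "\<forall>\<^sub>F x in at_infinity. f x \<noteq> 0 \<or> ?l x \<noteq> 0" for f :: "complex \<Rightarrow> real"
        by eventually_elim auto
      have "((\<lambda>x. G x / ?l x - (1 + \<epsilon>) * (H x / ?l x)) \<longlongrightarrow> 1 - (1 + \<epsilon>) * 1) at_infinity"
        by (intro tendsto_intros asymp_equivD_strong nz) (use G H in \<open>auto simp: is_green_function_def\<close>)
      then have "\<forall>\<^sub>F x in at_infinity. G x / ?l x - (1 + \<epsilon>) * (H x / ?l x) < 0"
        using \<epsilon> by (intro order_tendstoD) auto
      with lpos have "\<forall>\<^sub>F x in at_infinity. U x \<le> 0"
      proof eventually_elim
        case (elim x)
        have "G x / ?l x - (1 + \<epsilon>) * (H x / ?l x) = U x / ?l x"
          by (simp only: U_def diff_divide_distrib times_divide_eq_right)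
        then have "U x / ?l x < 0" using elim(2) by (simp only:)
        then show ?case using elim(1) unfolding divide_less_0_iff by linarith
      qed
      then show ?thesis unfolding eventually_at_infinity .
    qed
    then obtain R where R: "\<And>x. R \<le> cmod x \<Longrightarrow> U x \<le> 0" by blast
    have sub: "K \<subseteq> cball 0 R"
    proof
      fix x assume "x \<in> K"
      then have "\<not> U x \<le> 0" using p by (simp add: K_def)
      then have "\<not> R \<le> cmod x" using R by blast
      then show "x \<in> cball 0 R" by simp
    qed
    then have "compact K" using clK bounded_subset[OF bounded_cball] by (auto simp: compact_eq_bounded_closed)
    \<comment> \<open>The quadratic term is at most \<open>U z / 4\<close> on \<open>K\<close>. A
      maximum point of \<open>V\<close> then satisfies \<open>U x > U z / 2\<close> strictly and is
      interior to \<open>K\<close>, where the second derivatives can be tested in both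
      directions.\<close>
    define \<kappa> where "\<kappa> = U z / (4 * (R + cmod z + 1)\<^sup>2)"
    have R0: "R \<ge> 0"
    proof -
      have "z \<in> K" using z p by (simp add: K_def)
      then have "cmod z \<le> R" using sub by auto
      then show ?thesis using norm_ge_zero[of z] by linarith
    qed
    have pos: "(R + cmod z + 1)\<^sup>2 > 0" using R0 by (intro zero_less_power add_nonneg_pos) auto
    then have \<kappa>: "\<kappa> > 0" using p by (simp add: \<kappa>_def)
    define V where "V = (\<lambda>x. U x + \<kappa> * (cmod (x - z))\<^sup>2)"
    have "continuous_on K V" unfolding V_def
      by (intro continuous_intros continuous_on_subset[OF contU]) (auto simp: K_def)
    moreover have zK: "z \<in> K" using z p by (simp add: K_def)
    ultimately obtain x where x: "x \<in> K" "\<And>y. y \<in> K \<Longrightarrow> V y \<le> V x"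
      using continuous_attains_sup[OF \<open>compact K\<close>] by blast
    have xS: "x \<in> ?S" using x(1) by (simp add: K_def)
    have "V z \<le> V x" using x(2) zK by blast
    then have "U z \<le> U x + \<kappa> * (cmod (x - z))\<^sup>2" by (simp add: V_def)
    moreover have "\<kappa> * (cmod (x - z))\<^sup>2 \<le> U z / 4"
    proof -
      have "cmod (x - z) \<le> R + cmod z + 1" using norm_triangle_ineq4[of x z] sub x(1) by auto
      then have "\<kappa> * (cmod (x - z))\<^sup>2 \<le> \<kappa> * (R + cmod z + 1)\<^sup>2" using \<kappa> by (intro mult_left_mono power_mono) auto
      then show ?thesis using pos by (simp add: \<kappa>_def)
    qed
    ultimately have Ux: "U z / 2 < U x" using p by linarith
    have "open (?S \<inter> U -` {U z / 2<..})" by (rule continuous_open_preimage[OF contU S]) auto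
    moreover have "x \<in> ?S \<inter> U -` {U z / 2<..}" using Ux xS by auto
    ultimately obtain \<delta> where \<delta>: "\<delta> > 0" "ball x \<delta> \<subseteq> ?S \<inter> U -` {U z / 2<..}" by (meson open_contains_ball)
    have test: "dir_deriv v (dir_deriv v G) x - (1 + \<epsilon>) * dir_deriv v (dir_deriv v H) x + 2 * \<kappa> \<le> 0" if v: "v \<in> {1, \<i>}" for v
    proof (rule second_derivative_test[OF \<delta>(1)])
      define b where "b = Re (cnj v * (x - z))"
      have v1: "cmod v = 1" using v by auto
      have quad: "(cmod (x + of_real s * v - z))\<^sup>2 = (cmod (x - z))\<^sup>2 + 2 * b * s + s\<^sup>2" for s
        using v unfolding cmod_power2 b_def by (auto simp: power2_eq_square algebra_simps)
      have inS: "x + of_real s * v \<in> ball x \<delta>" if "\<bar>s\<bar> < \<delta>" for s :: real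
        using that v1 by (simp add: dist_norm norm_mult)
      let ?f = "\<lambda>s. G (x + of_real s * v) - (1 + \<epsilon>) * H (x + of_real s * v) + \<kappa> * ((cmod (x - z))\<^sup>2 + 2 * b * s + s\<^sup>2)"
      let ?f' = "\<lambda>s. dir_deriv v G (x + of_real s * v) - (1 + \<epsilon>) * dir_deriv v H (x + of_real s * v) + \<kappa> * (2 * b + 2 * s)"
      have fV: "?f s = V (x + of_real s * v)" for s by (simp only: V_def U_def quad)
      show "(?f has_real_derivative ?f' s) (at s)" if "\<bar>s\<bar> < \<delta>" for s
        using inS[OF that] \<delta>(2)
        by (intro DERIV_add DERIV_diff DERIV_cmult line_derivative_shift[OF c1(1) v] line_derivative_shift[OF c1(2) v])
           (auto intro!: derivative_eq_intros)
      show "?f s \<le> ?f 0" if "\<bar>s\<bar> < \<delta>" for s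
      proof -
        have "x + of_real s * v \<in> ?S \<inter> U -` {U z / 2<..}" using inS[OF that] \<delta>(2) by blast
        then have "x + of_real s * v \<in> K" by (auto simp: K_def)
        then show ?thesis using x(2) unfolding fV by simp
      qed
      have "(?f' has_real_derivative dir_deriv v (dir_deriv v G) (x + of_real 0 * v) - (1 + \<epsilon>) * dir_deriv v (dir_deriv v H) (x + of_real 0 * v) + \<kappa> * 2) (at 0)"
        by (intro DERIV_add DERIV_diff DERIV_cmult line_derivative_shift[OF c2(1) v] line_derivative_shift[OF c2(2) v] v)
           (use xS in \<open>auto intro!: derivative_eq_intros\<close>)
      then show "(?f' has_real_derivative dir_deriv v (dir_deriv v G) x - (1 + \<epsilon>) * dir_deriv v (dir_deriv v H) x + 2 * \<kappa>) (at 0)"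
        by (simp add: mult.commute)
    qed
    have "dir_deriv 1 (dir_deriv 1 G) x + dir_deriv \<i> (dir_deriv \<i> G) x
        - (1 + \<epsilon>) * (dir_deriv 1 (dir_deriv 1 H) x + dir_deriv \<i> (dir_deriv \<i> H) x) + 4 * \<kappa> \<le> 0"
      using test[of 1] test[of \<i>] by (simp add: algebra_simps)
    then show False using lap[OF xS] \<kappa> by simp
  qed
  have "((\<lambda>\<epsilon>. (1 + \<epsilon>) * H z) \<longlongrightarrow> (1 + 0) * H z) (at_right 0)" by (intro tendsto_intros)
  then have "((\<lambda>\<epsilon>. (1 + \<epsilon>) * H z) \<longlongrightarrow> H z) (at_right 0)" by simp
  then show ?thesis
    by (rule tendsto_lowerbound) (use main in \<open>auto intro!: eventually_at_rightI[of 0 1]\<close>)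
qed

section \<open>Logarithms of moduli as harmonic functions\<close>

lemma line_derivative_Re:
  assumes "(g has_field_derivative g') (at z)"
  shows "((\<lambda>s::real. Re (g (z + of_real s * v))) has_real_derivative Re (v * g')) (at 0)"
proof -
  have "((\<lambda>s::real. z + of_real s * v) has_vector_derivative v) (at 0)"
    by (auto intro!: derivative_eq_intros)
  then have "(g \<circ> (\<lambda>s::real. z + of_real s * v) has_vector_derivative v * g') (at 0)"
    by (rule field_vector_diff_chain_at) (use assms in simp)
  from bounded_linear.has_vector_derivative[OF bounded_linear_Re this] show ?thesis
    by (simp add: has_real_derivative_iff_has_vector_derivative o_def)
qed

lemma dir_deriv_cong:
  fixes u w :: "complex \<Rightarrow> real"
  assumes "open S" "z \<in> S" "\<And>x. x \<in> S \<Longrightarrow> u x = w x"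
    and "((\<lambda>s::real. w (z + of_real s * v)) has_real_derivative D) (at 0)"
  shows "((\<lambda>s::real. u (z + of_real s * v)) has_real_derivative D) (at 0)"
proof -
  have "open ((\<lambda>s::real. z + of_real s * v) -` S)"
    by (intro open_vimage assms(1)) (auto intro!: continuous_intros)
  moreover have "0 \<in> (\<lambda>s::real. z + of_real s * v) -` S" using assms(2) by simp
  ultimately have "\<forall>\<^sub>F s in nhds 0. s \<in> (\<lambda>s::real. z + of_real s * v) -` S" by (rule eventually_nhds_in_open)
  then have "\<forall>\<^sub>F s in nhds 0. u (z + of_real s * v) = w (z + of_real s * v)"
    by eventually_elim (use assms(3) in auto)
  then show ?thesis using assms(4) DERIV_cong_ev[OF refl, of "\<lambda>s. u (z + of_real s * v)" "\<lambda>s. w (z + of_real s * v)" 0 D D] by simp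
qed

lemma C1_on_intro:
  assumes S: "open S" and "\<And>v z. v \<in> {1, \<i>} \<Longrightarrow> z \<in> S \<Longrightarrow> ((\<lambda>s::real. u (z + of_real s * v)) has_real_derivative D v z) (at 0)"
    and "\<And>v. v \<in> {1, \<i>} \<Longrightarrow> continuous_on S (D v)"
  shows "C1_on u S" "\<And>v z. v \<in> {1, \<i>} \<Longrightarrow> z \<in> S \<Longrightarrow> dir_deriv v u z = D v z"
proof -
  show eq: "dir_deriv v u z = D v z" if "v \<in> {1, \<i>}" "z \<in> S" for v z
    unfolding dir_deriv_def using assms(2)[OF that] by (rule DERIV_imp_deriv)
  show "C1_on u S" unfolding C1_on_def
  proof (intro ballI conjI)
    fix v :: complex assume v: "v \<in> {1, \<i>}"
    show "(\<lambda>s::real. u (z + of_real s * v)) differentiable (at 0)" if "z \<in> S" for z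
      using assms(2)[OF v that] real_differentiable_def by blast
    show "continuous_on S (dir_deriv v u)"
      using continuous_on_cong[of S S "dir_deriv v u" "D v"] assms(3)[OF v] eq[OF v] by simp
  qed
qed

lemma harmonic_on_ln_cmod:
  assumes S: "open S" and f: "f holomorphic_on S" "\<And>z. z \<in> S \<Longrightarrow> f z \<noteq> 0"
  shows "harmonic_on (\<lambda>z. k * ln (cmod (f z))) S"
proof -
  let ?u = "\<lambda>z. k * ln (cmod (f z))"
  define g where "g = (\<lambda>z. of_real k * (deriv f z / f z))"
  have holg: "g holomorphic_on S" unfolding g_def using f S by (intro holomorphic_intros) auto
  have gd: "(g has_field_derivative deriv g z) (at z)" if "z \<in> S" for z
    by (rule holomorphic_derivI[OF holg S that])
  have 1: "((\<lambda>s::real. ?u (z + of_real s * v)) has_real_derivative Re (v * g z)) (at 0)" if z: "z \<in> S" for v z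
  proof (rule dir_deriv_cong[OF S z])
    \<comment> \<open>Dividing by \<open>f z\<close> places the argument of \<open>Ln\<close> at 1,
      away from the branch cut, so \<open>?L\<close> is differentiable at \<open>z\<close>. The real
      parts agree on all of \<open>S\<close>, across the cut as well, since the modulus is
      insensitive to the branch.\<close>
    let ?L = "\<lambda>x. of_real k * (Ln (f x / f z) + of_real (ln (cmod (f z))))"
    show "?u x = Re (?L x)" if "x \<in> S" for x
      using f(2)[OF that] f(2)[OF z] by (simp add: Re_Ln norm_divide ln_div)
    have "(f has_field_derivative deriv f z) (at z)" by (rule holomorphic_derivI[OF f(1) S z])
    then have "(?L has_field_derivative g z) (at z)"
      unfolding g_def using f(2)[OF z] by (auto intro!: derivative_eq_intros)
    then show "((\<lambda>s::real. Re (?L (z + of_real s * v))) has_real_derivative Re (v * g z)) (at 0)"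
      by (rule line_derivative_Re)
  qed
  have c0: "continuous_on S (\<lambda>z. Re (v * g z))" for v
    by (intro continuous_intros holomorphic_on_imp_continuous_on holg)
  have a1: "C1_on ?u S" and a2: "\<And>v z. v \<in> {1, \<i>} \<Longrightarrow> z \<in> S \<Longrightarrow> dir_deriv v ?u z = Re (v * g z)"
    using C1_on_intro[OF S, of ?u "\<lambda>v z. Re (v * g z)"] 1 c0 by blast+
  have 2: "((\<lambda>s::real. dir_deriv w ?u (z + of_real s * v)) has_real_derivative Re (v * (w * deriv g z))) (at 0)"
    if z: "z \<in> S" and w: "w \<in> {1, \<i>}" for v w z
  proof (rule dir_deriv_cong[OF S z a2[OF w]])
    show "((\<lambda>s::real. Re (w * g (z + of_real s * v))) has_real_derivative Re (v * (w * deriv g z))) (at 0)"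
      by (rule line_derivative_Re[where g = "\<lambda>x. w * g x"]) (intro DERIV_cmult gd z)
  qed
  have c: "continuous_on S (\<lambda>z. Re (v * (w * deriv g z)))" for v w
    by (intro continuous_intros holomorphic_on_imp_continuous_on holomorphic_deriv holg S)
  have b1: "C1_on (dir_deriv w ?u) S" and b2: "\<And>v z. v \<in> {1, \<i>} \<Longrightarrow> z \<in> S \<Longrightarrow> dir_deriv v (dir_deriv w ?u) z = Re (v * (w * deriv g z))"
    if "w \<in> {1, \<i>}" for w
    using C1_on_intro[OF S, of "dir_deriv w ?u" "\<lambda>v z. Re (v * (w * deriv g z))"] 2[OF _ that] c by blast+
  show ?thesis unfolding harmonic_on_def C2_on_def
    using a1 b1 b2[of 1 1] b2[of \<i> \<i>] by auto
qed

context exterior_uniformization begin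

lemma is_green_function_ln_\<Phi>: "is_green_function T (\<lambda>z. 1 / pi * ln (cmod (\<Phi> z)))"
  unfolding is_green_function_def
proof (intro conjI ballI)
  show "harmonic_on (\<lambda>z. 1 / pi * ln (cmod (\<Phi> z))) (outside T)"
    by (rule harmonic_on_ln_cmod[OF open_ext holo \<Phi>_nz])
  show "((\<lambda>z. 1 / pi * ln (cmod (\<Phi> z))) \<longlongrightarrow> 0) (at w within outside T)" if "w \<in> T" for w
    using tendsto_mult[OF tendsto_const[of "1 / pi"] tendsto_ln[OF \<Phi>_boundary[OF that]]] by simp
  have lc: "((\<lambda>z. ln (cmod (\<Phi> z / z))) \<longlongrightarrow> ln (cmod (of_real c :: complex))) at_infinity"
    using c_pos by (intro tendsto_ln tendsto_norm leading) simp
  have "filterlim (\<lambda>z::complex. ln (cmod z)) at_top at_infinity"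
    by (rule filterlim_compose[OF ln_at_top filterlim_norm_at_top])
  then have "((\<lambda>z. ln (cmod (\<Phi> z / z)) / ln (cmod z)) \<longlongrightarrow> 0) at_infinity"
    by (intro real_tendsto_divide_at_top[OF lc])
  from tendsto_add[OF tendsto_const[of 1] this]
  have "((\<lambda>z. 1 + ln (cmod (\<Phi> z / z)) / ln (cmod z)) \<longlongrightarrow> 1) at_infinity" by simp
  moreover obtain R where R: "\<And>z. R < cmod z \<Longrightarrow> z \<in> outside T"
    using outside_contains_exterior_ball[OF compact_imp_bounded[OF compactT]] by metis
  have "\<forall>\<^sub>F z in at_infinity. 1 + ln (cmod (\<Phi> z / z)) / ln (cmod z)
      = 1 / pi * ln (cmod (\<Phi> z)) / (1 / pi * ln (cmod z))"
    unfolding eventually_at_infinity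
  proof (intro exI[of _ "max 2 (R + 1)"] allI impI)
    fix z :: complex assume "max 2 (R + 1) \<le> cmod z"
    then have "1 < cmod z" "R < cmod z" by auto
    then have z: "z \<noteq> 0" "ln (cmod z) > 0" "\<Phi> z \<noteq> 0" using R \<Phi>_nz by (auto intro: ln_gt_zero)
    then show "1 + ln (cmod (\<Phi> z / z)) / ln (cmod z) = 1 / pi * ln (cmod (\<Phi> z)) / (1 / pi * ln (cmod z))"
      by (simp add: norm_divide ln_div diff_divide_distrib)
  qed
  ultimately show "(\<lambda>z. 1 / pi * ln (cmod (\<Phi> z))) \<sim>[at_infinity] (\<lambda>z. 1 / pi * ln (cmod z))"
    by (intro asymp_equivI') (auto elim: Lim_transform_eventually)
qed

lemma green_function_eq: "v \<in> outside T \<Longrightarrow> green_function T v = 1 / pi * ln (cmod (\<Phi> v))"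
proof -
  assume v: "v \<in> outside T"
  have "is_green_function T (green_function T)"
    unfolding green_function_def using is_green_function_ln_\<Phi> by (rule someI[of "is_green_function T"])
  then show ?thesis
    using green_function_le[OF compactT _ _ v] is_green_function_ln_\<Phi> by (meson antisym)
qed

end

section \<open>Averages over level curves\<close>

lemma norm_circlepath_0: "s \<ge> 0 \<Longrightarrow> cmod (circlepath 0 s \<theta>) = s"
  by (simp add: circlepath norm_mult)

text \<open>Cauchy's formula for Taylor coefficients, with the derivative
  \<open>2 * pi * \<i> * c\<close> of the circle cancelling one power in the denominator.\<close>

lemma circle_average_coefficient:
  assumes f: "f holomorphic_on ball 0 R" and s: "0 < s" "s < R"
  shows "((\<lambda>\<theta>. f (circlepath 0 s \<theta>) / circlepath 0 s \<theta> ^ k) has_integral (deriv ^^ k) f 0 / fact k) {0..1}"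
proof -
  let ?c = "circlepath 0 s"
  have cf: "continuous_on (cball 0 s) f" "f holomorphic_on ball 0 s"
    using f s by (auto intro!: holomorphic_on_imp_continuous_on intro: holomorphic_on_subset)
  define I where "I = contour_integral ?c (\<lambda>u. f u / (u - 0) ^ Suc k)"
  have w: "(0::complex) \<in> ball 0 s" using s by simp
  have "((\<lambda>u. f u / (u - 0) ^ Suc k) has_contour_integral I) ?c"
    unfolding I_def using Cauchy_higher_derivative_integral_circlepath(1)[OF cf w] by (rule has_contour_integral_integral)
  then have "((\<lambda>x. f (?c x) / (?c x - 0) ^ Suc k * vector_derivative ?c (at x within {0..1})) has_integral I) {0..1}"
    by (simp add: has_contour_integral_def)
  then have "((\<lambda>x. 1 / (2 * pi * \<i>) * (f (?c x) / (?c x - 0) ^ Suc k * vector_derivative ?c (at x within {0..1}))) has_integral 1 / (2 * pi * \<i>) * I) {0..1}"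
    by (rule has_integral_mult_right)
  moreover have "1 / (2 * pi * \<i>) * I = (deriv ^^ k) f 0 / fact k"
    using Cauchy_higher_derivative_integral_circlepath(2)[OF cf w, of k] by (simp add: I_def)
  ultimately have "((\<lambda>x. 1 / (2 * pi * \<i>) * (f (?c x) / (?c x - 0) ^ Suc k * vector_derivative ?c (at x within {0..1}))) has_integral (deriv ^^ k) f 0 / fact k) {0..1}"
    by simp
  then show ?thesis
  proof (rule has_integral_eq[rotated])
    fix x :: real assume x: "x \<in> {0..1}"
    have nz: "?c x \<noteq> 0" using norm_circlepath_0[of s x] s by auto
    have "vector_derivative ?c (at x within {0..1}) = 2 * pi * \<i> * ?c x"
      using vector_derivative_circlepath01[of x 0 s] x by (simp add: circlepath)
    then show "1 / (2 * pi * \<i>) * (f (?c x) / (?c x - 0) ^ Suc k * vector_derivative ?c (at x within {0..1})) = f (?c x) / ?c x ^ k"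
      using nz by simp
  qed
qed

lemma circle_average_power:
  assumes f: "f holomorphic_on ball 0 R" and s: "0 < s" "s < R" and k: "k > 0"
  shows "((\<lambda>\<theta>. f (circlepath 0 s \<theta>) * circlepath 0 s \<theta> ^ k) has_integral 0) {0..1}"
proof -
  have "(\<lambda>u. f u * u ^ k) holomorphic_on ball 0 R" by (intro holomorphic_intros f)
  from circle_average_coefficient[OF this s, of 0] show ?thesis using k by (simp add: zero_power)
qed

lemma circle_average_log:
  assumes F: "F holomorphic_on ball 0 R" "\<And>\<eta>. \<eta> \<in> ball 0 R \<Longrightarrow> F \<eta> \<noteq> 0" and s: "0 < s" "s < R"
  shows "((\<lambda>\<theta>. ln (cmod (F (circlepath 0 s \<theta>)))) has_integral ln (cmod (F 0))) {0..1}"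
proof -
  obtain g where g: "g holomorphic_on ball 0 R" "\<And>\<eta>. \<eta> \<in> ball 0 R \<Longrightarrow> F \<eta> = exp (g \<eta>)"
    using contractible_imp_holomorphic_log[OF F(1) convex_imp_contractible[OF convex_ball] F(2)] by blast
  have "((\<lambda>\<theta>. g (circlepath 0 s \<theta>)) has_integral g 0) {0..1}"
    using circle_average_coefficient[OF g(1) s, of 0] by simp
  from has_integral_linear[OF this bounded_linear_Re]
  have "((\<lambda>\<theta>. Re (g (circlepath 0 s \<theta>))) has_integral Re (g 0)) {0..1}" by (simp add: o_def)
  moreover have "Re (g (circlepath 0 s \<theta>)) = ln (cmod (F (circlepath 0 s \<theta>)))" for \<theta>
    using g(2)[of "circlepath 0 s \<theta>"] norm_circlepath_0[of s \<theta>] s by simp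
  moreover have "Re (g 0) = ln (cmod (F 0))" using g(2)[of 0] s by simp
  ultimately show ?thesis by simp
qed

text \<open>A coefficient is the average of \<open>2 Re p\<close> against a character, since
  the conjugate of \<open>p\<close> has no positive frequencies.\<close>

lemma coefficient_bound_nonneg_Re:
  assumes p: "p holomorphic_on ball 0 1" and pos: "\<And>\<eta>. \<eta> \<in> ball 0 1 \<Longrightarrow> Re (p \<eta>) \<ge> 0" and k: "k > 0"
  shows "cmod ((deriv ^^ k) p 0 / fact k) \<le> 2 * Re (p 0)"
proof -
  let ?a = "(deriv ^^ k) p 0 / fact k"
  have main: "cmod ?a * s ^ k \<le> 2 * Re (p 0)" if s: "0 < s" "s < 1" for s
  proof -
    let ?c = "circlepath 0 s"
    have nc: "cmod (?c \<theta>) = s" for \<theta> using norm_circlepath_0 s by simp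
    have "((\<lambda>\<theta>. cnj (p (?c \<theta>) * ?c \<theta> ^ k)) has_integral cnj 0) {0..1}"
      using has_integral_linear[OF circle_average_power[OF p s k] bounded_linear_cnj] by (simp add: o_def)
    from has_integral_mult_right[OF this, of "1 / of_real s ^ (2 * k)"]
    have "((\<lambda>\<theta>. 1 / of_real s ^ (2 * k) * cnj (p (?c \<theta>) * ?c \<theta> ^ k)) has_integral 0) {0..1}" by simp
    from has_integral_add[OF circle_average_coefficient[OF p s, of k] this]
    have "((\<lambda>\<theta>. p (?c \<theta>) / ?c \<theta> ^ k + 1 / of_real s ^ (2 * k) * cnj (p (?c \<theta>) * ?c \<theta> ^ k)) has_integral ?a) {0..1}" by simp
    moreover have "p (?c \<theta>) / ?c \<theta> ^ k + 1 / of_real s ^ (2 * k) * cnj (p (?c \<theta>) * ?c \<theta> ^ k)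
         = of_real (2 * Re (p (?c \<theta>))) / ?c \<theta> ^ k" for \<theta>
    proof -
      have nz: "?c \<theta> \<noteq> 0" using nc[of \<theta>] s by auto
      have "?c \<theta> * cnj (?c \<theta>) = of_real s ^ 2" using nc[of \<theta>] by (simp add: complex_norm_square[symmetric])
      then have "?c \<theta> ^ k * cnj (?c \<theta>) ^ k = of_real s ^ (2 * k)" by (metis power_mult power_mult_distrib)
      then have "cnj (?c \<theta>) ^ k = of_real s ^ (2 * k) / ?c \<theta> ^ k" using nz by (simp add: field_simps)
      then have "1 / of_real s ^ (2 * k) * cnj (p (?c \<theta>) * ?c \<theta> ^ k) = cnj (p (?c \<theta>)) / ?c \<theta> ^ k"
        using s by simp
      then show ?thesis by (simp add: complex_add_cnj add_divide_distrib[symmetric])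
    qed
    ultimately have i: "((\<lambda>\<theta>. of_real (2 * Re (p (?c \<theta>))) / ?c \<theta> ^ k) has_integral ?a) {0..1}" by simp
    have j: "((\<lambda>\<theta>. 2 * Re (p (?c \<theta>)) / s ^ k) has_integral 2 * Re (p 0) / s ^ k) {0..1}"
      using has_integral_linear[OF circle_average_coefficient[OF p s, of 0] bounded_linear_Re]
      by (auto simp: o_def intro!: has_integral_divide has_integral_mult_right)
    have "cmod ?a \<le> 2 * Re (p 0) / s ^ k"
      using integral_norm_bound_integral[OF has_integral_integrable[OF i] has_integral_integrable[OF j]] nc pos s
      unfolding integral_unique[OF i] integral_unique[OF j]
      by (simp add: norm_divide norm_mult norm_power)
    then show ?thesis using s by (simp add: pos_le_divide_eq)
  qed
  have "((\<lambda>s. cmod ?a * s ^ k) \<longlongrightarrow> cmod ?a * 1 ^ k) (at_left 1)" by (intro tendsto_intros)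
  then show ?thesis
    by (intro tendsto_upperbound[of _ _ "at_left 1"])
       (auto intro!: eventually_at_leftI[of 0 1] main simp: trivial_limit_at_left_real)
qed

text \<open>On the circle of radius \<open>s\<close> reflection leaves the modulus unchanged:
  \<open>c - b\<close> has the same modulus as \<open>s - cnj b * c / s\<close>. The latter is
  zero-free on a larger disc, its zero being the mirror image of \<open>b\<close>.\<close>

lemma circle_average_log_linear:
  assumes s: "cmod b < s"
  shows "((\<lambda>\<theta>. ln (cmod (circlepath 0 s \<theta> - b))) has_integral ln s) {0..1}"
proof (cases "b = 0")
  case True
  then show ?thesis using s norm_circlepath_0[of s] has_integral_const_real[of "ln s" 0 1] by simp
next
  case False
  have s0: "s > 0" using s norm_ge_zero[of b] by linarith
  let ?F = "\<lambda>\<eta>::complex. of_real s - cnj b * \<eta> / of_real s"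
  have R: "s < s\<^sup>2 / cmod b" using s s0 False by (simp add: pos_less_divide_eq power2_eq_square)
  have "((\<lambda>\<theta>. ln (cmod (?F (circlepath 0 s \<theta>)))) has_integral ln (cmod (?F 0))) {0..1}"
  proof (rule circle_average_log[OF _ _ s0 R])
    show "?F holomorphic_on ball 0 (s\<^sup>2 / cmod b)" using s0 by (intro holomorphic_intros) auto
    fix \<eta> :: complex assume "\<eta> \<in> ball 0 (s\<^sup>2 / cmod b)"
    then have "cmod \<eta> * cmod b < s\<^sup>2" using False by (simp add: pos_less_divide_eq)
    then have "cmod (cnj b * \<eta> / of_real s) < s" using s0 by (simp add: norm_divide norm_mult pos_divide_less_eq power2_eq_square mult.commute)
    then show "?F \<eta> \<noteq> 0" using s0 by auto
  qed
  moreover have "cmod (?F (circlepath 0 s \<theta>)) = cmod (circlepath 0 s \<theta> - b)" for \<theta>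
  proof -
    let ?c = "circlepath 0 s \<theta>"
    have c: "cmod ?c = s" using norm_circlepath_0 s0 by simp
    have "?F ?c * of_real s = ?c * cnj (?c - b)"
      using c s0 by (simp add: algebra_simps complex_norm_square[symmetric] power2_eq_square)
    then have "cmod (?F ?c) * s = s * cmod (?c - b)"
      using c s0 by (metis norm_mult norm_of_real abs_of_pos complex_mod_cnj)
    then show ?thesis using s0 by simp
  qed
  ultimately show ?thesis using s0 by simp
qed

context exterior_uniformization begin

text \<open>In the coordinate \<open>\<eta> = 1 / \<Phi>\<close> the level curves are circles, and \<open>\<Psi> (1 / \<eta>) - v\<close> has a simple pole at \<open>0\<close>,
  which \<open>G v\<close> removes.\<close>

definition curve :: "real \<Rightarrow> real \<Rightarrow> complex" where
  "curve s \<theta> = \<Psi> (inverse (circlepath 0 s \<theta>))"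

definition G :: "complex \<Rightarrow> complex \<Rightarrow> complex" where
  "G v \<eta> = (if \<eta> = 0 then of_real r else \<eta> * (\<Psi> (inverse \<eta>) - v))"

lemma inverse_gt1: "\<eta> \<noteq> 0 \<Longrightarrow> cmod \<eta> < 1 \<Longrightarrow> 1 < cmod (inverse \<eta>)"
  by (simp add: norm_inverse one_less_inverse)

lemma G_holo: "G v holomorphic_on ball 0 1"
proof (rule no_isolated_singularity'[where K = "{0}"])
  have "((\<lambda>\<eta>. \<Psi> (inverse \<eta>) / inverse \<eta> - \<eta> * v) \<longlongrightarrow> of_real r - 0 * v) (at 0)"
    by (intro tendsto_intros filterlim_compose[OF \<Psi>_leading filterlim_inverse_at_infinity])
  then have "(G v \<longlongrightarrow> of_real r) (at 0)"
    by (intro Lim_transform_eventually[of _ "of_real r - 0 * v" _ "G v", simplified])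
      (auto simp: G_def eventually_at_filter divide_inverse algebra_simps)
  then show "(G v \<longlongrightarrow> G v z) (at z within ball 0 1)" if "z \<in> {0}" for z
    using that by (auto simp: G_def[of v 0] intro: tendsto_within_subset)
  have "inverse ` (ball 0 1 - {0}) \<subseteq> {w. 1 < cmod w}" using inverse_gt1 by auto
  then have "(\<Psi> \<circ> inverse) holomorphic_on (ball 0 1 - {0})"
    by (rule holomorphic_on_compose_gen[OF _ holo_\<Psi>, rotated]) (auto intro!: holomorphic_intros)
  then have "(\<lambda>\<eta>. \<eta> * (\<Psi> (inverse \<eta>) - v)) holomorphic_on (ball 0 1 - {0})"
    by (intro holomorphic_intros) (simp add: o_def)
  then show "G v holomorphic_on (ball 0 1 - {0})"
    by (rule holomorphic_transform) (auto simp: G_def)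
qed auto

lemma G_zero:
  assumes "\<eta> \<in> ball 0 1" "G v \<eta> = 0" shows "v \<in> outside T" "\<eta> = 1 / \<Phi> v"
proof -
  have nz: "\<eta> \<noteq> 0" using assms r_pos by (auto simp: G_def)
  then have v: "v = \<Psi> (inverse \<eta>)" using assms by (simp add: G_def)
  have "1 < cmod (inverse \<eta>)" using inverse_gt1 nz assms by simp
  then show "v \<in> outside T" "\<eta> = 1 / \<Phi> v" using v \<Psi>_ext \<Phi>_\<Psi> by (auto simp: inverse_eq_divide)
qed

lemma G_curve: "0 < s \<Longrightarrow> G v (circlepath 0 s \<theta>) = circlepath 0 s \<theta> * (curve s \<theta> - v)"
  using norm_circlepath_0[of s \<theta>] by (auto simp: G_def curve_def)

lemma curve_ext:
  assumes "0 < s" "s < 1" shows "curve s \<theta> \<in> outside T" "cmod (\<Phi> (curve s \<theta>)) = 1 / s"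
proof -
  have c: "cmod (circlepath 0 s \<theta>) = s" using norm_circlepath_0 assms by simp
  then have "circlepath 0 s \<theta> \<noteq> 0" using assms by auto
  then have "1 < cmod (inverse (circlepath 0 s \<theta>))" using inverse_gt1[of "circlepath 0 s \<theta>"] assms c by simp
  then show "curve s \<theta> \<in> outside T" "cmod (\<Phi> (curve s \<theta>)) = 1 / s"
    unfolding curve_def using \<Psi>_ext \<Phi>_\<Psi> c by (simp_all add: norm_inverse inverse_eq_divide norm_divide)
qed

lemma continuous_curve:
  assumes "0 < s" "s < 1" shows "continuous_on A (curve s)"
  unfolding curve_def
proof (rule continuous_on_compose2[OF continuous_\<Psi>])
  have c: "circlepath 0 s \<theta> \<noteq> 0" for \<theta> using norm_circlepath_0[of s \<theta>] assms by auto
  then show "continuous_on A (\<lambda>\<theta>. inverse (circlepath 0 s \<theta>))"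
    unfolding circlepath by (intro continuous_intros) simp
  show "(\<lambda>\<theta>. inverse (circlepath 0 s \<theta>)) ` A \<subseteq> {w. 1 < cmod w}"
    using c inverse_gt1 norm_circlepath_0[of s] assms by auto
qed

text \<open>Off the exterior \<open>G v\<close> has no zero in the disc, so the mean of its
  logarithm is the value \<open>ln r\<close> at 0; the modulus \<open>s\<close> of the factor in
  front is subtracted.\<close>

lemma average_log_filled:
  assumes v: "v \<notin> outside T" and s: "0 < s" "s < 1"
  shows "((\<lambda>\<theta>. ln (cmod (v - curve s \<theta>))) has_integral ln r - ln s) {0..1}"
proof -
  have "((\<lambda>\<theta>. ln (cmod (G v (circlepath 0 s \<theta>)))) has_integral ln (cmod (G v 0))) {0..1}"
    by (rule circle_average_log[OF G_holo _ s]) (use G_zero(1) v in blast)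
  from has_integral_diff[OF this has_integral_const_real[of "ln s" 0 1]]
  have "((\<lambda>\<theta>. ln (cmod (G v (circlepath 0 s \<theta>))) - ln s) has_integral ln r - ln s) {0..1}"
    using r_pos by (simp add: G_def)
  moreover have "ln (cmod (G v (circlepath 0 s \<theta>))) - ln s = ln (cmod (v - curve s \<theta>))" for \<theta>
  proof -
    have "v \<noteq> curve s \<theta>" using v curve_ext(1)[OF s, of \<theta>] by auto
    then show ?thesis using s norm_circlepath_0[of s \<theta>]
      by (simp add: G_curve norm_mult ln_mult_pos norm_minus_commute)
  qed
  ultimately show ?thesis by simp
qed

text \<open>For \<open>v\<close> in the exterior \<open>G v\<close> has the single zero
  \<open>1 / \<Phi> v\<close>; it is divided out here, with the removable value filled in.\<close>

definition Q :: "complex \<Rightarrow> complex \<Rightarrow> complex" where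
  "Q v \<eta> = (if \<eta> = 1 / \<Phi> v then deriv (G v) (1 / \<Phi> v) else G v \<eta> / (\<eta> - 1 / \<Phi> v))"

lemma pole_in_ball: "v \<in> outside T \<Longrightarrow> 1 / \<Phi> v \<in> ball 0 1"
  using \<Phi>_gt1[of v] by (simp add: norm_divide) (subst pos_divide_less_eq; linarith)

lemma G_pole: "v \<in> outside T \<Longrightarrow> G v (1 / \<Phi> v) = 0"
  using \<Phi>_nz \<Psi>_\<Phi> by (simp add: G_def inverse_eq_divide)

lemma Q_holo:
  assumes v: "v \<in> outside T" shows "Q v holomorphic_on ball 0 1"
proof (rule no_isolated_singularity'[where K = "{1 / \<Phi> v}"])
  let ?p = "1 / \<Phi> v"
  have "(G v has_field_derivative deriv (G v) ?p) (at ?p)"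
    by (rule holomorphic_derivI[OF G_holo open_ball pole_in_ball[OF v]])
  then have "((\<lambda>\<eta>. G v \<eta> / (\<eta> - ?p)) \<longlongrightarrow> deriv (G v) ?p) (at ?p)"
    using G_pole[OF v] by (simp add: has_field_derivative_iff)
  then have "(Q v \<longlongrightarrow> deriv (G v) ?p) (at ?p)"
    by (rule Lim_transform_eventually) (auto simp: Q_def eventually_at_filter)
  then show "(Q v \<longlongrightarrow> Q v z) (at z within ball 0 1)" if "z \<in> {?p}" for z
    using that by (auto simp: Q_def[of v ?p] intro: tendsto_within_subset)
  have "(\<lambda>\<eta>. G v \<eta> / (\<eta> - ?p)) holomorphic_on (ball 0 1 - {?p})"
    by (intro holomorphic_intros holomorphic_on_subset[OF G_holo]) auto
  then show "Q v holomorphic_on (ball 0 1 - {?p})"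
    by (rule holomorphic_transform) (auto simp: Q_def)
qed auto

text \<open>The zero that was divided out is simple because \<open>\<Psi>\<close>, being injective,
  has nonvanishing derivative.\<close>

lemma Q_nonzero:
  assumes v: "v \<in> outside T" and \<eta>: "\<eta> \<in> ball 0 1" shows "Q v \<eta> \<noteq> 0"
proof (cases "\<eta> = 1 / \<Phi> v")
  case False
  then show ?thesis using G_zero(2)[OF \<eta>, of v] by (auto simp: Q_def)
next
  case True
  let ?p = "1 / \<Phi> v"
  have p: "?p \<noteq> 0" "inverse ?p = \<Phi> v" using \<Phi>_nz[OF v] by (auto simp: inverse_eq_divide)
  have opn: "open {w::complex. 1 < cmod w}" by (intro open_Collect_less continuous_intros)
  have inj: "inj_on \<Psi> {w. 1 < cmod w}" by (rule inj_on_inverseI[of _ \<Phi>]) (simp add: \<Phi>_\<Psi>)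
  have d: "deriv \<Psi> (\<Phi> v) \<noteq> 0"
    using holomorphic_injective_imp_regular[OF holo_\<Psi> opn inj] \<Phi>_gt1[OF v] by simp
  have "(\<Psi> has_field_derivative deriv \<Psi> (\<Phi> v)) (at (inverse ?p))"
    unfolding p(2) by (rule holomorphic_derivI[OF holo_\<Psi> opn]) (use \<Phi>_gt1[OF v] in simp)
  from DERIV_chain2[OF this DERIV_inverse[OF p(1)]]
  have "((\<lambda>\<eta>. \<eta> * (\<Psi> (inverse \<eta>) - v)) has_field_derivative
      1 * (\<Psi> (inverse ?p) - v) + deriv \<Psi> (\<Phi> v) * - (inverse ?p ^ Suc (Suc 0)) * ?p) (at ?p)"
    by (intro DERIV_mult DERIV_ident) (auto intro!: derivative_eq_intros)
  then have "((\<lambda>\<eta>. \<eta> * (\<Psi> (inverse \<eta>) - v)) has_field_derivative - (deriv \<Psi> (\<Phi> v) * \<Phi> v)) (at ?p)"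
    using p \<Psi>_\<Phi>[OF v] by simp
  then have "(G v has_field_derivative - (deriv \<Psi> (\<Phi> v) * \<Phi> v)) (at ?p)"
    by (rule has_field_derivative_transform_within_open[of _ _ _ "- {0}"]) (use p(1) in \<open>auto simp: G_def\<close>)
  then have "deriv (G v) ?p = - (deriv \<Psi> (\<Phi> v) * \<Phi> v)" by (rule DERIV_imp_deriv)
  then show ?thesis using d \<Phi>_nz[OF v] True by (simp add: Q_def)
qed

text \<open>The condition \<open>1 < s * cmod (\<Phi> v)\<close> puts \<open>v\<close> outside the
  level curve and the zero \<open>1 / \<Phi> v\<close> inside the circle. The linear factor then has
  logarithmic mean \<open>ln s\<close>, which cancels the modulus of the circle, and the result does
  not depend on \<open>s\<close>.\<close>

lemma average_log_exterior:
  assumes v: "v \<in> outside T" and s: "0 < s" "s < 1" "1 < s * cmod (\<Phi> v)"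
  shows "((\<lambda>\<theta>. ln (cmod (v - curve s \<theta>))) has_integral ln r + ln (cmod (\<Phi> v))) {0..1}"
proof -
  let ?p = "1 / \<Phi> v" and ?c = "circlepath 0 s"
  have p: "cmod ?p < s" using s(3) \<Phi>_gt1[OF v] by (simp add: norm_divide) (subst pos_divide_less_eq; linarith)
  have "((\<lambda>\<theta>. ln (cmod (Q v (?c \<theta>)))) has_integral ln (cmod (Q v 0))) {0..1}"
    by (rule circle_average_log[OF Q_holo[OF v] Q_nonzero[OF v] s(1,2)])
  from has_integral_diff[OF has_integral_add[OF this circle_average_log_linear[OF p]] has_integral_const_real[of "ln s" 0 1]]
  have "((\<lambda>\<theta>. ln (cmod (Q v (?c \<theta>))) + ln (cmod (?c \<theta> - ?p)) - ln s) has_integral ln (cmod (Q v 0)) + ln s - ln s) {0..1}"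
    by simp
  moreover have "ln (cmod (Q v 0)) = ln r + ln (cmod (\<Phi> v))"
    using \<Phi>_nz[OF v] r_pos by (simp add: Q_def G_def norm_divide norm_mult ln_mult_pos)
  moreover have "ln (cmod (Q v (?c \<theta>))) + ln (cmod (?c \<theta> - ?p)) - ln s = ln (cmod (v - curve s \<theta>))" for \<theta>
  proof -
    have c: "cmod (?c \<theta>) = s" using norm_circlepath_0 s by simp
    then have ne: "?c \<theta> \<noteq> ?p" using p by auto
    then have "Q v (?c \<theta>) * (?c \<theta> - ?p) = ?c \<theta> * (curve s \<theta> - v)"
      using G_curve[OF s(1)] by (simp add: Q_def)
    then have e: "cmod (Q v (?c \<theta>)) * cmod (?c \<theta> - ?p) = s * cmod (v - curve s \<theta>)"
      using c by (metis norm_minus_commute norm_mult)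
    have "Q v (?c \<theta>) \<noteq> 0" using Q_nonzero[OF v] c s by simp
    then have "ln (cmod (Q v (?c \<theta>))) + ln (cmod (?c \<theta> - ?p)) = ln (s * cmod (v - curve s \<theta>))"
      unfolding e[symmetric] using ne by (simp add: ln_mult_pos)
    moreover have "v \<noteq> curve s \<theta>" using curve_ext(2)[OF s(1,2), of \<theta>] s by auto
    ultimately show ?thesis using s by (simp add: ln_mult_pos)
  qed
  ultimately show ?thesis by simp
qed

end

section \<open>Bounds for the hitting probability\<close>

text \<open>Integrate the tangent inequality \<open>bk_tangent\<close> at the geometric mean
  \<open>Z\<close>: its slope multiplies \<open>ln (X \<theta>) - ln Z\<close>, which has mean 0.
  The terms in \<open>k2\<close> and \<open>k3\<close> then turn the first two moments of
  \<open>X\<close> into a gain over Jensen's inequality.\<close>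

lemma average_bk_lower:
  fixes X :: "real \<Rightarrow> real"
  assumes X: "continuous_on {0..1} X" "\<And>\<theta>. \<theta> \<in> {0..1} \<Longrightarrow> X \<theta> > 0" and Z: "Z > 0"
    and ln: "((\<lambda>\<theta>. ln (X \<theta>)) has_integral ln Z) {0..1}"
    and k: "\<And>Y. Y > 0 \<Longrightarrow> bk Y \<ge> k2 - 4 * k3 * Y"
    and m1: "(X has_integral m1) {0..1}" and m2: "((\<lambda>\<theta>. (X \<theta>)\<^sup>2) has_integral m2) {0..1}"
  shows "bk Z + k2 * (m1 - Z) - k3 * (m2 - Z\<^sup>2) \<le> integral {0..1} (\<lambda>\<theta>. bk (X \<theta>))"
proof -
  define t where "t = - bj Z - k2 * Z + 2 * k3 * Z\<^sup>2"
  have "continuous_on {0..1} (\<lambda>\<theta>. bk (X \<theta>))"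
    using X by (intro continuous_on_compose2[OF bk_continuous_on]) auto
  then have i: "((\<lambda>\<theta>. bk (X \<theta>)) has_integral integral {0..1} (\<lambda>\<theta>. bk (X \<theta>))) {0..1}"
    by (intro integrable_integral integrable_continuous_real)
  have 1: "((\<lambda>\<theta>. bk (X \<theta>) - k2 * X \<theta> + k3 * (X \<theta>)\<^sup>2) has_integral
      integral {0..1} (\<lambda>\<theta>. bk (X \<theta>)) - k2 * m1 + k3 * m2) {0..1}"
    by (intro has_integral_add has_integral_diff i has_integral_mult_right m1 m2)
  have c: "((\<lambda>\<theta>::real. k::real) has_integral k) {0..1}" for k
    using has_integral_const_real[of k 0 1] by simp
  have 2: "((\<lambda>\<theta>. bk Z - k2 * Z + k3 * Z\<^sup>2 + t * (ln (X \<theta>) - ln Z)) has_integral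
      bk Z - k2 * Z + k3 * Z\<^sup>2 + t * (ln Z - ln Z)) {0..1}"
    by (intro has_integral_add has_integral_diff has_integral_mult_right c ln)
  have "bk Z - k2 * Z + k3 * Z\<^sup>2 + t * (ln Z - ln Z) \<le> integral {0..1} (\<lambda>\<theta>. bk (X \<theta>)) - k2 * m1 + k3 * m2"
    by (rule has_integral_le[OF 2 1]) (use bk_tangent[OF k X(2) Z] in \<open>simp add: t_def\<close>)
  then show ?thesis by (simp add: algebra_simps)
qed

lemma average_bk_bounds:
  fixes X :: "real \<Rightarrow> real"
  assumes X: "continuous_on {0..1} X" "\<And>\<theta>. \<theta> \<in> {0..1} \<Longrightarrow> X \<theta> > 0"
    and ln: "((\<lambda>\<theta>. ln (X \<theta>)) has_integral ln Z) {0..1}"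
  shows "logterm Z \<le> integral {0..1} (\<lambda>\<theta>. bk (X \<theta>))"
    "(\<And>\<theta>. \<theta> \<in> {0..1} \<Longrightarrow> X \<theta> \<le> K) \<Longrightarrow> integral {0..1} (\<lambda>\<theta>. bk (X \<theta>)) \<le> logterm Z + bk_rem K"
proof -
  have "continuous_on {0..1} (\<lambda>\<theta>. bk (X \<theta>))"
    using X by (intro continuous_on_compose2[OF bk_continuous_on]) auto
  then have i: "((\<lambda>\<theta>. bk (X \<theta>)) has_integral integral {0..1} (\<lambda>\<theta>. bk (X \<theta>))) {0..1}"
    by (intro integrable_integral integrable_continuous_real)
  have c: "((\<lambda>\<theta>::real. k::real) has_integral k) {0..1}" for k
    using has_integral_const_real[of k 0 1] by simp
  have l: "((\<lambda>\<theta>. logterm (X \<theta>)) has_integral logterm Z) {0..1}"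
    unfolding logterm_def using has_integral_diff[OF has_integral_mult_right[OF ln, of "- 1 / 2"] c[of euler_mascheroni]] by simp
  show "logterm Z \<le> integral {0..1} (\<lambda>\<theta>. bk (X \<theta>))"
    by (rule has_integral_le[OF l i]) (use bk_rem_nonneg X(2) in \<open>simp add: bk_eq\<close>)
  show "integral {0..1} (\<lambda>\<theta>. bk (X \<theta>)) \<le> logterm Z + bk_rem K" if "\<And>\<theta>. \<theta> \<in> {0..1} \<Longrightarrow> X \<theta> \<le> K"
    by (rule has_integral_le[OF i has_integral_add[OF l c]]) (use bk_rem_mono[OF X(2)] that in \<open>simp add: bk_eq\<close>)
qed

context exterior_uniformization begin

abbreviation scaled :: "real \<Rightarrow> complex \<Rightarrow> real \<Rightarrow> real \<Rightarrow> real" where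
  "scaled \<tau> v s \<theta> \<equiv> (cmod (v - curve s \<theta>))\<^sup>2 / (2 * \<tau>)"

lemma scaled_continuous: "0 < s \<Longrightarrow> s < 1 \<Longrightarrow> \<tau> > 0 \<Longrightarrow> continuous_on A (scaled \<tau> v s)"
  by (intro continuous_intros continuous_curve) auto

lemma scaled_log_filled:
  assumes v: "v \<notin> outside T" and s: "0 < s" "s < 1" and \<tau>: "\<tau> > 0"
  shows "((\<lambda>\<theta>. ln (scaled \<tau> v s \<theta>)) has_integral ln ((r / s)\<^sup>2 / (2 * \<tau>))) {0..1}" "scaled \<tau> v s \<theta> > 0"
proof -
  have ne: "v \<noteq> curve s \<theta>" for \<theta> using curve_ext(1)[OF s] v by metis
  from has_integral_diff[OF has_integral_mult_right[OF average_log_filled[OF v s], of 2] has_integral_const_real[of "ln (2 * \<tau>)" 0 1]]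
  have "((\<lambda>\<theta>. 2 * ln (cmod (v - curve s \<theta>)) - ln (2 * \<tau>)) has_integral 2 * (ln r - ln s) - ln (2 * \<tau>)) {0..1}" by simp
  moreover have "2 * (ln r - ln s) - ln (2 * \<tau>) = ln ((r / s)\<^sup>2 / (2 * \<tau>))"
    using r_pos s \<tau> by (simp add: ln_div ln_realpow)
  moreover have "2 * ln (cmod (v - curve s \<theta>)) - ln (2 * \<tau>) = ln (scaled \<tau> v s \<theta>)" for \<theta>
    using ne[of \<theta>] \<tau> by (simp add: ln_div ln_realpow)
  ultimately show "((\<lambda>\<theta>. ln (scaled \<tau> v s \<theta>)) has_integral ln ((r / s)\<^sup>2 / (2 * \<tau>))) {0..1}" by simp
  show "scaled \<tau> v s \<theta> > 0" using ne[of \<theta>] \<tau> by simp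
qed

lemma scaled_log_exterior:
  assumes v: "v \<in> outside T" and s: "0 < s" "s < 1" "1 < s * cmod (\<Phi> v)" and \<tau>: "\<tau> > 0"
  shows "((\<lambda>\<theta>. ln (scaled \<tau> v s \<theta>)) has_integral ln ((r * cmod (\<Phi> v))\<^sup>2 / (2 * \<tau>))) {0..1}" "scaled \<tau> v s \<theta> > 0"
proof -
  have ne: "v \<noteq> curve s \<theta>" for \<theta> using curve_ext(2)[OF s(1,2), of \<theta>] s by auto
  from has_integral_diff[OF has_integral_mult_right[OF average_log_exterior[OF v s], of 2] has_integral_const_real[of "ln (2 * \<tau>)" 0 1]]
  have "((\<lambda>\<theta>. 2 * ln (cmod (v - curve s \<theta>)) - ln (2 * \<tau>)) has_integral 2 * (ln r + ln (cmod (\<Phi> v))) - ln (2 * \<tau>)) {0..1}" by simp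
  moreover have "2 * (ln r + ln (cmod (\<Phi> v))) - ln (2 * \<tau>) = ln ((r * cmod (\<Phi> v))\<^sup>2 / (2 * \<tau>))"
    using r_pos \<Phi>_nz[OF v] \<tau> by (simp add: ln_div ln_realpow ln_mult_pos)
  moreover have "2 * ln (cmod (v - curve s \<theta>)) - ln (2 * \<tau>) = ln (scaled \<tau> v s \<theta>)" for \<theta>
    using ne[of \<theta>] \<tau> by (simp add: ln_div ln_realpow)
  ultimately show "((\<lambda>\<theta>. ln (scaled \<tau> v s \<theta>)) has_integral ln ((r * cmod (\<Phi> v))\<^sup>2 / (2 * \<tau>))) {0..1}" by simp
  show "scaled \<tau> v s \<theta> > 0" using ne[of \<theta>] \<tau> by simp
qed

lemma shell_near:
  assumes "\<And>w. w \<in> T \<Longrightarrow> cmod (w - v) \<le> R" "R < R'"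
  obtains \<rho> where "\<rho> > 1" "\<And>x. x \<in> outside T \<Longrightarrow> cmod (\<Phi> x) < \<rho> \<Longrightarrow> cmod (x - v) \<le> R'"
proof -
  obtain \<rho> where \<rho>: "\<rho> > 1" "\<And>x. x \<in> outside T \<Longrightarrow> cmod (\<Phi> x) < \<rho> \<Longrightarrow> infdist x T < R' - R"
    using shell_close[of "R' - R"] assms(2) by auto
  have "cmod (x - v) \<le> R'" if x: "x \<in> outside T" "cmod (\<Phi> x) < \<rho>" for x
  proof -
    obtain w where w: "w \<in> T" "infdist x T = dist x w"
      using infdist_attains_inf[OF compact_imp_closed[OF compactT] nonempty] by metis
    have "cmod (x - v) \<le> dist x w + cmod (w - v)"
      using norm_triangle_ineq[of "x - w" "w - v"] by (simp add: dist_norm)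
    then show ?thesis using \<rho>(2)[OF x] w assms(1)[OF w(1)] by simp
  qed
  then show ?thesis using \<rho>(1) that by blast
qed

lemma eventually_level:
  assumes "\<rho> > 1" shows "\<forall>\<^sub>F s in at_left (1::real). 0 < s \<and> s < 1 \<and> 1 / s < \<rho>"
proof (rule eventually_at_leftI[of "1 / \<rho>"])
  show "1 / \<rho> < 1" using assms by simp
  fix s assume "s \<in> {1 / \<rho><..<1}"
  moreover have "1 / \<rho> > 0" using assms by simp
  ultimately have s: "1 / \<rho> < s" "s < 1" "s > 0" using less_trans[of 0 "1 / \<rho>" s] by auto
  then have "1 < s * \<rho>" using assms by (simp add: pos_divide_less_eq)
  then show "0 < s \<and> s < 1 \<and> 1 / s < \<rho>" using s by (simp add: pos_divide_less_eq mult.commute)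
qed

lemma curve_distance:
  assumes K: "closed K" and s: "0 < s" "s < 1" and "\<And>\<theta>. curve s \<theta> \<notin> K"
  obtains \<eta> where "\<eta> > 0" "\<And>x \<theta>. x \<in> K \<Longrightarrow> \<theta> \<in> {0..1} \<Longrightarrow> \<eta> \<le> cmod (x - curve s \<theta>)"
proof -
  have "compact (curve s ` {0..1})" by (intro compact_continuous_image continuous_curve s compact_Icc)
  moreover have "curve s ` {0..1} \<inter> K = {}" using assms(4) by auto
  ultimately obtain d where "d > 0" "\<forall>x\<in>curve s ` {0..1}. \<forall>y\<in>K. d \<le> dist x y"
    using separate_compact_closed[OF _ K] by blast
  then show ?thesis by (intro that[of d]) (auto simp: dist_norm norm_minus_commute)
qed

text \<open>For \<open>s\<close> close to 1 the level curve separates \<open>T\<close> from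
  \<open>z\<close> and lies within \<open>R'\<close> of \<open>z\<close>. There the averaged kernel
  at \<open>z\<close> is known up to the remainder, and \<open>hit_upper\<close> compares it with
  the lower bound \<open>m s\<close> on \<open>T\<close>; then \<open>s\<close> tends to 1.\<close>

lemma hit_laplace_upper:
  assumes BM: "planar_brownian_motion M z B" and z: "z \<in> outside T" and \<tau>: "\<tau> > 0"
    and R: "\<And>w. w \<in> T \<Longrightarrow> cmod (w - z) \<le> R" "R < R'"
    and m: "(m \<longlongrightarrow> m0) (at_left 1)"
      "\<forall>\<^sub>F s in at_left 1. 0 \<le> m s \<and> (\<forall>b\<in>T. m s \<le> integral {0..1} (\<lambda>\<theta>. bk (scaled \<tau> b s \<theta>)))"
  shows "hit_laplace M B T \<tau> * m0 \<le> logterm ((r * cmod (\<Phi> z))\<^sup>2 / (2 * \<tau>)) + bk_rem (R'\<^sup>2 / (2 * \<tau>))"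
proof -
  interpret planar_brownian_motion M z B by (rule BM)
  obtain \<rho> where \<rho>: "\<rho> > 1" "\<And>x. x \<in> outside T \<Longrightarrow> cmod (\<Phi> x) < \<rho> \<Longrightarrow> cmod (x - z) \<le> R'"
    using shell_near[OF R] by blast
  have "\<forall>\<^sub>F s in at_left 1. hit_laplace M B T \<tau> * m s \<le> logterm ((r * cmod (\<Phi> z))\<^sup>2 / (2 * \<tau>)) + bk_rem (R'\<^sup>2 / (2 * \<tau>))"
    using m(2) eventually_level[OF \<rho>(1)] eventually_level[OF \<Phi>_gt1[OF z]]
  proof eventually_elim
    case (elim s)
    have s: "0 < s" "s < 1" "1 < s * cmod (\<Phi> z)" using elim by (auto simp: pos_divide_less_eq mult.commute)
    have nz: "curve s \<theta> \<noteq> z" for \<theta> using curve_ext(2)[OF s(1,2), of \<theta>] s by auto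
    have "curve s \<theta> \<notin> insert z T" for \<theta> using nz ext_notin curve_ext(1)[OF s(1,2)] by auto
    then obtain \<eta> where \<eta>: "\<eta> > 0" "\<And>x \<theta>. x \<in> insert z T \<Longrightarrow> \<theta> \<in> {0..1} \<Longrightarrow> \<eta> \<le> cmod (x - curve s \<theta>)"
      using curve_distance[of "insert z T" s] s compactT by (metis closed_insert compact_imp_closed)
    have "hit_laplace M B T \<tau> * m s \<le> integral {0..1} (\<lambda>\<theta>. bk (scaled \<tau> z s \<theta>))"
      by (rule hit_upper[OF compact_imp_closed[OF compactT] ext_notin[OF z] \<tau> \<eta>(1) continuous_curve[OF s(1,2)]])
         (use \<eta>(2) elim in auto)
    also have "\<dots> \<le> logterm ((r * cmod (\<Phi> z))\<^sup>2 / (2 * \<tau>)) + bk_rem (R'\<^sup>2 / (2 * \<tau>))"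
    proof (rule average_bk_bounds(2)[OF scaled_continuous[OF s(1,2) \<tau>] scaled_log_exterior(2)[OF z s \<tau>] scaled_log_exterior(1)[OF z s \<tau>]])
      fix \<theta>
      have "cmod (curve s \<theta> - z) \<le> R'" using \<rho>(2) curve_ext[OF s(1,2)] elim by simp
      then have "(cmod (z - curve s \<theta>))\<^sup>2 \<le> R'\<^sup>2" by (intro power_mono) (simp_all add: norm_minus_commute)
      then show "scaled \<tau> z s \<theta> \<le> R'\<^sup>2 / (2 * \<tau>)" using \<tau> by (intro divide_right_mono) auto
    qed
    finally show ?case .
  qed
  moreover have "((\<lambda>s. hit_laplace M B T \<tau> * m s) \<longlongrightarrow> hit_laplace M B T \<tau> * m0) (at_left 1)"
    by (intro tendsto_intros m)
  ultimately show ?thesis by (intro tendsto_upperbound[of _ _ "at_left (1::real)"]) (auto simp: trivial_limit_at_left_real)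
qed

section \<open>Lower bound through enlarged obstacles\<close>

lemma open_level: "open {v \<in> outside T. \<rho> < cmod (\<Phi> v)}"
proof -
  have "open (outside T \<inter> (\<lambda>v. cmod (\<Phi> v)) -` {\<rho><..})"
    by (intro continuous_open_preimage open_ext continuous_intros continuous_\<Phi> open_greaterThan)
  moreover have "{v \<in> outside T. \<rho> < cmod (\<Phi> v)} = outside T \<inter> (\<lambda>v. cmod (\<Phi> v)) -` {\<rho><..}" by auto
  ultimately show ?thesis by simp
qed

text \<open>The filled \<open>T\<close> together with the collar on which \<open>\<Phi>\<close> has
  modulus at most \<open>\<rho>\<close>. Level curves with \<open>1 / s < \<rho>\<close> lie in it
  at positive distance from the complement, as \<open>hit_lower\<close> demands.\<close>

definition filled_level :: "real \<Rightarrow> complex set" where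
  "filled_level \<rho> = - {v \<in> outside T. \<rho> < cmod (\<Phi> v)}"

lemma closed_filled_level: "closed (filled_level \<rho>)"
  unfolding filled_level_def using open_level by (simp add: closed_Compl)

lemma hit_laplace_level:
  assumes BM: "planar_brownian_motion M z B" and z: "z \<in> outside T" and \<tau>: "\<tau> > 0"
    and d: "diameter T < d'" and \<rho>: "1 < \<rho>" "\<rho> < cmod (\<Phi> z)"
    and near: "\<And>x. x \<in> outside T \<Longrightarrow> cmod (\<Phi> x) \<le> \<rho> \<Longrightarrow> infdist x T < (d' - diameter T) / 2"
    and m: "m = logterm (r\<^sup>2 / (2 * \<tau>)) + bk_rem (d'\<^sup>2 / (2 * \<tau>))" "m \<ge> 0"
  shows "logterm ((r * cmod (\<Phi> z))\<^sup>2 / (2 * \<tau>)) \<le> hit_laplace M B (filled_level \<rho>) \<tau> * m"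
proof -
  interpret planar_brownian_motion M z B by (rule BM)
  let ?S = "filled_level \<rho>"
  obtain s where s: "0 < s" "s < 1" "1 / s < \<rho>"
    using eventually_happens'[OF _ eventually_level[OF \<rho>(1)]] by (auto simp: trivial_limit_at_left_real)
  have s\<rho>: "1 < s * \<rho>" using s by (simp add: pos_divide_less_eq mult.commute)
  have zs: "1 < s * cmod (\<Phi> z)" using s\<rho> \<rho>(2) s(1) by (meson less_trans mult_strict_left_mono)
  have zS: "z \<notin> ?S" using z \<rho> by (simp add: filled_level_def)
  have cS: "- ?S \<subseteq> {v \<in> outside T. \<rho> \<le> cmod (\<Phi> v)}" by (auto simp: filled_level_def)
  have clo: "x \<in> T \<or> (x \<in> outside T \<and> \<rho> \<le> cmod (\<Phi> x))" if x: "x \<in> closure (- ?S)" for x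
  proof -
    have "x \<in> closure (outside T)" using closure_mono[of "- ?S" "outside T"] cS x by blast
    then have "x \<in> outside T \<or> x \<in> T"
      using frontier_outside_subset[OF compact_imp_closed[OF compactT]] closure_Un_frontier[of "outside T"] by blast
    moreover have "\<rho> \<le> cmod (\<Phi> x)" if "x \<in> outside T"
    proof (rule ccontr)
      assume "\<not> \<rho> \<le> cmod (\<Phi> x)"
      then have "x \<in> outside T \<inter> (\<lambda>v. cmod (\<Phi> v)) -` {..<\<rho>}" using that by auto
      moreover have "open (outside T \<inter> (\<lambda>v. cmod (\<Phi> v)) -` {..<\<rho>})"
        by (intro continuous_open_preimage open_ext continuous_intros continuous_\<Phi> open_lessThan)
      ultimately have "outside T \<inter> (\<lambda>v. cmod (\<Phi> v)) -` {..<\<rho>} \<inter> - ?S \<noteq> {}"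
        using x open_Int_closure_eq_empty[of _ "- ?S"] by blast
      then show False using cS by auto
    qed
    ultimately show ?thesis by blast
  qed
  have "curve s \<theta> \<notin> closure (- ?S)" for \<theta>
    using clo[of "curve s \<theta>"] curve_ext[OF s(1,2), of \<theta>] s(3) ext_notin by auto
  then obtain \<eta> where \<eta>: "\<eta> > 0" "\<And>x \<theta>. x \<in> closure (- ?S) \<Longrightarrow> \<theta> \<in> {0..1} \<Longrightarrow> \<eta> \<le> cmod (x - curve s \<theta>)"
    using curve_distance[OF closed_closure s(1,2)] by metis
  have le: "integral {0..1} (\<lambda>\<theta>. bk (scaled \<tau> b s \<theta>)) \<le> m" if b: "b \<in> ?S" "b \<in> closure (- ?S)" for b
  proof -
    have near_b: "infdist b T < (d' - diameter T) / 2"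
      using clo[OF b(2)] b(1) near[of b] d by (auto simp: filled_level_def)
    obtain wb where wb: "wb \<in> T" "infdist b T = dist b wb"
      using infdist_attains_inf[OF compact_imp_closed[OF compactT] nonempty] by metis
    \<comment> \<open>Both \<open>b\<close> and the point of the curve are within half of the slack
      \<open>d' - diameter T\<close> of some point of \<open>T\<close>, so their distance is at most
      \<open>d'\<close>.\<close>
    have K: "scaled \<tau> b s \<theta> \<le> d'\<^sup>2 / (2 * \<tau>)" for \<theta>
    proof -
      obtain wc where wc: "wc \<in> T" "infdist (curve s \<theta>) T = dist (curve s \<theta>) wc"
        using infdist_attains_inf[OF compact_imp_closed[OF compactT] nonempty] by metis
      have "infdist (curve s \<theta>) T < (d' - diameter T) / 2"
        using curve_ext[OF s(1,2), of \<theta>] s(3) by (intro near) auto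
      moreover have "dist wb wc \<le> diameter T"
        using diameter_bounded_bound[OF compact_imp_bounded[OF compactT] wb(1) wc(1)] .
      moreover have "dist b (curve s \<theta>) \<le> dist b wb + dist wb wc + dist (curve s \<theta>) wc"
        using dist_triangle[of b "curve s \<theta>" wb] dist_triangle[of wb "curve s \<theta>" wc] by (simp add: dist_commute)
      ultimately have "dist b (curve s \<theta>) \<le> (d' - diameter T) / 2 + diameter T + (d' - diameter T) / 2"
        unfolding wb(2)[symmetric] wc(2)[symmetric] using near_b by linarith
      then have "dist b (curve s \<theta>) \<le> d'" by (simp add: field_simps)
      then have "(cmod (b - curve s \<theta>))\<^sup>2 \<le> d'\<^sup>2" by (intro power_mono) (simp_all add: dist_norm)
      then show ?thesis using \<tau> by (intro divide_right_mono) auto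
    qed
    \<comment> \<open>The logarithmic mean of the distance is
      \<open>ln (r * cmod (\<Phi> b))\<close> in the exterior and \<open>ln (r / s)\<close>
      otherwise, in both cases at least \<open>ln r\<close>.\<close>
    define Z where "Z = (if b \<in> outside T then (r * cmod (\<Phi> b))\<^sup>2 / (2 * \<tau>) else (r / s)\<^sup>2 / (2 * \<tau>))"
    have sb: "1 < s * cmod (\<Phi> b)" if "b \<in> outside T"
      proof -
      have "\<rho> \<le> cmod (\<Phi> b)" using clo[OF b(2)] that ext_notin by auto
      then have "s * \<rho> \<le> s * cmod (\<Phi> b)" using s(1) by simp
      then show ?thesis using s\<rho> by linarith
    qed
    have ln: "((\<lambda>\<theta>. ln (scaled \<tau> b s \<theta>)) has_integral ln Z) {0..1}" and pos: "scaled \<tau> b s \<theta> > 0" for \<theta>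
      using scaled_log_exterior[OF _ s(1,2) sb \<tau>] scaled_log_filled[OF _ s(1,2) \<tau>] by (auto simp: Z_def)
    have "integral {0..1} (\<lambda>\<theta>. bk (scaled \<tau> b s \<theta>)) \<le> logterm Z + bk_rem (d'\<^sup>2 / (2 * \<tau>))"
      by (rule average_bk_bounds(2)[OF scaled_continuous[OF s(1,2) \<tau>] pos ln K])
    moreover have "logterm Z \<le> logterm (r\<^sup>2 / (2 * \<tau>))"
    proof -
      have "r \<le> r * cmod (\<Phi> b)" if "b \<in> outside T" using \<Phi>_gt1[OF that] r_pos by simp
      moreover have "r \<le> r / s" using s r_pos by (simp add: pos_le_divide_eq)
      ultimately have "r\<^sup>2 / (2 * \<tau>) \<le> Z"
        unfolding Z_def using r_pos \<tau> by (cases "b \<in> outside T") (simp_all only: if_True if_False not_False_eq_True, (intro divide_right_mono power_mono; simp)+)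
      moreover have "r\<^sup>2 / (2 * \<tau>) > 0" using r_pos \<tau> by simp
      ultimately show ?thesis by (simp add: logterm_def)
    qed
    ultimately show ?thesis using m(1) by simp
  qed
  have "logterm ((r * cmod (\<Phi> z))\<^sup>2 / (2 * \<tau>)) \<le> integral {0..1} (\<lambda>\<theta>. bk (scaled \<tau> z s \<theta>))"
    by (rule average_bk_bounds(1)[OF scaled_continuous[OF s(1,2) \<tau>] scaled_log_exterior(2)[OF z s(1,2) zs \<tau>] scaled_log_exterior(1)[OF z s(1,2) zs \<tau>]])
  also have "\<dots> \<le> hit_laplace M B ?S \<tau> * m"
    by (rule hit_lower[OF closed_filled_level zS \<tau> \<eta>(1) continuous_curve[OF s(1,2)] _ m(2) le])
       (use \<eta>(2) closure_subset[of "- ?S"] in blast)+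
  finally show ?thesis .
qed

end

section \<open>Passing to the limit in the obstacle\<close>

context planar_brownian_motion begin

lemma hit_event_eq: "{\<omega> \<in> space M. \<exists>s\<in>{0..t}. B s \<omega> \<in> S} = space M - avoid S t"
  by (auto simp: avoid_def)

lemma hit_event_sets: "closed S \<Longrightarrow> {\<omega> \<in> space M. \<exists>s\<in>{0..t}. B s \<omega> \<in> S} \<in> sets M"
proof (cases "0 \<le> t")
  case True
  then show "closed S \<Longrightarrow> ?thesis" unfolding hit_event_eq using avoid_sets by blast
qed simp

lemma hit_prob_measurable: "closed S \<Longrightarrow> hit_prob M B S \<in> borel_measurable borel"
proof (rule borel_measurable_mono, rule monoI)
  assume "closed S"
  fix s t :: real assume "s \<le> t"
  show "hit_prob M B S s \<le> hit_prob M B S t"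
    unfolding hit_prob_def by (rule finite_measure_mono[OF _ hit_event_sets]) (use \<open>s \<le> t\<close> \<open>closed S\<close> in auto)
qed

lemma hit_laplace_tendsto:
  assumes S: "\<And>n. closed (S n)" "closed S'" and \<tau>: "\<tau> > 0"
    and lim: "\<And>t. t \<ge> 0 \<Longrightarrow> (\<lambda>n. hit_prob M B (S n) t) \<longlonglongrightarrow> hit_prob M B S' t"
  shows "(\<lambda>n. hit_laplace M B (S n) \<tau>) \<longlonglongrightarrow> hit_laplace M B S' \<tau>"
proof -
  have nn: "(\<integral>\<^sup>+ t. ennreal (indicator {0..} t * exp (- t / \<tau>)) \<partial>lborel) = ennreal \<tau>"
  proof (rule nn_integral_has_integral_lborel)
    have "((\<lambda>t. exp (- (1 / \<tau>) * t)) has_integral exp (- (1 / \<tau>) * 0) / (1 / \<tau>)) {0..}"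
      by (rule has_integral_exp_minus_to_infinity) (use \<tau> in simp)
    then have "((\<lambda>t. if t \<in> {0..} then exp (- (1 / \<tau>) * t) else 0) has_integral \<tau>) UNIV"
      using \<tau> by (simp only: has_integral_restrict_UNIV) simp
    then show "((\<lambda>t. indicator {0..} t * exp (- t / \<tau>)) has_integral \<tau>) UNIV"
      by (rule has_integral_eq[rotated]) (auto simp: indicator_def)
  qed auto
  have w: "integrable lborel (\<lambda>t. indicator {0..} t * exp (- t / \<tau>))"
    by (rule integrableI_nonneg) (use nn in auto)
  have m: "(\<lambda>t. indicator {0..} t *\<^sub>R (exp (- t / \<tau>) * hit_prob M B A t)) \<in> borel_measurable lborel" if "closed A" for A
    using hit_prob_measurable[OF that] by measurable
  have "(\<lambda>n. LINT t|lborel. indicator {0..} t *\<^sub>R (exp (- t / \<tau>) * hit_prob M B (S n) t))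
      \<longlonglongrightarrow> (LINT t|lborel. indicator {0..} t *\<^sub>R (exp (- t / \<tau>) * hit_prob M B S' t))"
  proof (rule integral_dominated_convergence[OF m[OF S(2)] m[OF S(1)] w])
    show "AE t in lborel. (\<lambda>n. indicator {0..} t *\<^sub>R (exp (- t / \<tau>) * hit_prob M B (S n) t))
        \<longlonglongrightarrow> indicator {0..} t *\<^sub>R (exp (- t / \<tau>) * hit_prob M B S' t)"
      using lim by (intro AE_I2) (auto simp: indicator_def intro!: tendsto_mult)
    show "AE t in lborel. norm (indicator {0..} t *\<^sub>R (exp (- t / \<tau>) * hit_prob M B (S n) t)) \<le> indicator {0..} t * exp (- t / \<tau>)" for n
      by (intro AE_I2) (auto simp: indicator_def hit_prob_def)
  qed
  then show ?thesis unfolding hit_laplace_def set_lebesgue_integral_def by (intro tendsto_mult tendsto_const)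
qed

end

text \<open>On the unit circle this quotient, the reciprocal of a Blaschke factor, has modulus 1. On
  the circle of radius \<open>s\<close> the identity
  \<open>1 - cnj p * c = (1 - s^2) + c * cnj (c - p)\<close> controls the deviation, which vanishes
  as \<open>s\<close> tends to 1.\<close>

lemma pole_factor_bound:
  fixes p c :: complex
  assumes p: "cmod p < s" "s < 1" and c: "cmod c = s"
  shows "cmod (1 - cnj p * c) / cmod (c - p) \<le> s + (1 - s\<^sup>2) / (s - cmod p)"
proof -
  have "1 - cnj p * c = of_real (1 - s\<^sup>2) + c * cnj (c - p)"
    using c by (simp add: algebra_simps complex_norm_square[symmetric])
  then have "cmod (1 - cnj p * c) \<le> cmod (of_real (1 - s\<^sup>2)) + cmod (c * cnj (c - p))"
    by (metis norm_triangle_ineq)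
  moreover have "s \<ge> 0" using c by auto
  then have "s\<^sup>2 \<le> 1" using p(2) by (simp add: power_le_one)
  ultimately have 1: "cmod (1 - cnj p * c) \<le> (1 - s\<^sup>2) + s * cmod (c - p)"
    using c by (simp add: norm_mult del: of_real_diff complex_cnj_diff)
  have 2: "s - cmod p \<le> cmod (c - p)" using norm_triangle_ineq2[of c p] c by simp
  have pos: "cmod (c - p) > 0" using 2 p by linarith
  have "cmod (1 - cnj p * c) / cmod (c - p) \<le> ((1 - s\<^sup>2) + s * cmod (c - p)) / cmod (c - p)"
    using 1 pos by (intro divide_right_mono) auto
  also have "\<dots> = s + (1 - s\<^sup>2) / cmod (c - p)" using pos by (simp add: add_divide_distrib)
  also have "\<dots> \<le> s + (1 - s\<^sup>2) / (s - cmod p)"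
    using 2 p \<open>s\<^sup>2 \<le> 1\<close> by (intro add_left_mono divide_left_mono mult_pos_pos pos) auto
  finally show ?thesis .
qed

context exterior_uniformization begin

lemma path_meets_boundary:
  assumes c: "continuous_on {0..s} f" and s: "s \<ge> 0" and f: "f 0 \<in> outside T" "f s \<notin> outside T"
  shows "\<exists>t\<in>{0..s::real}. f t \<in> T"
proof -
  have "connected (f ` {0..s})" by (intro connected_continuous_image c) simp
  then have "f ` {0..s} \<inter> frontier (outside T) \<noteq> {}"
    by (rule connected_Int_frontier) (use s f in force)+
  then show ?thesis using frontier_outside_subset[OF compact_imp_closed[OF compactT]] by auto
qed

text \<open>If a path meets all the decreasing closed sets by time \<open>t\<close>, compactness
  gives a time at which it lies in all of them, that is, off the exterior. Having started in the
  exterior, it has met \<open>T\<close> by then.\<close>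

lemma hit_laplace_level_tendsto:
  assumes BM: "planar_brownian_motion M z B" and z: "z \<in> outside T" and \<tau>: "\<tau> > 0"
  shows "(\<lambda>n. hit_laplace M B (filled_level (1 + 1 / real (Suc n))) \<tau>) \<longlonglongrightarrow> hit_laplace M B T \<tau>"
proof -
  interpret planar_brownian_motion M z B by (rule BM)
  let ?S = "\<lambda>n. filled_level (1 + 1 / real (Suc n))"
  have dec: "?S n \<subseteq> ?S m" if "m \<le> n" for m n
  proof -
    have "1 / real (Suc n) \<le> 1 / real (Suc m)" using that by (intro divide_left_mono) auto
    then show ?thesis by (auto simp: filled_level_def)
  qed
  have inter: "x \<notin> outside T" if "\<And>n. x \<in> ?S n" for x
  proof
    assume x: "x \<in> outside T"
    then obtain n where "inverse (real (Suc n)) < cmod (\<Phi> x) - 1" using reals_Archimedean[of "cmod (\<Phi> x) - 1"] \<Phi>_gt1 by auto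
    then show False using that[of n] x by (simp add: filled_level_def inverse_eq_divide del: of_nat_Suc)
  qed
  have "(\<lambda>n. hit_prob M B (?S n) t) \<longlonglongrightarrow> hit_prob M B T t" if t: "t \<ge> 0" for t
  proof -
    let ?E = "\<lambda>S. {\<omega> \<in> space M. \<exists>s\<in>{0..t}. B s \<omega> \<in> S}"
    have "(\<lambda>n. measure M (?E (?S n))) \<longlonglongrightarrow> measure M (\<Inter>n. ?E (?S n))"
    proof (rule finite_Lim_measure_decseq)
      show "range (\<lambda>n. ?E (?S n)) \<subseteq> sets M" using hit_event_sets[OF closed_filled_level] by auto
      show "decseq (\<lambda>n. ?E (?S n))" using dec by (intro decseq_SucI) (blast intro: le_SucI)
    qed
    moreover have "(\<Inter>n. ?E (?S n)) = ?E T"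
    proof (intro equalityI subsetI)
      fix \<omega> assume \<omega>: "\<omega> \<in> ?E T"
      have "T \<subseteq> ?S n" for n using ext_notin by (auto simp: filled_level_def)
      then show "\<omega> \<in> (\<Inter>n. ?E (?S n))" using \<omega> by blast
    next
      fix \<omega> assume \<omega>: "\<omega> \<in> (\<Inter>n. ?E (?S n))"
      then have sp: "\<omega> \<in> space M" by blast
      have cont: "continuous_on {0..u} (\<lambda>s. B s \<omega>)" for u
        by (rule continuous_on_subset[OF continuous_paths[OF sp]]) auto
      let ?K = "\<lambda>n. {0..t} \<inter> (\<lambda>s. B s \<omega>) -` ?S n"
      have "(\<Inter>n. ?K n) \<noteq> {}"
      proof (rule compact_nest)
        show "compact (?K n)" for n
          using continuous_closed_preimage[OF cont closed_atLeastAtMost closed_filled_level]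
          by (simp add: compact_eq_bounded_closed bounded_Int)
        show "?K n \<noteq> {}" for n using \<omega> by auto
        show "?K n \<subseteq> ?K m" if "m \<le> n" for m n using dec[OF that] by auto
      qed
      then obtain s where s: "s \<in> {0..t}" "\<And>n. B s \<omega> \<in> ?S n" by (simp only: ex_in_conv[symmetric] INT_iff Int_iff vimage_eq) blast
      have "\<exists>u\<in>{0..s}. B u \<omega> \<in> T"
        by (rule path_meets_boundary[OF cont]) (use s inter[OF s(2)] z start[OF sp] in auto)
      then show "\<omega> \<in> ?E T" using s(1) sp by force
    qed
    ultimately show ?thesis by (simp add: hit_prob_def)
  qed
  then show ?thesis by (rule hit_laplace_tendsto[OF closed_filled_level compact_imp_closed[OF compactT] \<tau>])
qed

theorem hit_laplace_lower:
  assumes BM: "planar_brownian_motion M z B" and z: "z \<in> outside T" and \<tau>: "\<tau> > 0"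
    and d: "diameter T < d'" and m: "m = logterm (r\<^sup>2 / (2 * \<tau>)) + bk_rem (d'\<^sup>2 / (2 * \<tau>))" "m \<ge> 0"
  shows "logterm ((r * cmod (\<Phi> z))\<^sup>2 / (2 * \<tau>)) \<le> hit_laplace M B T \<tau> * m"
proof -
  obtain \<rho>0 where \<rho>0: "\<rho>0 > 1" "\<And>v. v \<in> outside T \<Longrightarrow> cmod (\<Phi> v) < \<rho>0 \<Longrightarrow> infdist v T < (d' - diameter T) / 2"
    using shell_close[of "(d' - diameter T) / 2"] d by auto
  have "(\<lambda>n. 1 + 1 / real (Suc n)) \<longlonglongrightarrow> 1 + 0" by (intro tendsto_intros LIMSEQ_Suc[OF lim_1_over_n])
  then have lim: "(\<lambda>n. 1 + 1 / real (Suc n)) \<longlonglongrightarrow> 1" by simp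
  have "\<forall>\<^sub>F n in sequentially. 1 + 1 / real (Suc n) < \<rho>0" "\<forall>\<^sub>F n in sequentially. 1 + 1 / real (Suc n) < cmod (\<Phi> z)"
    using order_tendstoD(2)[OF lim] \<rho>0(1) \<Phi>_gt1[OF z] by blast+
  then have "\<forall>\<^sub>F n in sequentially. logterm ((r * cmod (\<Phi> z))\<^sup>2 / (2 * \<tau>)) \<le> hit_laplace M B (filled_level (1 + 1 / real (Suc n))) \<tau> * m"
  proof eventually_elim
    case (elim n)
    show ?case
      by (rule hit_laplace_level[OF BM z \<tau> d _ elim(2) \<rho>0(2) m]) (use elim(1) in \<open>simp_all del: of_nat_Suc\<close>)
  qed
  moreover have "(\<lambda>n. hit_laplace M B (filled_level (1 + 1 / real (Suc n))) \<tau> * m) \<longlonglongrightarrow> hit_laplace M B T \<tau> * m"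
    by (intro tendsto_intros hit_laplace_level_tendsto[OF BM z \<tau>])
  ultimately show ?thesis by (intro tendsto_lowerbound[of _ _ sequentially]) auto
qed

text \<open>This function is \<open>G z\<close> divided by the Blaschke factor with the same zero.
  On the circle of radius \<open>s\<close> the modulus of \<open>G z\<close> is \<open>s\<close>
  times the distance from \<open>z\<close> to the level curve; apply the maximum principle there and
  let \<open>s\<close> tend to 1.\<close>

lemma normalized_bound:
  assumes z: "z \<in> outside T" and R: "\<And>w. w \<in> T \<Longrightarrow> cmod (w - z) \<le> R" "R < R'"
    and \<eta>: "\<eta> \<in> ball 0 1"
  shows "cmod (Q z \<eta> * (1 - cnj (1 / \<Phi> z) * \<eta>)) \<le> R'"
proof -
  define p where "p = 1 / \<Phi> z"
  obtain \<rho> where \<rho>: "\<rho> > 1" "\<And>x. x \<in> outside T \<Longrightarrow> cmod (\<Phi> x) < \<rho> \<Longrightarrow> cmod (x - z) \<le> R'"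
    using shell_near[OF R] by blast
  have R0: "R' \<ge> 0" using R nonempty norm_ge_zero by (meson all_not_in_conv less_imp_le order_trans)
  have p1: "cmod p < 1" using pole_in_ball[OF z] by (simp add: p_def)
  have "\<forall>\<^sub>F s in at_left (1::real). cmod p < s" "\<forall>\<^sub>F s in at_left (1::real). cmod \<eta> < s"
    using p1 \<eta> order_tendstoD(1)[OF tendsto_ident_at[of "1::real" "{..<1}"]] by auto
  then have "\<forall>\<^sub>F s in at_left (1::real). cmod (Q z \<eta> * (1 - cnj p * \<eta>)) \<le> R' * (s * (s + (1 - s\<^sup>2) / (s - cmod p)))"
    using eventually_level[OF \<rho>(1)]
  proof eventually_elim
    case (elim s)
    let ?F = "\<lambda>\<eta>. Q z \<eta> * (1 - cnj p * \<eta>)"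
    have sub: "cball 0 s \<subseteq> ball (0::complex) 1" using elim by auto
    have hol: "?F holomorphic_on ball 0 1" by (intro holomorphic_intros Q_holo z)
    show ?case
    proof (rule maximum_modulus_frontier[of ?F "ball 0 s"])
      show "?F holomorphic_on interior (ball 0 s)" using holomorphic_on_subset[OF hol, of "ball 0 s"] sub ball_subset_cball[of 0 s] by (metis interior_open open_ball subset_trans)
      show "continuous_on (closure (ball 0 s)) ?F"
        using holomorphic_on_imp_continuous_on[OF hol] sub elim by (auto intro: continuous_on_subset)
      fix c assume "c \<in> frontier (ball (0::complex) s)"
      then have c: "cmod c = s" using elim by (simp add: dist_norm)
      have c0: "c \<noteq> 0" "c \<noteq> p" using c elim by auto
      have "Q z c * (1 - cnj p * c) = c * (\<Psi> (inverse c) - z) * ((1 - cnj p * c) / (c - p))"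
        using c0 by (simp add: Q_def G_def p_def)
      then have "cmod (?F c) = s * cmod (\<Psi> (inverse c) - z) * (cmod (1 - cnj p * c) / cmod (c - p))"
        using c by (simp only: norm_mult norm_divide)
      also have "\<dots> \<le> s * R' * (s + (1 - s\<^sup>2) / (s - cmod p))"
      proof (intro mult_mono mult_left_mono pole_factor_bound)
        have i: "1 < cmod (inverse c)" "cmod (inverse c) = 1 / s"
          using inverse_gt1[OF c0(1)] c elim by (auto simp: norm_inverse inverse_eq_divide norm_divide)
        show "cmod (\<Psi> (inverse c) - z) \<le> R'"
          using \<rho>(2)[OF \<Psi>_ext[OF i(1)]] \<Phi>_\<Psi>[OF i(1)] i(2) elim by simp
      qed (use elim c R0 in \<open>auto intro!: divide_nonneg_nonneg\<close>)
      finally show "cmod (?F c) \<le> R' * (s * (s + (1 - s\<^sup>2) / (s - cmod p)))" by (simp add: algebra_simps)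
    qed (use elim in auto)
  qed
  moreover have "((\<lambda>s. R' * (s * (s + (1 - s\<^sup>2) / (s - cmod p)))) \<longlongrightarrow> R' * (1 * (1 + (1 - 1\<^sup>2) / (1 - cmod p)))) (at_left (1::real))"
    by (intro tendsto_intros) (use p1 in simp)
  ultimately show ?thesis unfolding p_def[symmetric] by (intro tendsto_lowerbound[of _ R' "at_left (1::real)"]) (auto simp: trivial_limit_at_left_real)
qed

text \<open>Write \<open>G z = exp g * P\<close> with \<open>P\<close> the Blaschke factor. Then
  \<open>Re g\<close> is at most \<open>ln R'\<close> everywhere and equal to \<open>ln A\<close> at
  0, so every higher Taylor coefficient of \<open>g\<close> is bounded by
  \<open>2 * \<delta>\<close>. Since \<open>curve - z\<close> is \<open>G z\<close> divided by the
  circle variable, its moments are Taylor coefficients of \<open>G z\<close> and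
  \<open>(G z)^2\<close>, the same for all levels. For \<open>\<delta> = 0\<close> the function
  \<open>g\<close> is constant and the moments depend on \<open>e\<close> and \<open>A\<close> only,
  up to a rotation.\<close>

lemma curve_moments:
  assumes z: "z \<in> outside T" and R: "\<And>w. w \<in> T \<Longrightarrow> cmod (w - z) \<le> R" "R < R'"
  defines "e \<equiv> 1 / cmod (\<Phi> z)" and "A \<equiv> r * cmod (\<Phi> z)"
  defines "\<delta> \<equiv> ln R' - ln A"
  obtains \<mu>1 \<mu>2 where "\<delta> \<ge> 0"
    "cmod \<mu>1 \<le> A * ((1 - e\<^sup>2) + 2 * \<delta> * e)"
    "cmod \<mu>2 \<le> A\<^sup>2 * (\<bar>(1 - e\<^sup>2) * (1 - 3 * e\<^sup>2)\<bar> + 8 * \<delta> * e * (1 - e\<^sup>2) + e\<^sup>2 * (4 * \<delta> + 8 * \<delta>\<^sup>2))"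
    "\<And>s. 0 < s \<Longrightarrow> s < 1 \<Longrightarrow> ((\<lambda>\<theta>. curve s \<theta> - z) has_integral \<mu>1) {0..1}"
    "\<And>s. 0 < s \<Longrightarrow> s < 1 \<Longrightarrow> ((\<lambda>\<theta>. (curve s \<theta> - z)\<^sup>2) has_integral \<mu>2) {0..1}"
proof -
  define p where "p = 1 / \<Phi> z"
  have pe: "cmod p = e" "e < 1" "e \<ge> 0" using pole_in_ball[OF z] by (auto simp: p_def e_def norm_divide)
  have A0: "A > 0" using r_pos \<Phi>_nz[OF z] by (simp add: A_def)
  let ?F = "\<lambda>\<eta>. Q z \<eta> * (1 - cnj p * \<eta>)"
  have nz: "1 - cnj p * \<eta> \<noteq> 0" if "\<eta> \<in> ball 0 1" for \<eta>
  proof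
    assume "1 - cnj p * \<eta> = 0"
    then have "cmod (cnj p * \<eta>) = 1" by simp
    then have "e * cmod \<eta> = 1" using pe by (simp add: norm_mult)
    moreover have "e * cmod \<eta> \<le> e * 1" using that pe by (intro mult_left_mono) auto
    ultimately show False using pe by simp
  qed
  have holF: "?F holomorphic_on ball 0 1" by (intro holomorphic_intros Q_holo z)
  obtain g where g: "g holomorphic_on ball 0 1" "\<And>\<eta>. \<eta> \<in> ball 0 1 \<Longrightarrow> ?F \<eta> = exp (g \<eta>)"
    using contractible_imp_holomorphic_log[OF holF convex_imp_contractible[OF convex_ball]] Q_nonzero[OF z] nz by (metis mult_eq_0_iff)
  have F0: "cmod (?F 0) = A" using \<Phi>_nz[OF z] r_pos by (simp add: Q_def G_def norm_divide norm_mult p_def A_def)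
  have eg0: "cmod (exp (g 0)) = A" using F0 g(2)[of 0] by simp
  then have Reg0: "Re (g 0) = ln A" by (metis ln_exp norm_exp_eq_Re)
  have R0: "R' > 0"
  proof -
    have "A \<le> R'" using normalized_bound[OF z R, of 0] F0 by (simp add: p_def)
    then show ?thesis using A0 by simp
  qed
  have Reg: "Re (of_real (ln R') - g \<eta>) \<ge> 0" if "\<eta> \<in> ball 0 1" for \<eta>
  proof -
    have "exp (Re (g \<eta>)) \<le> exp (ln R')"
      using normalized_bound[OF z R that] g(2)[OF that] R0 by (simp add: p_def)
    then show ?thesis by simp
  qed
  have \<delta>: "\<delta> \<ge> 0" using Reg[of 0] Reg0 by (simp add: \<delta>_def)
  have coef: "cmod ((deriv ^^ k) g 0 / fact k) \<le> 2 * \<delta>" if k: "k > 0" for k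
  proof -
    have hol: "(\<lambda>\<eta>. of_real (ln R') - g \<eta>) holomorphic_on ball 0 1" by (intro holomorphic_intros g)
    have "cmod ((deriv ^^ k) (\<lambda>\<eta>. of_real (ln R') - g \<eta>) 0 / fact k) \<le> 2 * Re (of_real (ln R') - g 0)"
      by (rule coefficient_bound_nonneg_Re[OF hol Reg k])
    moreover have "(deriv ^^ k) (\<lambda>\<eta>. complex_of_real (ln R') - g \<eta>) 0 = - (deriv ^^ k) g 0"
      using higher_deriv_diff[of "\<lambda>_. of_real (ln R')" "ball 0 1" g 0 k] g(1) k by simp
    ultimately show ?thesis using Reg0 by (simp add: \<delta>_def norm_divide)
  qed
  define g1 g2 where "g1 = deriv g 0" and "g2 = deriv (deriv g) 0"
  have b1: "cmod g1 \<le> 2 * \<delta>" using coef[of 1] by (simp add: g1_def)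
  have b2: "cmod g2 \<le> 4 * \<delta>" using coef[of 2] by (simp add: g2_def numeral_2_eq_2 norm_divide)
  define P where "P = (\<lambda>\<eta>. (\<eta> - p) / (1 - cnj p * \<eta>))"
  have Geq: "G z \<eta> = exp (g \<eta>) * P \<eta>" if "\<eta> \<in> ball 0 1" for \<eta>
  proof (cases "\<eta> = p")
    case True
    then show ?thesis using G_pole[OF z] by (simp add: P_def p_def)
  next
    case False
    then have "Q z \<eta> * (\<eta> - p) = G z \<eta>" by (simp add: Q_def p_def)
    moreover have "exp (g \<eta>) * P \<eta> = Q z \<eta> * (\<eta> - p)"
      unfolding g(2)[OF that, symmetric] P_def using nz[OF that] by simp
    ultimately show ?thesis by simp
  qed
  define e2 where "e2 = complex_of_real (e\<^sup>2)"
  have pp: "p * cnj p = e2" using complex_norm_square[of p] pe(1) by (simp add: e2_def)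
  have dg: "(g has_field_derivative deriv g \<eta>) (at \<eta>)" "(deriv g has_field_derivative deriv (deriv g) \<eta>) (at \<eta>)" if "\<eta> \<in> ball 0 1" for \<eta>
    using that g(1) by (auto intro!: holomorphic_derivI[of _ "ball 0 1"] holomorphic_deriv)
  have dP: "(P has_field_derivative (1 - e2) / (1 - cnj p * \<eta>)\<^sup>2) (at \<eta>)" if "\<eta> \<in> ball 0 1" for \<eta>
  proof -
    have d: "(P has_field_derivative (1 * (1 - cnj p * \<eta>) - (\<eta> - p) * (- cnj p)) / ((1 - cnj p * \<eta>) * (1 - cnj p * \<eta>))) (at \<eta>)"
      unfolding P_def using nz[OF that] by (intro DERIV_divide) (auto intro!: derivative_eq_intros)
    have e: "1 * (1 - cnj p * \<eta>) - (\<eta> - p) * (- cnj p) = 1 - e2" using pp by (simp add: algebra_simps)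
    show ?thesis using d unfolding e power2_eq_square .
  qed
  have dE: "((\<lambda>\<eta>. exp (g \<eta>)) has_field_derivative exp (g \<eta>) * deriv g \<eta>) (at \<eta>)" if "\<eta> \<in> ball 0 1" for \<eta>
    by (rule DERIV_chain2[OF DERIV_exp dg(1)[OF that]])
  define D where "D = (\<lambda>\<eta>. exp (g \<eta>) * (deriv g \<eta> * P \<eta> + (1 - e2) / (1 - cnj p * \<eta>)\<^sup>2))"
  have dG: "(G z has_field_derivative D \<eta>) (at \<eta>)" if "\<eta> \<in> ball 0 1" for \<eta>
  \<comment> \<open>The derivative \<open>D\<close> is kept in closed form near 0 so that it can be
    differentiated once more for the second moment.\<close>
  proof (rule has_field_derivative_transform_within_open[of "\<lambda>\<eta>. exp (g \<eta>) * P \<eta>" _ _ "ball 0 1"])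
    show "((\<lambda>\<eta>. exp (g \<eta>) * P \<eta>) has_field_derivative D \<eta>) (at \<eta>)"
      by (rule DERIV_cong, rule DERIV_mult[OF dE[OF that] dP[OF that]]) (simp add: D_def algebra_simps)
  qed (use that Geq in auto)
  have P0: "P 0 = - p" by (simp add: P_def)
  have Dd: "(D has_field_derivative exp (g 0) * g1 * (g1 * P 0 + (1 - e2)) + (g2 * P 0 + (1 - e2) * g1 + 2 * cnj p * (1 - e2)) * exp (g 0)) (at 0)"
  proof -
    have q: "((\<lambda>\<eta>. (1 - e2) / (1 - cnj p * \<eta>)\<^sup>2) has_field_derivative 2 * cnj p * (1 - e2)) (at 0)"
      by (auto intro!: derivative_eq_intros)
    have "((\<lambda>\<eta>. exp (g \<eta>) * (deriv g \<eta> * P \<eta> + (1 - e2) / (1 - cnj p * \<eta>)\<^sup>2)) has_field_derivative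
        exp (g 0) * deriv g 0 * (deriv g 0 * P 0 + (1 - e2) / (1 - cnj p * 0)\<^sup>2)
        + (deriv (deriv g) 0 * P 0 + (1 - e2) / (1 - cnj p * 0)\<^sup>2 * deriv g 0 + 2 * cnj p * (1 - e2)) * exp (g 0)) (at 0)"
      by (intro DERIV_mult DERIV_add dE dg dP q) auto
    then show ?thesis by (simp add: D_def[abs_def] g1_def g2_def)
  qed
  define \<mu>1 where "\<mu>1 = D 0"
  define \<mu>2 where "\<mu>2 = (exp (g 0))\<^sup>2 * ((1 - e2) * (1 - 3 * e2) - 4 * p * (1 - e2) * g1 + p\<^sup>2 * (g2 + 2 * g1\<^sup>2))"
  have m1: "\<mu>1 = exp (g 0) * ((1 - e2) - p * g1)" by (simp add: \<mu>1_def D_def P0 g1_def)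
  have d1: "deriv (G z) 0 = \<mu>1" unfolding \<mu>1_def by (rule DERIV_imp_deriv[OF dG]) simp
  have d2: "(deriv ^^ 2) (\<lambda>\<eta>. (G z \<eta>)\<^sup>2) 0 / fact 2 = \<mu>2"
  proof -
    have 1: "((\<lambda>\<eta>. (G z \<eta>)\<^sup>2) has_field_derivative 2 * G z \<eta> * D \<eta>) (at \<eta>)" if "\<eta> \<in> ball 0 1" for \<eta>
      by (rule DERIV_cong, rule DERIV_power[OF dG[OF that]]) simp
    have "\<forall>\<^sub>F \<eta> in nhds 0. deriv (\<lambda>\<eta>. (G z \<eta>)\<^sup>2) \<eta> = 2 * G z \<eta> * D \<eta>"
      by (rule eventually_mono[OF eventually_nhds_in_open[of "ball (0::complex) 1" 0]]) (auto simp del: mem_ball simp: 1[THEN DERIV_imp_deriv])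
    then have "deriv (deriv (\<lambda>\<eta>. (G z \<eta>)\<^sup>2)) 0 = deriv (\<lambda>\<eta>. 2 * G z \<eta> * D \<eta>) 0" by (rule deriv_cong_ev) simp
    also have "\<dots> = 2 * D 0 * D 0 + (exp (g 0) * g1 * (g1 * P 0 + (1 - e2)) + (g2 * P 0 + (1 - e2) * g1 + 2 * cnj p * (1 - e2)) * exp (g 0)) * (2 * G z 0)"
      by (rule DERIV_imp_deriv, intro DERIV_mult Dd DERIV_cmult dG) simp
    \<comment> \<open>The extra term vanishes by \<open>p * cnj p = e2\<close>. Keeping it makes
      this step a polynomial identity in which \<open>cnj p\<close> is an independent
      variable.\<close>
    also have "\<dots> = 2 * \<mu>2 + 2 * (exp (g 0))\<^sup>2 * (1 - e2) * (2 * (e2 - p * cnj p))"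
    proof -
      have "G z 0 = exp (g 0) * P 0" by (rule Geq) simp
      moreover have "D 0 = exp (g 0) * ((1 - e2) - p * g1)" using m1 by (simp only: \<mu>1_def)
      moreover have "2 * (E * (1 - e2 - p * g1)) * (E * (1 - e2 - p * g1)) +
          (E * g1 * (g1 * - p + (1 - e2)) + (g2 * - p + (1 - e2) * g1 + 2 * q * (1 - e2)) * E) * (2 * (E * - p)) =
          2 * (E\<^sup>2 * ((1 - e2) * (1 - 3 * e2) - 4 * p * (1 - e2) * g1 + p\<^sup>2 * (g2 + 2 * g1\<^sup>2))) +
          2 * E\<^sup>2 * (1 - e2) * (2 * (e2 - p * q))" for E q :: complex
        by (simp add: algebra_simps power2_eq_square)
      ultimately show ?thesis unfolding \<mu>2_def P0 by (simp only:)
    qed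
    finally show ?thesis using pp by (simp add: numeral_2_eq_2)
  qed
  have e21: "e\<^sup>2 \<le> 1" using pe by (simp add: power_le_one)
  have n1: "cmod (1 - e2) = 1 - e\<^sup>2" using e21 unfolding e2_def
    by (metis abs_of_nonneg diff_ge_0_iff_ge norm_of_real of_real_1 of_real_diff)
  have n3: "cmod ((1 - e2) * (1 - 3 * e2)) = \<bar>(1 - e\<^sup>2) * (1 - 3 * e\<^sup>2)\<bar>"
  proof -
    have "(1 - e2) * (1 - 3 * e2) = of_real ((1 - e\<^sup>2) * (1 - 3 * e\<^sup>2))" by (simp add: e2_def)
    then show ?thesis by (simp only: norm_of_real)
  qed
  show thesis
  proof
    show "\<delta> \<ge> 0" by (rule \<delta>)
    have "cmod ((1 - e2) - p * g1) \<le> cmod (1 - e2) + cmod (p * g1)" by (rule norm_triangle_ineq4)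
    also have "\<dots> \<le> (1 - e\<^sup>2) + 2 * \<delta> * e"
      using mult_left_mono[OF b1 pe(3)] pe n1 by (simp add: norm_mult mult_ac)
    finally show "cmod \<mu>1 \<le> A * ((1 - e\<^sup>2) + 2 * \<delta> * e)"
      using A0 unfolding m1 norm_mult eg0 by (intro mult_left_mono) auto
    have "cmod ((1 - e2) * (1 - 3 * e2) - 4 * p * (1 - e2) * g1 + p\<^sup>2 * (g2 + 2 * g1\<^sup>2))
        \<le> cmod ((1 - e2) * (1 - 3 * e2)) + cmod (4 * p * (1 - e2) * g1) + cmod (p\<^sup>2 * (g2 + 2 * g1\<^sup>2))"
      by (meson norm_triangle_le norm_triangle_ineq4 add_right_mono)
    also have "\<dots> \<le> \<bar>(1 - e\<^sup>2) * (1 - 3 * e\<^sup>2)\<bar> + 8 * \<delta> * e * (1 - e\<^sup>2) + e\<^sup>2 * (4 * \<delta> + 8 * \<delta>\<^sup>2)"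
    proof (intro add_mono)
      have "cmod (4 * p * (1 - e2) * g1) = 4 * e * (1 - e\<^sup>2) * cmod g1" using pe n1 by (simp add: norm_mult)
      also have "\<dots> \<le> 4 * e * (1 - e\<^sup>2) * (2 * \<delta>)" using b1 pe e21 by (intro mult_left_mono) auto
      finally show "cmod (4 * p * (1 - e2) * g1) \<le> 8 * \<delta> * e * (1 - e\<^sup>2)" by (simp add: mult_ac)
      have "cmod (g2 + 2 * g1\<^sup>2) \<le> cmod g2 + 2 * (cmod g1)\<^sup>2"
        by (rule order_trans[OF norm_triangle_ineq]) (simp add: norm_mult norm_power)
      also have "\<dots> \<le> 4 * \<delta> + 2 * (2 * \<delta>)\<^sup>2" using b1 b2 by (intro add_mono mult_left_mono power_mono) auto
      finally have "cmod (g2 + 2 * g1\<^sup>2) \<le> 4 * \<delta> + 8 * \<delta>\<^sup>2" by (simp add: power2_eq_square)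
      then show "cmod (p\<^sup>2 * (g2 + 2 * g1\<^sup>2)) \<le> e\<^sup>2 * (4 * \<delta> + 8 * \<delta>\<^sup>2)"
        using pe by (simp add: norm_mult norm_power mult_left_mono)
    qed (simp add: n3)
    finally show "cmod \<mu>2 \<le> A\<^sup>2 * (\<bar>(1 - e\<^sup>2) * (1 - 3 * e\<^sup>2)\<bar> + 8 * \<delta> * e * (1 - e\<^sup>2) + e\<^sup>2 * (4 * \<delta> + 8 * \<delta>\<^sup>2))"
      unfolding \<mu>2_def norm_mult norm_power eg0 by (intro mult_left_mono) auto
    fix s :: real assume s: "0 < s" "s < 1"
    have c: "circlepath 0 s \<theta> \<noteq> 0" for \<theta> using norm_circlepath_0[of s \<theta>] s by auto
    show "((\<lambda>\<theta>. curve s \<theta> - z) has_integral \<mu>1) {0..1}"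
      using circle_average_coefficient[OF G_holo s, of z 1] c by (simp add: G_curve[OF s(1)] d1)
    have "(\<lambda>\<eta>. (G z \<eta>)\<^sup>2) holomorphic_on ball 0 1" by (intro holomorphic_intros G_holo)
    from circle_average_coefficient[OF this s, of 2]
    show "((\<lambda>\<theta>. (curve s \<theta> - z)\<^sup>2) has_integral \<mu>2) {0..1}"
      unfolding d2 using c by (simp add: G_curve[OF s(1)] power_mult_distrib)
  qed
qed

end

section \<open>The upper bound with moments of the level curves\<close>

context exterior_uniformization begin

text \<open>With \<open>k2 = k3 = g0 = 0\<close> this is Jensen's inequality; otherwise \<open>g0\<close> is the gain over it.  The parameters
  \<open>\<sigma>\<close> and \<open>t\<close> stand for \<open>|b - z| / R'\<close> and for the mean of \<open>Re ((w - z) cnj (b - z)) / R'\<^sup>2\<close> over the curve,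
  with \<open>b\<close> in \<open>T\<close>.\<close>

theorem hit_laplace_upper_moments:
  assumes BM: "planar_brownian_motion M z B" and z: "z \<in> outside T" and \<tau>: "\<tau> > 0"
    and R: "\<And>w. w \<in> T \<Longrightarrow> cmod (w - z) \<le> R" "R < R'"
    and k: "k2 \<ge> 0" "k3 \<ge> 0" "\<And>Y. Y > 0 \<Longrightarrow> bk Y \<ge> k2 - 4 * k3 * Y"
  defines "e \<equiv> 1 / cmod (\<Phi> z)" and "q \<equiv> r * cmod (\<Phi> z) / R'"
    and "y \<equiv> R'\<^sup>2 / (2 * \<tau>)" and "Yr \<equiv> r\<^sup>2 / (2 * \<tau>)"
  defines "\<delta> \<equiv> - ln q"
  defines "M1 \<equiv> q * ((1 - e\<^sup>2) + 2 * \<delta> * e)"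
    and "M2 \<equiv> q\<^sup>2 * (\<bar>(1 - e\<^sup>2) * (1 - 3 * e\<^sup>2)\<bar> + 8 * \<delta> * e * (1 - e\<^sup>2) + e\<^sup>2 * (4 * \<delta> + 8 * \<delta>\<^sup>2))"
  assumes gain: "\<And>\<sigma> t. 0 \<le> \<sigma> \<Longrightarrow> \<sigma> \<le> 1 \<Longrightarrow> t \<le> \<sigma> * M1 \<Longrightarrow> g0 \<le> k2 * (y * (q\<^sup>2 + \<sigma>\<^sup>2 - 2 * t) - Yr)
      - k3 * (y\<^sup>2 * ((1 + \<sigma>\<^sup>2)\<^sup>2 - 4 * (1 + \<sigma>\<^sup>2) * t + 2 * \<sigma>\<^sup>2 + 2 * \<sigma>\<^sup>2 * M2) - Yr\<^sup>2)"
    and pos: "0 < bk Yr + g0"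
  shows "\<delta> \<ge> 0" "hit_laplace M B T \<tau> * (bk Yr + g0) \<le> logterm ((r * cmod (\<Phi> z))\<^sup>2 / (2 * \<tau>)) + bk_rem y"
proof -
  define A where "A = r * cmod (\<Phi> z)"
  have A0: "A > 0" using r_pos \<Phi>_nz[OF z] by (simp add: A_def)
  have R0: "R' > 0"
    using R nonempty norm_ge_zero by (meson all_not_in_conv less_le_trans not_less order_trans)
  have \<delta>: "\<delta> = ln R' - ln A" using A0 R0 by (simp add: \<delta>_def q_def A_def[symmetric] ln_div)
  obtain \<mu>1 \<mu>2 where \<mu>: "\<delta> \<ge> 0"
    "cmod \<mu>1 \<le> A * ((1 - e\<^sup>2) + 2 * \<delta> * e)"
    "cmod \<mu>2 \<le> A\<^sup>2 * (\<bar>(1 - e\<^sup>2) * (1 - 3 * e\<^sup>2)\<bar> + 8 * \<delta> * e * (1 - e\<^sup>2) + e\<^sup>2 * (4 * \<delta> + 8 * \<delta>\<^sup>2))"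
    "\<And>s. 0 < s \<Longrightarrow> s < 1 \<Longrightarrow> ((\<lambda>\<theta>. curve s \<theta> - z) has_integral \<mu>1) {0..1}"
    "\<And>s. 0 < s \<Longrightarrow> s < 1 \<Longrightarrow> ((\<lambda>\<theta>. (curve s \<theta> - z)\<^sup>2) has_integral \<mu>2) {0..1}"
    using curve_moments[OF z R] unfolding e_def[symmetric] A_def[symmetric] \<delta>[symmetric] by blast
  show "\<delta> \<ge> 0" by (rule \<mu>(1))
  have qA: "q = A / R'" by (simp add: q_def A_def)
  have \<mu>1: "cmod \<mu>1 \<le> R' * M1" using \<mu>(2) R0 by (simp add: M1_def qA)
  have \<mu>2: "cmod \<mu>2 \<le> R'\<^sup>2 * M2" using \<mu>(3) R0 by (simp add: M2_def qA power_divide)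
  define Z where "Z = (\<lambda>s. (r / s)\<^sup>2 / (2 * \<tau>))"
  \<comment> \<open>The gain is assumed at \<open>Yr\<close>, whereas on the curve of level
    \<open>s\<close> the geometric mean is \<open>Z s\<close>. The terms in \<open>k2\<close> and
    \<open>k3\<close> convert one into the other and disappear as \<open>s\<close> tends to
    1.\<close>
  define m where "m = (\<lambda>s. bk (Z s) + g0 + k2 * (Yr - Z s) - k3 * (Yr\<^sup>2 - (Z s)\<^sup>2))"
  have Yr0: "Yr > 0" using r_pos \<tau> by (simp add: Yr_def)
  have "((\<lambda>s. (r / s)\<^sup>2 / (2 * \<tau>)) \<longlongrightarrow> (r / 1)\<^sup>2 / (2 * \<tau>)) (at_left 1)"
    by (intro tendsto_intros) (use \<tau> in auto)
  then have Zlim: "(Z \<longlongrightarrow> Yr) (at_left 1)" by (simp add: Z_def Yr_def)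
  have "isCont bk Yr" using bk_continuous_on Yr0 by (simp add: continuous_on_eq_continuous_at)
  then have "(m \<longlongrightarrow> bk Yr + g0 + k2 * (Yr - Yr) - k3 * (Yr\<^sup>2 - Yr\<^sup>2)) (at_left 1)"
    unfolding m_def by (intro tendsto_intros Zlim isCont_tendsto_compose[of _ bk])
  then have mlim: "(m \<longlongrightarrow> bk Yr + g0) (at_left 1)" by simp
  obtain \<rho> where \<rho>: "\<rho> > 1" "\<And>x. x \<in> outside T \<Longrightarrow> cmod (\<Phi> x) < \<rho> \<Longrightarrow> cmod (x - z) \<le> R'"
    using shell_near[OF R] by blast
  have "\<forall>\<^sub>F s in at_left 1. 0 \<le> m s \<and> (\<forall>b\<in>T. m s \<le> integral {0..1} (\<lambda>\<theta>. bk (scaled \<tau> b s \<theta>)))"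
    using order_tendstoD(1)[OF mlim pos] eventually_level[OF \<rho>(1)] eventually_level[OF \<Phi>_gt1[OF z]]
  proof eventually_elim
    case (elim s)
    have s: "0 < s" "s < 1" "1 < s * cmod (\<Phi> z)" using elim by (auto simp: pos_divide_less_eq mult.commute)
    let ?w = "\<lambda>\<theta>. curve s \<theta> - z"
    have w: "cmod (?w \<theta>) \<le> R'" for \<theta> using \<rho>(2) curve_ext[OF s(1,2)] elim by simp
    have c: "((\<lambda>\<theta>. x) has_integral x) {0..1::real}" for x :: real
      using has_integral_const_real[of x 0 1] by simp
    have cw: "continuous_on {0..1} ?w" by (intro continuous_intros continuous_curve s)
    have "continuous_on {0..1} (\<lambda>\<theta>. (cmod (?w \<theta>))\<^sup>2)" by (intro continuous_intros cw)
    then obtain I where I: "((\<lambda>\<theta>. (cmod (?w \<theta>))\<^sup>2) has_integral I) {0..1}"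
      using integrable_continuous_real by blast
    \<comment> \<open>Jensen's inequality for the logarithm: the mean of
      \<open>ln ((cmod (curve s \<theta> - z))\<^sup>2)\<close> is
      \<open>ln (A\<^sup>2)\<close>.\<close>
    have IA: "A\<^sup>2 \<le> I"
    proof -
      have "((\<lambda>\<theta>. ln ((cmod (z - curve s \<theta>))\<^sup>2 / (2 * (1/2)))) has_integral ln ((r * cmod (\<Phi> z))\<^sup>2 / (2 * (1/2)))) {0..1}"
        by (rule scaled_log_exterior(1)[OF z s]) simp
      then have l: "((\<lambda>\<theta>. ln ((cmod (?w \<theta>))\<^sup>2)) has_integral ln (A\<^sup>2)) {0..1}"
        by (simp add: A_def norm_minus_commute)
      have "((\<lambda>\<theta>. ln (A\<^sup>2) + 1 / A\<^sup>2 * ((cmod (?w \<theta>))\<^sup>2 - A\<^sup>2)) has_integral ln (A\<^sup>2) + 1 / A\<^sup>2 * (I - A\<^sup>2)) {0..1}"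
        by (intro has_integral_add has_integral_diff has_integral_mult_right I c)
      with l have "ln (A\<^sup>2) \<le> ln (A\<^sup>2) + 1 / A\<^sup>2 * (I - A\<^sup>2)"
      proof (rule has_integral_le)
        fix \<theta> :: real
        have wp: "(cmod (?w \<theta>))\<^sup>2 > 0" using curve_ext(2)[OF s(1,2), of \<theta>] s by auto
        have "ln ((cmod (?w \<theta>))\<^sup>2 / A\<^sup>2) \<le> (cmod (?w \<theta>))\<^sup>2 / A\<^sup>2 - 1" by (rule ln_le_minus_one) (use wp A0 in simp)
        then show "ln ((cmod (?w \<theta>))\<^sup>2) \<le> ln (A\<^sup>2) + 1 / A\<^sup>2 * ((cmod (?w \<theta>))\<^sup>2 - A\<^sup>2)"
          using wp A0 by (simp add: ln_div right_diff_distrib)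
      qed
      then show ?thesis using A0 by (simp add: zero_le_divide_iff)
    qed
    have "m s \<le> integral {0..1} (\<lambda>\<theta>. bk (scaled \<tau> b s \<theta>))" if b: "b \<in> T" for b
    proof -
      define \<beta> where "\<beta> = b - z"
      define \<sigma> where "\<sigma> = cmod \<beta> / R'"
      have \<beta>R: "cmod \<beta> = R' * \<sigma>" using R0 by (simp add: \<sigma>_def)
      have \<sigma>: "0 \<le> \<sigma>" "\<sigma> \<le> 1" using R(1)[OF b] R(2) R0 by (auto simp: \<sigma>_def \<beta>_def)
      define \<rho>1 where "\<rho>1 = Re (\<mu>1 * cnj \<beta>)"
      define t where "t = \<rho>1 / R'\<^sup>2"
      have \<rho>1: "\<rho>1 = R'\<^sup>2 * t" using R0 by (simp add: t_def)
      have "\<rho>1 \<le> cmod \<mu>1 * cmod \<beta>" unfolding \<rho>1_def using complex_Re_le_cmod[of "\<mu>1 * cnj \<beta>"] by (simp add: norm_mult)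
      also have "\<dots> \<le> (R' * M1) * (R' * \<sigma>)" unfolding \<beta>R using \<mu>1 R0 \<sigma> by (intro mult_right_mono) auto
      finally have "R'\<^sup>2 * t \<le> R'\<^sup>2 * (\<sigma> * M1)" unfolding \<rho>1 by (simp add: power2_eq_square algebra_simps)
      then have t: "t \<le> \<sigma> * M1" using R0 by simp
      let ?\<rho> = "\<lambda>\<theta>. Re (?w \<theta> * cnj \<beta>)"
      have sq: "(cmod (b - curve s \<theta>))\<^sup>2 = (cmod (?w \<theta>))\<^sup>2 + (cmod \<beta>)\<^sup>2 - 2 * ?\<rho> \<theta>" for \<theta>
        unfolding cmod_power2 \<beta>_def by (simp add: power2_eq_square algebra_simps)
      have I1: "(?\<rho> has_integral \<rho>1) {0..1}"
        unfolding \<rho>1_def using has_integral_linear[OF has_integral_mult_left[OF \<mu>(4)[OF s(1,2)], of "cnj \<beta>"] bounded_linear_Re]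
        by (simp add: o_def)
      have I2: "((\<lambda>\<theta>. Re ((?w \<theta>)\<^sup>2 * (cnj \<beta>)\<^sup>2)) has_integral Re (\<mu>2 * (cnj \<beta>)\<^sup>2)) {0..1}"
        using has_integral_linear[OF has_integral_mult_left[OF \<mu>(5)[OF s(1,2)], of "(cnj \<beta>)\<^sup>2"] bounded_linear_Re]
        by (simp add: o_def)
      define m1 where "m1 = (I + (cmod \<beta>)\<^sup>2 - 2 * \<rho>1) / (2 * \<tau>)"
      have X1: "(scaled \<tau> b s has_integral m1) {0..1}"
        unfolding sq m1_def by (intro has_integral_divide has_integral_diff has_integral_add has_integral_mult_right I I1 c)
      have m1: "y * (q\<^sup>2 + \<sigma>\<^sup>2 - 2 * t) \<le> m1"
      proof -
        have "y * (q\<^sup>2 + \<sigma>\<^sup>2 - 2 * t) = (A\<^sup>2 + (cmod \<beta>)\<^sup>2 - 2 * \<rho>1) / (2 * \<tau>)"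
        proof -
          have "A\<^sup>2 = R'\<^sup>2 * q\<^sup>2" using R0 by (simp add: qA power_divide)
          then have "R'\<^sup>2 * (q\<^sup>2 + \<sigma>\<^sup>2 - 2 * t) = A\<^sup>2 + (cmod \<beta>)\<^sup>2 - 2 * \<rho>1"
            unfolding \<beta>R \<rho>1 by (simp add: power_mult_distrib distrib_left right_diff_distrib)
          then show ?thesis unfolding y_def times_divide_eq_left by simp
        qed
        also have "\<dots> \<le> m1" unfolding m1_def using IA \<tau> by (intro divide_right_mono) auto
        finally show ?thesis .
      qed
      have "continuous_on {0..1} (\<lambda>\<theta>. (scaled \<tau> b s \<theta>)\<^sup>2)" by (intro continuous_on_power scaled_continuous s \<tau>)
      then obtain m2 where X2: "((\<lambda>\<theta>. (scaled \<tau> b s \<theta>)\<^sup>2) has_integral m2) {0..1}"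
        using integrable_continuous_real by blast
      let ?b2 = "(cmod \<beta>)\<^sup>2"
      have "((\<lambda>\<theta>. ((R'\<^sup>2 + ?b2)\<^sup>2 - 4 * (R'\<^sup>2 + ?b2) * ?\<rho> \<theta> + 2 * R'\<^sup>2 * ?b2 + 2 * Re ((?w \<theta>)\<^sup>2 * (cnj \<beta>)\<^sup>2)) / (2 * \<tau>)\<^sup>2) has_integral
          ((R'\<^sup>2 + ?b2)\<^sup>2 - 4 * (R'\<^sup>2 + ?b2) * \<rho>1 + 2 * R'\<^sup>2 * ?b2 + 2 * Re (\<mu>2 * (cnj \<beta>)\<^sup>2)) / (2 * \<tau>)\<^sup>2) {0..1}"
        by (intro has_integral_divide has_integral_diff has_integral_add has_integral_mult_right I1 I2 c)
      with X2 have "m2 \<le> ((R'\<^sup>2 + ?b2)\<^sup>2 - 4 * (R'\<^sup>2 + ?b2) * \<rho>1 + 2 * R'\<^sup>2 * ?b2 + 2 * Re (\<mu>2 * (cnj \<beta>)\<^sup>2)) / (2 * \<tau>)\<^sup>2"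
      proof (rule has_integral_le)
        fix \<theta> :: real
        have w2: "(cmod (?w \<theta>))\<^sup>2 \<le> R'\<^sup>2" using w by (intro power_mono) auto
        have "(cmod (b - curve s \<theta>))\<^sup>2 \<le> R'\<^sup>2 + ?b2 - 2 * ?\<rho> \<theta>" unfolding sq using w2 by simp
        then have "((cmod (b - curve s \<theta>))\<^sup>2)\<^sup>2 \<le> (R'\<^sup>2 + ?b2 - 2 * ?\<rho> \<theta>)\<^sup>2" by (intro power_mono) auto
        also have "\<dots> = (R'\<^sup>2 + ?b2)\<^sup>2 - 4 * (R'\<^sup>2 + ?b2) * ?\<rho> \<theta> + 4 * (?\<rho> \<theta>)\<^sup>2"
          by (simp add: power2_eq_square algebra_simps)
        \<comment> \<open>For complex \<open>v\<close> twice the square of \<open>Re v\<close> is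
          \<open>(cmod v)^2 + Re (v^2)\<close>. This brings in the holomorphic second moment, which
          is the one known from \<open>curve_moments\<close>.\<close>
        also have "4 * (?\<rho> \<theta>)\<^sup>2 = 2 * ((cmod (?w \<theta>))\<^sup>2 * ?b2) + 2 * Re ((?w \<theta>)\<^sup>2 * (cnj \<beta>)\<^sup>2)"
          unfolding cmod_power2 by (simp add: power2_eq_square algebra_simps)
        also have "(cmod (?w \<theta>))\<^sup>2 * ?b2 \<le> R'\<^sup>2 * ?b2" using w2 by (intro mult_right_mono) auto
        finally have "((cmod (b - curve s \<theta>))\<^sup>2)\<^sup>2 \<le> (R'\<^sup>2 + ?b2)\<^sup>2 - 4 * (R'\<^sup>2 + ?b2) * ?\<rho> \<theta> + 2 * R'\<^sup>2 * ?b2 + 2 * Re ((?w \<theta>)\<^sup>2 * (cnj \<beta>)\<^sup>2)"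
          by simp
        then show "(scaled \<tau> b s \<theta>)\<^sup>2 \<le> ((R'\<^sup>2 + ?b2)\<^sup>2 - 4 * (R'\<^sup>2 + ?b2) * ?\<rho> \<theta> + 2 * R'\<^sup>2 * ?b2 + 2 * Re ((?w \<theta>)\<^sup>2 * (cnj \<beta>)\<^sup>2)) / (2 * \<tau>)\<^sup>2"
          unfolding power_divide by (intro divide_right_mono) auto
      qed
      also have "\<dots> \<le> ((R'\<^sup>2 + ?b2)\<^sup>2 - 4 * (R'\<^sup>2 + ?b2) * \<rho>1 + 2 * R'\<^sup>2 * ?b2 + 2 * (R'\<^sup>2 * M2 * ?b2)) / (2 * \<tau>)\<^sup>2"
      proof (intro divide_right_mono add_left_mono mult_left_mono)
        have "Re (\<mu>2 * (cnj \<beta>)\<^sup>2) \<le> cmod \<mu>2 * ?b2" using complex_Re_le_cmod[of "\<mu>2 * (cnj \<beta>)\<^sup>2"] by (simp add: norm_mult norm_power)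
        also have "\<dots> \<le> R'\<^sup>2 * M2 * ?b2" using \<mu>2 by (intro mult_right_mono) auto
        finally show "Re (\<mu>2 * (cnj \<beta>)\<^sup>2) \<le> R'\<^sup>2 * M2 * ?b2" .
      qed auto
      also have "\<dots> = y\<^sup>2 * ((1 + \<sigma>\<^sup>2)\<^sup>2 - 4 * (1 + \<sigma>\<^sup>2) * t + 2 * \<sigma>\<^sup>2 + 2 * \<sigma>\<^sup>2 * M2)"
      proof -
        have "(R'\<^sup>2 + ?b2)\<^sup>2 - 4 * (R'\<^sup>2 + ?b2) * \<rho>1 + 2 * R'\<^sup>2 * ?b2 + 2 * (R'\<^sup>2 * M2 * ?b2)
            = (R'\<^sup>2)\<^sup>2 * ((1 + \<sigma>\<^sup>2)\<^sup>2 - 4 * (1 + \<sigma>\<^sup>2) * t + 2 * \<sigma>\<^sup>2 + 2 * \<sigma>\<^sup>2 * M2)"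
          unfolding \<beta>R \<rho>1 by (simp add: power2_eq_square algebra_simps)
        then show ?thesis unfolding y_def times_divide_eq_left power_divide by simp
      qed
      finally have m2: "m2 \<le> y\<^sup>2 * ((1 + \<sigma>\<^sup>2)\<^sup>2 - 4 * (1 + \<sigma>\<^sup>2) * t + 2 * \<sigma>\<^sup>2 + 2 * \<sigma>\<^sup>2 * M2)" .
      have bo: "b \<notin> outside T" using b ext_notin by blast
      have Z0: "Z s > 0" using r_pos s \<tau> by (simp add: Z_def)
      have "bk (Z s) + k2 * (m1 - Z s) - k3 * (m2 - (Z s)\<^sup>2) \<le> integral {0..1} (\<lambda>\<theta>. bk (scaled \<tau> b s \<theta>))"
        by (rule average_bk_lower[OF scaled_continuous[OF s(1,2) \<tau>] scaled_log_filled(2)[OF bo s(1,2) \<tau>] Z0 _ k(3) X1 X2])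
           (use scaled_log_filled(1)[OF bo s(1,2) \<tau>] in \<open>simp add: Z_def\<close>)
      moreover have "k2 * (y * (q\<^sup>2 + \<sigma>\<^sup>2 - 2 * t)) \<le> k2 * m1" using m1 k(1) by (rule mult_left_mono)
      moreover have "k3 * m2 \<le> k3 * (y\<^sup>2 * ((1 + \<sigma>\<^sup>2)\<^sup>2 - 4 * (1 + \<sigma>\<^sup>2) * t + 2 * \<sigma>\<^sup>2 + 2 * \<sigma>\<^sup>2 * M2))" using m2 k(2) by (rule mult_left_mono)
      ultimately show ?thesis using gain[OF \<sigma> t] unfolding m_def right_diff_distrib by linarith
    qed
    then show ?case using elim by simp
  qed
  from hit_laplace_upper[OF BM z \<tau> R mlim this]
  show "hit_laplace M B T \<tau> * (bk Yr + g0) \<le> logterm ((r * cmod (\<Phi> z))\<^sup>2 / (2 * \<tau>)) + bk_rem y"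
    by (simp add: y_def)
qed

end

section \<open>Both bounds in the variables of the numerical inequalities\<close>

context exterior_uniformization begin

lemma logterm_shift:
  assumes z: "z \<in> outside T" and \<tau>: "\<tau> > 0"
  shows "logterm ((r * cmod (\<Phi> z))\<^sup>2 / (2 * \<tau>)) = logterm (r\<^sup>2 / (2 * \<tau>)) - ln (cmod (\<Phi> z))"
  using r_pos \<Phi>_nz[OF z] \<tau> by (simp add: logterm_def ln_div ln_mult_pos ln_realpow)

text \<open>The hypotheses in the new variables: the condition on \<open>\<tau>\<close> becomes
  \<open>x > 0\<close>, the condition \<open>exp euler_mascheroni * r \<le> R\<close> becomes
  \<open>\<Delta> \<ge> 0\<close>, and \<open>logterm (r\<^sup>2 / (2 * \<tau>))\<close> is half of
  \<open>ln (\<tau> / \<tau>0)\<close> from the theorem.\<close>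

lemma scale_bound:
  assumes \<tau>: "\<tau> > 0" and R: "exp euler_mascheroni * r \<le> R" "\<tau> > exp 1 / 2 * R\<^sup>2"
  defines "y \<equiv> R\<^sup>2 / (2 * \<tau>)" and "x \<equiv> - ln (R\<^sup>2 / (2 * \<tau>)) - 1" and "\<Delta> \<equiv> ln (R / r) - euler_mascheroni"
  shows "R > 0" "x > 0" "y = exp (- (1 + x))" "\<Delta> \<ge> 0" "logterm (r\<^sup>2 / (2 * \<tau>)) = (1 + x) / 2 + \<Delta>"
    "r\<^sup>2 / (2 * \<tau>) = y * exp (- 2 * (euler_mascheroni + \<Delta>))"
proof -
  have R0: "R > 0" using R(1) r_pos by (meson exp_gt_zero less_le_trans mult_pos_pos)
  then show "R > 0" .
  have y0: "y > 0" using R0 \<tau> by (simp add: y_def)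
  have "y * exp 1 < 1" using R(2) \<tau> by (simp add: y_def pos_divide_less_eq mult.commute)
  then have "ln (y * exp 1) < 0" using y0 by simp
  then show "x > 0" using y0 by (simp add: x_def y_def[symmetric] ln_mult_pos)
  show "y = exp (- (1 + x))" using y0 by (simp add: x_def y_def[symmetric])
  have "exp euler_mascheroni \<le> R / r" using R(1) r_pos by (simp add: pos_le_divide_eq)
  then have "euler_mascheroni \<le> ln (R / r)" using R0 r_pos by (simp add: ln_ge_iff)
  then show "\<Delta> \<ge> 0" by (simp add: \<Delta>_def)
  show "logterm (r\<^sup>2 / (2 * \<tau>)) = (1 + x) / 2 + \<Delta>"
    using R0 r_pos \<tau> by (simp add: logterm_def x_def \<Delta>_def ln_div ln_realpow field_simps)
  have "exp (- 2 * (euler_mascheroni + \<Delta>)) = exp (- (2 * ln (R / r)))" by (simp add: \<Delta>_def algebra_simps)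
  also have "\<dots> = inverse ((R / r)\<^sup>2)" using R0 r_pos by (simp add: exp_minus exp_double)
  finally show "r\<^sup>2 / (2 * \<tau>) = y * exp (- 2 * (euler_mascheroni + \<Delta>))"
    using R0 by (simp add: y_def power_divide)
qed

lemma laplace_lower_bound:
  assumes BM: "planar_brownian_motion M z B" and z: "z \<in> outside T" and \<tau>: "\<tau> > 0"
    and d: "diameter T < d" "exp euler_mascheroni * r \<le> d" "\<tau> > exp 1 / 2 * d\<^sup>2"
  shows "hit_laplace M B T \<tau> \<ge> 1 - ln (cmod (\<Phi> z)) / logterm (r\<^sup>2 / (2 * \<tau>)) - (4 / 5) * (d\<^sup>2 / \<tau>)"
proof -
  interpret planar_brownian_motion M z B by (rule BM)
  define x where "x = - ln (d\<^sup>2 / (2 * \<tau>)) - 1"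
  define y where "y = d\<^sup>2 / (2 * \<tau>)"
  define a where "a = logterm (r\<^sup>2 / (2 * \<tau>))"
  note s = scale_bound[OF \<tau> d(2,3), folded x_def y_def, folded a_def]
  have y0: "y > 0" using s(3) by simp
  have a: "a \<ge> (1 + x) / 2" using s(4,5) by linarith
  have m: "a + bk_rem y \<ge> 0" using add_nonneg_nonneg[OF _ bk_rem_nonneg[OF y0], of a] a s(2) by simp
  have "1 - ln (cmod (\<Phi> z)) / a - (8 / 5) * y \<le> hit_laplace M B T \<tau>"
  proof (rule laplace_lower_numeric[OF _ s(3) a])
    show "0 \<le> ln (cmod (\<Phi> z))" using \<Phi>_gt1[OF z] by simp
    show "0 \<le> hit_laplace M B T \<tau>" by (rule hit_laplace_bounds[OF compact_imp_closed[OF compactT] ext_notin[OF z] \<tau>])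
    show "a - ln (cmod (\<Phi> z)) \<le> hit_laplace M B T \<tau> * (a + bk_rem y)"
      using hit_laplace_lower[OF BM z \<tau> d(1) refl] m unfolding logterm_shift[OF z \<tau>] a_def y_def by simp
  qed (use s(2) in simp)
  then show ?thesis using \<tau> by (simp add: a_def y_def)
qed

lemma laplace_upper_bound:
  assumes BM: "planar_brownian_motion M z B" and z: "z \<in> outside T" and \<tau>: "\<tau> > 0"
    and R0: "\<And>w. w \<in> T \<Longrightarrow> cmod (w - z) \<le> R0" "R0 < R" and R: "exp euler_mascheroni * r \<le> R" "\<tau> > exp 1 / 2 * R\<^sup>2"
  shows "hit_laplace M B T \<tau> \<le> 1 - ln (cmod (\<Phi> z)) / logterm (r\<^sup>2 / (2 * \<tau>)) + (4 / 5) * (R\<^sup>2 / \<tau>)"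
proof -
  interpret planar_brownian_motion M z B by (rule BM)
  define x where "x = - ln (R\<^sup>2 / (2 * \<tau>)) - 1"
  define y where "y = R\<^sup>2 / (2 * \<tau>)"
  define a where "a = logterm (r\<^sup>2 / (2 * \<tau>))"
  define \<Delta> where "\<Delta> = ln (R / r) - euler_mascheroni"
  define \<rho> where "\<rho> = exp (- 2 * (euler_mascheroni + \<Delta>))"
  define u where "u = hit_laplace M B T \<tau>"
  define h where "h = ln (cmod (\<Phi> z))"
  define \<delta> where "\<delta> = - ln (r * cmod (\<Phi> z) / R)"
  note s = scale_bound[OF \<tau> R, folded x_def y_def \<Delta>_def, folded \<rho>_def, folded a_def]
  have y0: "y > 0" using s(3) by simp
  have q0: "r * cmod (\<Phi> z) / R > 0" using r_pos \<Phi>_nz[OF z] s(1) by simp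
  have h: "h = euler_mascheroni + \<Delta> - \<delta>"
    using r_pos \<Phi>_nz[OF z] s(1) by (simp add: h_def \<Delta>_def \<delta>_def ln_div ln_mult_pos)
  have q: "r * cmod (\<Phi> z) / R = exp (- \<delta>)" using q0 by (simp add: \<delta>_def)
  have e: "1 / cmod (\<Phi> z) = exp (- (euler_mascheroni + \<Delta> - \<delta>))"
    unfolding h[symmetric] h_def using \<Phi>_nz[OF z] by (simp add: exp_minus inverse_eq_divide)
  have bkr: "bk (r\<^sup>2 / (2 * \<tau>)) = a + bk_rem (y * \<rho>)" unfolding bk_eq a_def s(6)[symmetric] ..
  have a0: "a > 0" unfolding s(5) using s(2,4) by (simp add: add_pos_nonneg)
  have E0: "bk_rem (y * \<rho>) \<ge> 0" by (rule bk_rem_nonneg) (simp add: y0 \<rho>_def)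
  have u0: "u \<ge> 0" unfolding u_def by (rule hit_laplace_bounds[OF compact_imp_closed[OF compactT] ext_notin[OF z] \<tau>])
  \<comment> \<open>All gain parameters are zero here, which is plain Jensen.\<close>
  have J: "\<delta> \<ge> 0" "u * (a + bk_rem (y * \<rho>)) \<le> a - h + bk_rem y"
    using hit_laplace_upper_moments[OF BM z \<tau> R0, of 0 0 0] bk_nonneg a0 E0
    unfolding bkr logterm_shift[OF z \<tau>] \<delta>_def[symmetric] u_def[symmetric] h_def[symmetric] a_def[symmetric] y_def[symmetric] by auto
  have "u \<le> 1 - h / a + (8 / 5) * y"
  proof (cases "x \<ge> (51 / 500) \<or> \<Delta> \<ge> (21 / 500) \<or> \<delta> \<ge> (111 / 2000)")
    case True
    show ?thesis
      using laplace_upper_jensen[OF less_imp_le[OF s(2)] s(4) J(1) s(3) True, of u] u0 J(2)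
      unfolding s(5)[symmetric] h[symmetric] \<rho>_def[symmetric] by blast
  next
    case False
    then have box: "x \<le> (51 / 500)" "\<Delta> \<le> (21 / 500)" "\<delta> \<le> (111 / 2000)" by auto
    define g where "g = y * ((33 / 250) - (59 / 25) * \<delta> - (81 / 100) * \<Delta>)"
    have "exp (- (1 + x)) \<le> exp (- 1)" using s(2) by simp
    then have y1: "y \<le> 46 / 125" unfolding s(3)[symmetric] using exp_numeric(2) by linarith
    \<comment> \<open>The line is written in the form required of \<open>k2\<close> and
      \<open>k3\<close>, with the values 81/100 and 81/200.\<close>
    have lb: "bk Y \<ge> (81 / 100) - 4 * (81 / 200) * Y" if "Y > 0" for Y using bk_linear_lower[OF that] by simp
    \<comment> \<open>On the box the bracket of \<open>g\<close> may become slightly negative;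
      -17/500 bounds it from below, and \<open>a > 1 / 2\<close> keeps the total positive.\<close>
    have "y * (- (17 / 500)) \<le> g" unfolding g_def using box y0 by (intro mult_left_mono) auto
    moreover have "(1 + x) / 2 > 1 / 2" using s(2) by simp
    then have "a > 1 / 2" unfolding s(5) using s(4) by linarith
    ultimately have gp: "0 < bk (r\<^sup>2 / (2 * \<tau>)) + g" unfolding bkr using y1 y0 E0 by linarith
    have "u * (bk (r\<^sup>2 / (2 * \<tau>)) + g) \<le> logterm ((r * cmod (\<Phi> z))\<^sup>2 / (2 * \<tau>)) + bk_rem (R\<^sup>2 / (2 * \<tau>))"
      unfolding u_def
    proof (rule hit_laplace_upper_moments(2)[OF BM z \<tau> R0 _ _ lb _ gp])
      fix \<sigma> t :: real
      assume \<sigma>: "0 \<le> \<sigma>" "\<sigma> \<le> 1"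
      assume t: "t \<le> \<sigma> * (r * cmod (\<Phi> z) / R * (1 - (1 / cmod (\<Phi> z))\<^sup>2 + 2 * - ln (r * cmod (\<Phi> z) / R) * (1 / cmod (\<Phi> z))))"
      note t' = t[unfolded q e ln_exp minus_minus]
      show "g \<le> (81 / 100) * (R\<^sup>2 / (2 * \<tau>) * ((r * cmod (\<Phi> z) / R)\<^sup>2 + \<sigma>\<^sup>2 - 2 * t) - r\<^sup>2 / (2 * \<tau>)) -
          (81 / 200) * ((R\<^sup>2 / (2 * \<tau>))\<^sup>2 * ((1 + \<sigma>\<^sup>2)\<^sup>2 - 4 * (1 + \<sigma>\<^sup>2) * t + 2 * \<sigma>\<^sup>2 +
            2 * \<sigma>\<^sup>2 * ((r * cmod (\<Phi> z) / R)\<^sup>2 * (\<bar>(1 - (1 / cmod (\<Phi> z))\<^sup>2) * (1 - 3 * (1 / cmod (\<Phi> z))\<^sup>2)\<bar>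
              + 8 * - ln (r * cmod (\<Phi> z) / R) * (1 / cmod (\<Phi> z)) * (1 - (1 / cmod (\<Phi> z))\<^sup>2)
              + (1 / cmod (\<Phi> z))\<^sup>2 * (4 * - ln (r * cmod (\<Phi> z) / R) + 8 * (- ln (r * cmod (\<Phi> z) / R))\<^sup>2)))) - (r\<^sup>2 / (2 * \<tau>))\<^sup>2)"
        unfolding q e ln_exp minus_minus y_def[symmetric] s(6) \<rho>_def g_def
        by (rule corner_gain[OF s(4) box(2) J(1) box(3) y0 y1 \<sigma> t'])
    qed auto
    then have "u * (a + bk_rem (y * \<rho>) + g) \<le> a - h + bk_rem y"
      unfolding bkr logterm_shift[OF z \<tau>] h_def[symmetric] a_def[symmetric] y_def[symmetric] .
    then show ?thesis
      using laplace_upper_corner[OF less_imp_le[OF s(2)] box(1) s(4) box(2) J(1) box(3) s(3)]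
      unfolding s(5)[symmetric] h[symmetric] \<rho>_def[symmetric] g_def[symmetric] by simp
  qed
  then show ?thesis using \<tau> by (simp add: u_def h_def a_def y_def)
qed

end

theorem theorem1p2:
  fixes T :: "complex set" and z :: complex
    and M :: "'w measure" and B :: "real \<Rightarrow> 'w \<Rightarrow> complex"
    and r d \<tau>0 R \<tau> :: real
  assumes T: "connected T" "compact T" "T \<noteq> {}" "\<forall>a. T \<noteq> {a}"
    and z: "z \<in> outside T"
    and B: "planar_brownian_motion M z B"
    and r: "r = conformal_radius T"
    and d: "d = max (diameter T) (exp euler_mascheroni * r)"
    and \<tau>0: "\<tau>0 = 1 / 2 * exp (2 * euler_mascheroni) * r\<^sup>2"
    and R: "R = max (SUP w\<in>T. cmod (w - z)) (exp euler_mascheroni * r)"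
    and \<tau>: "\<tau> > 0"
  shows "(\<tau> > exp 1 / 2 * d\<^sup>2 \<longrightarrow>
            hit_laplace M B T \<tau> \<ge> 1 - 2 * pi * green_function T z / ln (\<tau> / \<tau>0) - 0.8 * (d\<^sup>2 / \<tau>)) \<and>
         (\<tau> > exp 1 / 2 * R\<^sup>2 \<longrightarrow>
            hit_laplace M B T \<tau> \<le> 1 - 2 * pi * green_function T z / ln (\<tau> / \<tau>0) + 0.8 * (R\<^sup>2 / \<tau>))"
proof -
  obtain c where c: "c > 0" "((\<lambda>z. exterior_map T z / z) \<longlongrightarrow> of_real c) at_infinity"
    and em: "exterior_map T holomorphic_on outside T" "bij_betw (exterior_map T) (outside T) {w. 1 < cmod w}"
      "filterlim (exterior_map T) at_infinity at_infinity"
    using exterior_map_exists[OF T(2,1,3,4)] by (auto simp: is_exterior_map_def)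
  interpret X: exterior_uniformization T "exterior_map T" c
    by unfold_locales (use T c em in auto)
  have rX: "r = X.r" unfolding r conformal_radius_def by (rule X.conformal_radius_limit)
  have r0: "r > 0" using X.r_pos rX by simp
  let ?h = "ln (cmod (exterior_map T z))" and ?a = "logterm (r\<^sup>2 / (2 * \<tau>))"
  have "ln (\<tau> / \<tau>0) = 2 * ?a"
    unfolding \<tau>0 logterm_def using r0 \<tau> by (simp add: ln_div ln_mult_pos ln_realpow)
  then have ha: "2 * pi * green_function T z / ln (\<tau> / \<tau>0) = ?h / ?a"
    using X.green_function_eq[OF z] by simp
  \<comment> \<open>The estimates need a radius strictly larger than the true one, to make room for
    level curves around \<open>T\<close>. The strict condition on \<open>\<tau>\<close> tolerates a
    small increase, and the bounds are continuous in the radius.\<close>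
  have right: "\<forall>\<^sub>F s in at_right D. s > D \<and> \<tau> > exp 1 / 2 * s\<^sup>2" if "\<tau> > exp 1 / 2 * D\<^sup>2" for D :: real
  proof -
    have "((\<lambda>s. exp 1 / 2 * s\<^sup>2) \<longlongrightarrow> exp 1 / 2 * D\<^sup>2) (at_right D)" by (intro tendsto_intros)
    from order_tendstoD(2)[OF this that] show ?thesis
      by (auto intro: eventually_conj simp: eventually_at_right_less)
  qed
  show ?thesis
  proof (intro conjI impI)
    assume "\<tau> > exp 1 / 2 * d\<^sup>2"
    note ev = right[OF this]
    have "\<forall>\<^sub>F s in at_right d. hit_laplace M B T \<tau> \<ge> 1 - ?h / ?a - 0.8 * (s\<^sup>2 / \<tau>)"
      using ev
    proof eventually_elim
      case (elim s)
      then show ?case using X.laplace_lower_bound[OF B z \<tau>, of s] by (simp add: rX d)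
    qed
    moreover have "((\<lambda>s. 1 - ?h / ?a - 0.8 * (s\<^sup>2 / \<tau>)) \<longlongrightarrow> 1 - ?h / ?a - 0.8 * (d\<^sup>2 / \<tau>)) (at_right d)"
      using \<tau> by (intro tendsto_intros) auto
    ultimately show "hit_laplace M B T \<tau> \<ge> 1 - 2 * pi * green_function T z / ln (\<tau> / \<tau>0) - 0.8 * (d\<^sup>2 / \<tau>)"
      unfolding ha by (intro tendsto_upperbound[of _ _ "at_right d"]) auto
  next
    assume "\<tau> > exp 1 / 2 * R\<^sup>2"
    note ev = right[OF this]
    have "bdd_above ((\<lambda>w. cmod (w - z)) ` T)"
      by (intro compact_imp_bounded[THEN bounded_imp_bdd_above] compact_continuous_image T continuous_intros)
    then have sup: "cmod (w - z) \<le> (SUP w\<in>T. cmod (w - z))" if "w \<in> T" for w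
      using that by (intro cSUP_upper)
    have "\<forall>\<^sub>F s in at_right R. hit_laplace M B T \<tau> \<le> 1 - ?h / ?a + 0.8 * (s\<^sup>2 / \<tau>)"
      using ev
    proof eventually_elim
      case (elim s)
      then show ?case using X.laplace_upper_bound[OF B z \<tau> sup, of s] by (simp add: rX R)
    qed
    moreover have "((\<lambda>s. 1 - ?h / ?a + 0.8 * (s\<^sup>2 / \<tau>)) \<longlongrightarrow> 1 - ?h / ?a + 0.8 * (R\<^sup>2 / \<tau>)) (at_right R)"
      using \<tau> by (intro tendsto_intros) auto
    ultimately show "hit_laplace M B T \<tau> \<le> 1 - 2 * pi * green_function T z / ln (\<tau> / \<tau>0) + 0.8 * (R\<^sup>2 / \<tau>)"
      unfolding ha by (intro tendsto_lowerbound[of _ _ "at_right R"]) auto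
  qed
qed

end
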